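(* Let $n\ge1$ and let $\mathcal D$ be an additive category. The assignments $(\mathcal D,\mathcal X)\mapsto(\mathcal D,\mathbb G_{\mathcal X},\mathfrak r_{\mathcal X})$ and $(\mathcal D,\mathbb G,\mathfrak r)\mapsto(\mathcal D,\mathcal X_{(\mathbb G,\mathfrak r)})$ (defined in the context) induce mutually inverse one-to-one correspondences between (i) the $n$-exact structures $(\mathcal D,\mathcal X)$ on $\mathcal D$ with small extension groups, and (ii) the $n$-exangulated structures $(\mathcal D,\mathbb G,\mathfrak r)$ on $\mathcal D$ for which all $\mathfrak r$-inflations are monic and all $\mathfrak r$-deflations are epic, modulo equivalences of $n$-exangulated categories of the form $(\mathrm{Id}_{\mathcal D},\Gamma)$.
   Context: **Complexes.** For an additive category $\mathcal D$, $\mathbf C^{n+2}_{\mathcal D}$ is the category of complexes $X_\bullet\colon X_0\xrightarrow{d^X_0}X_1\to\cdots\to X_n\xrightarrow{d^X_n}X_{n+1}$ over $\mathcal D$ concentrated in degrees $0,\dots,n+1$, with chain maps $f_\bullet=(f_0,\dots,f_{n+1})$. For $A,C\in\mathcal D$, $\mathbf C^{n+2}_{(\mathcal D;A,C)}$ is its subcategory of complexes with $X_0=A$, $X_{n+1}=C$ and chain maps with $f_0=\mathrm{id}_A$, $f_{n+1}=\mathrm{id}_C$; two of its morphisms are homotopic if their difference is null-homotopic as a chain map, and $[X_\bullet]_{\mathcal D}$ is the resulting homotopy equivalence class of $X_\bullet$ in $\mathbf C^{n+2}_{(\mathcal D;A,C)}$. For $X\in\mathcal D$ and $0\le i\le n$,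 $\mathrm{triv}_i(X)_\bullet$ has $X$ in degrees $i,i+1$ with differential $\mathrm{id}_X$ between them and $0$ elsewhere. **Extensions.** Let $\mathbb G\colon\mathcal D^{\mathrm{op}}\times\mathcal D\to\mathsf{Ab}$ be biadditive. For $\delta\in\mathbb G(C,A)$, $a\colon A\to B$, $c\colon D\to C$ write $a_*\delta=\mathbb G(C,a)(\delta)$ and $c^*\delta=\mathbb G(c,A)(\delta)$. For $\delta\in\mathbb G(C,A)$, $\rho\in\mathbb G(D,B)$, a morphism $(a,c)\colon\delta\to\rho$ is a pair $a\colon A\to B$, $c\colon C\to D$ with $a_*\delta=c^*\rho$. An $n$-exangle is a pair $\langle X_\bullet,\delta\rangle$ with $X_\bullet\in\mathbf C^{n+2}_{\mathcal D}$, $\delta\in\mathbb G(X_{n+1},X_0)$, $(d^X_0)_*\delta=0$, $(d^X_n)^*\delta=0$, such that for all $X\in\mathcal D$ the sequences $\mathcal D(X,X_0)\to\cdots\to\mathcal D(X,X_{n+1})\to\mathbb G(X,X_0)$ (last map $f\mapsto f^*\delta$) and $\mathcal D(X_{n+1},X)\to\cdots\to\mathcal D(X_0,X)\to\mathbb G(X_{n+1},X)$ (last map $g\mapsto g_*\delta$) are exact. **Exact realisation.** An exact realisation $\mathfrak r$ of $\mathbb G$ assigns to each $\delta\in\mathbb G(C,A)$ a homotopy equivalence class $\mathfrak r(\delta)$ of an object of $\mathbf C^{n+2}_{(\mathcal D;A,C)}$ such that: (R0) if $[X_\bullet]_{\mathcal D}=\mathfrak r(\delta)$, $[Y_\bullet]_{\mathcal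 D}=\mathfrak r(\rho)$ and $(a,c)\colon\delta\to\rho$ is a morphism of extensions, there is a chain map $f_\bullet\colon X_\bullet\to Y_\bullet$ (a lift of $(a,c)$) with $f_0=a$, $f_{n+1}=c$; (R1) if $\mathfrak r(\delta)=[X_\bullet]_{\mathcal D}$ then $\langle X_\bullet,\delta\rangle$ is an $n$-exangle; (R2) for all $A,C\in\mathcal D$, $\mathfrak r$ sends $0\in\mathbb G(0,A)$ to $[\mathrm{triv}_0(A)_\bullet]_{\mathcal D}$ and $0\in\mathbb G(C,0)$ to $[\mathrm{triv}_n(C)_\bullet]_{\mathcal D}$. If $\mathfrak r(\delta)=[X_\bullet]_{\mathcal D}$, then $\langle X_\bullet,\delta\rangle$ is called $\mathfrak r$-distinguished, $X_\bullet$ an $\mathfrak r$-conflation, $d^X_0$ an $\mathfrak r$-inflation and $d^X_n$ an $\mathfrak r$-deflation. **$n$-exangulated category (structure).** A triple $(\mathcal D,\mathbb G,\mathfrak r)$ with $\mathcal D$ additive, $\mathbb G$ biadditive and $\mathfrak r$ an exact realisation of $\mathbb G$ such that: (EA1) $\mathfrak r$-inflations are closed under composition; (EA1$^{\mathrm{op}}$) $\mathfrak r$-deflations are closed under composition; (EA2) for $c\colon X_{n+1}\to Y_{n+1}$ and $\mathfrak r$-distinguished $\langle X_\bullet,c^*\rho\rangle$, $\langle Y_\bullet,\rho\rangle$ with $A:=X_0=Y_0$, there is a lift $f_\bullet$ of $(\mathrm{id}_A,c)$ such that $\langle M^f_\bullet,(d^X_0)_*\rho\rangle$ is $\mathfrak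 r$-distinguished, where $M^f_\bullet$ is the complex $X_1\to X_2\oplus Y_1\to\cdots\to X_{n+1}\oplus Y_n\to Y_{n+1}$ with differentials $\begin{bmatrix}-d^X_1\\ f_1\end{bmatrix}$, then $\begin{bmatrix}-d^X_{i}&0\\ f_{i}&d^Y_{i-1}\end{bmatrix}$ for $i=2,\dots,n$, then $\begin{bmatrix}f_{n+1}&d^Y_n\end{bmatrix}$; (EA2$^{\mathrm{op}}$) for $a\colon X_0\to Y_0$ and $\mathfrak r$-distinguished $\langle X_\bullet,\delta\rangle$, $\langle Y_\bullet,a_*\delta\rangle$ with $C:=X_{n+1}=Y_{n+1}$, there is a lift $f_\bullet$ of $(a,\mathrm{id}_C)$ such that $\langle N^f_\bullet,(d^Y_n)^*\delta\rangle$ is $\mathfrak r$-distinguished, where $N^f_\bullet$ is the complex $X_0\to X_1\oplus Y_0\to\cdots\to X_n\oplus Y_{n-1}\to Y_n$ with differentials $\begin{bmatrix}d^X_0\\ f_0\end{bmatrix}$, then $\begin{bmatrix}d^X_i&0\\ f_i&-d^Y_{i-1}\end{bmatrix}$ for $i=1,\dots,n-1$, then $\begin{bmatrix}f_n&-d^Y_{n-1}\end{bmatrix}$. **Functors and equivalences.** An $n$-exangulated functor $(\mathscr F,\Gamma)\colon(\mathcal D,\mathbb G,\mathfrak r)\to(\mathcal D',\mathbb G',\mathfrak r')$ is an additive functor $\mathscr F\colon\mathcal D\to\mathcal D'$ with a natural transformation $\Gamma\colon\mathbb G(-,-)\Rightarrow\mathbb G'(\mathscr F-,\mathscr F-)$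 such that $[X_\bullet]_{\mathcal D}=\mathfrak r(\delta)$ implies $[\mathscr F(X_\bullet)]_{\mathcal D'}=\mathfrak r'(\Gamma_{(C,A)}(\delta))$ for all $\delta\in\mathbb G(C,A)$. It is an $n$-exangulated equivalence if $\mathscr F$ is an equivalence and $\Gamma$ is a natural isomorphism. **$n$-exact categories (Jasso).** $X_\bullet\in\mathbf C^{n+2}_{\mathcal D}$ is an $n$-exact sequence if for all $X\in\mathcal D$ the sequences $0\to\mathcal D(X,X_0)\to\cdots\to\mathcal D(X,X_{n+1})$ and $0\to\mathcal D(X_{n+1},X)\to\cdots\to\mathcal D(X_0,X)$ are exact. A weak isomorphism of $n$-exact sequences is a chain map $f_\bullet$ such that $f_k$ and $f_{k+1}$ are isomorphisms for some $k\in\{0,\dots,n+1\}$, where $f_{n+2}:=f_0$. Given a chain map $(f_0,\dots,f_n)$ from $X_0\to\cdots\to X_n$ to $Y_0\to\cdots\to Y_n$, its cone is $X_0\to X_1\oplus Y_0\to\cdots\to X_n\oplus Y_{n-1}\to Y_n$ with differentials $\begin{bmatrix}-d^X_0\\ f_0\end{bmatrix}$, $\begin{bmatrix}-d^X_i&0\\ f_i&d^Y_{i-1}\end{bmatrix}$ ($1\le i\le n-1$), $\begin{bmatrix}f_n&d^Y_{n-1}\end{bmatrix}$. It is an $n$-pushout diagram (of $X_0\to\cdots\to X_n$ along $f_0$) if for all $X\in\mathcal D$ applying $\mathcal D(-,X)$ to the cone gives an exact sequence $0\to\mathcal D(Y_n,X)\to\mathcal D(X_n\oplus Y_{n-1},X)\to\cdots\to\mathcal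 D(X_0,X)$. Dually, it is an $n$-pullback diagram (of $Y_0\to\cdots\to Y_n$ along $f_n$) if for all $X$ applying $\mathcal D(X,-)$ to the cone gives an exact sequence $0\to\mathcal D(X,X_0)\to\cdots\to\mathcal D(X,Y_n)$. An $n$-exact structure on $\mathcal D$ is a class $\mathcal X$ of $n$-exact sequences closed under weak isomorphisms of $n$-exact sequences (if one of two $n$-exact sequences connected by a weak isomorphism is in $\mathcal X$, so is the other) such that, calling $d^X_0$ (resp. $d^X_n$) for $X_\bullet\in\mathcal X$ an admissible monomorphism (resp. admissible epimorphism): (E0) the zero complex is in $\mathcal X$; (E1) admissible monomorphisms are closed under composition; (E1$^{\mathrm{op}}$) admissible epimorphisms are closed under composition; (E2) for $X_\bullet\in\mathcal X$ and $f\colon X_0\to Y_0$ there is an $n$-pushout diagram of $X_0\to\cdots\to X_n$ along $f$, with target $Y_0\to\cdots\to Y_n$, such that $Y_0\to Y_1$ is an admissible monomorphism; (E2$^{\mathrm{op}}$) for $X_\bullet\in\mathcal X$ and $g\colon Y_{n+1}\to X_{n+1}$ there is an $n$-pullback diagram of $X_1\to\cdots\to X_{n+1}$ along $g$, with source $Y_1\to\cdots\to Y_{n+1}$, such that $Y_n\to Y_{n+1}$ is an admissible epimorphism. The pair $(\mathcal D,\mathcal X)$ is then an $n$-exact category. **From $n$-exact to $n$-exangulated.** Put $\mathbb G_{\mathcal X}(C,A):=\{[X_\bullet]_{\mathcal D}: X_\bullet\in\mathcal X\cap\mathbf C^{n+2}_{(\mathcal D;A,C)}\}$. $(\mathcal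 D,\mathcal X)$ has small extension groups if $\mathbb G_{\mathcal X}(C,A)$ is a set for all $A,C\in\mathcal D$. In that case $\mathbb G_{\mathcal X}$ becomes a biadditive functor $\mathcal D^{\mathrm{op}}\times\mathcal D\to\mathsf{Ab}$ as follows (all well defined). For $a\colon A\to B$, $\mathbb G_{\mathcal X}(C,a)([X_\bullet]_{\mathcal D})=[Y_\bullet]_{\mathcal D}$, where $Y_\bullet\in\mathcal X\cap\mathbf C^{n+2}_{(\mathcal D;B,C)}$ admits a chain map $f_\bullet\colon X_\bullet\to Y_\bullet$ with $f_0=a$, $f_{n+1}=\mathrm{id}_C$ whose part in degrees $0,\dots,n$ is an $n$-pushout diagram. For $c\colon D\to C$, $\mathbb G_{\mathcal X}(c,A)([X_\bullet]_{\mathcal D})=[Y_\bullet]_{\mathcal D}$, where $Y_\bullet\in\mathcal X\cap\mathbf C^{n+2}_{(\mathcal D;A,D)}$ admits a chain map $f_\bullet\colon Y_\bullet\to X_\bullet$ with $f_0=\mathrm{id}_A$, $f_{n+1}=c$ whose part in degrees $1,\dots,n+1$ is an $n$-pullback diagram. Addition is the Baer sum $[X_\bullet]_{\mathcal D}+[Y_\bullet]_{\mathcal D}=\mathbb G_{\mathcal X}(\Delta_C,\nabla_A)([X_\bullet\oplus Y_\bullet]_{\mathcal D})$ with $\Delta_C\colon C\to C\oplus C$ the diagonal and $\nabla_A\colon A\oplus A\to A$ the codiagonal. The realisation is $\mathfrak r_{\mathcal X}(\delta):=[X_\bullet]_{\mathcal D}$ for $\delta=[X_\bullet]_{\mathcal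 D}\in\mathbb G_{\mathcal X}(C,A)$. **From $n$-exangulated to $n$-exact.** For an $n$-exangulated category $(\mathcal D,\mathbb G,\mathfrak r)$, $\mathcal X_{(\mathbb G,\mathfrak r)}$ is the class of all $\mathfrak r$-conflations. *)

theory Defs
  imports "HOL-Algebra.Coset"
begin

section \<open>Additive categories\<close>

record ('o, 'm) precat =
  Obj :: "'o set"
  Arr :: "'m set"
  Dom :: "'m \<Rightarrow> 'o"
  Cod :: "'m \<Rightarrow> 'o"
  Ide :: "'o \<Rightarrow> 'm"
  Comp :: "'m \<Rightarrow> 'm \<Rightarrow> 'm" (infixr \<open>\<cdot>\<index>\<close> 75)
  Plus :: "'m \<Rightarrow> 'm \<Rightarrow> 'm" (infixl \<open>\<boxplus>\<index>\<close> 65)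
  Zero :: "'o \<Rightarrow> 'o \<Rightarrow> 'm"

definition homs :: "('o, 'm) precat \<Rightarrow> 'o \<Rightarrow> 'o \<Rightarrow> 'm set" where
  "homs D A B = {f \<in> Arr D. Dom D f = A \<and> Cod D f = B}"

definition homgrp :: "('o, 'm) precat \<Rightarrow> 'o \<Rightarrow> 'o \<Rightarrow> 'm monoid" where
  "homgrp D A B = \<lparr>carrier = homs D A B, mult = Plus D, one = Zero D A B\<rparr>"

definition neg :: "('o, 'm) precat \<Rightarrow> 'm \<Rightarrow> 'm" where
  "neg D f = inv\<^bsub>homgrp D (Dom D f) (Cod D f)\<^esub> f"

locale category =
  fixes D :: "('o, 'm) precat"
  assumes Dom_in: "f \<in> Arr D \<Longrightarrow> Dom D f \<in> Obj D"
    and Cod_in: "f \<in> Arr D \<Longrightarrow> Cod D f \<in> Obj D"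
    and Ide_in: "A \<in> Obj D \<Longrightarrow> Ide D A \<in> homs D A A"
    and Comp_in: "f \<in> homs D A B \<Longrightarrow> g \<in> homs D B C \<Longrightarrow> g \<cdot>\<^bsub>D\<^esub> f \<in> homs D A C"
    and Ide_left: "f \<in> homs D A B \<Longrightarrow> Ide D B \<cdot>\<^bsub>D\<^esub> f = f"
    and Ide_right: "f \<in> homs D A B \<Longrightarrow> f \<cdot>\<^bsub>D\<^esub> Ide D A = f"
    and Comp_assoc: "f \<in> homs D A B \<Longrightarrow> g \<in> homs D B C \<Longrightarrow> h \<in> homs D C E \<Longrightarrow>
      (h \<cdot>\<^bsub>D\<^esub> g) \<cdot>\<^bsub>D\<^esub> f = h \<cdot>\<^bsub>D\<^esub> (g \<cdot>\<^bsub>D\<^esub> f)"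

locale preadditive_category = category +
  assumes homgrp: "A \<in> Obj D \<Longrightarrow> B \<in> Obj D \<Longrightarrow> comm_group (homgrp D A B)"
    and Comp_Plus: "f \<in> homs D A B \<Longrightarrow> f' \<in> homs D A B \<Longrightarrow> g \<in> homs D B C \<Longrightarrow>
      g \<cdot>\<^bsub>D\<^esub> (f \<boxplus>\<^bsub>D\<^esub> f') = (g \<cdot>\<^bsub>D\<^esub> f) \<boxplus>\<^bsub>D\<^esub> (g \<cdot>\<^bsub>D\<^esub> f')"
    and Plus_Comp: "f \<in> homs D A B \<Longrightarrow> g \<in> homs D B C \<Longrightarrow> g' \<in> homs D B C \<Longrightarrow>
      (g \<boxplus>\<^bsub>D\<^esub> g') \<cdot>\<^bsub>D\<^esub> f = (g \<cdot>\<^bsub>D\<^esub> f) \<boxplus>\<^bsub>D\<^esub> (g' \<cdot>\<^bsub>D\<^esub> f)"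

definition is_zero_obj :: "('o, 'm) precat \<Rightarrow> 'o \<Rightarrow> bool" where
  "is_zero_obj D Z \<longleftrightarrow> Z \<in> Obj D \<and>
     (\<forall>A\<in>Obj D. (\<exists>!f. f \<in> homs D Z A) \<and> (\<exists>!f. f \<in> homs D A Z))"

record ('o, 'm) biproduct =
  BObj :: 'o
  In1 :: 'm
  In2 :: 'm
  Pr1 :: 'm
  Pr2 :: 'm

definition is_biproduct :: "('o, 'm) precat \<Rightarrow> 'o \<Rightarrow> 'o \<Rightarrow> ('o, 'm) biproduct \<Rightarrow> bool" where
  "is_biproduct D A B P \<longleftrightarrow> BObj P \<in> Obj D \<and>
     In1 P \<in> homs D A (BObj P) \<and> In2 P \<in> homs D B (BObj P) \<and>
     Pr1 P \<in> homs D (BObj P) A \<and> Pr2 P \<in> homs D (BObj P) B \<and>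
     Pr1 P \<cdot>\<^bsub>D\<^esub> In1 P = Ide D A \<and> Pr2 P \<cdot>\<^bsub>D\<^esub> In2 P = Ide D B \<and>
     Pr2 P \<cdot>\<^bsub>D\<^esub> In1 P = Zero D A B \<and> Pr1 P \<cdot>\<^bsub>D\<^esub> In2 P = Zero D B A \<and>
     (In1 P \<cdot>\<^bsub>D\<^esub> Pr1 P) \<boxplus>\<^bsub>D\<^esub> (In2 P \<cdot>\<^bsub>D\<^esub> Pr2 P) = Ide D (BObj P)"

locale additive_category = preadditive_category +
  assumes ex_zero_obj: "\<exists>Z. is_zero_obj D Z"
    and ex_biproduct: "A \<in> Obj D \<Longrightarrow> B \<in> Obj D \<Longrightarrow> \<exists>P. is_biproduct D A B P"

text \<open>The zero object and the biproducts are chosen once and for all; other choices are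
  canonically isomorphic.\<close>

definition zero_obj :: "('o, 'm) precat \<Rightarrow> 'o" where
  "zero_obj D = (SOME Z. is_zero_obj D Z)"

definition biprod :: "('o, 'm) precat \<Rightarrow> 'o \<Rightarrow> 'o \<Rightarrow> ('o, 'm) biproduct" where
  "biprod D A B = (SOME P. is_biproduct D A B P)"

definition dsum :: "('o, 'm) precat \<Rightarrow> 'o \<Rightarrow> 'o \<Rightarrow> 'o" where
  "dsum D A B = BObj (biprod D A B)"

text \<open>Column \<open>(u, v)\<^sup>T : A \<rightarrow> B\<^sub>1 \<oplus> B\<^sub>2\<close>, row \<open>(u, v) : A\<^sub>1 \<oplus> A\<^sub>2 \<rightarrow> B\<close>, and the matrix with
  rows \<open>(u, v)\<close> and \<open>(u', v')\<close>.\<close>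

definition col :: "('o, 'm) precat \<Rightarrow> 'm \<Rightarrow> 'm \<Rightarrow> 'm" where
  "col D u v = (In1 (biprod D (Cod D u) (Cod D v)) \<cdot>\<^bsub>D\<^esub> u) \<boxplus>\<^bsub>D\<^esub>
               (In2 (biprod D (Cod D u) (Cod D v)) \<cdot>\<^bsub>D\<^esub> v)"

definition row :: "('o, 'm) precat \<Rightarrow> 'm \<Rightarrow> 'm \<Rightarrow> 'm" where
  "row D u v = (u \<cdot>\<^bsub>D\<^esub> Pr1 (biprod D (Dom D u) (Dom D v))) \<boxplus>\<^bsub>D\<^esub>
               (v \<cdot>\<^bsub>D\<^esub> Pr2 (biprod D (Dom D u) (Dom D v)))"

definition mat22 :: "('o, 'm) precat \<Rightarrow> 'm \<Rightarrow> 'm \<Rightarrow> 'm \<Rightarrow> 'm \<Rightarrow> 'm" where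
  "mat22 D u v u' v' = col D (row D u v) (row D u' v')"

definition is_monic :: "('o, 'm) precat \<Rightarrow> 'm \<Rightarrow> bool" where
  "is_monic D f \<longleftrightarrow> f \<in> Arr D \<and>
     (\<forall>W\<in>Obj D. \<forall>g\<in>homs D W (Dom D f). \<forall>h\<in>homs D W (Dom D f).
        f \<cdot>\<^bsub>D\<^esub> g = f \<cdot>\<^bsub>D\<^esub> h \<longrightarrow> g = h)"

definition is_epic :: "('o, 'm) precat \<Rightarrow> 'm \<Rightarrow> bool" where
  "is_epic D f \<longleftrightarrow> f \<in> Arr D \<and>
     (\<forall>W\<in>Obj D. \<forall>g\<in>homs D (Cod D f) W. \<forall>h\<in>homs D (Cod D f) W.
        g \<cdot>\<^bsub>D\<^esub> f = h \<cdot>\<^bsub>D\<^esub> f \<longrightarrow> g = h)"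

definition is_iso_arr :: "('o, 'm) precat \<Rightarrow> 'm \<Rightarrow> bool" where
  "is_iso_arr D f \<longleftrightarrow> f \<in> Arr D \<and>
     (\<exists>g\<in>homs D (Cod D f) (Dom D f). g \<cdot>\<^bsub>D\<^esub> f = Ide D (Dom D f) \<and> f \<cdot>\<^bsub>D\<^esub> g = Ide D (Cod D f))"

definition closed_under_comp :: "('o, 'm) precat \<Rightarrow> 'm set \<Rightarrow> bool" where
  "closed_under_comp D M \<longleftrightarrow> (\<forall>f\<in>M. \<forall>g\<in>M. Cod D f = Dom D g \<longrightarrow> g \<cdot>\<^bsub>D\<^esub> f \<in> M)"


section \<open>Complexes\<close>

record ('o, 'm) cplx =
  ob :: "nat \<Rightarrow> 'o"
  df :: "nat \<Rightarrow> 'm"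

text \<open>\<open>complexes D k\<close> are the complexes with \<open>k\<close> terms, in degrees \<open>0, \<dots>, k - 1\<close>.
  The families are extensional, so that equality of complexes is degreewise equality.\<close>

definition complexes :: "('o, 'm) precat \<Rightarrow> nat \<Rightarrow> ('o, 'm) cplx set" where
  "complexes D k = {X.
     ob X \<in> {..<k} \<rightarrow>\<^sub>E Obj D \<and>
     df X \<in> (\<Pi>\<^sub>E i\<in>{..<k - 1}. homs D (ob X i) (ob X (i + 1))) \<and>
     (\<forall>i. i + 2 < k \<longrightarrow> df X (i + 1) \<cdot>\<^bsub>D\<^esub> df X i = Zero D (ob X i) (ob X (i + 2)))}"

definition chain_maps ::
  "('o, 'm) precat \<Rightarrow> nat \<Rightarrow> ('o, 'm) cplx \<Rightarrow> ('o, 'm) cplx \<Rightarrow> (nat \<Rightarrow> 'm) set" where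
  "chain_maps D k X Y = {f \<in> (\<Pi>\<^sub>E i\<in>{..<k}. homs D (ob X i) (ob Y i)).
     \<forall>i. i + 1 < k \<longrightarrow> f (i + 1) \<cdot>\<^bsub>D\<^esub> df X i = df Y i \<cdot>\<^bsub>D\<^esub> f i}"

definition null_homotopic ::
  "('o, 'm) precat \<Rightarrow> nat \<Rightarrow> ('o, 'm) cplx \<Rightarrow> ('o, 'm) cplx \<Rightarrow> (nat \<Rightarrow> 'm) \<Rightarrow> bool" where
  "null_homotopic D k X Y u \<longleftrightarrow>
     (\<exists>h. (\<forall>i\<in>{1..<k}. h i \<in> homs D (ob X i) (ob Y (i - 1))) \<and>
        (\<forall>i<k. u i =
           (if i + 1 < k then h (i + 1) \<cdot>\<^bsub>D\<^esub> df X i else Zero D (ob X i) (ob Y i)) \<boxplus>\<^bsub>D\<^esub>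
           (if 0 < i then df Y (i - 1) \<cdot>\<^bsub>D\<^esub> h i else Zero D (ob X i) (ob Y i))))"

definition homotopic ::
  "('o, 'm) precat \<Rightarrow> nat \<Rightarrow> ('o, 'm) cplx \<Rightarrow> ('o, 'm) cplx \<Rightarrow> (nat \<Rightarrow> 'm) \<Rightarrow> (nat \<Rightarrow> 'm) \<Rightarrow> bool"
  where
  "homotopic D k X Y f g \<longleftrightarrow> null_homotopic D k X Y (\<lambda>i\<in>{..<k}. f i \<boxplus>\<^bsub>D\<^esub> neg D (g i))"

definition ends_complexes :: "('o, 'm) precat \<Rightarrow> nat \<Rightarrow> 'o \<Rightarrow> 'o \<Rightarrow> ('o, 'm) cplx set" where
  "ends_complexes D n A C = {X \<in> complexes D (n + 2). ob X 0 = A \<and> ob X (n + 1) = C}"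

definition ends_maps ::
  "('o, 'm) precat \<Rightarrow> nat \<Rightarrow> 'o \<Rightarrow> 'o \<Rightarrow> ('o, 'm) cplx \<Rightarrow> ('o, 'm) cplx \<Rightarrow> (nat \<Rightarrow> 'm) set" where
  "ends_maps D n A C X Y =
     {f \<in> chain_maps D (n + 2) X Y. f 0 = Ide D A \<and> f (n + 1) = Ide D C}"

definition htpy_equivalent ::
  "('o, 'm) precat \<Rightarrow> nat \<Rightarrow> 'o \<Rightarrow> 'o \<Rightarrow> ('o, 'm) cplx \<Rightarrow> ('o, 'm) cplx \<Rightarrow> bool" where
  "htpy_equivalent D n A C X Y \<longleftrightarrow>
     (\<exists>f\<in>ends_maps D n A C X Y. \<exists>g\<in>ends_maps D n A C Y X.
        homotopic D (n + 2) X X (\<lambda>i\<in>{..<n + 2}. g i \<cdot>\<^bsub>D\<^esub> f i) (\<lambda>i\<in>{..<n + 2}. Ide D (ob X i)) \<and>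
        homotopic D (n + 2) Y Y (\<lambda>i\<in>{..<n + 2}. f i \<cdot>\<^bsub>D\<^esub> g i) (\<lambda>i\<in>{..<n + 2}. Ide D (ob Y i)))"

definition htpy_class :: "('o, 'm) precat \<Rightarrow> nat \<Rightarrow> ('o, 'm) cplx \<Rightarrow> ('o, 'm) cplx set" where
  "htpy_class D n X =
     {Y \<in> ends_complexes D n (ob X 0) (ob X (n + 1)).
        htpy_equivalent D n (ob X 0) (ob X (n + 1)) X Y}"

definition triv :: "('o, 'm) precat \<Rightarrow> nat \<Rightarrow> nat \<Rightarrow> 'o \<Rightarrow> ('o, 'm) cplx" where
  "triv D n i X = (let T = (\<lambda>j. if j = i \<or> j = i + 1 then X else zero_obj D) in
     \<lparr>ob = (\<lambda>j\<in>{..<n + 2}. T j),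
      df = (\<lambda>j\<in>{..<n + 1}. if j = i then Ide D X else Zero D (T j) (T (j + 1)))\<rparr>)"

definition zero_cplx :: "('o, 'm) precat \<Rightarrow> nat \<Rightarrow> ('o, 'm) cplx" where
  "zero_cplx D n =
     \<lparr>ob = (\<lambda>j\<in>{..<n + 2}. zero_obj D),
      df = (\<lambda>j\<in>{..<n + 1}. Zero D (zero_obj D) (zero_obj D))\<rparr>"

definition dsum_cplx ::
  "('o, 'm) precat \<Rightarrow> nat \<Rightarrow> ('o, 'm) cplx \<Rightarrow> ('o, 'm) cplx \<Rightarrow> ('o, 'm) cplx" where
  "dsum_cplx D k X Y =
     \<lparr>ob = (\<lambda>i\<in>{..<k}. dsum D (ob X i) (ob Y i)),
      df = (\<lambda>i\<in>{..<k - 1}.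
        mat22 D (df X i) (Zero D (ob Y i) (ob X (i + 1)))
                (Zero D (ob X i) (ob Y (i + 1))) (df Y i))\<rparr>"

text \<open>The part of \<open>X\<close> in degrees \<open>s, \<dots>, s + k - 1\<close>, reindexed to start in degree \<open>0\<close>.\<close>

definition segment :: "nat \<Rightarrow> nat \<Rightarrow> ('o, 'm) cplx \<Rightarrow> ('o, 'm) cplx" where
  "segment s k X = \<lparr>ob = (\<lambda>i\<in>{..<k}. ob X (i + s)), df = (\<lambda>i\<in>{..<k - 1}. df X (i + s))\<rparr>"

definition segment_map :: "nat \<Rightarrow> nat \<Rightarrow> (nat \<Rightarrow> 'm) \<Rightarrow> nat \<Rightarrow> 'm" where
  "segment_map s k f = (\<lambda>i\<in>{..<k}. f (i + s))"


section \<open>Exactness\<close>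

definition exact_at ::
  "'a monoid \<Rightarrow> ('a \<Rightarrow> 'b) \<Rightarrow> 'b monoid \<Rightarrow> ('b \<Rightarrow> 'c) \<Rightarrow> 'c monoid \<Rightarrow> bool" where
  "exact_at A f B g C \<longleftrightarrow> f \<in> hom A B \<and> g \<in> hom B C \<and> f ` carrier A = kernel B C g"

text \<open>Exactness of \<open>D(W, X\<^sub>0) \<rightarrow> \<dots> \<rightarrow> D(W, X\<^sub>k\<^sub>-\<^sub>1)\<close> and of
  \<open>D(X\<^sub>k\<^sub>-\<^sub>1, W) \<rightarrow> \<dots> \<rightarrow> D(X\<^sub>0, W)\<close> at all inner terms.\<close>

definition cov_exact :: "('o, 'm) precat \<Rightarrow> nat \<Rightarrow> ('o, 'm) cplx \<Rightarrow> 'o \<Rightarrow> bool" where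
  "cov_exact D k X W \<longleftrightarrow> (\<forall>i. i + 2 < k \<longrightarrow>
     exact_at (homgrp D W (ob X i)) (\<lambda>g. df X i \<cdot>\<^bsub>D\<^esub> g)
              (homgrp D W (ob X (i + 1))) (\<lambda>g. df X (i + 1) \<cdot>\<^bsub>D\<^esub> g)
              (homgrp D W (ob X (i + 2))))"

definition contra_exact :: "('o, 'm) precat \<Rightarrow> nat \<Rightarrow> ('o, 'm) cplx \<Rightarrow> 'o \<Rightarrow> bool" where
  "contra_exact D k X W \<longleftrightarrow> (\<forall>i. i + 2 < k \<longrightarrow>
     exact_at (homgrp D (ob X (i + 2)) W) (\<lambda>g. g \<cdot>\<^bsub>D\<^esub> df X (i + 1))
              (homgrp D (ob X (i + 1)) W) (\<lambda>g. g \<cdot>\<^bsub>D\<^esub> df X i)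
              (homgrp D (ob X i) W))"

text \<open>As above, now also at the leftmost term: exactness of \<open>0 \<rightarrow> D(W, X\<^sub>0) \<rightarrow> \<dots> \<rightarrow> D(W, X\<^sub>n\<^sub>+\<^sub>1)\<close> for all \<open>W\<close>, and dually of
  \<open>0 \<rightarrow> D(X\<^sub>n\<^sub>+\<^sub>1, W) \<rightarrow> \<dots> \<rightarrow> D(X\<^sub>0, W)\<close>.\<close>

definition cov_left_exact :: "('o, 'm) precat \<Rightarrow> nat \<Rightarrow> ('o, 'm) cplx \<Rightarrow> bool" where
  "cov_left_exact D n X \<longleftrightarrow> (\<forall>W\<in>Obj D.
     kernel (homgrp D W (ob X 0)) (homgrp D W (ob X 1)) (\<lambda>g. df X 0 \<cdot>\<^bsub>D\<^esub> g)
       = {Zero D W (ob X 0)} \<and>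
     cov_exact D (n + 2) X W)"

definition contra_left_exact :: "('o, 'm) precat \<Rightarrow> nat \<Rightarrow> ('o, 'm) cplx \<Rightarrow> bool" where
  "contra_left_exact D n X \<longleftrightarrow> (\<forall>W\<in>Obj D.
     kernel (homgrp D (ob X (n + 1)) W) (homgrp D (ob X n) W) (\<lambda>g. g \<cdot>\<^bsub>D\<^esub> df X n)
       = {Zero D (ob X (n + 1)) W} \<and>
     contra_exact D (n + 2) X W)"


section \<open>Biadditive functors and their extensions\<close>

text \<open>\<open>GObj G C A\<close> is the abelian group \<open>G(C, A)\<close>, in the multiplicative notation of
  \<^theory>\<open>HOL-Algebra.Group\<close>; \<open>GMap G c a\<close> is \<open>G(c, a)\<close>, contravariant in \<open>c\<close>.\<close>

record ('o, 'm, 'e) bifun =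
  GObj :: "'o \<Rightarrow> 'o \<Rightarrow> 'e monoid"
  GMap :: "'m \<Rightarrow> 'm \<Rightarrow> 'e \<Rightarrow> 'e"

definition biadditive_functor :: "('o, 'm) precat \<Rightarrow> ('o, 'm, 'e) bifun \<Rightarrow> bool" where
  "biadditive_functor D G \<longleftrightarrow>
     (\<forall>C\<in>Obj D. \<forall>A\<in>Obj D. comm_group (GObj G C A)) \<and>
     (\<forall>c\<in>Arr D. \<forall>a\<in>Arr D.
        GMap G c a \<in> hom (GObj G (Cod D c) (Dom D a)) (GObj G (Dom D c) (Cod D a))) \<and>
     (\<forall>C\<in>Obj D. \<forall>A\<in>Obj D. \<forall>\<delta>\<in>carrier (GObj G C A). GMap G (Ide D C) (Ide D A) \<delta> = \<delta>) \<and>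
     (\<forall>c\<in>Arr D. \<forall>c'\<in>Arr D. \<forall>a\<in>Arr D. \<forall>a'\<in>Arr D.
        Cod D c' = Dom D c \<and> Cod D a = Dom D a' \<longrightarrow>
        (\<forall>\<delta>\<in>carrier (GObj G (Cod D c) (Dom D a)).
           GMap G (c \<cdot>\<^bsub>D\<^esub> c') (a' \<cdot>\<^bsub>D\<^esub> a) \<delta> = GMap G c' a' (GMap G c a \<delta>))) \<and>
     (\<forall>C\<in>Obj D. \<forall>C'\<in>Obj D. \<forall>c\<in>homs D C' C. \<forall>c'\<in>homs D C' C. \<forall>a\<in>Arr D.
        \<forall>\<delta>\<in>carrier (GObj G C (Dom D a)).
           GMap G (c \<boxplus>\<^bsub>D\<^esub> c') a \<delta> = GMap G c a \<delta> \<otimes>\<^bsub>GObj G C' (Cod D a)\<^esub> GMap G c' a \<delta>) \<and>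
     (\<forall>A\<in>Obj D. \<forall>A'\<in>Obj D. \<forall>a\<in>homs D A A'. \<forall>a'\<in>homs D A A'. \<forall>c\<in>Arr D.
        \<forall>\<delta>\<in>carrier (GObj G (Cod D c) A).
           GMap G c (a \<boxplus>\<^bsub>D\<^esub> a') \<delta> = GMap G c a \<delta> \<otimes>\<^bsub>GObj G (Dom D c) A'\<^esub> GMap G c a' \<delta>)"

text \<open>\<open>push D G C a \<delta>\<close> is \<open>a\<^sub>*\<delta> = G(C, a)(\<delta>)\<close> and \<open>pull D G A c \<delta>\<close> is \<open>c\<^sup>*\<delta> = G(c, A)(\<delta>)\<close>.\<close>

definition push :: "('o, 'm) precat \<Rightarrow> ('o, 'm, 'e) bifun \<Rightarrow> 'o \<Rightarrow> 'm \<Rightarrow> 'e \<Rightarrow> 'e" where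
  "push D G C a \<delta> = GMap G (Ide D C) a \<delta>"

definition pull :: "('o, 'm) precat \<Rightarrow> ('o, 'm, 'e) bifun \<Rightarrow> 'o \<Rightarrow> 'm \<Rightarrow> 'e \<Rightarrow> 'e" where
  "pull D G A c \<delta> = GMap G c (Ide D A) \<delta>"

definition is_n_exangle ::
  "('o, 'm) precat \<Rightarrow> nat \<Rightarrow> ('o, 'm, 'e) bifun \<Rightarrow> ('o, 'm) cplx \<Rightarrow> 'e \<Rightarrow> bool" where
  "is_n_exangle D n G X \<delta> \<longleftrightarrow>
     X \<in> complexes D (n + 2) \<and>
     \<delta> \<in> carrier (GObj G (ob X (n + 1)) (ob X 0)) \<and>
     push D G (ob X (n + 1)) (df X 0) \<delta> = \<one>\<^bsub>GObj G (ob X (n + 1)) (ob X 1)\<^esub> \<and>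
     pull D G (ob X 0) (df X n) \<delta> = \<one>\<^bsub>GObj G (ob X n) (ob X 0)\<^esub> \<and>
     (\<forall>W\<in>Obj D.
        cov_exact D (n + 2) X W \<and>
        exact_at (homgrp D W (ob X n)) (\<lambda>g. df X n \<cdot>\<^bsub>D\<^esub> g)
                 (homgrp D W (ob X (n + 1))) (\<lambda>c. pull D G (ob X 0) c \<delta>)
                 (GObj G W (ob X 0)) \<and>
        contra_exact D (n + 2) X W \<and>
        exact_at (homgrp D (ob X 1) W) (\<lambda>g. g \<cdot>\<^bsub>D\<^esub> df X 0)
                 (homgrp D (ob X 0) W) (\<lambda>a. push D G (ob X (n + 1)) a \<delta>)
                 (GObj G (ob X (n + 1)) W))"


section \<open>\<open>n\<close>-exangulated structures\<close>

text \<open>\<open>r C A \<delta>\<close> is the realisation of \<open>\<delta> \<in> G(C, A)\<close>.\<close>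

type_synonym ('o, 'm, 'e) realisation = "'o \<Rightarrow> 'o \<Rightarrow> 'e \<Rightarrow> ('o, 'm) cplx set"

definition distinguished ::
  "('o, 'm) precat \<Rightarrow> nat \<Rightarrow> ('o, 'm, 'e) bifun \<Rightarrow> ('o, 'm, 'e) realisation \<Rightarrow>
     ('o, 'm) cplx \<Rightarrow> 'e \<Rightarrow> bool" where
  "distinguished D n G r X \<delta> \<longleftrightarrow>
     X \<in> complexes D (n + 2) \<and>
     \<delta> \<in> carrier (GObj G (ob X (n + 1)) (ob X 0)) \<and>
     r (ob X (n + 1)) (ob X 0) \<delta> = htpy_class D n X"

definition conflations ::
  "('o, 'm) precat \<Rightarrow> nat \<Rightarrow> ('o, 'm, 'e) bifun \<Rightarrow> ('o, 'm, 'e) realisation \<Rightarrow> ('o, 'm) cplx set"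
  where
  "conflations D n G r = {X. \<exists>\<delta>. distinguished D n G r X \<delta>}"

definition inflations ::
  "('o, 'm) precat \<Rightarrow> nat \<Rightarrow> ('o, 'm, 'e) bifun \<Rightarrow> ('o, 'm, 'e) realisation \<Rightarrow> 'm set" where
  "inflations D n G r = (\<lambda>X. df X 0) ` conflations D n G r"

definition deflations ::
  "('o, 'm) precat \<Rightarrow> nat \<Rightarrow> ('o, 'm, 'e) bifun \<Rightarrow> ('o, 'm, 'e) realisation \<Rightarrow> 'm set" where
  "deflations D n G r = (\<lambda>X. df X n) ` conflations D n G r"

definition exact_realisation ::
  "('o, 'm) precat \<Rightarrow> nat \<Rightarrow> ('o, 'm, 'e) bifun \<Rightarrow> ('o, 'm, 'e) realisation \<Rightarrow> bool" where
  "exact_realisation D n G r \<longleftrightarrow>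
     (\<forall>C\<in>Obj D. \<forall>A\<in>Obj D. \<forall>\<delta>\<in>carrier (GObj G C A).
        r C A \<delta> \<in> htpy_class D n ` ends_complexes D n A C) \<and>
     \<comment> \<open>(R0)\<close>
     (\<forall>X Y \<delta> \<rho>. distinguished D n G r X \<delta> \<and> distinguished D n G r Y \<rho> \<longrightarrow>
        (\<forall>a\<in>homs D (ob X 0) (ob Y 0). \<forall>c\<in>homs D (ob X (n + 1)) (ob Y (n + 1)).
           push D G (ob X (n + 1)) a \<delta> = pull D G (ob Y 0) c \<rho> \<longrightarrow>
           (\<exists>f\<in>chain_maps D (n + 2) X Y. f 0 = a \<and> f (n + 1) = c))) \<and>
     \<comment> \<open>(R1)\<close>
     (\<forall>X \<delta>. distinguished D n G r X \<delta> \<longrightarrow> is_n_exangle D n G X \<delta>) \<and>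
     \<comment> \<open>(R2)\<close>
     (\<forall>A\<in>Obj D. r (zero_obj D) A \<one>\<^bsub>GObj G (zero_obj D) A\<^esub> = htpy_class D n (triv D n 0 A)) \<and>
     (\<forall>C\<in>Obj D. r C (zero_obj D) \<one>\<^bsub>GObj G C (zero_obj D)\<^esub> = htpy_class D n (triv D n n C))"

definition M_cone ::
  "('o, 'm) precat \<Rightarrow> nat \<Rightarrow> ('o, 'm) cplx \<Rightarrow> ('o, 'm) cplx \<Rightarrow> (nat \<Rightarrow> 'm) \<Rightarrow> ('o, 'm) cplx" where
  "M_cone D n X Y f =
     \<lparr>ob = (\<lambda>i\<in>{..<n + 2}.
        if i = 0 then ob X 1
        else if i = n + 1 then ob Y (n + 1)
        else dsum D (ob X (i + 1)) (ob Y i)),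
      df = (\<lambda>i\<in>{..<n + 1}.
        if i = 0 then col D (neg D (df X 1)) (f 1)
        else if i = n then row D (f (n + 1)) (df Y n)
        else mat22 D (neg D (df X (i + 1))) (Zero D (ob Y i) (ob X (i + 2)))
                     (f (i + 1)) (df Y i))\<rparr>"

definition N_cone ::
  "('o, 'm) precat \<Rightarrow> nat \<Rightarrow> ('o, 'm) cplx \<Rightarrow> ('o, 'm) cplx \<Rightarrow> (nat \<Rightarrow> 'm) \<Rightarrow> ('o, 'm) cplx" where
  "N_cone D n X Y f =
     \<lparr>ob = (\<lambda>i\<in>{..<n + 2}.
        if i = 0 then ob X 0
        else if i = n + 1 then ob Y n
        else dsum D (ob X i) (ob Y (i - 1))),
      df = (\<lambda>i\<in>{..<n + 1}.
        if i = 0 then col D (df X 0) (f 0)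
        else if i = n then row D (f n) (neg D (df Y (n - 1)))
        else mat22 D (df X i) (Zero D (ob Y (i - 1)) (ob X (i + 1)))
                     (f i) (neg D (df Y (i - 1))))\<rparr>"

definition n_exangulated ::
  "('o, 'm) precat \<Rightarrow> nat \<Rightarrow> ('o, 'm, 'e) bifun \<Rightarrow> ('o, 'm, 'e) realisation \<Rightarrow> bool" where
  "n_exangulated D n G r \<longleftrightarrow>
     additive_category D \<and> biadditive_functor D G \<and> exact_realisation D n G r \<and>
     \<comment> \<open>(EA1) and its dual\<close>
     closed_under_comp D (inflations D n G r) \<and>
     closed_under_comp D (deflations D n G r) \<and>
     \<comment> \<open>(EA2)\<close>
     (\<forall>X Y c \<rho>. ob X 0 = ob Y 0 \<and> c \<in> homs D (ob X (n + 1)) (ob Y (n + 1)) \<and>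
        distinguished D n G r Y \<rho> \<and> distinguished D n G r X (pull D G (ob Y 0) c \<rho>) \<longrightarrow>
        (\<exists>f\<in>chain_maps D (n + 2) X Y. f 0 = Ide D (ob X 0) \<and> f (n + 1) = c \<and>
           distinguished D n G r (M_cone D n X Y f) (push D G (ob Y (n + 1)) (df X 0) \<rho>))) \<and>
     \<comment> \<open>dual of (EA2)\<close>
     (\<forall>X Y a \<delta>. ob X (n + 1) = ob Y (n + 1) \<and> a \<in> homs D (ob X 0) (ob Y 0) \<and>
        distinguished D n G r X \<delta> \<and> distinguished D n G r Y (push D G (ob X (n + 1)) a \<delta>) \<longrightarrow>
        (\<exists>f\<in>chain_maps D (n + 2) X Y. f 0 = a \<and> f (n + 1) = Ide D (ob X (n + 1)) \<and>
           distinguished D n G r (N_cone D n X Y f) (pull D G (ob X 0) (df Y n) \<delta>)))"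


section \<open>\<open>n\<close>-exangulated functors and equivalences\<close>

record ('o, 'm, 'p, 'q) func =
  OMap :: "'o \<Rightarrow> 'p"
  AMap :: "'m \<Rightarrow> 'q"

definition is_functor ::
  "('o, 'm) precat \<Rightarrow> ('p, 'q) precat \<Rightarrow> ('o, 'm, 'p, 'q) func \<Rightarrow> bool" where
  "is_functor D D' F \<longleftrightarrow>
     (\<forall>A\<in>Obj D. OMap F A \<in> Obj D' \<and> AMap F (Ide D A) = Ide D' (OMap F A)) \<and>
     (\<forall>f\<in>Arr D. AMap F f \<in> homs D' (OMap F (Dom D f)) (OMap F (Cod D f))) \<and>
     (\<forall>f\<in>Arr D. \<forall>g\<in>Arr D. Cod D f = Dom D g \<longrightarrow>
        AMap F (g \<cdot>\<^bsub>D\<^esub> f) = AMap F g \<cdot>\<^bsub>D'\<^esub> AMap F f)"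

definition is_additive_functor ::
  "('o, 'm) precat \<Rightarrow> ('p, 'q) precat \<Rightarrow> ('o, 'm, 'p, 'q) func \<Rightarrow> bool" where
  "is_additive_functor D D' F \<longleftrightarrow> is_functor D D' F \<and>
     (\<forall>A\<in>Obj D. \<forall>B\<in>Obj D. \<forall>f\<in>homs D A B. \<forall>g\<in>homs D A B.
        AMap F (f \<boxplus>\<^bsub>D\<^esub> g) = AMap F f \<boxplus>\<^bsub>D'\<^esub> AMap F g)"

definition id_func :: "('o, 'm, 'o, 'm) func" where
  "id_func = \<lparr>OMap = id, AMap = id\<rparr>"

definition comp_func ::
  "('p, 'q, 's, 't) func \<Rightarrow> ('o, 'm, 'p, 'q) func \<Rightarrow> ('o, 'm, 's, 't) func" where
  "comp_func H F = \<lparr>OMap = OMap H \<circ> OMap F, AMap = AMap H \<circ> AMap F\<rparr>"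

definition is_nat_iso ::
  "('o, 'm) precat \<Rightarrow> ('p, 'q) precat \<Rightarrow> ('o, 'm, 'p, 'q) func \<Rightarrow> ('o, 'm, 'p, 'q) func \<Rightarrow>
     ('o \<Rightarrow> 'q) \<Rightarrow> bool" where
  "is_nat_iso D D' F H \<eta> \<longleftrightarrow>
     (\<forall>A\<in>Obj D. \<eta> A \<in> homs D' (OMap F A) (OMap H A) \<and> is_iso_arr D' (\<eta> A)) \<and>
     (\<forall>f\<in>Arr D. \<eta> (Cod D f) \<cdot>\<^bsub>D'\<^esub> AMap F f = AMap H f \<cdot>\<^bsub>D'\<^esub> \<eta> (Dom D f))"

definition is_equivalence_functor ::
  "('o, 'm) precat \<Rightarrow> ('p, 'q) precat \<Rightarrow> ('o, 'm, 'p, 'q) func \<Rightarrow> bool" where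
  "is_equivalence_functor D D' F \<longleftrightarrow> is_functor D D' F \<and>
     (\<exists>H. is_functor D' D H \<and>
        (\<exists>\<eta>. is_nat_iso D D id_func (comp_func H F) \<eta>) \<and>
        (\<exists>\<epsilon>. is_nat_iso D' D' (comp_func F H) id_func \<epsilon>))"

definition map_cplx ::
  "nat \<Rightarrow> ('o, 'm, 'p, 'q) func \<Rightarrow> ('o, 'm) cplx \<Rightarrow> ('p, 'q) cplx" where
  "map_cplx k F X =
     \<lparr>ob = (\<lambda>i\<in>{..<k}. OMap F (ob X i)), df = (\<lambda>i\<in>{..<k - 1}. AMap F (df X i))\<rparr>"

definition is_nat_trans_ext ::
  "('o, 'm) precat \<Rightarrow> ('o, 'm, 'e) bifun \<Rightarrow> ('p, 'q, 'f) bifun \<Rightarrow> ('o, 'm, 'p, 'q) func \<Rightarrow>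
     ('o \<Rightarrow> 'o \<Rightarrow> 'e \<Rightarrow> 'f) \<Rightarrow> bool" where
  "is_nat_trans_ext D G G' F \<Gamma> \<longleftrightarrow>
     (\<forall>C\<in>Obj D. \<forall>A\<in>Obj D. \<Gamma> C A \<in> hom (GObj G C A) (GObj G' (OMap F C) (OMap F A))) \<and>
     (\<forall>c\<in>Arr D. \<forall>a\<in>Arr D. \<forall>\<delta>\<in>carrier (GObj G (Cod D c) (Dom D a)).
        \<Gamma> (Dom D c) (Cod D a) (GMap G c a \<delta>) =
        GMap G' (AMap F c) (AMap F a) (\<Gamma> (Cod D c) (Dom D a) \<delta>))"

definition n_exangulated_functor ::
  "nat \<Rightarrow> ('o, 'm) precat \<Rightarrow> ('o, 'm, 'e) bifun \<Rightarrow> ('o, 'm, 'e) realisation \<Rightarrow>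
     ('p, 'q) precat \<Rightarrow> ('p, 'q, 'f) bifun \<Rightarrow> ('p, 'q, 'f) realisation \<Rightarrow>
     ('o, 'm, 'p, 'q) func \<Rightarrow> ('o \<Rightarrow> 'o \<Rightarrow> 'e \<Rightarrow> 'f) \<Rightarrow> bool" where
  "n_exangulated_functor n D G r D' G' r' F \<Gamma> \<longleftrightarrow>
     is_additive_functor D D' F \<and> is_nat_trans_ext D G G' F \<Gamma> \<and>
     (\<forall>C\<in>Obj D. \<forall>A\<in>Obj D. \<forall>\<delta>\<in>carrier (GObj G C A). \<forall>X\<in>ends_complexes D n A C.
        r C A \<delta> = htpy_class D n X \<longrightarrow>
        r' (OMap F C) (OMap F A) (\<Gamma> C A \<delta>) = htpy_class D' n (map_cplx (n + 2) F X))"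

definition n_exangulated_equivalence ::
  "nat \<Rightarrow> ('o, 'm) precat \<Rightarrow> ('o, 'm, 'e) bifun \<Rightarrow> ('o, 'm, 'e) realisation \<Rightarrow>
     ('p, 'q) precat \<Rightarrow> ('p, 'q, 'f) bifun \<Rightarrow> ('p, 'q, 'f) realisation \<Rightarrow>
     ('o, 'm, 'p, 'q) func \<Rightarrow> ('o \<Rightarrow> 'o \<Rightarrow> 'e \<Rightarrow> 'f) \<Rightarrow> bool" where
  "n_exangulated_equivalence n D G r D' G' r' F \<Gamma> \<longleftrightarrow>
     n_exangulated_functor n D G r D' G' r' F \<Gamma> \<and>
     is_equivalence_functor D D' F \<and>
     (\<forall>C\<in>Obj D. \<forall>A\<in>Obj D. \<Gamma> C A \<in> iso (GObj G C A) (GObj G' (OMap F C) (OMap F A)))"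


section \<open>\<open>n\<close>-exact structures\<close>

definition n_exact_sequences :: "('o, 'm) precat \<Rightarrow> nat \<Rightarrow> ('o, 'm) cplx set" where
  "n_exact_sequences D n =
     {X \<in> complexes D (n + 2). cov_left_exact D n X \<and> contra_left_exact D n X}"

text \<open>The indices are read cyclically: \<open>f\<^sub>n\<^sub>+\<^sub>2\<close> means \<open>f\<^sub>0\<close>.\<close>

definition weak_iso ::
  "('o, 'm) precat \<Rightarrow> nat \<Rightarrow> ('o, 'm) cplx \<Rightarrow> ('o, 'm) cplx \<Rightarrow> (nat \<Rightarrow> 'm) \<Rightarrow> bool" where
  "weak_iso D n X Y f \<longleftrightarrow> f \<in> chain_maps D (n + 2) X Y \<and>
     (\<exists>k\<le>n + 1. is_iso_arr D (f k) \<and> is_iso_arr D (f ((k + 1) mod (n + 2))))"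

text \<open>The cone of a chain map between complexes with \<open>n + 1\<close> terms; its signs differ from those
  of \<open>N_cone\<close>.\<close>

definition cone ::
  "('o, 'm) precat \<Rightarrow> nat \<Rightarrow> ('o, 'm) cplx \<Rightarrow> ('o, 'm) cplx \<Rightarrow> (nat \<Rightarrow> 'm) \<Rightarrow> ('o, 'm) cplx" where
  "cone D n X Y f =
     \<lparr>ob = (\<lambda>i\<in>{..<n + 2}.
        if i = 0 then ob X 0
        else if i = n + 1 then ob Y n
        else dsum D (ob X i) (ob Y (i - 1))),
      df = (\<lambda>i\<in>{..<n + 1}.
        if i = 0 then col D (neg D (df X 0)) (f 0)
        else if i = n then row D (f n) (df Y (n - 1))
        else mat22 D (neg D (df X i)) (Zero D (ob Y (i - 1)) (ob X (i + 1)))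
                     (f i) (df Y (i - 1)))\<rparr>"

definition n_pushout_diagram ::
  "('o, 'm) precat \<Rightarrow> nat \<Rightarrow> ('o, 'm) cplx \<Rightarrow> ('o, 'm) cplx \<Rightarrow> (nat \<Rightarrow> 'm) \<Rightarrow> bool" where
  "n_pushout_diagram D n X Y f \<longleftrightarrow>
     X \<in> complexes D (n + 1) \<and> Y \<in> complexes D (n + 1) \<and> f \<in> chain_maps D (n + 1) X Y \<and>
     contra_left_exact D n (cone D n X Y f)"

definition n_pullback_diagram ::
  "('o, 'm) precat \<Rightarrow> nat \<Rightarrow> ('o, 'm) cplx \<Rightarrow> ('o, 'm) cplx \<Rightarrow> (nat \<Rightarrow> 'm) \<Rightarrow> bool" where
  "n_pullback_diagram D n X Y f \<longleftrightarrow>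
     X \<in> complexes D (n + 1) \<and> Y \<in> complexes D (n + 1) \<and> f \<in> chain_maps D (n + 1) X Y \<and>
     cov_left_exact D n (cone D n X Y f)"

definition admissible_monos :: "('o, 'm) cplx set \<Rightarrow> 'm set" where
  "admissible_monos \<X> = (\<lambda>X. df X 0) ` \<X>"

definition admissible_epis :: "nat \<Rightarrow> ('o, 'm) cplx set \<Rightarrow> 'm set" where
  "admissible_epis n \<X> = (\<lambda>X. df X n) ` \<X>"

definition n_exact_structure :: "('o, 'm) precat \<Rightarrow> nat \<Rightarrow> ('o, 'm) cplx set \<Rightarrow> bool" where
  "n_exact_structure D n \<X> \<longleftrightarrow>
     \<X> \<subseteq> n_exact_sequences D n \<and>
     (\<forall>X\<in>n_exact_sequences D n. \<forall>Y\<in>n_exact_sequences D n.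
        (\<exists>f. weak_iso D n X Y f) \<longrightarrow> (X \<in> \<X> \<longleftrightarrow> Y \<in> \<X>)) \<and>
     \<comment> \<open>(E0)\<close>
     zero_cplx D n \<in> \<X> \<and>
     \<comment> \<open>(E1) and its dual\<close>
     closed_under_comp D (admissible_monos \<X>) \<and>
     closed_under_comp D (admissible_epis n \<X>) \<and>
     \<comment> \<open>(E2)\<close>
     (\<forall>X\<in>\<X>. \<forall>B\<in>Obj D. \<forall>a\<in>homs D (ob X 0) B.
        \<exists>Y f. n_pushout_diagram D n (segment 0 (n + 1) X) Y f \<and>
          f 0 = a \<and> df Y 0 \<in> admissible_monos \<X>) \<and>
     \<comment> \<open>dual of (E2); the source \<open>Y\<close> is indexed from \<open>0\<close>\<close>
     (\<forall>X\<in>\<X>. \<forall>B\<in>Obj D. \<forall>c\<in>homs D B (ob X (n + 1)).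
        \<exists>Y f. n_pullback_diagram D n Y (segment 1 (n + 1) X) f \<and>
          f n = c \<and> df Y (n - 1) \<in> admissible_epis n \<X>)"


section \<open>From \<open>n\<close>-exact to \<open>n\<close>-exangulated structures\<close>

definition ext_classes ::
  "('o, 'm) precat \<Rightarrow> nat \<Rightarrow> ('o, 'm) cplx set \<Rightarrow> 'o \<Rightarrow> 'o \<Rightarrow> ('o, 'm) cplx set set" where
  "ext_classes D n \<X> C A = htpy_class D n ` (\<X> \<inter> ends_complexes D n A C)"

text \<open>The type \<open>'e\<close> plays the role of the universe of sets in which abelian groups live: a
  collection is small iff it injects into \<open>'e\<close>.\<close>

definition small_extension_groups ::
  "'e itself \<Rightarrow> ('o, 'm) precat \<Rightarrow> nat \<Rightarrow> ('o, 'm) cplx set \<Rightarrow> bool" where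
  "small_extension_groups _ D n \<X> \<longleftrightarrow>
     (\<forall>A\<in>Obj D. \<forall>C\<in>Obj D. \<exists>\<iota> :: ('o, 'm) cplx set \<Rightarrow> 'e. inj_on \<iota> (ext_classes D n \<X> C A))"

definition X_push ::
  "('o, 'm) precat \<Rightarrow> nat \<Rightarrow> ('o, 'm) cplx set \<Rightarrow> 'm \<Rightarrow> ('o, 'm) cplx set \<Rightarrow> ('o, 'm) cplx set"
  where
  "X_push D n \<X> a E = (THE E'.
     \<exists>X\<in>\<X>. \<exists>Y\<in>\<X> \<inter> ends_complexes D n (Cod D a) (ob X (n + 1)).
       \<exists>f\<in>chain_maps D (n + 2) X Y.
         E = htpy_class D n X \<and> E' = htpy_class D n Y \<and>
         f 0 = a \<and> f (n + 1) = Ide D (ob X (n + 1)) \<and>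
         n_pushout_diagram D n (segment 0 (n + 1) X) (segment 0 (n + 1) Y)
           (segment_map 0 (n + 1) f))"

definition X_pull ::
  "('o, 'm) precat \<Rightarrow> nat \<Rightarrow> ('o, 'm) cplx set \<Rightarrow> 'm \<Rightarrow> ('o, 'm) cplx set \<Rightarrow> ('o, 'm) cplx set"
  where
  "X_pull D n \<X> c E = (THE E'.
     \<exists>X\<in>\<X>. \<exists>Y\<in>\<X> \<inter> ends_complexes D n (ob X 0) (Dom D c).
       \<exists>f\<in>chain_maps D (n + 2) Y X.
         E = htpy_class D n X \<and> E' = htpy_class D n Y \<and>
         f 0 = Ide D (ob X 0) \<and> f (n + 1) = c \<and>
         n_pullback_diagram D n (segment 1 (n + 1) Y) (segment 1 (n + 1) X)
           (segment_map 1 (n + 1) f))"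

definition X_map ::
  "('o, 'm) precat \<Rightarrow> nat \<Rightarrow> ('o, 'm) cplx set \<Rightarrow> 'm \<Rightarrow> 'm \<Rightarrow>
     ('o, 'm) cplx set \<Rightarrow> ('o, 'm) cplx set" where
  "X_map D n \<X> c a E = X_push D n \<X> a (X_pull D n \<X> c E)"

definition diagonal :: "('o, 'm) precat \<Rightarrow> 'o \<Rightarrow> 'm" where
  "diagonal D C = col D (Ide D C) (Ide D C)"

definition codiagonal :: "('o, 'm) precat \<Rightarrow> 'o \<Rightarrow> 'm" where
  "codiagonal D A = row D (Ide D A) (Ide D A)"

definition baer_sum ::
  "('o, 'm) precat \<Rightarrow> nat \<Rightarrow> ('o, 'm) cplx set \<Rightarrow> 'o \<Rightarrow> 'o \<Rightarrow>
     ('o, 'm) cplx set \<Rightarrow> ('o, 'm) cplx set \<Rightarrow> ('o, 'm) cplx set" where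
  "baer_sum D n \<X> C A E E' = (THE E''.
     \<exists>X\<in>\<X> \<inter> ends_complexes D n A C. \<exists>Y\<in>\<X> \<inter> ends_complexes D n A C.
       E = htpy_class D n X \<and> E' = htpy_class D n Y \<and>
       E'' = X_map D n \<X> (diagonal D C) (codiagonal D A)
               (htpy_class D n (dsum_cplx D (n + 2) X Y)))"

text \<open>The group structure is determined by the sum alone; the unit field has to be its neutral
  element.\<close>

definition baer_zero ::
  "('o, 'm) precat \<Rightarrow> nat \<Rightarrow> ('o, 'm) cplx set \<Rightarrow> 'o \<Rightarrow> 'o \<Rightarrow> ('o, 'm) cplx set" where
  "baer_zero D n \<X> C A = (THE E. E \<in> ext_classes D n \<X> C A \<and>
     (\<forall>E'\<in>ext_classes D n \<X> C A.
        baer_sum D n \<X> C A E E' = E' \<and> baer_sum D n \<X> C A E' E = E'))"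

definition G_of ::
  "('o, 'm) precat \<Rightarrow> nat \<Rightarrow> ('o, 'm) cplx set \<Rightarrow> ('o, 'm, ('o, 'm) cplx set) bifun" where
  "G_of D n \<X> =
     \<lparr>GObj = (\<lambda>C A. \<lparr>carrier = ext_classes D n \<X> C A, mult = baer_sum D n \<X> C A,
                     one = baer_zero D n \<X> C A\<rparr>),
      GMap = X_map D n \<X>\<rparr>"

text \<open>The elements of \<open>G_of D n \<X>\<close> already are homotopy classes; each is realised by itself.\<close>

definition r_of :: "('o, 'm, ('o, 'm) cplx set) realisation" where
  "r_of C A E = E"


section \<open>The two sides of the correspondence\<close>

definition exact_structures ::
  "'e itself \<Rightarrow> ('o, 'm) precat \<Rightarrow> nat \<Rightarrow> ('o, 'm) cplx set set" where
  "exact_structures U D n = {\<X>. n_exact_structure D n \<X> \<and> small_extension_groups U D n \<X>}"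

definition exangulated_structures ::
  "('o, 'm) precat \<Rightarrow> nat \<Rightarrow> (('o, 'm, 'e) bifun \<times> ('o, 'm, 'e) realisation) set" where
  "exangulated_structures D n = {(G, r). n_exangulated D n G r \<and>
     (\<forall>f\<in>inflations D n G r. is_monic D f) \<and> (\<forall>f\<in>deflations D n G r. is_epic D f)}"

definition id_equivalent ::
  "('o, 'm) precat \<Rightarrow> nat \<Rightarrow> ('o, 'm, 'e) bifun \<times> ('o, 'm, 'e) realisation \<Rightarrow>
     ('o, 'm, 'f) bifun \<times> ('o, 'm, 'f) realisation \<Rightarrow> bool" where
  "id_equivalent D n S S' \<longleftrightarrow>
     (\<exists>\<Gamma>. n_exangulated_equivalence n D (fst S) (snd S) D (fst S') (snd S') id_func \<Gamma>)"

definition id_equivalence_rel ::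
  "('o, 'm) precat \<Rightarrow> nat \<Rightarrow>
     (('o, 'm, 'e) bifun \<times> ('o, 'm, 'e) realisation) rel" where
  "id_equivalence_rel D n =
     {(S, S'). S \<in> exangulated_structures D n \<and> S' \<in> exangulated_structures D n \<and>
        id_equivalent D n S S'}"

text \<open>The equivalence class of \<open>(G_of D n \<X>, r_of)\<close>, among the structures whose extension groups
  have elements in \<open>'e\<close>.\<close>

definition exangulated_class_of ::
  "('o, 'm) precat \<Rightarrow> nat \<Rightarrow> ('o, 'm) cplx set \<Rightarrow>
     (('o, 'm, 'e) bifun \<times> ('o, 'm, 'e) realisation) set" where
  "exangulated_class_of D n \<X> =
     {S \<in> exangulated_structures D n. id_equivalent D n (G_of D n \<X>, r_of) S}"

text \<open>The common class of conflations of the members of an equivalence class.\<close>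

definition conflations_of_class ::
  "('o, 'm) precat \<Rightarrow> nat \<Rightarrow> (('o, 'm, 'e) bifun \<times> ('o, 'm, 'e) realisation) set \<Rightarrow>
     ('o, 'm) cplx set" where
  "conflations_of_class D n K = the_elem ((\<lambda>(G, r). conflations D n G r) ` K)"

end

theory Submission
  imports Defs
begin

text \<open>On the \<open>n\<close>-exact side everything rests on one factorisation: a chain map between members of
  \<open>\<X>\<close> with ends \<open>(a, c)\<close> splits as a pushout along \<open>a\<close> followed by a pullback along \<open>c\<close>. Hence the
  homotopy class of a pushout or pullback depends only on the class of the original sequence. Any two
  classes are of the form \<open>x\<^sub>*E\<close>, \<open>y\<^sub>*E\<close> with the same \<open>E\<close>, and then their Baer sum is
  \<open>(x + y)\<^sub>*E\<close>, so the group axioms and biadditivity are inherited from the Hom groups. The cones in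
  (EA2) are \<open>n\<close>-exact because they are cones of pushout and pullback squares.

  On the \<open>n\<close>-exangulated side, monic inflations and epic deflations turn the long exact sequences of
  a conflation into \<open>n\<close>-exactness. Applying (EA2) to a split deflation shows that the kernel of
  \<open>(d\<^sub>0\<^sup>X)\<^sub>*\<close> consists of the pullbacks of \<open>\<delta>\<close>, which forces every chain map between conflations to
  be a morphism of extensions. So the realisation is injective, and its inverse is the natural isomorphism
  from the functor of classes of conflations. An \<open>n\<close>-exangulated structure is thus determined, up to an
  isomorphism over the identity, by its conflations, and the functor of classes of a small \<open>n\<close>-exact
  structure is moved to the prescribed type of extensions along injections.\<close>

section \<open>Calculus in an additive category\<close>

text \<open>For n \<ge> 2 a chain map with identity ends need not be an isomorphism: contractible
  summands in the inner degrees are invisible. So inner terms are never compared directly, and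
  everything is phrased through the ends: \<open>emap D n X Y a c\<close> says that some chain map
  has ends \<open>a\<close> and \<open>c\<close>. Exactness of the Hom complexes carries information
  from one end to the other. If the left end extends over \<open>d\<^sub>0\<close>, the right end
  factors through \<open>d\<^sub>n\<close>, and conversely; two chain maps with the same left end
  have right ends that differ by a map through \<open>d\<^sub>n\<close>. This exchange replaces the
  five lemma. It yields the splitting criterion, the description of the zero class, the exactness of
  the sequences that end in extension groups, and the uniqueness of pushouts. Duality covers
  statements about single complexes and chain maps. Cones, direct sums and Baer sums depend on
  chosen biproducts and are treated on both sides by hand; for this reason pushouts and pullbacks
  are first restated without cones, as \<open>po_elt\<close> and \<open>pb_elt\<close>.\<close>

lemma in_homs: "f \<in> homs D A B \<longleftrightarrow> f \<in> Arr D \<and> Dom D f = A \<and> Cod D f = B"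
  by (simp add: homs_def)

text \<open>\<open>D\<close> is declared as a structure, so that composition and addition can be
  written without index.\<close>

locale acat = additive_category D for D :: "('o, 'm) precat" (structure)
begin

lemma homs_obj: assumes "f \<in> homs D A B" shows "A \<in> Obj D" "B \<in> Obj D"
  using assms Dom_in Cod_in by (auto simp: in_homs)

lemma obj_Dom[simp]: "f \<in> Arr D \<Longrightarrow> Dom D f \<in> Obj D" by (rule Dom_in)
lemma obj_Cod[simp]: "f \<in> Arr D \<Longrightarrow> Cod D f \<in> Obj D" by (rule Cod_in)

lemma Comp_homs: "f \<in> Arr D \<Longrightarrow> g \<in> Arr D \<Longrightarrow> Cod D f = Dom D g \<Longrightarrow>
    g \<cdot> f \<in> homs D (Dom D f) (Cod D g)"
  by (rule Comp_in[of f _ "Dom D g"]) (simp_all add: in_homs)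

text \<open>The typing rules speak of \<open>Arr\<close>, \<open>Dom\<close> and \<open>Cod\<close>
  instead of \<open>homs\<close>: in this form the simplifier computes the ends of a composite from
  those of its factors. Facts about \<open>homs\<close> are brought into the same form by
  \<open>[unfolded in_homs]\<close> throughout.\<close>

lemma Comp_type[simp]:
  assumes "f \<in> Arr D" "g \<in> Arr D" "Cod D f = Dom D g"
  shows "g \<cdot> f \<in> Arr D" "Dom D (g \<cdot> f) = Dom D f" "Cod D (g \<cdot> f) = Cod D g"
  using Comp_homs[OF assms] by (simp_all add: in_homs)

lemma Ide_type[simp]:
  assumes "A \<in> Obj D"
  shows "Ide D A \<in> Arr D" "Dom D (Ide D A) = A" "Cod D (Ide D A) = A"
  using Ide_in[OF assms] by (simp_all add: in_homs)

lemma Ide_Comp[simp]: "f \<in> Arr D \<Longrightarrow> Cod D f = B \<Longrightarrow> Ide D B \<cdot> f = f"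
  by (rule Ide_left) (auto simp: in_homs)

lemma Comp_Ide[simp]: "f \<in> Arr D \<Longrightarrow> Dom D f = A \<Longrightarrow> f \<cdot> Ide D A = f"
  by (rule Ide_right) (auto simp: in_homs)

lemma assoc: "f \<in> Arr D \<Longrightarrow> g \<in> Arr D \<Longrightarrow> h \<in> Arr D \<Longrightarrow> Cod D f = Dom D g \<Longrightarrow> Cod D g = Dom D h \<Longrightarrow>
    (h \<cdot> g) \<cdot> f = h \<cdot> (g \<cdot> f)"
  by (rule Comp_assoc) (auto simp: in_homs)

lemma grp: "A \<in> Obj D \<Longrightarrow> B \<in> Obj D \<Longrightarrow> group (homgrp D A B)"
  using homgrp comm_group.axioms(2) by blast

lemma homgrp_simps[simp]:
  "carrier (homgrp D A B) = homs D A B" "mult (homgrp D A B) = Plus D" "one (homgrp D A B) = Zero D A B"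
  by (simp_all add: homgrp_def)

lemma Plus_homs: "f \<in> homs D A B \<Longrightarrow> g \<in> homs D A B \<Longrightarrow> f \<boxplus> g \<in> homs D A B"
  using group.subgroup_self[OF grp] monoid.m_closed[of "homgrp D A B" f g] grp[THEN group.is_monoid] homs_obj
  by (metis homgrp_simps(1,2))

lemma Zero_homs: "A \<in> Obj D \<Longrightarrow> B \<in> Obj D \<Longrightarrow> Zero D A B \<in> homs D A B"
  using monoid.one_closed[OF grp[THEN group.is_monoid], of A B] by simp

lemma neg_homs: "f \<in> homs D A B \<Longrightarrow> neg D f \<in> homs D A B"
  using group.inv_closed[OF grp, of A B f] homs_obj[of f A B] by (simp add: neg_def in_homs)

lemma Plus_type[simp]:
  assumes "f \<in> Arr D" "g \<in> Arr D" "Dom D f = Dom D g" "Cod D f = Cod D g"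
  shows "f \<boxplus> g \<in> Arr D" "Dom D (f \<boxplus> g) = Dom D g" "Cod D (f \<boxplus> g) = Cod D g"
  using Plus_homs[of f "Dom D g" "Cod D g" g] assms by (simp_all add: in_homs)

lemma Zero_type[simp]:
  assumes "A \<in> Obj D" "B \<in> Obj D"
  shows "Zero D A B \<in> Arr D" "Dom D (Zero D A B) = A" "Cod D (Zero D A B) = B"
  using Zero_homs[OF assms] by (simp_all add: in_homs)

lemma neg_type[simp]:
  assumes "f \<in> Arr D"
  shows "neg D f \<in> Arr D" "Dom D (neg D f) = Dom D f" "Cod D (neg D f) = Cod D f"
  using neg_homs[of f "Dom D f" "Cod D f"] assms by (simp_all add: in_homs)

lemma Plus_assoc:
  assumes "f \<in> Arr D" "g \<in> Arr D" "h \<in> Arr D" "Dom D f = Dom D g" "Cod D f = Cod D g"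
    "Dom D h = Dom D g" "Cod D h = Cod D g"
  shows "(f \<boxplus> g) \<boxplus> h = f \<boxplus> (g \<boxplus> h)"
  using monoid.m_assoc[OF grp[THEN group.is_monoid], of "Dom D g" "Cod D g" f g h] assms
  by (simp add: in_homs)

lemma Plus_comm:
  assumes "f \<in> Arr D" "g \<in> Arr D" "Dom D f = Dom D g" "Cod D f = Cod D g"
  shows "f \<boxplus> g = g \<boxplus> f"
  using comm_monoid.m_comm[OF comm_group.axioms(1)[OF homgrp], of "Dom D g" "Cod D g" f g] assms
  by (simp add: in_homs)

lemma Plus_lcomm:
  assumes "f \<in> Arr D" "g \<in> Arr D" "h \<in> Arr D" "Dom D f = Dom D g" "Cod D f = Cod D g"
    "Dom D h = Dom D g" "Cod D h = Cod D g"
  shows "f \<boxplus> (g \<boxplus> h) = g \<boxplus> (f \<boxplus> h)"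
proof -
  have "f \<boxplus> (g \<boxplus> h) = (f \<boxplus> g) \<boxplus> h" using assms by (simp add: Plus_assoc)
  also have "f \<boxplus> g = g \<boxplus> f" using assms by (intro Plus_comm)
  also have "(g \<boxplus> f) \<boxplus> h = g \<boxplus> (f \<boxplus> h)" using assms by (simp add: Plus_assoc)
  finally show ?thesis .
qed

lemma Zero_Plus[simp]: "f \<in> Arr D \<Longrightarrow> Dom D f = A \<Longrightarrow> Cod D f = B \<Longrightarrow> Zero D A B \<boxplus> f = f"
  using monoid.l_one[OF grp[THEN group.is_monoid], of "Dom D f" "Cod D f" f]
  by (auto simp add: in_homs)

lemma Plus_Zero[simp]: "f \<in> Arr D \<Longrightarrow> Dom D f = A \<Longrightarrow> Cod D f = B \<Longrightarrow> f \<boxplus> Zero D A B = f"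
  using Zero_Plus[of f A B] Plus_comm[of f "Zero D A B"] by (metis Cod_in Dom_in Zero_type)

lemma neg_Plus[simp]: "f \<in> Arr D \<Longrightarrow> neg D f \<boxplus> f = Zero D (Dom D f) (Cod D f)"
  using group.l_inv[OF grp, of "Dom D f" "Cod D f" f] by (simp add: in_homs neg_def)

lemma Plus_neg[simp]: "f \<in> Arr D \<Longrightarrow> f \<boxplus> neg D f = Zero D (Dom D f) (Cod D f)"
  using Plus_comm[of f "neg D f"] neg_Plus by (metis neg_type)

lemma neg_Plus2[simp]: "f \<in> Arr D \<Longrightarrow> g \<in> Arr D \<Longrightarrow> Dom D f = Dom D g \<Longrightarrow> Cod D f = Cod D g \<Longrightarrow>
    neg D f \<boxplus> (f \<boxplus> g) = g"
  by (subst Plus_assoc[symmetric]) simp_all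

lemma Plus_neg2[simp]: "f \<in> Arr D \<Longrightarrow> g \<in> Arr D \<Longrightarrow> Dom D f = Dom D g \<Longrightarrow> Cod D f = Cod D g \<Longrightarrow>
    f \<boxplus> (neg D f \<boxplus> g) = g"
  by (subst Plus_assoc[symmetric]) simp_all

lemma Plus_cancel:
  assumes "f \<in> Arr D" "g \<in> Arr D" "h \<in> Arr D" "Dom D f = Dom D g" "Cod D f = Cod D g"
    "Dom D f = Dom D h" "Cod D f = Cod D h"
  shows "f \<boxplus> g = f \<boxplus> h \<longleftrightarrow> g = h"
  using assms neg_Plus2[of f g] neg_Plus2[of f h] by metis

lemma Comp_plus:
  "f \<in> Arr D \<Longrightarrow> f' \<in> Arr D \<Longrightarrow> g \<in> Arr D \<Longrightarrow> Dom D f = Dom D f' \<Longrightarrow> Cod D f = Dom D g \<Longrightarrow> Cod D f' = Dom D g \<Longrightarrow>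
    g \<cdot> (f \<boxplus> f') = (g \<cdot> f) \<boxplus> (g \<cdot> f')"
  by (rule Comp_Plus) (auto simp: in_homs)

lemma plus_Comp:
  "f \<in> Arr D \<Longrightarrow> g \<in> Arr D \<Longrightarrow> g' \<in> Arr D \<Longrightarrow> Cod D f = Dom D g \<Longrightarrow> Dom D g' = Dom D g \<Longrightarrow> Cod D g' = Cod D g \<Longrightarrow>
    (g \<boxplus> g') \<cdot> f = (g \<cdot> f) \<boxplus> (g' \<cdot> f)"
  by (rule Plus_Comp) (auto simp: in_homs)

text \<open>Source of \<open>Comp_Zero\<close> and \<open>Zero_Comp\<close>: bilinearity makes a
  composite with a zero arrow idempotent.\<close>

lemma Plus_idem: "f \<in> Arr D \<Longrightarrow> f \<boxplus> f = f \<Longrightarrow> f = Zero D (Dom D f) (Cod D f)"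
  using Plus_cancel[of f f "Zero D (Dom D f) (Cod D f)"] by simp

lemma Comp_Zero[simp]: "g \<in> Arr D \<Longrightarrow> A \<in> Obj D \<Longrightarrow> Dom D g = B \<Longrightarrow> g \<cdot> Zero D A B = Zero D A (Cod D g)"
  using Plus_idem[of "g \<cdot> Zero D A B"] by (auto simp: Comp_plus[symmetric])

lemma Zero_Comp[simp]: "f \<in> Arr D \<Longrightarrow> B \<in> Obj D \<Longrightarrow> Cod D f = A \<Longrightarrow> Zero D A B \<cdot> f = Zero D (Dom D f) B"
  using Plus_idem[of "Zero D A B \<cdot> f"] by (auto simp: plus_Comp[symmetric])

lemma neg_unique: "f \<in> Arr D \<Longrightarrow> g \<in> Arr D \<Longrightarrow> Dom D f = Dom D g \<Longrightarrow> Cod D f = Cod D g \<Longrightarrow>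
   f \<boxplus> g = Zero D (Dom D f) (Cod D f) \<Longrightarrow> g = neg D f"
  by (rule iffD1[OF Plus_cancel[of f]]) simp_all

lemma Comp_neg: "f \<in> Arr D \<Longrightarrow> g \<in> Arr D \<Longrightarrow> Cod D f = Dom D g \<Longrightarrow> g \<cdot> neg D f = neg D (g \<cdot> f)"
  by (rule neg_unique) (simp_all add: Comp_plus[symmetric])

lemma neg_Comp: "f \<in> Arr D \<Longrightarrow> g \<in> Arr D \<Longrightarrow> Cod D f = Dom D g \<Longrightarrow> neg D g \<cdot> f = neg D (g \<cdot> f)"
  by (rule neg_unique) (simp_all add: plus_Comp[symmetric])

lemma neg_neg[simp]: "f \<in> Arr D \<Longrightarrow> neg D (neg D f) = f"
  by (rule neg_unique[symmetric]) simp_all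

lemma neg_Zero[simp]: "A \<in> Obj D \<Longrightarrow> B \<in> Obj D \<Longrightarrow> neg D (Zero D A B) = Zero D A B"
  by (rule neg_unique[symmetric]) simp_all

lemma neg_plus: "f \<in> Arr D \<Longrightarrow> g \<in> Arr D \<Longrightarrow> Dom D f = Dom D g \<Longrightarrow> Cod D f = Cod D g \<Longrightarrow>
   neg D (f \<boxplus> g) = neg D f \<boxplus> neg D g"
  by (rule neg_unique[symmetric]) (simp_all add: Plus_assoc Plus_lcomm[of g])

lemma eq_Plus_iff: "f \<in> Arr D \<Longrightarrow> g \<in> Arr D \<Longrightarrow> h \<in> Arr D \<Longrightarrow> Dom D f = Dom D g \<Longrightarrow> Cod D f = Cod D g \<Longrightarrow>
   Dom D h = Dom D g \<Longrightarrow> Cod D h = Cod D g \<Longrightarrow> f = g \<boxplus> h \<longleftrightarrow> f \<boxplus> neg D g = h"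
  apply (rule iffI)
   apply (simp add: Plus_comm[of g h] Plus_assoc)
  apply (drule sym[of _ h])
  apply (simp add: Plus_comm[of f] )
  done

lemma eq_iff_diff: "f \<in> Arr D \<Longrightarrow> g \<in> Arr D \<Longrightarrow> Dom D f = Dom D g \<Longrightarrow> Cod D f = Cod D g \<Longrightarrow>
   f = g \<longleftrightarrow> f \<boxplus> neg D g = Zero D (Dom D g) (Cod D g)"
  by (subst eq_Plus_iff[symmetric]) simp_all

lemmas distr = Comp_plus plus_Comp Comp_neg neg_Comp neg_plus

text \<open>Composites are nested to the right, so an equation between two-fold composites is only
  found with a tail \<open>x\<close> attached.\<close>

lemma reassoc: "a \<cdot> b = c \<cdot> e \<Longrightarrow> a \<in> Arr D \<Longrightarrow> b \<in> Arr D \<Longrightarrow> c \<in> Arr D \<Longrightarrow> e \<in> Arr D \<Longrightarrow> x \<in> Arr D \<Longrightarrow>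
   Cod D b = Dom D a \<Longrightarrow> Cod D e = Dom D c \<Longrightarrow> Cod D x = Dom D b \<Longrightarrow> Dom D e = Dom D b \<Longrightarrow>
   a \<cdot> (b \<cdot> x) = c \<cdot> (e \<cdot> x)"
  by (metis assoc)

lemma reassoc1: "a \<cdot> b = c \<Longrightarrow> a \<in> Arr D \<Longrightarrow> b \<in> Arr D \<Longrightarrow> x \<in> Arr D \<Longrightarrow>
   Cod D b = Dom D a \<Longrightarrow> Cod D x = Dom D b \<Longrightarrow> a \<cdot> (b \<cdot> x) = c \<cdot> x"
  by (metis assoc)

section \<open>The zero object and biproducts\<close>

lemma zero_obj: "is_zero_obj D (zero_obj D)"
  unfolding zero_obj_def using ex_zero_obj by (rule someI_ex)

lemma zero_obj_Obj[simp]: "zero_obj D \<in> Obj D"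
  using zero_obj by (simp add: is_zero_obj_def)

lemma from_zero_obj: "f \<in> homs D (zero_obj D) A \<Longrightarrow> f = Zero D (zero_obj D) A"
  using zero_obj Zero_homs[of "zero_obj D" A] homs_obj[of f] unfolding is_zero_obj_def by metis

lemma to_zero_obj: "f \<in> homs D A (zero_obj D) \<Longrightarrow> f = Zero D A (zero_obj D)"
  using zero_obj Zero_homs[of A "zero_obj D"] homs_obj[of f] unfolding is_zero_obj_def by metis

lemma biprod: "A \<in> Obj D \<Longrightarrow> B \<in> Obj D \<Longrightarrow> is_biproduct D A B (biprod D A B)"
  unfolding biprod_def using ex_biproduct by (rule someI_ex)

lemma biprod_type[simp]:
  assumes "A \<in> Obj D" "B \<in> Obj D"
  shows "dsum D A B \<in> Obj D"
    "In1 (biprod D A B) \<in> Arr D" "Dom D (In1 (biprod D A B)) = A" "Cod D (In1 (biprod D A B)) = dsum D A B"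
    "In2 (biprod D A B) \<in> Arr D" "Dom D (In2 (biprod D A B)) = B" "Cod D (In2 (biprod D A B)) = dsum D A B"
    "Pr1 (biprod D A B) \<in> Arr D" "Dom D (Pr1 (biprod D A B)) = dsum D A B" "Cod D (Pr1 (biprod D A B)) = A"
    "Pr2 (biprod D A B) \<in> Arr D" "Dom D (Pr2 (biprod D A B)) = dsum D A B" "Cod D (Pr2 (biprod D A B)) = B"
  using biprod[OF assms] by (simp_all add: is_biproduct_def dsum_def in_homs)

lemma biprod_eq[simp]:
  assumes "A \<in> Obj D" "B \<in> Obj D"
  shows "Pr1 (biprod D A B) \<cdot> In1 (biprod D A B) = Ide D A"
    "Pr2 (biprod D A B) \<cdot> In2 (biprod D A B) = Ide D B"
    "Pr2 (biprod D A B) \<cdot> In1 (biprod D A B) = Zero D A B"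
    "Pr1 (biprod D A B) \<cdot> In2 (biprod D A B) = Zero D B A"
    "(In1 (biprod D A B) \<cdot> Pr1 (biprod D A B)) \<boxplus> (In2 (biprod D A B) \<cdot> Pr2 (biprod D A B)) = Ide D (dsum D A B)"
  using biprod[OF assms] by (simp_all add: is_biproduct_def dsum_def in_homs)

lemma biprod_eq2[simp]:
  assumes "A \<in> Obj D" "B \<in> Obj D" "x \<in> Arr D"
  shows "Cod D x = A \<Longrightarrow> Pr1 (biprod D A B) \<cdot> (In1 (biprod D A B) \<cdot> x) = x"
    "Cod D x = B \<Longrightarrow> Pr2 (biprod D A B) \<cdot> (In2 (biprod D A B) \<cdot> x) = x"
    "Cod D x = A \<Longrightarrow> Pr2 (biprod D A B) \<cdot> (In1 (biprod D A B) \<cdot> x) = Zero D (Dom D x) B"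
    "Cod D x = B \<Longrightarrow> Pr1 (biprod D A B) \<cdot> (In2 (biprod D A B) \<cdot> x) = Zero D (Dom D x) A"
  using assms by (simp_all add: assoc[symmetric])

lemma col_type[simp]:
  assumes "u \<in> Arr D" "v \<in> Arr D" "Dom D u = Dom D v"
  shows "col D u v \<in> Arr D" "Dom D (col D u v) = Dom D v" "Cod D (col D u v) = dsum D (Cod D u) (Cod D v)"
  using assms by (simp_all add: col_def)

lemma row_type[simp]:
  assumes "u \<in> Arr D" "v \<in> Arr D" "Cod D u = Cod D v"
  shows "row D u v \<in> Arr D" "Cod D (row D u v) = Cod D v" "Dom D (row D u v) = dsum D (Dom D u) (Dom D v)"
  using assms by (simp_all add: row_def)

lemma mat22_type[simp]:
  assumes "a \<in> Arr D" "b \<in> Arr D" "c \<in> Arr D" "d \<in> Arr D" "Cod D a = Cod D b" "Cod D c = Cod D d"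
    "Dom D a = Dom D c" "Dom D b = Dom D d"
  shows "mat22 D a b c d \<in> Arr D" "Cod D (mat22 D a b c d) = dsum D (Cod D b) (Cod D d)"
    "Dom D (mat22 D a b c d) = dsum D (Dom D c) (Dom D d)"
  using assms by (simp_all add: mat22_def)

lemma Pr_col[simp]:
  assumes "u \<in> Arr D" "v \<in> Arr D" "Dom D u = Dom D v"
  shows "Cod D u = A \<Longrightarrow> Cod D v = B \<Longrightarrow> Pr1 (biprod D A B) \<cdot> col D u v = u"
    "Cod D u = A \<Longrightarrow> Cod D v = B \<Longrightarrow> Pr2 (biprod D A B) \<cdot> col D u v = v"
  using assms by (auto simp add: col_def distr)

lemma row_In[simp]:
  assumes "u \<in> Arr D" "v \<in> Arr D" "Cod D u = Cod D v"
  shows "Dom D u = A \<Longrightarrow> Dom D v = B \<Longrightarrow> row D u v \<cdot> In1 (biprod D A B) = u"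
    "Dom D u = A \<Longrightarrow> Dom D v = B \<Longrightarrow> row D u v \<cdot> In2 (biprod D A B) = v"
  using assms by (auto simp add: row_def distr assoc)

lemma row_col:
  assumes "u \<in> Arr D" "v \<in> Arr D" "Cod D u = Cod D v" "a \<in> Arr D" "b \<in> Arr D" "Dom D a = Dom D b"
    "Cod D a = Dom D u" "Cod D b = Dom D v"
  shows "row D u v \<cdot> col D a b = (u \<cdot> a) \<boxplus> (v \<cdot> b)"
proof -
  have "row D u v \<cdot> col D a b = (u \<cdot> (Pr1 (biprod D (Dom D u) (Dom D v)) \<cdot> col D a b))
     \<boxplus> (v \<cdot> (Pr2 (biprod D (Dom D u) (Dom D v)) \<cdot> col D a b))"
    using assms by (simp add: row_def distr assoc del: Pr_col)
  then show ?thesis using assms by simp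
qed

lemma Comp_row:
  assumes "u \<in> Arr D" "v \<in> Arr D" "Cod D u = Cod D v" "w \<in> Arr D" "Dom D w = Cod D v"
  shows "w \<cdot> row D u v = row D (w \<cdot> u) (w \<cdot> v)"
  using assms by (simp add: row_def distr assoc)

lemma col_Comp:
  assumes "u \<in> Arr D" "v \<in> Arr D" "Dom D u = Dom D v" "w \<in> Arr D" "Cod D w = Dom D v"
  shows "col D u v \<cdot> w = col D (u \<cdot> w) (v \<cdot> w)"
  using assms by (simp add: col_def distr assoc)

lemma row_plus:
  assumes "u \<in> Arr D" "v \<in> Arr D" "Cod D u = Cod D v" "u' \<in> Arr D" "v' \<in> Arr D" "Dom D u' = Dom D u"
    "Dom D v' = Dom D v" "Cod D u' = Cod D v" "Cod D v' = Cod D v"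
  shows "row D u v \<boxplus> row D u' v' = row D (u \<boxplus> u') (v \<boxplus> v')"
  using assms by (simp add: row_def distr assoc Plus_assoc Plus_lcomm)

lemma col_plus:
  assumes "u \<in> Arr D" "v \<in> Arr D" "Dom D u = Dom D v" "u' \<in> Arr D" "v' \<in> Arr D" "Cod D u' = Cod D u"
    "Cod D v' = Cod D v" "Dom D u' = Dom D v" "Dom D v' = Dom D v"
  shows "col D u v \<boxplus> col D u' v' = col D (u \<boxplus> u') (v \<boxplus> v')"
  using assms by (simp add: col_def distr assoc Plus_assoc Plus_lcomm)

lemma row_eta:
  assumes "f \<in> Arr D" "A \<in> Obj D" "B \<in> Obj D" "Dom D f = dsum D A B"
  shows "row D (f \<cdot> In1 (biprod D A B)) (f \<cdot> In2 (biprod D A B)) = f"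
  using assms biprod_eq(5)[of A B] by (simp add: row_def assoc distr(1)[symmetric])

lemma col_eta:
  assumes "f \<in> Arr D" "A \<in> Obj D" "B \<in> Obj D" "Cod D f = dsum D A B"
  shows "col D (Pr1 (biprod D A B) \<cdot> f) (Pr2 (biprod D A B) \<cdot> f) = f"
  using assms biprod_eq(5)[of A B] by (simp add: col_def assoc[symmetric] distr(2)[symmetric])

lemma row_ex:
  assumes "f \<in> Arr D" "A \<in> Obj D" "B \<in> Obj D" "Dom D f = dsum D A B"
  obtains u v where "u \<in> homs D A (Cod D f)" "v \<in> homs D B (Cod D f)" "f = row D u v"
  using row_eta[OF assms] assms by (metis (no_types, lifting) biprod_type(2-7) Comp_homs)

lemma col_ex:
  assumes "f \<in> Arr D" "A \<in> Obj D" "B \<in> Obj D" "Cod D f = dsum D A B"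
  obtains u v where "u \<in> homs D (Dom D f) A" "v \<in> homs D (Dom D f) B" "f = col D u v"
  using col_eta[OF assms] assms by (metis (no_types, lifting) biprod_type(8-13) Comp_homs)

lemma row_inj:
  assumes "u \<in> Arr D" "v \<in> Arr D" "Cod D u = Cod D v" "u' \<in> Arr D" "v' \<in> Arr D" "Dom D u' = Dom D u"
    "Dom D v' = Dom D v" "Cod D u' = Cod D v'"
  shows "row D u v = row D u' v' \<longleftrightarrow> u = u' \<and> v = v'"
  using assms row_In[of u v] row_In[of u' v'] by metis

lemma col_inj:
  assumes "u \<in> Arr D" "v \<in> Arr D" "Dom D u = Dom D v" "u' \<in> Arr D" "v' \<in> Arr D" "Cod D u' = Cod D u"
    "Cod D v' = Cod D v" "Dom D u' = Dom D v'"
  shows "col D u v = col D u' v' \<longleftrightarrow> u = u' \<and> v = v'"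
  using assms Pr_col[of u v] Pr_col[of u' v'] by metis

lemma row_Zero: "A \<in> Obj D \<Longrightarrow> B \<in> Obj D \<Longrightarrow> C \<in> Obj D \<Longrightarrow>
    row D (Zero D A C) (Zero D B C) = Zero D (dsum D A B) C"
  by (simp add: row_def)

lemma col_Zero: "A \<in> Obj D \<Longrightarrow> B \<in> Obj D \<Longrightarrow> C \<in> Obj D \<Longrightarrow>
    col D (Zero D C A) (Zero D C B) = Zero D C (dsum D A B)"
  by (simp add: col_def)

lemma row_mat22:
  assumes "a \<in> Arr D" "b \<in> Arr D" "c \<in> Arr D" "d \<in> Arr D" "Cod D a = Cod D b" "Cod D c = Cod D d"
    "Dom D a = Dom D c" "Dom D b = Dom D d" "u \<in> Arr D" "v \<in> Arr D" "Cod D u = Cod D v"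
    "Dom D u = Cod D b" "Dom D v = Cod D d"
  shows "row D u v \<cdot> mat22 D a b c d = row D ((u \<cdot> a) \<boxplus> (v \<cdot> c)) ((u \<cdot> b) \<boxplus> (v \<cdot> d))"
  using assms by (simp add: mat22_def row_col Comp_row row_plus)

lemma mat22_col:
  assumes "a \<in> Arr D" "b \<in> Arr D" "c \<in> Arr D" "d \<in> Arr D" "Cod D a = Cod D b" "Cod D c = Cod D d"
    "Dom D a = Dom D c" "Dom D b = Dom D d" "u \<in> Arr D" "v \<in> Arr D" "Dom D u = Dom D v"
    "Cod D u = Dom D c" "Cod D v = Dom D d"
  shows "mat22 D a b c d \<cdot> col D u v = col D ((a \<cdot> u) \<boxplus> (b \<cdot> v)) ((c \<cdot> u) \<boxplus> (d \<cdot> v))"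
  using assms by (simp add: mat22_def col_Comp row_col)

lemma mat22_mat22:
  assumes "a \<in> Arr D" "b \<in> Arr D" "c \<in> Arr D" "d \<in> Arr D" "Cod D a = Cod D b" "Cod D c = Cod D d"
    "Dom D a = Dom D c" "Dom D b = Dom D d"
    "a' \<in> Arr D" "b' \<in> Arr D" "c' \<in> Arr D" "d' \<in> Arr D" "Cod D a' = Cod D b'" "Cod D c' = Cod D d'"
    "Dom D a' = Dom D c'" "Dom D b' = Dom D d'" "Cod D b' = Dom D c" "Cod D d' = Dom D d"
  shows "mat22 D a b c d \<cdot> mat22 D a' b' c' d' =
    mat22 D ((a \<cdot> a') \<boxplus> (b \<cdot> c')) ((a \<cdot> b') \<boxplus> (b \<cdot> d')) ((c \<cdot> a') \<boxplus> (d \<cdot> c')) ((c \<cdot> b') \<boxplus> (d \<cdot> d'))"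
  using assms unfolding mat22_def[of D a b c d] mat22_def[of D "_ \<boxplus> _"]
  by (simp add: col_Comp row_mat22)

lemma mat22_Zero: "A \<in> Obj D \<Longrightarrow> B \<in> Obj D \<Longrightarrow> C \<in> Obj D \<Longrightarrow> E \<in> Obj D \<Longrightarrow>
    mat22 D (Zero D A C) (Zero D B C) (Zero D A E) (Zero D B E) = Zero D (dsum D A B) (dsum D C E)"
  by (simp add: mat22_def row_Zero col_Zero)

lemma isoD:
  assumes "is_iso_arr D f" "f \<in> homs D A B"
  obtains g where "g \<in> homs D B A" "g \<cdot> f = Ide D A" "f \<cdot> g = Ide D B"
  using assms by (auto simp: is_iso_arr_def in_homs)

lemma isoI:
  assumes "f \<in> homs D A B" "g \<in> homs D B A" "g \<cdot> f = Ide D A" "f \<cdot> g = Ide D B"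
  shows "is_iso_arr D f"
  using assms by (auto simp: is_iso_arr_def in_homs)

lemma iso_Ide: "A \<in> Obj D \<Longrightarrow> is_iso_arr D (Ide D A)"
  by (rule isoI[of _ A A "Ide D A"]) (auto simp: in_homs)

end

section \<open>Complexes and the opposite category\<close>

text \<open>Duality is strict: reversing twice gives \<open>D\<close> itself, and the opposite Hom
  groups are the same groups with the same negation. Dual statements therefore come back without
  comparison isomorphisms.\<close>

definition opcat :: "('o, 'm) precat \<Rightarrow> ('o, 'm) precat" where
  "opcat D = \<lparr>Obj = Obj D, Arr = Arr D, Dom = Cod D, Cod = Dom D, Ide = Ide D,
     Comp = (\<lambda>g f. Comp D f g), Plus = Plus D, Zero = (\<lambda>A B. Zero D B A)\<rparr>"

lemma opcat_simps[simp]: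
  "Obj (opcat D) = Obj D" "Arr (opcat D) = Arr D" "Dom (opcat D) = Cod D" "Cod (opcat D) = Dom D"
  "Ide (opcat D) = Ide D" "Comp (opcat D) g f = Comp D f g" "Plus (opcat D) = Plus D"
  "Zero (opcat D) A B = Zero D B A" "homs (opcat D) A B = homs D B A" "opcat (opcat D) = D"
  by (auto simp: opcat_def homs_def)

lemma homgrp_op[simp]: "homgrp (opcat D) A B = homgrp D B A"
  by (simp add: homgrp_def)

lemma neg_op[simp]: "neg (opcat D) f = neg D f"
  by (simp add: neg_def)

lemma is_iso_arr_op[simp]: "is_iso_arr (opcat D) f = is_iso_arr D f"
  by (auto simp: is_iso_arr_def)

text \<open>In contrast to \<^const>\<open>complexes\<close> and \<^const>\<open>chain_maps\<close>, the number is the top degree.\<close>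

definition cpx :: "('o, 'm) precat \<Rightarrow> nat \<Rightarrow> ('o, 'm) cplx \<Rightarrow> bool" where
  "cpx D m X \<longleftrightarrow> X \<in> complexes D (Suc m)"

definition cmap :: "('o, 'm) precat \<Rightarrow> nat \<Rightarrow> ('o, 'm) cplx \<Rightarrow> ('o, 'm) cplx \<Rightarrow> (nat \<Rightarrow> 'm) \<Rightarrow> bool" where
  "cmap D m X Y f \<longleftrightarrow> f \<in> chain_maps D (Suc m) X Y"

definition ccomp :: "('o, 'm) precat \<Rightarrow> nat \<Rightarrow> (nat \<Rightarrow> 'm) \<Rightarrow> (nat \<Rightarrow> 'm) \<Rightarrow> nat \<Rightarrow> 'm" where
  "ccomp D m g f = (\<lambda>i\<in>{..<Suc m}. g i \<cdot>\<^bsub>D\<^esub> f i)"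

definition cid :: "('o, 'm) precat \<Rightarrow> nat \<Rightarrow> ('o, 'm) cplx \<Rightarrow> nat \<Rightarrow> 'm" where
  "cid D m X = (\<lambda>i\<in>{..<Suc m}. Ide D (ob X i))"

definition czero :: "('o, 'm) precat \<Rightarrow> nat \<Rightarrow> ('o, 'm) cplx \<Rightarrow> ('o, 'm) cplx \<Rightarrow> nat \<Rightarrow> 'm" where
  "czero D m X Y = (\<lambda>i\<in>{..<Suc m}. Zero D (ob X i) (ob Y i))"

lemma ccomp_simp[simp]: "i \<le> m \<Longrightarrow> ccomp D m g f i = g i \<cdot>\<^bsub>D\<^esub> f i"
  by (simp add: ccomp_def)

lemma cid_simp[simp]: "i \<le> m \<Longrightarrow> cid D m X i = Ide D (ob X i)"
  by (simp add: cid_def)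

lemma czero_simp[simp]: "i \<le> m \<Longrightarrow> czero D m X Y i = Zero D (ob X i) (ob Y i)"
  by (simp add: czero_def)

lemma complexes_cpx: "X \<in> complexes D (n + 2) \<longleftrightarrow> cpx D (Suc n) X" "X \<in> complexes D (n + 1) \<longleftrightarrow> cpx D n X"
  by (simp_all add: cpx_def)

lemma chain_maps_cmap: "f \<in> chain_maps D (n + 2) X Y \<longleftrightarrow> cmap D (Suc n) X Y f"
  "f \<in> chain_maps D (n + 1) X Y \<longleftrightarrow> cmap D n X Y f"
  by (simp_all add: cmap_def)

lemma cpxI:
  assumes "\<And>i. i \<le> m \<Longrightarrow> ob X i \<in> Obj D" "\<And>i. i < m \<Longrightarrow> df X i \<in> homs D (ob X i) (ob X (Suc i))"
    "\<And>i. Suc i < m \<Longrightarrow> df X (Suc i) \<cdot>\<^bsub>D\<^esub> df X i = Zero D (ob X i) (ob X (Suc (Suc i)))"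
    "ob X \<in> extensional {..<Suc m}" "df X \<in> extensional {..<m}"
  shows "cpx D m X"
  using assms by (auto simp: cpx_def complexes_def PiE_def less_Suc_eq_le)

lemma cpxD:
  assumes "cpx D m X"
  shows "i \<le> m \<Longrightarrow> ob X i \<in> Obj D" "i < m \<Longrightarrow> df X i \<in> homs D (ob X i) (ob X (Suc i))"
    "Suc i < m \<Longrightarrow> df X (Suc i) \<cdot>\<^bsub>D\<^esub> df X i = Zero D (ob X i) (ob X (Suc (Suc i)))"
    "ob X \<in> extensional {..<Suc m}" "df X \<in> extensional {..<m}"
  using assms by (auto simp: cpx_def complexes_def PiE_def Pi_def less_Suc_eq_le)

lemma cpx_type:
  assumes "cpx D m X"
  shows "\<And>i. i \<le> m \<Longrightarrow> ob X i \<in> Obj D" "\<And>i. i < m \<Longrightarrow> df X i \<in> Arr D"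
    "\<And>i. i < m \<Longrightarrow> Dom D (df X i) = ob X i" "\<And>i. i < m \<Longrightarrow> Cod D (df X i) = ob X (Suc i)"
    "\<And>i. Suc i < m \<Longrightarrow> df X (Suc i) \<cdot>\<^bsub>D\<^esub> df X i = Zero D (ob X i) (ob X (Suc (Suc i)))"
  using cpxD[OF assms] by (auto simp: in_homs)

lemma cmapI:
  assumes "\<And>i. i \<le> m \<Longrightarrow> f i \<in> homs D (ob X i) (ob Y i)"
    "\<And>i. i < m \<Longrightarrow> f (Suc i) \<cdot>\<^bsub>D\<^esub> df X i = df Y i \<cdot>\<^bsub>D\<^esub> f i"
  shows "cmap D m X Y (\<lambda>i\<in>{..<Suc m}. f i)"
  using assms by (auto simp: cmap_def chain_maps_def)

lemma cmapD:
  assumes "cmap D m X Y f"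
  shows "i \<le> m \<Longrightarrow> f i \<in> homs D (ob X i) (ob Y i)"
    "i < m \<Longrightarrow> f (Suc i) \<cdot>\<^bsub>D\<^esub> df X i = df Y i \<cdot>\<^bsub>D\<^esub> f i"
  using assms by (auto simp: cmap_def chain_maps_def PiE_def Pi_def)

lemma cmap_type:
  assumes "cmap D m X Y f"
  shows "\<And>i. i \<le> m \<Longrightarrow> f i \<in> Arr D" "\<And>i. i \<le> m \<Longrightarrow> Dom D (f i) = ob X i" "\<And>i. i \<le> m \<Longrightarrow> Cod D (f i) = ob Y i"
  using cmapD(1)[OF assms] by (auto simp: in_homs)

lemma cpx_ext: "cpx D m X \<Longrightarrow> cpx D m Y \<Longrightarrow> (\<And>i. i \<le> m \<Longrightarrow> ob X i = ob Y i) \<Longrightarrow>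
    (\<And>i. i < m \<Longrightarrow> df X i = df Y i) \<Longrightarrow> X = (Y :: ('o, 'm) cplx)"
  by (rule cplx.equality)
     (auto intro!: extensionalityI[of _ "{..<Suc m}" "ob Y"] extensionalityI[of _ "{..<m}" "df Y"] dest: cpxD(4,5))

definition opc :: "nat \<Rightarrow> ('o, 'm) cplx \<Rightarrow> ('o, 'm) cplx" where
  "opc m X = \<lparr>ob = (\<lambda>i\<in>{..<Suc m}. ob X (m - i)), df = (\<lambda>i\<in>{..<m}. df X (m - Suc i))\<rparr>"

definition opf :: "nat \<Rightarrow> (nat \<Rightarrow> 'm) \<Rightarrow> nat \<Rightarrow> 'm" where
  "opf m f = (\<lambda>i\<in>{..<Suc m}. f (m - i))"

lemma opc_simps[simp]:
  "i \<le> m \<Longrightarrow> ob (opc m X) i = ob X (m - i)"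
  "i < m \<Longrightarrow> df (opc m X) i = df X (m - Suc i)"
  "i \<le> m \<Longrightarrow> opf m f i = f (m - i)"
  by (simp_all add: opc_def opf_def)

lemma opc_cpx: assumes "cpx D m X" shows "cpx (opcat D) m (opc m X)"
proof (rule cpxI)
  fix i assume i: "i < m"
  then show "df (opc m X) i \<in> homs (opcat D) (ob (opc m X) i) (ob (opc m X) (Suc i))"
    using cpxD(2)[OF assms, of "m - Suc i"] by (simp add: Suc_diff_Suc)
next
  fix i assume "Suc i < m"
  then show "df (opc m X) (Suc i) \<cdot>\<^bsub>opcat D\<^esub> df (opc m X) i =
    Zero (opcat D) (ob (opc m X) i) (ob (opc m X) (Suc (Suc i)))"
    using cpxD(3)[OF assms, of "m - Suc (Suc i)"] by (simp add: Suc_diff_Suc)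
qed (use cpxD(1)[OF assms] in \<open>auto simp: opc_def\<close>)

lemma opc_opc: assumes "cpx D m X" shows "opc m (opc m X) = X"
  by (rule cpx_ext[OF _ assms]) (use opc_cpx[OF opc_cpx[OF assms]] in auto)

lemma opf_cmap: assumes "cmap D m X Y f" shows "cmap (opcat D) m (opc m Y) (opc m X) (opf m f)"
  unfolding opf_def
proof (rule cmapI)
  fix i assume i: "i \<le> m"
  then show "f (m - i) \<in> homs (opcat D) (ob (opc m Y) i) (ob (opc m X) i)"
    using cmapD(1)[OF assms, of "m - i"] by (simp add: Suc_diff_Suc)
next
  fix i assume "i < m"
  then show "f (m - Suc i) \<cdot>\<^bsub>opcat D\<^esub> df (opc m Y) i = df (opc m X) i \<cdot>\<^bsub>opcat D\<^esub> f (m - i)"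
    using cmapD(2)[OF assms, of "m - Suc i"] by (simp add: Suc_diff_Suc)
qed

lemma op_cmap: assumes "cmap (opcat D) m (opc m Y) (opc m X) f" "cpx D m X" "cpx D m Y"
  shows "cmap D m X Y (opf m f)"
  using opf_cmap[OF assms(1)] assms(2,3) by (simp add: opc_opc)

subsection \<open>Exactness in cancellation form\<close>

text \<open>Exactness of Hom complexes at an inner term, stated for two arrows with the same image instead of
  for one arrow with image zero: this avoids subtraction.\<close>

definition contraX :: "('o, 'm) precat \<Rightarrow> nat \<Rightarrow> ('o, 'm) cplx \<Rightarrow> bool" where
  "contraX D n X \<longleftrightarrow> (\<forall>W.
     (\<forall>x\<in>homs D (ob X (Suc n)) W. \<forall>y\<in>homs D (ob X (Suc n)) W.
        x \<cdot>\<^bsub>D\<^esub> df X n = y \<cdot>\<^bsub>D\<^esub> df X n \<longrightarrow> x = y) \<and>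
     (\<forall>i<n. \<forall>x\<in>homs D (ob X (Suc i)) W. \<forall>y\<in>homs D (ob X (Suc i)) W.
        x \<cdot>\<^bsub>D\<^esub> df X i = y \<cdot>\<^bsub>D\<^esub> df X i \<longrightarrow>
        (\<exists>t\<in>homs D (ob X (Suc (Suc i))) W. x = y \<boxplus>\<^bsub>D\<^esub> (t \<cdot>\<^bsub>D\<^esub> df X (Suc i)))))"

definition covX :: "('o, 'm) precat \<Rightarrow> nat \<Rightarrow> ('o, 'm) cplx \<Rightarrow> bool" where
  "covX D n X \<longleftrightarrow> (\<forall>W.
     (\<forall>x\<in>homs D W (ob X 0). \<forall>y\<in>homs D W (ob X 0).
        df X 0 \<cdot>\<^bsub>D\<^esub> x = df X 0 \<cdot>\<^bsub>D\<^esub> y \<longrightarrow> x = y) \<and>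
     (\<forall>i<n. \<forall>x\<in>homs D W (ob X (Suc i)). \<forall>y\<in>homs D W (ob X (Suc i)).
        df X (Suc i) \<cdot>\<^bsub>D\<^esub> x = df X (Suc i) \<cdot>\<^bsub>D\<^esub> y \<longrightarrow>
        (\<exists>t\<in>homs D W (ob X i). x = y \<boxplus>\<^bsub>D\<^esub> (df X i \<cdot>\<^bsub>D\<^esub> t))))"

definition nex :: "('o, 'm) precat \<Rightarrow> nat \<Rightarrow> ('o, 'm) cplx \<Rightarrow> bool" where
  "nex D n X \<longleftrightarrow> cpx D (Suc n) X \<and> contraX D n X \<and> covX D n X"

lemma contraX_epi: "contraX D n X \<Longrightarrow> x \<in> homs D (ob X (Suc n)) W \<Longrightarrow> y \<in> homs D (ob X (Suc n)) W \<Longrightarrow>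
    x \<cdot>\<^bsub>D\<^esub> df X n = y \<cdot>\<^bsub>D\<^esub> df X n \<Longrightarrow> x = y"
  unfolding contraX_def by blast

lemma contraX_diff: assumes "contraX D n X" "i < n" "x \<in> homs D (ob X (Suc i)) W" "y \<in> homs D (ob X (Suc i)) W"
    "x \<cdot>\<^bsub>D\<^esub> df X i = y \<cdot>\<^bsub>D\<^esub> df X i"
  obtains t where "t \<in> homs D (ob X (Suc (Suc i))) W" "x = y \<boxplus>\<^bsub>D\<^esub> (t \<cdot>\<^bsub>D\<^esub> df X (Suc i))"
  using assms unfolding contraX_def by blast

lemma covX_mono: "covX D n X \<Longrightarrow> x \<in> homs D W (ob X 0) \<Longrightarrow> y \<in> homs D W (ob X 0) \<Longrightarrow>
    df X 0 \<cdot>\<^bsub>D\<^esub> x = df X 0 \<cdot>\<^bsub>D\<^esub> y \<Longrightarrow> x = y"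
  unfolding covX_def by blast

lemma covX_diff: assumes "covX D n X" "i < n" "x \<in> homs D W (ob X (Suc i))" "y \<in> homs D W (ob X (Suc i))"
    "df X (Suc i) \<cdot>\<^bsub>D\<^esub> x = df X (Suc i) \<cdot>\<^bsub>D\<^esub> y"
  obtains t where "t \<in> homs D W (ob X i)" "x = y \<boxplus>\<^bsub>D\<^esub> (df X i \<cdot>\<^bsub>D\<^esub> t)"
  using assms unfolding covX_def by blast

lemma reindex_less: "(\<forall>i<n::nat. P (n - Suc i)) \<longleftrightarrow> (\<forall>i<n. P i)"
  by (metis Suc_diff_Suc diff_Suc_less diff_diff_cancel less_imp_le_nat zero_less_diff zero_less_Suc
      Suc_diff_le diff_less_Suc Suc_leI)

lemma covX_op[simp]: "covX (opcat D) n (opc (Suc n) X) \<longleftrightarrow> contraX D n X"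
proof -
  let ?P = "\<lambda>W i. \<forall>x\<in>homs D (ob X (Suc i)) W. \<forall>y\<in>homs D (ob X (Suc i)) W.
        x \<cdot>\<^bsub>D\<^esub> df X i = y \<cdot>\<^bsub>D\<^esub> df X i \<longrightarrow>
        (\<exists>t\<in>homs D (ob X (Suc (Suc i))) W. x = y \<boxplus>\<^bsub>D\<^esub> (t \<cdot>\<^bsub>D\<^esub> df X (Suc i)))"
  have "(\<forall>i<n. \<forall>x\<in>homs (opcat D) W (ob (opc (Suc n) X) (Suc i)). \<forall>y\<in>homs (opcat D) W (ob (opc (Suc n) X) (Suc i)).
        df (opc (Suc n) X) (Suc i) \<cdot>\<^bsub>opcat D\<^esub> x = df (opc (Suc n) X) (Suc i) \<cdot>\<^bsub>opcat D\<^esub> y \<longrightarrow>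
        (\<exists>t\<in>homs (opcat D) W (ob (opc (Suc n) X) i). x = y \<boxplus>\<^bsub>opcat D\<^esub> (df (opc (Suc n) X) i \<cdot>\<^bsub>opcat D\<^esub> t)))
     \<longleftrightarrow> (\<forall>i<n. ?P W i)" for W
  proof (subst reindex_less[of n "?P W", symmetric], intro all_cong)
    fix i assume "i < n"
    then have "Suc (n - Suc i) = n - i" "Suc (n - i) = Suc n - i" by auto
    then show "(\<forall>x\<in>homs (opcat D) W (ob (opc (Suc n) X) (Suc i)). \<forall>y\<in>homs (opcat D) W (ob (opc (Suc n) X) (Suc i)).
        df (opc (Suc n) X) (Suc i) \<cdot>\<^bsub>opcat D\<^esub> x = df (opc (Suc n) X) (Suc i) \<cdot>\<^bsub>opcat D\<^esub> y \<longrightarrow>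
        (\<exists>t\<in>homs (opcat D) W (ob (opc (Suc n) X) i). x = y \<boxplus>\<^bsub>opcat D\<^esub> (df (opc (Suc n) X) i \<cdot>\<^bsub>opcat D\<^esub> t)))
      \<longleftrightarrow> ?P W (n - Suc i)" using \<open>i < n\<close> by simp
  qed
  then show ?thesis
    unfolding covX_def contraX_def by (simp only:) simp
qed

lemma contraX_op: assumes "cpx D (Suc n) X"
  shows "contraX (opcat D) n (opc (Suc n) X) \<longleftrightarrow> covX D n X"
  using covX_op[of "opcat D" n "opc (Suc n) X"] opc_opc[OF assms] by simp

lemma nex_op: "nex D n X \<Longrightarrow> nex (opcat D) n (opc (Suc n) X)"
  by (auto simp: nex_def opc_cpx contraX_op)

context acat
begin

text \<open>Injections and projections trade places. The biproduct that \<open>biprod\<close>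
  selects in \<open>opcat D\<close> may still differ from the one selected in \<open>D\<close>, so
  duality is applied only to notions that do not mention \<open>dsum\<close>.\<close>

lemma acat_op: "acat (opcat D)"
proof -
  have "\<exists>P. is_biproduct (opcat D) A B P" if "A \<in> Obj D" "B \<in> Obj D" for A B
  proof
    show "is_biproduct (opcat D) A B \<lparr>BObj = dsum D A B, In1 = Pr1 (biprod D A B), In2 = Pr2 (biprod D A B),
      Pr1 = In1 (biprod D A B), Pr2 = In2 (biprod D A B)\<rparr>"
      using that by (simp add: is_biproduct_def in_homs)
  qed
  moreover have "is_zero_obj (opcat D) (zero_obj D)"
    using zero_obj by (auto simp: is_zero_obj_def)
  ultimately show ?thesis
    unfolding acat_def
    by (intro additive_category.intro preadditive_category.intro category.intro
        preadditive_category_axioms.intro additive_category_axioms.intro exI[of _ "zero_obj D"])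
      (auto simp: in_homs homgrp assoc distr)
qed

section \<open>Chain maps, homotopies and liftings\<close>

lemma cmap_comp:
  assumes "cpx D m X" "cpx D m Y" "cpx D m T" "cmap D m X Y f" "cmap D m Y T g"
  shows "cmap D m X T (ccomp D m g f)"
  unfolding ccomp_def
proof (rule cmapI)
  note [simp] = cpx_type[OF assms(1)] cpx_type[OF assms(2)] cpx_type[OF assms(3)]
    cmap_type[OF assms(4)] cmap_type[OF assms(5)]
  fix i assume "i \<le> m" then show "g i \<cdot> f i \<in> homs D (ob X i) (ob T i)" by (simp add: in_homs)
next
  note [simp] = cpx_type[OF assms(1)] cpx_type[OF assms(2)] cpx_type[OF assms(3)]
    cmap_type[OF assms(4)] cmap_type[OF assms(5)]
  fix i assume i: "i < m"
  show "(g (Suc i) \<cdot> f (Suc i)) \<cdot> df X i = df T i \<cdot> (g i \<cdot> f i)"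
    using i cmapD(2)[OF assms(4) i] reassoc[OF cmapD(2)[OF assms(5) i], of "f i"] by (simp add: assoc)
qed

lemma cmap_id: "cpx D m X \<Longrightarrow> cmap D m X X (cid D m X)"
  unfolding cid_def by (rule cmapI) (auto simp: cpx_type in_homs)

lemma cmap_zero: "cpx D m X \<Longrightarrow> cpx D m Y \<Longrightarrow> cmap D m X Y (czero D m X Y)"
  unfolding czero_def by (rule cmapI) (auto simp: cpx_type in_homs)

text \<open>A homotopy is built one degree at a time. The invariant is composed with
  \<open>df Y i\<close> because \<open>f i\<close> and \<open>g i\<close> may also differ by an
  earlier term of the homotopy, which this composition kills; for the same reason it is restored one
  degree higher.\<close>

lemma homotopy_step:
  assumes X: "cpx D (Suc n) X" "contraX D n X" and Y: "cpx D (Suc n) Y"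
    and f: "cmap D (Suc n) X Y f" and g: "cmap D (Suc n) X Y g" and i: "i < n"
    and h: "h \<in> homs D (ob X (Suc i)) (ob Y i)"
    and eq: "df Y i \<cdot> f i = (df Y i \<cdot> g i) \<boxplus> (df Y i \<cdot> (h \<cdot> df X i))"
  obtains h' where "h' \<in> homs D (ob X (Suc (Suc i))) (ob Y (Suc i))"
    "f (Suc i) = g (Suc i) \<boxplus> ((df Y i \<cdot> h) \<boxplus> (h' \<cdot> df X (Suc i)))"
    "df Y (Suc i) \<cdot> f (Suc i) = (df Y (Suc i) \<cdot> g (Suc i)) \<boxplus> (df Y (Suc i) \<cdot> (h' \<cdot> df X (Suc i)))"
proof -
  note [simp] = cpx_type[OF X(1)] cpx_type[OF Y] cmap_type[OF f] cmap_type[OF g] h[unfolded in_homs]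
  have "f (Suc i) \<cdot> df X i = (g (Suc i) \<boxplus> (df Y i \<cdot> h)) \<cdot> df X i"
    using i cmapD(2)[OF f, of i] cmapD(2)[OF g, of i] eq by (simp add: distr assoc)
  then obtain t where t: "t \<in> homs D (ob X (Suc (Suc i))) (ob Y (Suc i))"
    "f (Suc i) = (g (Suc i) \<boxplus> (df Y i \<cdot> h)) \<boxplus> (t \<cdot> df X (Suc i))"
    using contraX_diff[OF X(2) i, of "f (Suc i)" "ob Y (Suc i)" "g (Suc i) \<boxplus> (df Y i \<cdot> h)"] i
    by (auto simp: in_homs)
  note [simp] = t(1)[unfolded in_homs]
  show thesis
  proof (rule that[OF t(1)])
    show 1: "f (Suc i) = g (Suc i) \<boxplus> ((df Y i \<cdot> h) \<boxplus> (t \<cdot> df X (Suc i)))"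
      using t(2) i by (simp add: Plus_assoc)
    show "df Y (Suc i) \<cdot> f (Suc i) = (df Y (Suc i) \<cdot> g (Suc i)) \<boxplus> (df Y (Suc i) \<cdot> (t \<cdot> df X (Suc i)))"
      unfolding 1 using i reassoc1[OF cpx_type(5)[OF Y, of i], of h] by (simp add: distr)
  qed
qed

text \<open>In the top degree the homotopy has no further component; instead \<open>df X n\<close>
  can be cancelled on the right.\<close>

lemma homotopy_end:
  assumes X: "cpx D (Suc n) X" "contraX D n X" and Y: "cpx D (Suc n) Y"
    and f: "cmap D (Suc n) X Y f" and g: "cmap D (Suc n) X Y g"
    and h: "h \<in> homs D (ob X (Suc n)) (ob Y n)"
    and eq: "df Y n \<cdot> f n = (df Y n \<cdot> g n) \<boxplus> (df Y n \<cdot> (h \<cdot> df X n))"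
  shows "f (Suc n) = g (Suc n) \<boxplus> (df Y n \<cdot> h)"
proof -
  note [simp] = cpx_type[OF X(1)] cpx_type[OF Y] cmap_type[OF f] cmap_type[OF g] h[unfolded in_homs]
  have "f (Suc n) \<cdot> df X n = (g (Suc n) \<boxplus> (df Y n \<cdot> h)) \<cdot> df X n"
    using cmapD(2)[OF f, of n] cmapD(2)[OF g, of n] eq by (simp add: distr assoc)
  then show ?thesis
    by (rule contraX_epi[OF X(2), rotated 2]) (auto simp: in_homs)
qed

text \<open>Runs the recursion from degree \<open>k\<close>, with nothing below, and keeps only the
  outcome in the top degree. This is how information about one end of a chain map reaches the
  other.\<close>

lemma ends_up:
  assumes X: "cpx D (Suc n) X" "contraX D n X" and Y: "cpx D (Suc n) Y"
    and f: "cmap D (Suc n) X Y f" and g: "cmap D (Suc n) X Y g" and k: "k \<le> n"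
    and h: "h \<in> homs D (ob X (Suc k)) (ob Y k)" "f k = g k \<boxplus> (h \<cdot> df X k)"
  obtains h' where "h' \<in> homs D (ob X (Suc n)) (ob Y n)" "f (Suc n) = g (Suc n) \<boxplus> (df Y n \<cdot> h')"
proof -
  note [simp] = cpx_type[OF X(1)] cpx_type[OF Y] cmap_type[OF f] cmap_type[OF g]
  have "\<exists>h\<in>homs D (ob X (Suc n)) (ob Y n). df Y n \<cdot> f n = (df Y n \<cdot> g n) \<boxplus> (df Y n \<cdot> (h \<cdot> df X n))"
    using k
  proof (induction rule: dec_induct)
    case base
    have "df Y k \<cdot> f k = (df Y k \<cdot> g k) \<boxplus> (df Y k \<cdot> (h \<cdot> df X k))"
      unfolding h(2) using k h(1)[unfolded in_homs] by (simp add: distr)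
    then show ?case using h(1) by blast
  next
    case (step i)
    then obtain h where h: "h \<in> homs D (ob X (Suc i)) (ob Y i)"
      "df Y i \<cdot> f i = (df Y i \<cdot> g i) \<boxplus> (df Y i \<cdot> (h \<cdot> df X i))" by blast
    show ?case by (rule homotopy_step[OF X Y f g \<open>i < n\<close> h]) blast
  qed
  then show thesis using homotopy_end[OF X Y f g] that by blast
qed

text \<open>The homotopy starts with the zero component out of degree 1, which is admissible because
  \<open>f\<close> and \<open>g\<close> agree in degree 0, and continues by
  \<open>homotopy_step\<close>.\<close>

lemma homotopicI:
  assumes X: "cpx D (Suc n) X" "contraX D n X" and Y: "cpx D (Suc n) Y"
    and f: "cmap D (Suc n) X Y f" and g: "cmap D (Suc n) X Y g" and eq: "f 0 = g 0"
  shows "homotopic D (n + 2) X Y f g"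
proof -
  note [simp] = cpx_type[OF X(1)] cpx_type[OF Y] cmap_type[OF f] cmap_type[OF g]
  let ?P = "\<lambda>i h. i \<le> n \<longrightarrow> h \<in> homs D (ob X (Suc i)) (ob Y i) \<and>
    df Y i \<cdot> f i = (df Y i \<cdot> g i) \<boxplus> (df Y i \<cdot> (h \<cdot> df X i))"
  let ?Q = "\<lambda>i h h'. i < n \<longrightarrow> f (Suc i) = g (Suc i) \<boxplus> ((df Y i \<cdot> h) \<boxplus> (h' \<cdot> df X (Suc i)))"
  let ?z = "Zero D (ob X (Suc 0)) (ob Y 0)"
  have "\<exists>h. h 0 = ?z \<and> (\<forall>i. ?P i (h i)) \<and> (\<forall>i. ?Q i (h i) (h (Suc i)))"
  proof -
    have "\<exists>h. \<forall>i. ((i = 0 \<longrightarrow> h i = ?z) \<and> ?P i (h i)) \<and> ?Q i (h i) (h (Suc i))"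
    \<comment> \<open>\<open>?P\<close> and \<open>?Q\<close> are vacuous beyond the top degree, so
      the choice can run over all of \<open>nat\<close>.\<close>
    proof (rule dependent_nat_choice[where P = "\<lambda>i h. (i = 0 \<longrightarrow> h = ?z) \<and> ?P i h" and Q = ?Q])
      show "\<exists>h. ((0::nat) = 0 \<longrightarrow> h = ?z) \<and> ?P 0 h" by (simp add: eq in_homs)
      fix h and i :: nat assume "(i = 0 \<longrightarrow> h = ?z) \<and> ?P i h"
      then show "\<exists>h'. ((Suc i = 0 \<longrightarrow> h' = ?z) \<and> ?P (Suc i) h') \<and> ?Q i h h'"
      proof (cases "i < n")
        case True
        then have h: "h \<in> homs D (ob X (Suc i)) (ob Y i)"
          "df Y i \<cdot> f i = (df Y i \<cdot> g i) \<boxplus> (df Y i \<cdot> (h \<cdot> df X i))"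
          using \<open>(i = 0 \<longrightarrow> h = ?z) \<and> ?P i h\<close> by auto
        show ?thesis by (rule homotopy_step[OF X Y f g True h]) blast
      qed auto
    qed
    then show ?thesis by blast
  qed
  then obtain h where h0: "h 0 = ?z" and P: "\<And>i. ?P i (h i)" and Q: "\<And>i. ?Q i (h i) (h (Suc i))" by blast
  have ht: "i \<le> n \<Longrightarrow> h i \<in> Arr D \<and> Dom D (h i) = ob X (Suc i) \<and> Cod D (h i) = ob Y i" for i
    using P[of i] by (simp add: in_homs)
  note [simp] = ht
  have e: "f (Suc n) = g (Suc n) \<boxplus> (df Y n \<cdot> h n)"
    using P[of n] by (intro homotopy_end[OF X Y f g]) auto
  show ?thesis
    unfolding homotopic_def null_homotopic_def
  \<comment> \<open>Here \<open>h i\<close> leaves degree \<open>i + 1\<close>, whereas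
    \<open>null_homotopic\<close> indexes each component by the degree that it leaves.\<close>
  proof (intro exI[of _ "\<lambda>i. h (i - 1)"] conjI ballI allI impI)
    fix i assume "i \<in> {1..<n + 2}"
    then show "h (i - 1) \<in> homs D (ob X i) (ob Y (i - 1))" using P[of "i - 1"] by auto
  next
    fix i assume i: "i < n + 2"
    consider "i = 0" | j where "i = Suc j" "j < n" | "i = Suc n" using i by (cases i) force+
    then show "(\<lambda>i\<in>{..<n + 2}. f i \<boxplus> neg D (g i)) i =
         (if i + 1 < n + 2 then h (i + 1 - 1) \<cdot> df X i else Zero D (ob X i) (ob Y i)) \<boxplus>
         (if 0 < i then df Y (i - 1) \<cdot> h (i - 1) else Zero D (ob X i) (ob Y i))"
    proof cases
      case 1 then show ?thesis by (simp add: eq h0)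
    next
      case 2
      have "f i \<boxplus> neg D (g i) = (df Y j \<cdot> h j) \<boxplus> (h (Suc j) \<cdot> df X (Suc j))"
        using 2 Q[of j] by (subst eq_Plus_iff[symmetric]) simp_all
      then show ?thesis using 2 by (simp add: Plus_comm[of "df Y j \<cdot> h j"])
    next
      case 3
      have "f i \<boxplus> neg D (g i) = df Y n \<cdot> h n"
        using 3 e by (subst eq_Plus_iff[symmetric]) simp_all
      then show ?thesis using 3 by simp
    qed
  qed
qed

text \<open>\<open>df Y (k + 1) \<cdot> b\<close> vanishes on \<open>df X k\<close>, hence factors
  through \<open>df X (k + 1)\<close>, and the factor is the next component. The induction is on the
  number of degrees left.\<close>

lemma lift_up:
  assumes X: "cpx D (Suc n) X" "contraX D n X" and Y: "cpx D (Suc n) Y"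
  shows "k \<le> n \<Longrightarrow> a \<in> homs D (ob X k) (ob Y k) \<Longrightarrow> b \<in> homs D (ob X (Suc k)) (ob Y (Suc k)) \<Longrightarrow>
    b \<cdot> df X k = df Y k \<cdot> a \<Longrightarrow>
    \<exists>F. F k = a \<and> F (Suc k) = b \<and> (\<forall>i. k \<le> i \<and> i \<le> Suc n \<longrightarrow> F i \<in> homs D (ob X i) (ob Y i)) \<and>
      (\<forall>i. k \<le> i \<and> i \<le> n \<longrightarrow> F (Suc i) \<cdot> df X i = df Y i \<cdot> F i)"
proof (induction "n - k" arbitrary: k a b)
  case 0
  then show ?case
    by (intro exI[of _ "\<lambda>i. if i \<le> k then a else b"]) (auto simp: le_Suc_eq)
next
  case (Suc m)
  note [simp] = cpx_type[OF X(1)] cpx_type[OF Y] Suc.prems(2,3)[unfolded in_homs]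
  have k: "k < n" using Suc.hyps(2) by simp
  have "(df Y (Suc k) \<cdot> b) \<cdot> df X k = Zero D (ob X (Suc k)) (ob Y (Suc (Suc k))) \<cdot> df X k"
    using k Suc.prems(4) reassoc1[OF cpx_type(5)[OF Y, of k], of a] by (simp add: assoc)
  then obtain t where t: "t \<in> homs D (ob X (Suc (Suc k))) (ob Y (Suc (Suc k)))"
    "df Y (Suc k) \<cdot> b = Zero D (ob X (Suc k)) (ob Y (Suc (Suc k))) \<boxplus> (t \<cdot> df X (Suc k))"
    using contraX_diff[OF X(2) k, of "df Y (Suc k) \<cdot> b" "ob Y (Suc (Suc k))" "Zero D (ob X (Suc k)) (ob Y (Suc (Suc k)))"] k
    by (auto simp: in_homs)
  note [simp] = t(1)[unfolded in_homs]
  have "t \<cdot> df X (Suc k) = df Y (Suc k) \<cdot> b" using t(2) k by simp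
  moreover have "m = n - Suc k" "Suc k \<le> n" using Suc.hyps(2) k by auto
  ultimately obtain F where F: "F (Suc k) = b" "F (Suc (Suc k)) = t"
      "\<And>i. Suc k \<le> i \<and> i \<le> Suc n \<Longrightarrow> F i \<in> homs D (ob X i) (ob Y i)"
      "\<And>i. Suc k \<le> i \<and> i \<le> n \<Longrightarrow> F (Suc i) \<cdot> df X i = df Y i \<cdot> F i"
    using Suc.hyps(1)[OF _ _ Suc.prems(3) t(1)] by blast
  show ?case
    using F Suc.prems k by (intro exI[of _ "\<lambda>i. if i = k then a else F i"]) auto
qed

end

context acat
begin

lemma ends_down:
  assumes X: "cpx D (Suc n) X" and Y: "cpx D (Suc n) Y" "covX D n Y"
    and f: "cmap D (Suc n) X Y f" and g: "cmap D (Suc n) X Y g" and k: "k \<le> n"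
    and h: "h \<in> homs D (ob X (Suc k)) (ob Y k)" "f (Suc k) = g (Suc k) \<boxplus> (df Y k \<cdot> h)"
  obtains h' where "h' \<in> homs D (ob X (Suc 0)) (ob Y 0)" "f 0 = g 0 \<boxplus> (h' \<cdot> df X 0)"
proof -
  interpret op: acat "opcat D" by (rule acat_op)
  have "Suc (n - k) = Suc n - k" using k by simp
  then obtain h' where "h' \<in> homs (opcat D) (ob (opc (Suc n) Y) (Suc n)) (ob (opc (Suc n) X) n)"
     "opf (Suc n) f (Suc n) = opf (Suc n) g (Suc n) \<boxplus> (df (opc (Suc n) X) n \<cdot>\<^bsub>opcat D\<^esub> h')"
    using op.ends_up[OF opc_cpx[OF Y(1)] _ opc_cpx[OF X] opf_cmap[OF f] opf_cmap[OF g], of "n - k" h]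
      k h Y(2) contraX_op[OF Y(1)] by auto
  then show thesis using that[of h'] by simp
qed

lemma lift_down:
  assumes X: "cpx D (Suc n) X" and Y: "cpx D (Suc n) Y" "covX D n Y"
    and k: "k \<le> n" and a: "a \<in> homs D (ob X k) (ob Y k)" and b: "b \<in> homs D (ob X (Suc k)) (ob Y (Suc k))"
    and eq: "b \<cdot> df X k = df Y k \<cdot> a"
  shows "\<exists>F. F k = a \<and> F (Suc k) = b \<and> (\<forall>i\<le>Suc k. F i \<in> homs D (ob X i) (ob Y i)) \<and>
      (\<forall>i\<le>k. F (Suc i) \<cdot> df X i = df Y i \<cdot> F i)"
proof -
  interpret op: acat "opcat D" by (rule acat_op)
  have *: "Suc (n - k) = Suc n - k" using k by simp
  from op.lift_up[OF opc_cpx[OF Y(1)] _ opc_cpx[OF X], of "n - k" b a]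
  obtain F where F: "F (n - k) = b" "F (Suc n - k) = a"
    "\<And>i. n - k \<le> i \<and> i \<le> Suc n \<Longrightarrow> F i \<in> homs D (ob X (Suc n - i)) (ob Y (Suc n - i))"
    "\<And>i. n - k \<le> i \<and> i \<le> n \<Longrightarrow> F i \<cdot> df X (n - i) = df Y (n - i) \<cdot> F (Suc i)"
    using k a b eq Y(2) contraX_op[OF Y(1)] * by auto
  have "F (Suc n - Suc i) \<cdot> df X i = df Y i \<cdot> F (Suc n - i)" if "i \<le> k" for i
    using F(4)[of "n - i"] that k by (simp add: Suc_diff_le)
  moreover have "F (Suc n - i) \<in> homs D (ob X i) (ob Y i)" if "i \<le> Suc k" for i
    using F(3)[of "Suc n - i"] that k by (cases "i = Suc k") auto
  ultimately show ?thesis using F(1,2) by (intro exI[of _ "\<lambda>i. F (Suc n - i)"]) auto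
qed

text \<open>Glues an upward and a downward lift along degree \<open>k\<close>. Covariant exactness
  of \<open>Y\<close> serves the downward half, which is empty for \<open>k = 0\<close>.\<close>

lemma lift_from:
  assumes X: "cpx D (Suc n) X" "contraX D n X" and Y: "cpx D (Suc n) Y" and k: "k \<le> n" "k = 0 \<or> covX D n Y"
    and a: "a \<in> homs D (ob X k) (ob Y k)" and b: "b \<in> homs D (ob X (Suc k)) (ob Y (Suc k))"
    and eq: "b \<cdot> df X k = df Y k \<cdot> a"
  obtains f where "cmap D (Suc n) X Y f" "f k = a" "f (Suc k) = b"
proof -
  obtain F where F: "F k = a" "F (Suc k) = b" "\<And>i. k \<le> i \<Longrightarrow> i \<le> Suc n \<Longrightarrow> F i \<in> homs D (ob X i) (ob Y i)"
      "\<And>i. k \<le> i \<Longrightarrow> i \<le> n \<Longrightarrow> F (Suc i) \<cdot> df X i = df Y i \<cdot> F i"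
    using lift_up[OF X Y k(1) a b eq] by blast
  obtain F' where F': "F' k = a" "\<And>i. i \<le> k \<Longrightarrow> F' i \<in> homs D (ob X i) (ob Y i)"
      "\<And>i. i < k \<Longrightarrow> F' (Suc i) \<cdot> df X i = df Y i \<cdot> F' i"
  proof (cases "k = 0")
    case True then show ?thesis using that[of "\<lambda>_. a"] a by simp
  next
    case False
    then show ?thesis using that lift_down[OF X(1) Y _ k(1) a b eq] k(2)
      by (metis le_Suc_eq less_imp_le_nat)
  qed
  let ?G = "\<lambda>i. if i \<le> k then F' i else F i"
  have "cmap D (Suc n) X Y (\<lambda>i\<in>{..<Suc (Suc n)}. ?G i)"
  proof (rule cmapI)
    fix i assume "i < Suc n"
    then show "?G (Suc i) \<cdot> df X i = df Y i \<cdot> ?G i"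
      using F F' by (cases "i < k"; cases "i = k") (auto simp: not_le less_Suc_eq_le Suc_le_eq)
  qed (use F F' in auto)
  then show thesis using that F F' k by auto
qed

text \<open>Adds the null-homotopic map whose homotopy is \<open>h\<close> in the top degree and
  zero elsewhere. It alters degrees \<open>n\<close> and \<open>n + 1\<close> only, and
  \<open>1 \<le> n\<close> keeps degree 0 apart from them.\<close>

lemma adjust_end:
  assumes X: "cpx D (Suc n) X" and Y: "cpx D (Suc n) Y" and n: "1 \<le> n"
    and k: "cmap D (Suc n) X Y k" and h: "h \<in> homs D (ob X (Suc n)) (ob Y n)"
    and c: "c = k (Suc n) \<boxplus> (df Y n \<cdot> h)"
  obtains k' where "cmap D (Suc n) X Y k'" "k' 0 = k 0" "k' (Suc n) = c"
proof -
  note [simp] = cpx_type[OF X(1)] cpx_type[OF Y] cmap_type[OF k] h[unfolded in_homs]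
  let ?G = "\<lambda>i. if i = Suc n then c else if i = n then k n \<boxplus> (h \<cdot> df X n) else k i"
  have "cmap D (Suc n) X Y (\<lambda>i\<in>{..<Suc (Suc n)}. ?G i)"
  proof (rule cmapI)
    fix i assume "i \<le> Suc n" then show "?G i \<in> homs D (ob X i) (ob Y i)"
      using c by (auto simp: in_homs)
  next
    fix i assume "i < Suc n"
    then consider "i = n" | "Suc i = n" | "Suc i < n" by linarith
    then show "?G (Suc i) \<cdot> df X i = df Y i \<cdot> ?G i"
    proof cases
      case 1 then show ?thesis using c cmapD(2)[OF k, of n] by (simp add: distr assoc)
    next
      case 2
      then have "h \<cdot> (df X n \<cdot> df X i) = Zero D (ob X i) (ob Y n)" using cpx_type(5)[OF X, of i] by auto
      then show ?thesis using 2 cmapD(2)[OF k, of i] by (auto simp add: distr assoc)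
    next
      case 3 then show ?thesis using cmapD(2)[OF k, of i] by simp
    qed
  qed
  then show thesis using that n by auto
qed

lemma adjust_start:
  assumes X: "cpx D (Suc n) X" and Y: "cpx D (Suc n) Y" and n: "1 \<le> n"
    and k: "cmap D (Suc n) X Y k" and h: "h \<in> homs D (ob X (Suc 0)) (ob Y 0)"
    and c: "c = k 0 \<boxplus> (h \<cdot> df X 0)"
  obtains k' where "cmap D (Suc n) X Y k'" "k' (Suc n) = k (Suc n)" "k' 0 = c"
proof -
  interpret op: acat "opcat D" by (rule acat_op)
  obtain k' where "cmap (opcat D) (Suc n) (opc (Suc n) Y) (opc (Suc n) X) k'"
    "k' 0 = k (Suc n)" "k' (Suc n) = c"
    using op.adjust_end[OF opc_cpx[OF Y] opc_cpx[OF X] n opf_cmap[OF k], of h c] h c by auto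
  then show thesis using that[of "opf (Suc n) k'"] op_cmap[OF _ X Y] by simp
qed

text \<open>A lift \<open>k\<close> of \<open>b\<close>, composed with \<open>g\<close>, agrees with
  \<open>f\<close> in degree 0, so the top components differ by some
  \<open>df T n \<cdot> h\<close>. The section \<open>g'\<close> carries this defect over to
  \<open>Y\<close>, where \<open>adjust_end\<close> absorbs it.\<close>

lemma extend_along:
  assumes n: "1 \<le> n" and X: "cpx D (Suc n) X" "contraX D n X" and Y: "cpx D (Suc n) Y" "contraX D n Y"
    and T: "cpx D (Suc n) T"
    and g: "cmap D (Suc n) X Y g" and f: "cmap D (Suc n) X T f"
    and b: "b \<in> homs D (ob Y 0) (ob T 0)" "b \<cdot> g 0 = f 0"
    and w: "w \<in> homs D (ob Y (Suc 0)) (ob T (Suc 0))" "df T 0 \<cdot> b = w \<cdot> df Y 0"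
    and g': "g' \<in> homs D (ob Y (Suc n)) (ob X (Suc n))" "g (Suc n) \<cdot> g' = Ide D (ob Y (Suc n))"
  obtains k where "cmap D (Suc n) Y T k" "k 0 = b" "k (Suc n) = f (Suc n) \<cdot> g'"
proof -
  note [simp] = cpx_type[OF X(1)] cpx_type[OF Y(1)] cpx_type[OF T] cmap_type[OF f] cmap_type[OF g]
    b(1)[unfolded in_homs] w(1)[unfolded in_homs] g'(1)[unfolded in_homs]
  obtain k where k: "cmap D (Suc n) Y T k" "k 0 = b"
    using lift_from[OF Y T, of 0 b w] b w by auto
  note [simp] = cmap_type[OF k(1)]
  obtain h where h: "h \<in> homs D (ob X (Suc n)) (ob T n)"
      "f (Suc n) = (k (Suc n) \<cdot> g (Suc n)) \<boxplus> (df T n \<cdot> h)"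
    using ends_up[OF X T f cmap_comp[OF X(1) Y(1) T g k(1)], of 0 "Zero D (ob X (Suc 0)) (ob T 0)"] b k
    by (auto simp: in_homs)
  note [simp] = h(1)[unfolded in_homs]
  have "f (Suc n) \<cdot> g' = k (Suc n) \<boxplus> (df T n \<cdot> (h \<cdot> g'))"
    unfolding h(2) by (simp add: distr assoc g'(2))
  then show thesis
    using adjust_end[OF Y(1) T n k(1), of "h \<cdot> g'" "f (Suc n) \<cdot> g'"] k(2) that by (auto simp: in_homs)
qed

text \<open>\<open>Y\<close> is a homotopy retract of \<open>X\<close>: move arrows to
  \<open>X\<close> by \<open>g\<close>, use exactness there, move back by \<open>f\<close> and
  correct with the homotopy. The contravariant half is obtained by applying this in
  \<open>opcat D\<close>.\<close>

lemma nex_transport: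
  assumes n: "1 \<le> n" and X: "nex D n X" and Y: "cpx D (Suc n) Y"
    and f: "cmap D (Suc n) X Y f" and g: "cmap D (Suc n) Y X g"
    and ho: "homotopic D (n + 2) Y Y (ccomp D (Suc n) f g) (cid D (Suc n) Y)"
  shows "covX D n Y"
proof -
  have X': "cpx D (Suc n) X" "contraX D n X" "covX D n X" using X by (auto simp: nex_def)
  note [simp] = cpx_type[OF X'(1)] cpx_type[OF Y(1)] cmap_type[OF f] cmap_type[OF g]
  obtain h where h: "\<And>i. i \<in> {1..<n + 2} \<Longrightarrow> h i \<in> homs D (ob Y i) (ob Y (i - 1))"
    and eq: "\<And>i. i < n + 2 \<Longrightarrow> (\<lambda>i\<in>{..<n + 2}. ccomp D (Suc n) f g i \<boxplus> neg D (cid D (Suc n) Y i)) i =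
           (if i + 1 < n + 2 then h (i + 1) \<cdot> df Y i else Zero D (ob Y i) (ob Y i)) \<boxplus>
           (if 0 < i then df Y (i - 1) \<cdot> h i else Zero D (ob Y i) (ob Y i))"
    using ho unfolding homotopic_def null_homotopic_def by blast
  have ht: "1 \<le> i \<Longrightarrow> i \<le> Suc n \<Longrightarrow> h i \<in> Arr D \<and> Dom D (h i) = ob Y i \<and> Cod D (h i) = ob Y (i - 1)" for i
    using h[of i] by (simp add: in_homs)
  note [simp] = ht
  have e: "f i \<cdot> g i = Ide D (ob Y i) \<boxplus> ((h (Suc i) \<cdot> df Y i) \<boxplus> (if 0 < i then df Y (i - 1) \<cdot> h i else Zero D (ob Y i) (ob Y i)))"
    if "i \<le> n" for i
  proof (cases "i = 0")
    case True then show ?thesis using eq[of i] that by (subst eq_Plus_iff) auto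
  next
    case False
    then have "i - 1 < Suc n" "Suc (i - 1) = i" using that by auto
    then show ?thesis using eq[of i] that False by (subst eq_Plus_iff) auto
  qed
  show ?thesis unfolding covX_def
  proof (intro allI conjI ballI impI)
    fix W x y assume "x \<in> homs D W (ob Y 0)" "y \<in> homs D W (ob Y 0)" and xy: "df Y 0 \<cdot> x = df Y 0 \<cdot> y"
    then have [simp]: "x \<in> Arr D" "y \<in> Arr D" "Dom D x = W" "Dom D y = W" "Cod D x = ob Y 0" "Cod D y = ob Y 0"
      by (auto simp: in_homs)
    have "df X 0 \<cdot> (g 0 \<cdot> x) = df X 0 \<cdot> (g 0 \<cdot> y)"
      using reassoc[OF cmapD(2)[OF g, of 0, symmetric], of x] reassoc[OF cmapD(2)[OF g, of 0, symmetric], of y] xy by simp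
    then have "g 0 \<cdot> x = g 0 \<cdot> y" by (rule covX_mono[OF X'(3), rotated 2]) (auto simp: in_homs)
    then have "(f 0 \<cdot> g 0) \<cdot> x = (f 0 \<cdot> g 0) \<cdot> y" by (simp add: assoc)
    then have "x \<boxplus> (h 1 \<cdot> (df Y 0 \<cdot> x)) = y \<boxplus> (h 1 \<cdot> (df Y 0 \<cdot> y))"
      unfolding e[OF le0] by (simp add: distr assoc)
    then have "(h 1 \<cdot> (df Y 0 \<cdot> y)) \<boxplus> x = (h 1 \<cdot> (df Y 0 \<cdot> y)) \<boxplus> y"
      by (simp add: xy Plus_comm[of x] Plus_comm[of y])
    then show "x = y" by (subst (asm) Plus_cancel) auto
  next
    fix W x y i assume i: "i < n" and "x \<in> homs D W (ob Y (Suc i))" "y \<in> homs D W (ob Y (Suc i))"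
      and xy: "df Y (Suc i) \<cdot> x = df Y (Suc i) \<cdot> y"
    then have [simp]: "x \<in> Arr D" "y \<in> Arr D" "Dom D x = W" "Dom D y = W" "Cod D x = ob Y (Suc i)" "Cod D y = ob Y (Suc i)"
      by (auto simp: in_homs)
    have "df X (Suc i) \<cdot> (g (Suc i) \<cdot> x) = df X (Suc i) \<cdot> (g (Suc i) \<cdot> y)"
      using reassoc[OF cmapD(2)[OF g, of "Suc i", symmetric], of x] reassoc[OF cmapD(2)[OF g, of "Suc i", symmetric], of y] xy i by simp
    then obtain t where t: "t \<in> homs D W (ob X i)" "g (Suc i) \<cdot> x = (g (Suc i) \<cdot> y) \<boxplus> (df X i \<cdot> t)"
      using covX_diff[OF X'(3) i, of "g (Suc i) \<cdot> x" W "g (Suc i) \<cdot> y"] i by (auto simp: in_homs)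
    note [simp] = t(1)[unfolded in_homs]
    have "(f (Suc i) \<cdot> g (Suc i)) \<cdot> x = ((f (Suc i) \<cdot> g (Suc i)) \<cdot> y) \<boxplus> (df Y i \<cdot> (f i \<cdot> t))"
      using i t(2) reassoc[OF cmapD(2)[OF f, of i], of t] by (simp add: assoc distr)
    then have *: "x \<boxplus> ((h (Suc (Suc i)) \<cdot> (df Y (Suc i) \<cdot> y)) \<boxplus> (df Y i \<cdot> (h (Suc i) \<cdot> x))) =
       (y \<boxplus> ((h (Suc (Suc i)) \<cdot> (df Y (Suc i) \<cdot> y)) \<boxplus> (df Y i \<cdot> (h (Suc i) \<cdot> y)))) \<boxplus> (df Y i \<cdot> (f i \<cdot> t))"
      using e[of "Suc i"] i xy by (simp add: distr assoc)
    define p where "p = h (Suc (Suc i)) \<cdot> (df Y (Suc i) \<cdot> y)"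
    have [simp]: "p \<in> Arr D" "Dom D p = W" "Cod D p = ob Y (Suc i)" using i by (auto simp: p_def)
    have "p \<boxplus> (x \<boxplus> (df Y i \<cdot> (h (Suc i) \<cdot> x))) = p \<boxplus> (y \<boxplus> ((df Y i \<cdot> (h (Suc i) \<cdot> y)) \<boxplus> (df Y i \<cdot> (f i \<cdot> t))))"
      using * i unfolding p_def[symmetric] by (simp add: Plus_assoc Plus_lcomm)
    then have "x \<boxplus> (df Y i \<cdot> (h (Suc i) \<cdot> x)) = y \<boxplus> ((df Y i \<cdot> (h (Suc i) \<cdot> y)) \<boxplus> (df Y i \<cdot> (f i \<cdot> t)))"
      using i by (subst (asm) Plus_cancel) auto
    then have "(df Y i \<cdot> (h (Suc i) \<cdot> x)) \<boxplus> x = y \<boxplus> ((df Y i \<cdot> (h (Suc i) \<cdot> y)) \<boxplus> (df Y i \<cdot> (f i \<cdot> t)))"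
      using i by (simp add: Plus_comm[of x])
    then have "neg D (df Y i \<cdot> (h (Suc i) \<cdot> x)) \<boxplus> ((df Y i \<cdot> (h (Suc i) \<cdot> x)) \<boxplus> x) =
       neg D (df Y i \<cdot> (h (Suc i) \<cdot> x)) \<boxplus> (y \<boxplus> ((df Y i \<cdot> (h (Suc i) \<cdot> y)) \<boxplus> (df Y i \<cdot> (f i \<cdot> t))))"
      by simp
    then have "x = y \<boxplus> (df Y i \<cdot> (neg D (h (Suc i) \<cdot> x) \<boxplus> ((h (Suc i) \<cdot> y) \<boxplus> (f i \<cdot> t))))"
      using i by (simp add: distr Plus_lcomm[of y])
    then show "\<exists>t\<in>homs D W (ob Y i). x = y \<boxplus> (df Y i \<cdot> t)"
      using i by (intro bexI) (assumption, auto simp: in_homs)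
  qed
qed

end

section \<open>Chain maps with prescribed ends\<close>

text \<open>Extension classes see a chain map only through its ends, so the inner components are
  hidden behind an existential quantifier.\<close>

definition emap :: "('o, 'm) precat \<Rightarrow> nat \<Rightarrow> ('o, 'm) cplx \<Rightarrow> ('o, 'm) cplx \<Rightarrow> 'm \<Rightarrow> 'm \<Rightarrow> bool" where
  "emap D n X Y a c \<longleftrightarrow> (\<exists>f. cmap D (Suc n) X Y f \<and> f 0 = a \<and> f (Suc n) = c)"

lemma emapI: "cmap D (Suc n) X Y f \<Longrightarrow> emap D n X Y (f 0) (f (Suc n))"
  by (auto simp: emap_def)

lemma emapE: assumes "emap D n X Y a c"
  obtains f where "cmap D (Suc n) X Y f" "f 0 = a" "f (Suc n) = c"
  using assms by (auto simp: emap_def)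

lemma emap_homs: assumes "emap D n X Y a c"
  shows "a \<in> homs D (ob X 0) (ob Y 0)" "c \<in> homs D (ob X (Suc n)) (ob Y (Suc n))"
  using assms by (auto simp: emap_def dest: cmapD)

lemma emap_type: assumes "emap D n X Y a c"
  shows "a \<in> Arr D" "Dom D a = ob X 0" "Cod D a = ob Y 0" "c \<in> Arr D" "Dom D c = ob X (Suc n)" "Cod D c = ob Y (Suc n)"
  using emap_homs[OF assms] by (auto simp: in_homs)

lemma emap_op: "emap D n X Y a c \<Longrightarrow> emap (opcat D) n (opc (Suc n) Y) (opc (Suc n) X) c a"
  using opf_cmap[of D "Suc n" X Y] by (force simp: emap_def)

lemma emap_opD:
  assumes "emap (opcat D) n (opc (Suc n) Y) (opc (Suc n) X) c a" "cpx D (Suc n) X" "cpx D (Suc n) Y"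
  shows "emap D n X Y a c"
  using emap_op[OF assms(1)] assms(2,3) by (simp add: opc_opc)

text \<open>Exactness of the cone of \<open>(f\<^sub>0, \<dots>, f\<^sub>n)\<close>, spelled out on components: these are the pushout and the
  pullback property.\<close>

definition po_elt :: "('o, 'm) precat \<Rightarrow> nat \<Rightarrow> ('o, 'm) cplx \<Rightarrow> ('o, 'm) cplx \<Rightarrow> (nat \<Rightarrow> 'm) \<Rightarrow> bool" where
  "po_elt D n X Y f \<longleftrightarrow> (\<forall>W.
     (\<forall>s\<in>homs D (ob Y n) W. \<forall>s'\<in>homs D (ob Y n) W.
        s \<cdot>\<^bsub>D\<^esub> f n = s' \<cdot>\<^bsub>D\<^esub> f n \<and> s \<cdot>\<^bsub>D\<^esub> df Y (n - 1) = s' \<cdot>\<^bsub>D\<^esub> df Y (n - 1) \<longrightarrow> s = s') \<and>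
     (\<forall>i<n. \<forall>u\<in>homs D (ob X (Suc i)) W. \<forall>v\<in>homs D (ob Y i) W.
        u \<cdot>\<^bsub>D\<^esub> df X i = v \<cdot>\<^bsub>D\<^esub> f i \<and> (0 < i \<longrightarrow> v \<cdot>\<^bsub>D\<^esub> df Y (i - 1) = Zero D (ob Y (i - 1)) W) \<longrightarrow>
        (\<exists>w\<in>homs D (ob Y (Suc i)) W. v = w \<cdot>\<^bsub>D\<^esub> df Y i \<and>
          (if Suc i < n then \<exists>t\<in>homs D (ob X (Suc (Suc i))) W. u = (w \<cdot>\<^bsub>D\<^esub> f (Suc i)) \<boxplus>\<^bsub>D\<^esub> (t \<cdot>\<^bsub>D\<^esub> df X (Suc i))
           else u = w \<cdot>\<^bsub>D\<^esub> f (Suc i)))))"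

definition pb_elt :: "('o, 'm) precat \<Rightarrow> nat \<Rightarrow> ('o, 'm) cplx \<Rightarrow> ('o, 'm) cplx \<Rightarrow> (nat \<Rightarrow> 'm) \<Rightarrow> bool" where
  "pb_elt D n X Y f \<longleftrightarrow> (\<forall>W.
     (\<forall>s\<in>homs D W (ob X 0). \<forall>s'\<in>homs D W (ob X 0).
        f 0 \<cdot>\<^bsub>D\<^esub> s = f 0 \<cdot>\<^bsub>D\<^esub> s' \<and> df X 0 \<cdot>\<^bsub>D\<^esub> s = df X 0 \<cdot>\<^bsub>D\<^esub> s' \<longrightarrow> s = s') \<and>
     (\<forall>i<n. \<forall>u\<in>homs D W (ob X (Suc i)). \<forall>v\<in>homs D W (ob Y i).
        df Y i \<cdot>\<^bsub>D\<^esub> v = f (Suc i) \<cdot>\<^bsub>D\<^esub> u \<and> (Suc i < n \<longrightarrow> df X (Suc i) \<cdot>\<^bsub>D\<^esub> u = Zero D W (ob X (Suc (Suc i)))) \<longrightarrow>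
        (\<exists>w\<in>homs D W (ob X i). u = df X i \<cdot>\<^bsub>D\<^esub> w \<and>
          (if 0 < i then \<exists>t\<in>homs D W (ob Y (i - 1)). v = (f i \<cdot>\<^bsub>D\<^esub> w) \<boxplus>\<^bsub>D\<^esub> (df Y (i - 1) \<cdot>\<^bsub>D\<^esub> t)
           else v = f i \<cdot>\<^bsub>D\<^esub> w))))"

text \<open>\<open>po_elt\<close> looks at degrees up to \<open>n\<close> only, so a complex with
  \<open>n + 2\<close> terms may stand in for its initial segment.\<close>

lemma po_elt_cong:
  assumes "n \<ge> 1" "\<And>i. i \<le> n \<Longrightarrow> ob X i = ob X' i" "\<And>i. i \<le> n \<Longrightarrow> ob Y i = ob Y' i" "\<And>i. i < n \<Longrightarrow> df X i = df X' i"
    "\<And>i. i < n \<Longrightarrow> df Y i = df Y' i" "\<And>i. i \<le> n \<Longrightarrow> f i = f' i"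
  shows "po_elt D n X Y f \<longleftrightarrow> po_elt D n X' Y' f'"
  unfolding po_elt_def using assms
  by (intro all_cong1 conj_cong refl all_cong ball_cong imp_cong bex_cong if_cong) auto

lemma po_elt_op:
  assumes "n \<ge> 1"
  shows "po_elt (opcat D) n (opc n Y) (opc n X) (opf n f) \<longleftrightarrow> pb_elt D n X Y f"
proof -
  let ?P = "\<lambda>W i. \<forall>u\<in>homs D W (ob X (Suc i)). \<forall>v\<in>homs D W (ob Y i).
        df Y i \<cdot>\<^bsub>D\<^esub> v = f (Suc i) \<cdot>\<^bsub>D\<^esub> u \<and> (Suc i < n \<longrightarrow> df X (Suc i) \<cdot>\<^bsub>D\<^esub> u = Zero D W (ob X (Suc (Suc i)))) \<longrightarrow>
        (\<exists>w\<in>homs D W (ob X i). u = df X i \<cdot>\<^bsub>D\<^esub> w \<and>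
          (if 0 < i then \<exists>t\<in>homs D W (ob Y (i - 1)). v = (f i \<cdot>\<^bsub>D\<^esub> w) \<boxplus>\<^bsub>D\<^esub> (df Y (i - 1) \<cdot>\<^bsub>D\<^esub> t)
           else v = f i \<cdot>\<^bsub>D\<^esub> w))"
  \<comment> \<open>Reversal exchanges the two complexes, so the variables \<open>u\<close> and
    \<open>v\<close> trade places as well.\<close>
  have P: "?P W (n - Suc i) \<longleftrightarrow> (\<forall>u\<in>homs D W (ob Y (n - Suc i)). \<forall>v\<in>homs D W (ob X (n - i)).
        df Y (n - Suc i) \<cdot>\<^bsub>D\<^esub> u = f (n - i) \<cdot>\<^bsub>D\<^esub> v \<and> (0 < i \<longrightarrow> df X (n - i) \<cdot>\<^bsub>D\<^esub> v = Zero D W (ob X (Suc n - i))) \<longrightarrow>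
        (\<exists>w\<in>homs D W (ob X (n - Suc i)). v = df X (n - Suc i) \<cdot>\<^bsub>D\<^esub> w \<and>
          (if Suc i < n then \<exists>t\<in>homs D W (ob Y (n - Suc (Suc i))). u = (f (n - Suc i) \<cdot>\<^bsub>D\<^esub> w) \<boxplus>\<^bsub>D\<^esub> (df Y (n - Suc (Suc i)) \<cdot>\<^bsub>D\<^esub> t)
           else u = f (n - Suc i) \<cdot>\<^bsub>D\<^esub> w)))" if "i < n" for i W
  proof -
    have "Suc (n - Suc i) = n - i" "Suc (n - i) = Suc n - i" "n - Suc i - 1 = n - Suc (Suc i)"
      "n - i < n \<longleftrightarrow> 0 < i" "0 < n - Suc i \<longleftrightarrow> Suc i < n" using that by auto
    then show ?thesis by (simp only:) blast
  qed
  have "(\<forall>i<n. ?P W i) \<longleftrightarrow> (\<forall>i<n. ?P W (n - Suc i))" for W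
    by (rule reindex_less[of n "?P W", symmetric])
  also have "\<dots> W \<longleftrightarrow> (\<forall>i<n. \<forall>u\<in>homs D W (ob Y (n - Suc i)). \<forall>v\<in>homs D W (ob X (n - i)).
        df Y (n - Suc i) \<cdot>\<^bsub>D\<^esub> u = f (n - i) \<cdot>\<^bsub>D\<^esub> v \<and> (0 < i \<longrightarrow> df X (n - i) \<cdot>\<^bsub>D\<^esub> v = Zero D W (ob X (Suc n - i))) \<longrightarrow>
        (\<exists>w\<in>homs D W (ob X (n - Suc i)). v = df X (n - Suc i) \<cdot>\<^bsub>D\<^esub> w \<and>
          (if Suc i < n then \<exists>t\<in>homs D W (ob Y (n - Suc (Suc i))). u = (f (n - Suc i) \<cdot>\<^bsub>D\<^esub> w) \<boxplus>\<^bsub>D\<^esub> (df Y (n - Suc (Suc i)) \<cdot>\<^bsub>D\<^esub> t)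
           else u = f (n - Suc i) \<cdot>\<^bsub>D\<^esub> w)))" (is "_ \<longleftrightarrow> ?R W") for W
    by (rule all_cong) (simp only: P)
  finally have R: "(\<forall>i<n. ?P W i) \<longleftrightarrow> ?R W" for W .
  show ?thesis
    unfolding po_elt_def pb_elt_def R using assms by (simp add: Suc_diff_le cong: conj_cong if_cong)
qed

context acat
begin

lemma emap_comp: "cpx D (Suc n) X \<Longrightarrow> cpx D (Suc n) Y \<Longrightarrow> cpx D (Suc n) T \<Longrightarrow>
    emap D n X Y a c \<Longrightarrow> emap D n Y T a' c' \<Longrightarrow> emap D n X T (a' \<cdot> a) (c' \<cdot> c)"
  unfolding emap_def by (metis cmap_comp ccomp_simp le0 order_refl)

lemma emap_id: "cpx D (Suc n) X \<Longrightarrow> emap D n X X (Ide D (ob X 0)) (Ide D (ob X (Suc n)))"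
  using emapI[OF cmap_id[of "Suc n" X]] by simp

text \<open>Comparison with the zero map by \<open>ends_up\<close>. Applied to a chain map whose
  right end is an identity, it turns an extension over \<open>d\<^sub>0\<close> into a section of
  \<open>d\<^sub>n\<close>.\<close>

lemma emap_null_up:
  assumes X: "cpx D (Suc n) X" "contraX D n X" and Y: "cpx D (Suc n) Y" and f: "emap D n X Y (u \<cdot> df X 0) c"
    and u: "u \<in> homs D (ob X (Suc 0)) (ob Y 0)"
  obtains h where "h \<in> homs D (ob X (Suc n)) (ob Y n)" "c = df Y n \<cdot> h"
proof -
  obtain f where f: "cmap D (Suc n) X Y f" "f 0 = u \<cdot> df X 0" "f (Suc n) = c" using emapE[OF f] .
  note [simp] = cpx_type[OF X(1)] cpx_type[OF Y] u[unfolded in_homs]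
  have "f 0 = czero D (Suc n) X Y 0 \<boxplus> (u \<cdot> df X 0)" using f by simp
  then obtain h where h: "h \<in> homs D (ob X (Suc n)) (ob Y n)" "f (Suc n) = czero D (Suc n) X Y (Suc n) \<boxplus> (df Y n \<cdot> h)"
    using ends_up[OF X Y f(1) cmap_zero[OF X(1) Y] le0 u] by blast
  then show thesis using that[OF h(1)] f(3) h(1)[unfolded in_homs] by simp
qed

lemma emap_null_down:
  assumes X: "cpx D (Suc n) X" and Y: "cpx D (Suc n) Y" "covX D n Y" and f: "emap D n X Y a (df Y n \<cdot> u)"
    and u: "u \<in> homs D (ob X (Suc n)) (ob Y n)"
  obtains h where "h \<in> homs D (ob X (Suc 0)) (ob Y 0)" "a = h \<cdot> df X 0"
proof -
  obtain f where f: "cmap D (Suc n) X Y f" "f 0 = a" "f (Suc n) = df Y n \<cdot> u" using emapE[OF f] .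
  note [simp] = cpx_type[OF X(1)] cpx_type[OF Y(1)] u[unfolded in_homs]
  have "f (Suc n) = czero D (Suc n) X Y (Suc n) \<boxplus> (df Y n \<cdot> u)" using f by simp
  then obtain h where h: "h \<in> homs D (ob X (Suc 0)) (ob Y 0)" "f 0 = czero D (Suc n) X Y 0 \<boxplus> (h \<cdot> df X 0)"
    using ends_down[OF X Y f(1) cmap_zero[OF X(1) Y(1)] order_refl u] by blast
  then show thesis using that[OF h(1)] f(2) h(1)[unfolded in_homs] by simp
qed

text \<open>The homotopy between the two chain maps starts with zero, since their left ends
  coincide.\<close>

lemma emap_diff_up:
  assumes X: "cpx D (Suc n) X" "contraX D n X" and Y: "cpx D (Suc n) Y" and f: "emap D n X Y a c" "emap D n X Y a c'"
  obtains h where "h \<in> homs D (ob X (Suc n)) (ob Y n)" "c = c' \<boxplus> (df Y n \<cdot> h)"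
proof -
  obtain f where f': "cmap D (Suc n) X Y f" "f 0 = a" "f (Suc n) = c" using emapE[OF f(1)] .
  obtain g where g: "cmap D (Suc n) X Y g" "g 0 = a" "g (Suc n) = c'" using emapE[OF f(2)] .
  note [simp] = cpx_type[OF X(1)] cpx_type[OF Y] emap_type[OF f(1)]
  have "f 0 = g 0 \<boxplus> (Zero D (ob X (Suc 0)) (ob Y 0) \<cdot> df X 0)" using f' g by simp
  then show thesis
    using ends_up[OF X Y f'(1) g(1) le0 Zero_homs] f' g that by auto
qed

lemma emap_diff_down:
  assumes X: "cpx D (Suc n) X" and Y: "cpx D (Suc n) Y" "covX D n Y" and f: "emap D n X Y a c" "emap D n X Y a' c"
  obtains h where "h \<in> homs D (ob X (Suc 0)) (ob Y 0)" "a = a' \<boxplus> (h \<cdot> df X 0)"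
proof -
  obtain f where f': "cmap D (Suc n) X Y f" "f 0 = a" "f (Suc n) = c" using emapE[OF f(1)] .
  obtain g where g: "cmap D (Suc n) X Y g" "g 0 = a'" "g (Suc n) = c" using emapE[OF f(2)] .
  note [simp] = cpx_type[OF X(1)] cpx_type[OF Y(1)] emap_type[OF f(1)]
  have "f (Suc n) = g (Suc n) \<boxplus> (df Y n \<cdot> Zero D (ob X (Suc n)) (ob Y n))" using f' g by simp
  then show thesis
    using ends_down[OF X Y f'(1) g(1) order_refl Zero_homs] f' g that by auto
qed

lemma emap_adjust_end:
  assumes "cpx D (Suc n) X" "cpx D (Suc n) Y" "1 \<le> n" "emap D n X Y a c" "h \<in> homs D (ob X (Suc n)) (ob Y n)"
  shows "emap D n X Y a (c \<boxplus> (df Y n \<cdot> h))"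
  using assms(4) adjust_end[OF assms(1-3) _ assms(5)] unfolding emap_def by metis

lemma emap_adjust_start:
  assumes "cpx D (Suc n) X" "cpx D (Suc n) Y" "1 \<le> n" "emap D n X Y a c" "h \<in> homs D (ob X (Suc 0)) (ob Y 0)"
  shows "emap D n X Y (a \<boxplus> (h \<cdot> df X 0)) c"
  using assms(4) adjust_start[OF assms(1-3) _ assms(5)] unfolding emap_def by metis

section \<open>Homotopy classes of n-exact sequences\<close>

lemma homotopic_op:
  assumes X: "cpx D (Suc n) X" and Y: "cpx D (Suc n) Y"
    and ho: "homotopic D (n + 2) X Y f g"
  shows "homotopic (opcat D) (n + 2) (opc (Suc n) Y) (opc (Suc n) X) (opf (Suc n) f) (opf (Suc n) g)"
proof -
  note [simp] = cpx_type[OF X(1)] cpx_type[OF Y(1)]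
  obtain h where h: "\<And>i. i \<in> {1..<n + 2} \<Longrightarrow> h i \<in> homs D (ob X i) (ob Y (i - 1))"
    and eq: "\<And>i. i < n + 2 \<Longrightarrow> (\<lambda>i\<in>{..<n + 2}. f i \<boxplus> neg D (g i)) i =
           (if i + 1 < n + 2 then h (i + 1) \<cdot> df X i else Zero D (ob X i) (ob Y i)) \<boxplus>
           (if 0 < i then df Y (i - 1) \<cdot> h i else Zero D (ob X i) (ob Y i))"
    using ho unfolding homotopic_def null_homotopic_def by blast
  have ht: "1 \<le> i \<Longrightarrow> i \<le> Suc n \<Longrightarrow> h i \<in> Arr D \<and> Dom D (h i) = ob X i \<and> Cod D (h i) = ob Y (i - 1)" for i
    using h[of i] by (simp add: in_homs)
  note [simp] = ht
  have e: "f i \<boxplus> neg D (g i) = (if 0 < i then df Y (i - 1) \<cdot> h i else Zero D (ob X i) (ob Y i)) \<boxplus>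
      (if i \<le> n then h (Suc i) \<cdot> df X i else Zero D (ob X i) (ob Y i))" if "i \<le> Suc n" for i
  proof -
    have "f i \<boxplus> neg D (g i) = (if i \<le> n then h (Suc i) \<cdot> df X i else Zero D (ob X i) (ob Y i)) \<boxplus>
       (if 0 < i then df Y (i - 1) \<cdot> h i else Zero D (ob X i) (ob Y i))"
      using eq[of i] that by (auto simp: less_Suc_eq_le)
    also have "\<dots> = (if 0 < i then df Y (i - 1) \<cdot> h i else Zero D (ob X i) (ob Y i)) \<boxplus>
        (if i \<le> n then h (Suc i) \<cdot> df X i else Zero D (ob X i) (ob Y i))"
      using that by (cases i) (auto intro!: Plus_comm)
    finally show ?thesis .
  qed
  show ?thesis
    unfolding homotopic_def null_homotopic_def
  \<comment> \<open>The component from degree \<open>j\<close> to \<open>j - 1\<close> becomes,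
    after reversal, the one that leaves degree \<open>n + 1 - (j - 1) = n + 2 - j\<close>.\<close>
  proof (intro exI[of _ "\<lambda>i. h (Suc (Suc n) - i)"] conjI ballI allI impI)
    fix i assume "i \<in> {1..<n + 2}"
    then obtain j where "i = Suc j" "j \<le> n" by (cases i) auto
    then show "h (Suc (Suc n) - i) \<in> homs (opcat D) (ob (opc (Suc n) Y) i) (ob (opc (Suc n) X) (i - 1))"
      using h[of "Suc (Suc n) - i"] by (simp add: Suc_diff_le)
  next
    fix i assume i: "i < n + 2"
    consider "i = 0" | "0 < i" "i \<le> n" | "i = Suc n" using i by linarith
    then show "(\<lambda>i\<in>{..<n + 2}. opf (Suc n) f i \<boxplus>\<^bsub>opcat D\<^esub> neg (opcat D) (opf (Suc n) g i)) i =
         (if i + 1 < n + 2 then h (Suc (Suc n) - (i + 1)) \<cdot>\<^bsub>opcat D\<^esub> df (opc (Suc n) Y) i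
          else Zero (opcat D) (ob (opc (Suc n) Y) i) (ob (opc (Suc n) X) i)) \<boxplus>\<^bsub>opcat D\<^esub>
         (if 0 < i then df (opc (Suc n) X) (i - 1) \<cdot>\<^bsub>opcat D\<^esub> h (Suc (Suc n) - i)
          else Zero (opcat D) (ob (opc (Suc n) Y) i) (ob (opc (Suc n) X) i))"
      by cases (use e[of "Suc n - i"] in \<open>auto simp: Suc_diff_le\<close>)
  qed
qed

text \<open>Homotopies disappear from the description. Between n-exact sequences
  \<open>homotopicI\<close> supplies them for chain maps with identity ends; conversely a homotopy
  equivalence carries n-exactness along, by \<open>nex_transport\<close> here and in the opposite
  category.\<close>

lemma htpy_class_iff:
  assumes n: "1 \<le> n" and X: "nex D n X"
  shows "Y \<in> htpy_class D n X \<longleftrightarrow> nex D n Y \<and> emap D n X Y (Ide D (ob X 0)) (Ide D (ob X (Suc n))) \<and>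
     emap D n Y X (Ide D (ob X 0)) (Ide D (ob X (Suc n)))" (is "?L \<longleftrightarrow> ?R")
proof
  have X': "cpx D (Suc n) X" "contraX D n X" "covX D n X" using X by (auto simp: nex_def)
  {
    assume ?L
    then obtain f g where Y: "cpx D (Suc n) Y"
      and f: "cmap D (Suc n) X Y f" "f 0 = Ide D (ob X 0)" "f (Suc n) = Ide D (ob X (Suc n))"
      and g: "cmap D (Suc n) Y X g" "g 0 = Ide D (ob X 0)" "g (Suc n) = Ide D (ob X (Suc n))"
      and "homotopic D (n + 2) Y Y (\<lambda>i\<in>{..<n + 2}. f i \<cdot> g i) (\<lambda>i\<in>{..<n + 2}. Ide D (ob Y i))"
      by (auto simp: htpy_class_def htpy_equivalent_def ends_complexes_def ends_maps_def cpx_def cmap_def)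
    then have ho: "homotopic D (n + 2) Y Y (ccomp D (Suc n) f g) (cid D (Suc n) Y)"
      by (simp add: ccomp_def cid_def)
    interpret op: acat "opcat D" by (rule acat_op)
    have *: "opf (Suc n) (ccomp D (Suc n) f g) = ccomp (opcat D) (Suc n) (opf (Suc n) g) (opf (Suc n) f)"
      "opf (Suc n) (cid D (Suc n) Y) = cid (opcat D) (Suc n) (opc (Suc n) Y)"
      by (auto simp add: opf_def ccomp_def cid_def opc_def restrict_def fun_eq_iff less_Suc_eq_le)
    have "covX D n Y" by (rule nex_transport[OF n X Y f(1) g(1) ho])
    moreover have "covX (opcat D) n (opc (Suc n) Y)"
      by (rule op.nex_transport[OF n nex_op[OF X] opc_cpx[OF Y] opf_cmap[OF g(1)] opf_cmap[OF f(1)]])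
         (use homotopic_op[OF Y Y ho] * in simp)
    ultimately show ?R using Y f g by (auto simp: nex_def emap_def)
  }
  {
    assume R: ?R
    then obtain f g where Y: "cpx D (Suc n) Y" "contraX D n Y"
      and f: "cmap D (Suc n) X Y f" "f 0 = Ide D (ob X 0)" "f (Suc n) = Ide D (ob X (Suc n))"
      and g: "cmap D (Suc n) Y X g" "g 0 = Ide D (ob X 0)" "g (Suc n) = Ide D (ob X (Suc n))"
      by (auto simp: nex_def emap_def)
    have e: "ob Y 0 = ob X 0" "ob Y (Suc n) = ob X (Suc n)"
      using cmapD(1)[OF f(1), of 0] cmapD(1)[OF f(1), of "Suc n"] f cpxD(1)[OF X'(1)] by (auto simp: in_homs)
    have "homotopic D (n + 2) X X (ccomp D (Suc n) g f) (cid D (Suc n) X)"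
      by (rule homotopicI[OF X'(1,2) X'(1) cmap_comp[OF X'(1) Y(1) X'(1) f(1) g(1)] cmap_id[OF X'(1)]])
         (use f g cpxD(1)[OF X'(1)] in simp)
    moreover have "homotopic D (n + 2) Y Y (ccomp D (Suc n) f g) (cid D (Suc n) Y)"
      by (rule homotopicI[OF Y Y(1) cmap_comp[OF Y(1) X'(1) Y(1) g(1) f(1)] cmap_id[OF Y(1)]])
         (use f g e cpxD(1)[OF X'(1)] in simp)
    ultimately show ?L using f g e Y
      unfolding htpy_class_def htpy_equivalent_def ends_complexes_def ends_maps_def ccomp_def cid_def
      by (auto simp: cpx_def cmap_def)
  }
qed

lemma htpy_class_eq:
  assumes n: "1 \<le> n" and X: "nex D n X" and Y: "nex D n Y"
  shows "htpy_class D n X = htpy_class D n Y \<longleftrightarrow> emap D n X Y (Ide D (ob X 0)) (Ide D (ob X (Suc n))) \<and>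
     emap D n Y X (Ide D (ob X 0)) (Ide D (ob X (Suc n)))" (is "?L \<longleftrightarrow> ?R")
proof
  have c: "cpx D (Suc n) X" "cpx D (Suc n) Y" using X Y by (auto simp: nex_def)
  have Y1: "Y \<in> htpy_class D n Y"
    using htpy_class_iff[OF n Y, of Y] Y emap_id[OF c(2)] by simp
  {
    assume ?L
    then show ?R using Y1 htpy_class_iff[OF n X, of Y] by simp
  }
  assume R: ?R
  then have e: "ob Y 0 = ob X 0" "ob Y (Suc n) = ob X (Suc n)"
    using emap_type[of D n X Y] cpxD(1)[OF c(1)] by fastforce+
  have I: "Ide D (ob X 0) \<cdot> Ide D (ob X 0) = Ide D (ob X 0)" "Ide D (ob X (Suc n)) \<cdot> Ide D (ob X (Suc n)) = Ide D (ob X (Suc n))"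
    using cpxD(1)[OF c(1)] by auto
  show ?L
  proof (rule Set.set_eqI)
    fix T
    have "(emap D n X T (Ide D (ob X 0)) (Ide D (ob X (Suc n))) \<longleftrightarrow> emap D n Y T (Ide D (ob X 0)) (Ide D (ob X (Suc n)))) \<and>
      (emap D n T X (Ide D (ob X 0)) (Ide D (ob X (Suc n))) \<longleftrightarrow> emap D n T Y (Ide D (ob X 0)) (Ide D (ob X (Suc n))))"
      if "nex D n T"
      using emap_comp[of n X Y T, OF c] emap_comp[of n Y X T, OF c(2,1)] emap_comp[of n T X Y, OF _ c] emap_comp[of n T Y X, OF _ c(2,1)]
        that R I unfolding nex_def by metis
    then show "T \<in> htpy_class D n X \<longleftrightarrow> T \<in> htpy_class D n Y"
      unfolding htpy_class_iff[OF n X] htpy_class_iff[OF n Y] e by blast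
  qed
qed

text \<open>(E2) yields the pushout in degrees \<open>0, \<dots>, n\<close> only; its universal property provides the last
  differential.\<close>

lemma push_from_po_elt:
  assumes n: "1 \<le> n" and sub: "\<And>X. X \<in> XX \<Longrightarrow> nex D n X"
    and wk: "\<And>X Y f. X \<in> XX \<Longrightarrow> nex D n Y \<Longrightarrow> cmap D (Suc n) Y X f \<Longrightarrow> is_iso_arr D (f 0) \<Longrightarrow>
      is_iso_arr D (f (Suc 0)) \<Longrightarrow> Y \<in> XX"
    and X: "X \<in> XX" and Y: "cpx D n Y" and Y': "Y' \<in> XX" "df Y' 0 = df Y 0"
    and f: "\<And>i. i \<le> n \<Longrightarrow> f i \<in> homs D (ob X i) (ob Y i)" "\<And>i. i < n \<Longrightarrow> f (Suc i) \<cdot> df X i = df Y i \<cdot> f i"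
    and po: "po_elt D n X Y f"
  shows "\<exists>Z\<in>XX. emap D n X Z (f 0) (Ide D (ob X (Suc n)))"
proof -
  have X': "cpx D (Suc n) X" "contraX D n X" using sub[OF X] by (auto simp: nex_def)
  have cY': "cpx D (Suc n) Y'" "contraX D n Y'" using sub[OF Y'(1)] by (auto simp: nex_def)
  have ft: "i \<le> n \<Longrightarrow> f i \<in> Arr D \<and> Dom D (f i) = ob X i \<and> Cod D (f i) = ob Y i" for i
    using f(1) by (simp add: in_homs)
  note [simp] = cpx_type[OF X'(1)] cpx_type[OF Y] cpx_type[OF cY'(1)] ft
  let ?C = "ob X (Suc n)"
  note A = po[unfolded po_elt_def, rule_format, THEN conjunct1, rule_format]
  note B = po[unfolded po_elt_def, rule_format, THEN conjunct2, rule_format]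
  obtain m where m: "n = Suc m" using n by (cases n) auto
  have "df X n \<cdot> df X m = Zero D (ob X m) ?C" using cpx_type(5)[OF X'(1), of m] m by simp
  \<comment> \<open>The last differential of the pushout is induced by \<open>df X n\<close> on
    \<open>X\<^sub>n\<close> and zero on \<open>Y\<^sub>m\<close>, where
    \<open>m = n - 1\<close>.\<close>
  then obtain d where d: "d \<in> homs D (ob Y n) ?C" "Zero D (ob Y m) ?C = d \<cdot> df Y m" "df X n = d \<cdot> f n"
    using B[of m "df X n" ?C "Zero D (ob Y m) ?C"] m by (auto simp: in_homs)
  note [simp] = d(1)[unfolded in_homs]
  define Z where "Z = \<lparr>ob = (\<lambda>i\<in>{..<Suc (Suc n)}. if i = Suc n then ?C else ob Y i), df = (\<lambda>i\<in>{..<Suc n}. if i = n then d else df Y i)\<rparr>"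
  have Zs: "ob Z (Suc n) = ?C" "\<And>i. i \<le> n \<Longrightarrow> ob Z i = ob Y i" "df Z n = d" "\<And>i. i < n \<Longrightarrow> df Z i = df Y i"
    by (auto simp: Z_def)
  have Z: "cpx D (Suc n) Z"
  proof (rule cpxI)
    fix i assume "Suc i < Suc n"
    then consider "Suc i < n" | "i = m" using m by linarith
    then show "df Z (Suc i) \<cdot> df Z i = Zero D (ob Z i) (ob Z (Suc (Suc i)))"
      by cases (use m d(2) Zs(1,3) in \<open>auto simp: Zs\<close>)
  next
    fix i assume "i < Suc n"
    then consider "i < n" | "i = n" by linarith
    then show "df Z i \<in> homs D (ob Z i) (ob Z (Suc i))" by cases (auto simp: Zs in_homs)
  next
    fix i assume "i \<le> Suc n" then show "ob Z i \<in> Obj D" by (cases "i = Suc n") (auto simp: Zs)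
  qed (auto simp: Z_def)
  have cZ: "contraX D n Z"
    unfolding contraX_def
  proof (intro allI conjI ballI impI)
    fix W x y assume "x \<in> homs D (ob Z (Suc n)) W" "y \<in> homs D (ob Z (Suc n)) W" and e: "x \<cdot> df Z n = y \<cdot> df Z n"
    then have xy: "x \<in> homs D ?C W" "y \<in> homs D ?C W" by (auto simp: Zs)
    note [simp] = xy[unfolded in_homs]
    have "(x \<cdot> d) \<cdot> f n = (y \<cdot> d) \<cdot> f n" using e by (simp add: Zs)
    then show "x = y" by (intro contraX_epi[OF X'(2) xy]) (simp add: assoc d(3))
  next
    fix W x y i assume i: "i < n" and "x \<in> homs D (ob Z (Suc i)) W" "y \<in> homs D (ob Z (Suc i)) W" and e: "x \<cdot> df Z i = y \<cdot> df Z i"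
    then have xy: "x \<in> homs D (ob Y (Suc i)) W" "y \<in> homs D (ob Y (Suc i)) W"
      and e: "x \<cdot> df Y i = y \<cdot> df Y i" by (auto simp: Zs)
    note [simp] = xy[unfolded in_homs]
    have [simp]: "W \<in> Obj D" using homs_obj[OF xy(1)] by simp
    have "(x \<cdot> f (Suc i)) \<cdot> df X i = (y \<cdot> f (Suc i)) \<cdot> df X i"
      using i f(2)[OF i] reassoc[OF e, of "f i"] by (simp add: assoc)
    then obtain t where t: "t \<in> homs D (ob X (Suc (Suc i))) W" "x \<cdot> f (Suc i) = (y \<cdot> f (Suc i)) \<boxplus> (t \<cdot> df X (Suc i))"
      using contraX_diff[OF X'(2) i, of "x \<cdot> f (Suc i)" W "y \<cdot> f (Suc i)"] i by (auto simp: in_homs)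
    note [simp] = t(1)[unfolded in_homs]
    show "\<exists>t\<in>homs D (ob Z (Suc (Suc i))) W. x = y \<boxplus> (t \<cdot> df Z (Suc i))"
    proof (cases "Suc i = n")
      \<comment> \<open>Beyond degree \<open>n\<close> there is only the end \<open>C\<close>, so
        the cancellation property of the pushout takes the place of its extension property.\<close>
      case True
      have "x = y \<boxplus> (t \<cdot> d)"
      proof (rule A[of _ W])
        show "x \<cdot> f n = (y \<boxplus> (t \<cdot> d)) \<cdot> f n \<and> x \<cdot> df Y (n - 1) = (y \<boxplus> (t \<cdot> d)) \<cdot> df Y (n - 1)"
          using t(2) True d(3) e d(2)[symmetric] m by (simp add: distr assoc)
      qed (use True in \<open>auto simp: in_homs\<close>)
      then show ?thesis using True t(1) Zs by auto
    next
      case False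
      then have i': "Suc i < n" using i by simp
      have "t \<cdot> df X (Suc i) = (x \<boxplus> neg D y) \<cdot> f (Suc i)"
        using t(2) i' by (subst (asm) eq_Plus_iff) (simp_all add: distr)
      moreover have "(x \<boxplus> neg D y) \<cdot> df Y i = Zero D (ob Y i) W"
        using e i' by (simp add: distr)
      ultimately obtain w where w: "w \<in> homs D (ob Y (Suc (Suc i))) W" "x \<boxplus> neg D y = w \<cdot> df Y (Suc i)"
        using B[OF i', of t W "x \<boxplus> neg D y"] t(1) i' by (auto simp: in_homs)
      then have "x = y \<boxplus> (w \<cdot> df Y (Suc i))"
        using i' w(1)[unfolded in_homs] by (subst eq_Plus_iff) auto
      then show ?thesis using i' w(1) by (auto simp: Zs)
    qed
  qed
  have o1: "ob Y' 0 = ob Y 0" "ob Y' (Suc 0) = ob Y (Suc 0)"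
    using Y'(2) cpx_type(3,4)[OF cY'(1), of 0] cpx_type(3,4)[OF Y, of 0] n by auto
  \<comment> \<open>\<open>Y'\<close> is a member of \<open>XX\<close> with the same first
    differential as \<open>Z\<close>, so the identities in degrees 0 and 1 extend to chain maps in
    both directions.\<close>
  obtain F where F: "cmap D (Suc n) Z Y' F" "F 0 = Ide D (ob Y 0)" "F (Suc 0) = Ide D (ob Y (Suc 0))"
    using lift_from[OF Z cZ cY'(1), of 0 "Ide D (ob Y 0)" "Ide D (ob Y (Suc 0))"] o1 n Y'(2)
    by (auto simp: Zs in_homs)
  obtain G where G: "cmap D (Suc n) Y' Z G" "G 0 = Ide D (ob Y 0)" "G (Suc 0) = Ide D (ob Y (Suc 0))"
    using lift_from[OF cY' Z, of 0 "Ide D (ob Y 0)" "Ide D (ob Y (Suc 0))"] o1 n Y'(2)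
    by (auto simp: Zs in_homs)
  \<comment> \<open>The composite is the identity in degree 0, so \<open>Z\<close> is a homotopy
    retract of \<open>Y'\<close> and inherits its covariant exactness.\<close>
  have "homotopic D (n + 2) Z Z (ccomp D (Suc n) G F) (cid D (Suc n) Z)"
    by (rule homotopicI[OF Z cZ Z cmap_comp[OF Z cY'(1) Z F(1) G(1)] cmap_id[OF Z]]) (use F G Zs in simp)
  then have "covX D n Z"
    using nex_transport[OF n sub[OF Y'(1)] Z G(1) F(1)] by simp
  then have "Z \<in> XX"
    by (intro wk[OF Y'(1) _ F(1)]) (use Z cZ F n in \<open>auto simp: nex_def iso_Ide\<close>)
  moreover have "cmap D (Suc n) X Z (\<lambda>i\<in>{..<Suc (Suc n)}. if i = Suc n then Ide D ?C else f i)"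
  proof (rule cmapI)
    fix i assume "i < Suc n"
    then consider "i < n" | "i = n" by linarith
    then show "(if Suc i = Suc n then Ide D ?C else f (Suc i)) \<cdot> df X i = df Z i \<cdot> (if i = Suc n then Ide D ?C else f i)"
      by cases (use f(2) d(3) in \<open>auto simp: Zs\<close>)
  qed (auto simp: Zs in_homs)
  ultimately show ?thesis using emapI by fastforce
qed

end

section \<open>Classes of \<open>n\<close>-exact sequences with pushouts and pullbacks\<close>

text \<open>A self-dual list of axioms, so that \<open>nx_op\<close> dualises every consequence.
  \<open>push_ex\<close> and \<open>pull_ex\<close> ask only for chain maps with the right ends;
  that these are pushouts and pullbacks is shown in \<open>po_pb_elt\<close>. \<open>weak\<close> is
  the cyclic case of weak isomorphisms, where the two ends are invertible.\<close>

locale nx = acat +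
  fixes n :: nat and XX :: "('a, 'b) cplx set"
  assumes n: "1 \<le> n"
    and nex: "X \<in> XX \<Longrightarrow> nex D n X"
    and weak: "nex D n X \<Longrightarrow> nex D n Y \<Longrightarrow> emap D n X Y a c \<Longrightarrow> is_iso_arr D a \<Longrightarrow> is_iso_arr D c \<Longrightarrow> X \<in> XX \<longleftrightarrow> Y \<in> XX"
    and push_ex: "X \<in> XX \<Longrightarrow> a \<in> homs D (ob X 0) B \<Longrightarrow> \<exists>Y\<in>XX. emap D n X Y a (Ide D (ob X (Suc n)))"
    and pull_ex: "X \<in> XX \<Longrightarrow> c \<in> homs D B (ob X (Suc n)) \<Longrightarrow> \<exists>Y\<in>XX. emap D n Y X (Ide D (ob X 0)) c"
begin

lemma cp: "X \<in> XX \<Longrightarrow> cpx D (Suc n) X" and co: "X \<in> XX \<Longrightarrow> contraX D n X" and cv: "X \<in> XX \<Longrightarrow> covX D n X"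
  using nex by (auto simp: nex_def)

lemma nx_op: "nx (opcat D) n (opc (Suc n) ` XX)"
proof -
  interpret op: acat "opcat D" by (rule acat_op)
  show ?thesis
  proof (intro nx.intro acat_op nx_axioms.intro)
    show "nex (opcat D) n X" if "X \<in> opc (Suc n) ` XX" for X using that nex nex_op by auto
    fix X Y a c assume *: "nex (opcat D) n X" "nex (opcat D) n Y" "emap (opcat D) n X Y a c"
       "is_iso_arr (opcat D) a" "is_iso_arr (opcat D) c"
    have m: "T \<in> opc (Suc n) ` XX \<longleftrightarrow> opc (Suc n) T \<in> XX" if "nex (opcat D) n T" for T
      using opc_opc[of "opcat D" "Suc n" T] opc_opc[OF cp] that unfolding nex_def by (metis (full_types) imageE imageI)
    show "X \<in> opc (Suc n) ` XX \<longleftrightarrow> Y \<in> opc (Suc n) ` XX"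
      unfolding m[OF *(1)] m[OF *(2)]
      using weak[of "opc (Suc n) Y" "opc (Suc n) X" c a] nex_op[OF *(1)] nex_op[OF *(2)] emap_op[OF *(3)] *(4,5) by auto
  next
    fix X a B assume "X \<in> opc (Suc n) ` XX" "a \<in> homs (opcat D) (ob X 0) B"
    then show "\<exists>Y\<in>opc (Suc n) ` XX. emap (opcat D) n X Y a (Ide (opcat D) (ob X (Suc n)))"
      using pull_ex emap_op by fastforce
  next
    fix X c B assume "X \<in> opc (Suc n) ` XX" "c \<in> homs (opcat D) B (ob X (Suc n))"
    then show "\<exists>Y\<in>opc (Suc n) ` XX. emap (opcat D) n Y X (Ide (opcat D) (ob X 0)) c"
      using push_ex emap_op by fastforce
  qed (rule n)
qed

lemma ecomp: "X \<in> XX \<Longrightarrow> Y \<in> XX \<Longrightarrow> Z \<in> XX \<Longrightarrow> emap D n X Y a c \<Longrightarrow> emap D n Y Z a' c' \<Longrightarrow> emap D n X Z (a' \<cdot> a) (c' \<cdot> c)"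
  by (rule emap_comp[OF cp cp cp])

text \<open>The class of a split sequence vanishes, so \<open>v\<close> factors through \<open>d\<^sub>0\<^sup>Y\<close> as soon as the pushout of
  \<open>Y\<close> along \<open>v\<close> splits.\<close>

lemma factor_through_mono:
  assumes X: "X \<in> XX" and Y: "Y \<in> XX" and f: "emap D n X Y a c"
    and e: "e \<in> homs D (ob Y (Suc n)) (ob X (Suc n))" "c \<cdot> e = Ide D (ob Y (Suc n))"
    and u: "u \<in> homs D (ob X (Suc 0)) W" and v: "v \<in> homs D (ob Y 0) W" and eq: "v \<cdot> a = u \<cdot> df X 0"
  obtains w where "w \<in> homs D (ob Y (Suc 0)) W" "v = w \<cdot> df Y 0"
proof -
  obtain Z where Z: "Z \<in> XX" and em: "emap D n Y Z v (Ide D (ob Y (Suc n)))" using push_ex[OF Y v] by auto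
  obtain g where g: "cmap D (Suc n) Y Z g" "g 0 = v" "g (Suc n) = Ide D (ob Y (Suc n))" using emapE[OF em] .
  note [simp] = cpx_type[OF cp[OF X]] cpx_type[OF cp[OF Y]] cpx_type[OF cp[OF Z]] cmap_type[OF g(1)]
    e(1)[unfolded in_homs] u(1)[unfolded in_homs] v(1)[unfolded in_homs] emap_type[OF f]
  have o: "ob Z 0 = W" "ob Z (Suc n) = ob Y (Suc n)"
    using emap_type[OF em] by auto
  have [simp]: "W \<in> Obj D" using homs_obj[OF u] by simp
  \<comment> \<open>The left end of the composite extends over \<open>df X 0\<close>, so
    \<open>c\<close> factors through \<open>df Z n\<close>. Precomposing with \<open>e\<close> gives
    a section of \<open>df Z n\<close>, and then a retraction \<open>r\<close> of
    \<open>df Z 0\<close>.\<close>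
  have "emap D n X Z (u \<cdot> df X 0) c" using ecomp[OF X Y Z f em] eq by simp
  then obtain h where h: "h \<in> homs D (ob X (Suc n)) (ob Z n)" "c = df Z n \<cdot> h"
    using emap_null_up[OF cp[OF X] co[OF X] cp[OF Z]] u o by blast
  note [simp] = h(1)[unfolded in_homs]
  have "emap D n Z Z (Ide D (ob Z 0)) (df Z n \<cdot> (h \<cdot> e))"
    using emap_id[OF cp[OF Z]] e(2) o h(2) by (simp add: assoc)
  moreover have "h \<cdot> e \<in> homs D (ob Z (Suc n)) (ob Z n)" using o by (simp add: in_homs)
  ultimately obtain r where r: "r \<in> homs D (ob Z (Suc 0)) (ob Z 0)" "Ide D (ob Z 0) = r \<cdot> df Z 0"
    using emap_null_down[OF cp[OF Z] cp[OF Z] cv[OF Z]] by blast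
  note [simp] = r(1)[unfolded in_homs]
  have "v = (r \<cdot> df Z 0) \<cdot> v" using r(2)[symmetric] o(1) by simp
  also have "\<dots> = (r \<cdot> g (Suc 0)) \<cdot> df Y 0" using cmapD(2)[OF g(1), of 0] g(2) o(1) by (simp add: assoc)
  finally show thesis using o(1) by (intro that[of "r \<cdot> g (Suc 0)"]) (auto simp: in_homs)
qed

text \<open>The universal property of pushouts in terms of ends. By
  \<open>factor_through_mono\<close> the arrow \<open>df T 0 \<cdot> b\<close> extends over
  \<open>df Y 0\<close>, after which \<open>extend_along\<close> applies.\<close>

lemma factor:
  assumes X: "X \<in> XX" and Y: "Y \<in> XX" and T: "cpx D (Suc n) T" and g: "emap D n X Y a c" and f: "emap D n X T (b \<cdot> a) c'"
    and e: "e \<in> homs D (ob Y (Suc n)) (ob X (Suc n))" "c \<cdot> e = Ide D (ob Y (Suc n))"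
    and b: "b \<in> homs D (ob Y 0) (ob T 0)"
  shows "emap D n Y T b (c' \<cdot> e)"
proof -
  obtain g' where g': "cmap D (Suc n) X Y g'" "g' 0 = a" "g' (Suc n) = c" using emapE[OF g] .
  obtain f' where f': "cmap D (Suc n) X T f'" "f' 0 = b \<cdot> a" "f' (Suc n) = c'" using emapE[OF f] .
  note [simp] = cpx_type[OF cp[OF X]] cpx_type[OF cp[OF Y]] cpx_type[OF T] cmap_type[OF f'(1)] cmap_type[OF g'(1)]
    e(1)[unfolded in_homs] b[unfolded in_homs] emap_type[OF g] emap_type(4-6)[OF f]
  have "(df T 0 \<cdot> b) \<cdot> a = f' (Suc 0) \<cdot> df X 0"
    using cmapD(2)[OF f'(1), of 0] f' by (simp add: assoc)
  then obtain w where "w \<in> homs D (ob Y (Suc 0)) (ob T (Suc 0))" "df T 0 \<cdot> b = w \<cdot> df Y 0"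
    using factor_through_mono[OF X Y g e, of "f' (Suc 0)" "ob T (Suc 0)" "df T 0 \<cdot> b"] by (auto simp: in_homs)
  then show ?thesis
    using extend_along[OF n cp[OF X] co[OF X] cp[OF Y] co[OF Y] T g'(1) f'(1) b, of w e] g' f' e emapI by metis
qed

text \<open>A chain map with identity ends can be reversed: apply \<open>factor\<close> to it and
  the identity of \<open>X\<close>. One direction thus decides equality of classes.\<close>

lemma eq_class:
  assumes "X \<in> XX" "Y \<in> XX"
  shows "htpy_class D n X = htpy_class D n Y \<longleftrightarrow> emap D n X Y (Ide D (ob X 0)) (Ide D (ob X (Suc n)))"
proof -
  have "emap D n Y X (Ide D (ob X 0)) (Ide D (ob X (Suc n)))" if e: "emap D n X Y (Ide D (ob X 0)) (Ide D (ob X (Suc n)))"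
  proof -
    note [simp] = cpx_type[OF cp[OF assms(1)]]
    have o: "ob Y 0 = ob X 0" "ob Y (Suc n) = ob X (Suc n)" using emap_type[OF e] by auto
    show ?thesis
      using factor[OF assms cp[OF assms(1)] e, of "Ide D (ob X 0)" "Ide D (ob X (Suc n))" "Ide D (ob X (Suc n))"]
        emap_id[OF cp[OF assms(1)]] o by (simp add: in_homs)
  qed
  then show ?thesis using htpy_class_eq[OF n nex nex] assms by blast
qed

lemma push_unique:
  assumes X: "X \<in> XX" and Y: "Y \<in> XX" and Y': "Y' \<in> XX" and e: "emap D n X Y a (Ide D (ob X (Suc n)))" "emap D n X Y' a (Ide D (ob X (Suc n)))"
  shows "htpy_class D n Y = htpy_class D n Y'"
proof -
  note [simp] = cpx_type[OF cp[OF X]] cpx_type[OF cp[OF Y]]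
  have o: "ob Y (Suc n) = ob X (Suc n)" "ob Y' (Suc n) = ob X (Suc n)" "ob Y' 0 = ob Y 0"
    using emap_type[OF e(1)] emap_type[OF e(2)] by auto
  show ?thesis unfolding eq_class[OF Y Y']
    using factor[OF X Y cp[OF Y'] e(1), of "Ide D (ob Y 0)" "Ide D (ob X (Suc n))" "Ide D (ob X (Suc n))"] e(2) o emap_type[OF e(1)]
    by (simp add: in_homs)
qed

lemma pull_unique:
  assumes X: "X \<in> XX" and Y: "Y \<in> XX" and Y': "Y' \<in> XX" and e: "emap D n Y X (Ide D (ob X 0)) c" "emap D n Y' X (Ide D (ob X 0)) c"
  shows "htpy_class D n Y = htpy_class D n Y'"
proof -
  interpret op: nx "opcat D" n "opc (Suc n) ` XX" by (rule nx_op)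
  have "htpy_class (opcat D) n (opc (Suc n) Y) = htpy_class (opcat D) n (opc (Suc n) Y')"
    using op.push_unique[of "opc (Suc n) X" "opc (Suc n) Y" "opc (Suc n) Y'" c] emap_op[OF e(1)] emap_op[OF e(2)] X Y Y' by simp
  then have "emap (opcat D) n (opc (Suc n) Y) (opc (Suc n) Y') (Ide D (ob Y (Suc n))) (Ide D (ob Y 0))"
    using op.eq_class[of "opc (Suc n) Y" "opc (Suc n) Y'"] Y Y' by simp
  from emap_opD[OF this cp[OF Y'] cp[OF Y]] show ?thesis
    using eq_class[OF Y' Y] emap_type[OF e(1)] emap_type[OF e(2)] cpxD(1)[OF cp[OF X]] by simp
qed

text \<open>\<open>T\<close> receives a chain map from the pushout of \<open>X\<close> along
  \<open>a\<close>, with ends an identity and \<open>c\<close>. Both are isomorphisms, so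
  \<open>weak\<close> decides membership.\<close>

lemma closed_push:
  assumes X: "X \<in> XX" and T: "nex D n T" and f: "emap D n X T a c" and c: "is_iso_arr D c"
  shows "T \<in> XX"
proof -
  have T': "cpx D (Suc n) T" using T by (simp add: nex_def)
  note [simp] = cpx_type[OF cp[OF X]] cpx_type[OF T']
  obtain Y where Y: "Y \<in> XX" and g: "emap D n X Y a (Ide D (ob X (Suc n)))"
    using push_ex[OF X emap_homs(1)[OF f]] by auto
  have o: "ob Y 0 = ob T 0" "ob Y (Suc n) = ob X (Suc n)" using emap_type[OF g] emap_type[OF f] by auto
  have "emap D n Y T (Ide D (ob T 0)) (c \<cdot> Ide D (ob X (Suc n)))"
    by (rule factor[OF X Y T' g]) (use f o emap_type[OF f] in \<open>auto simp: in_homs\<close>)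
  then show ?thesis using weak[OF nex[OF Y] T] Y c emap_type[OF f] iso_Ide by auto
qed

lemma closed_pull:
  assumes X: "X \<in> XX" and T: "nex D n T" and f: "emap D n T X a c" and c: "is_iso_arr D a"
  shows "T \<in> XX"
proof -
  interpret op: nx "opcat D" n "opc (Suc n) ` XX" by (rule nx_op)
  have "opc (Suc n) T \<in> opc (Suc n) ` XX"
    using op.closed_push[OF _ nex_op[OF T] emap_op[OF f]] X c by simp
  then obtain T' where "T' \<in> XX" "opc (Suc n) T = opc (Suc n) T'" by auto
  then have "opc (Suc n) (opc (Suc n) T) = T'" using opc_opc[OF cp] by metis
  moreover have "opc (Suc n) (opc (Suc n) T) = T" using T opc_opc by (auto simp: nex_def)
  ultimately show ?thesis using \<open>T' \<in> XX\<close> by simp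
qed

lemma push_pull:
  assumes X: "X \<in> XX" and Y: "Y \<in> XX" and f: "emap D n X Y a c"
  obtains Z where "Z \<in> XX" "emap D n X Z a (Ide D (ob X (Suc n)))" "emap D n Z Y (Ide D (ob Y 0)) c"
proof -
  note [simp] = cpx_type[OF cp[OF X]] cpx_type[OF cp[OF Y]]
  obtain Z where Z: "Z \<in> XX" and g: "emap D n X Z a (Ide D (ob X (Suc n)))"
    using push_ex[OF X emap_homs(1)[OF f]] by auto
  have o: "ob Z 0 = ob Y 0" "ob Z (Suc n) = ob X (Suc n)" using emap_type[OF g] emap_type[OF f] by auto
  have "emap D n Z Y (Ide D (ob Y 0)) (c \<cdot> Ide D (ob X (Suc n)))"
    by (rule factor[OF X Z cp[OF Y] g]) (use f o emap_type[OF f] in \<open>auto simp: in_homs\<close>)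
  then show thesis using that Z g emap_type[OF f] by simp
qed

text \<open>For the pushout half, \<open>v\<close> extends over \<open>df Y i\<close> by
  \<open>factor_through_mono\<close> in degree 0 and by exactness of \<open>Y\<close> above;
  exactness of \<open>X\<close> then produces \<open>t\<close>. The pullback half follows from
  exactness of both rows and \<open>df X n = df Y n \<cdot> f n\<close>.\<close>

lemma po_pb_elt:
  assumes X: "X \<in> XX" and Y: "Y \<in> XX" and f: "cmap D (Suc n) X Y f" "f (Suc n) = Ide D (ob X (Suc n))"
  shows "po_elt D n X Y f" "pb_elt D n X Y f"
proof -
  note [simp] = cpx_type[OF cp[OF X]] cpx_type[OF cp[OF Y]] cmap_type[OF f(1)]
  obtain m where m: "n = Suc m" using n by (cases n) auto
  have o: "ob Y (Suc n) = ob X (Suc n)" using cmap_type[OF f(1), of "Suc n"] f(2) by simp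
  have fn: "df X n = df Y n \<cdot> f n" using cmapD(2)[OF f(1), of n] f(2) by simp
  show "po_elt D n X Y f"
    unfolding po_elt_def
  proof (intro allI conjI ballI impI)
    fix W s s' assume s: "s \<in> homs D (ob Y n) W" "s' \<in> homs D (ob Y n) W"
      and eq: "s \<cdot> f n = s' \<cdot> f n \<and> s \<cdot> df Y (n - 1) = s' \<cdot> df Y (n - 1)"
    note [simp] = s[unfolded in_homs]
    have [simp]: "W \<in> Obj D" using homs_obj[OF s(1)] by simp
    obtain t where t: "t \<in> homs D (ob Y (Suc n)) W" "s = s' \<boxplus> (t \<cdot> df Y n)"
      using contraX_diff[OF co[OF Y], of m s W s'] s eq m by auto
    note [simp] = t(1)[unfolded in_homs]
    have "(s' \<boxplus> (t \<cdot> df Y n)) \<cdot> f n = s' \<cdot> f n" using t(2) eq by simp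
    then have "(s' \<cdot> f n) \<boxplus> (t \<cdot> df X n) = (s' \<cdot> f n) \<boxplus> Zero D (ob X n) W"
      using fn o by (simp add: distr assoc)
    then have "t \<cdot> df X n = Zero D (ob X (Suc n)) W \<cdot> df X n"
      using o by (subst (asm) Plus_cancel) auto
    then have "t = Zero D (ob X (Suc n)) W" using o by (intro contraX_epi[OF co[OF X], of t W]) (auto simp: in_homs)
    then show "s = s'" using t(2) o by simp
  next
    fix W i u v assume i: "i < n" and u: "u \<in> homs D (ob X (Suc i)) W" and v: "v \<in> homs D (ob Y i) W"
      and eq: "u \<cdot> df X i = v \<cdot> f i \<and> (0 < i \<longrightarrow> v \<cdot> df Y (i - 1) = Zero D (ob Y (i - 1)) W)"
    note [simp] = u[unfolded in_homs] v[unfolded in_homs]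
    have [simp]: "W \<in> Obj D" using homs_obj[OF u] by simp
    obtain w where w: "w \<in> homs D (ob Y (Suc i)) W" "v = w \<cdot> df Y i"
    proof (cases i)
      case 0
      show ?thesis
        by (rule factor_through_mono[OF X Y emapI[OF f(1)], of "Ide D (ob X (Suc n))" u W v])
          (use that 0 eq f(2) o u v in \<open>auto simp: in_homs\<close>)
    next
      case (Suc j)
      then have "v \<cdot> df Y j = Zero D (ob Y (Suc j)) W \<cdot> df Y j" using eq i by simp
      then obtain w where "w \<in> homs D (ob Y (Suc (Suc j))) W" "v = Zero D (ob Y (Suc j)) W \<boxplus> (w \<cdot> df Y (Suc j))"
        using contraX_diff[OF co[OF Y], of j v W "Zero D (ob Y (Suc j)) W"] v Suc i by (auto simp: in_homs)
      then show ?thesis using that[of w] Suc i by (simp add: in_homs)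
    qed
    note [simp] = w(1)[unfolded in_homs]
    have "u \<cdot> df X i = (w \<cdot> f (Suc i)) \<cdot> df X i"
      using eq w(2) i cmapD(2)[OF f(1), of i] by (simp add: assoc)
    then obtain t where t: "t \<in> homs D (ob X (Suc (Suc i))) W" "u = (w \<cdot> f (Suc i)) \<boxplus> (t \<cdot> df X (Suc i))"
      using contraX_diff[OF co[OF X], of i u W "w \<cdot> f (Suc i)"] u i by (auto simp: in_homs)
    note [simp] = t(1)[unfolded in_homs]
    show "\<exists>w\<in>homs D (ob Y (Suc i)) W. v = w \<cdot> df Y i \<and>
          (if Suc i < n then \<exists>t\<in>homs D (ob X (Suc (Suc i))) W. u = (w \<cdot> f (Suc i)) \<boxplus> (t \<cdot> df X (Suc i))
           else u = w \<cdot> f (Suc i))"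
    proof (cases "Suc i = n")
      \<comment> \<open>In the last degree \<open>t\<close> starts at the common right end of
        \<open>X\<close> and \<open>Y\<close>, so it is absorbed into \<open>w\<close>.\<close>
      case True
      then have "df Y n \<cdot> df Y i = Zero D (ob Y i) (ob Y (Suc n))" using cpx_type(5)[OF cp[OF Y], of i] by simp
      then show ?thesis using True t w fn o i
        by (intro bexI[of _ "w \<boxplus> (t \<cdot> df Y n)"]) (auto simp: in_homs distr assoc)
    next
      case False then show ?thesis using i t w by auto
    qed
  qed
  show "pb_elt D n X Y f"
    unfolding pb_elt_def
  proof (intro allI conjI ballI impI)
    fix W s s' assume s: "s \<in> homs D W (ob X 0)" "s' \<in> homs D W (ob X 0)"
      and eq: "f 0 \<cdot> s = f 0 \<cdot> s' \<and> df X 0 \<cdot> s = df X 0 \<cdot> s'"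
    then show "s = s'" using covX_mono[OF cv[OF X] s] by simp
  next
    fix W i u v assume i: "i < n" and u: "u \<in> homs D W (ob X (Suc i))" and v: "v \<in> homs D W (ob Y i)"
      and eq: "df Y i \<cdot> v = f (Suc i) \<cdot> u \<and> (Suc i < n \<longrightarrow> df X (Suc i) \<cdot> u = Zero D W (ob X (Suc (Suc i))))"
    note [simp] = u[unfolded in_homs] v[unfolded in_homs]
    have [simp]: "W \<in> Obj D" using homs_obj[OF u] by simp
    have "df X (Suc i) \<cdot> u = df X (Suc i) \<cdot> Zero D W (ob X (Suc i))"
    proof (cases "Suc i = n")
      case True
      then have "df X n \<cdot> u = (df Y n \<cdot> df Y i) \<cdot> v" using fn eq i o by (simp add: assoc)
      then show ?thesis using True cpx_type(5)[OF cp[OF Y], of i] o by simp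
    qed (use i eq in simp)
    then obtain w where w: "w \<in> homs D W (ob X i)" "u = df X i \<cdot> w"
      using covX_diff[OF cv[OF X] i, of u W "Zero D W (ob X (Suc i))"] u i by (auto simp: in_homs)
    note [simp] = w(1)[unfolded in_homs]
    have e: "df Y i \<cdot> v = df Y i \<cdot> (f i \<cdot> w)"
      using eq w(2) i reassoc[OF cmapD(2)[OF f(1), of i], of w] by simp
    show "\<exists>w\<in>homs D W (ob X i). u = df X i \<cdot> w \<and>
          (if 0 < i then \<exists>t\<in>homs D W (ob Y (i - 1)). v = (f i \<cdot> w) \<boxplus> (df Y (i - 1) \<cdot> t)
           else v = f i \<cdot> w)"
    proof (cases i)
      case 0
      then have "v = f i \<cdot> w" using covX_mono[OF cv[OF Y], of v W "f 0 \<cdot> w"] v e by (simp add: in_homs)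
      then show ?thesis using 0 w by auto
    next
      case (Suc j)
      then obtain t where "t \<in> homs D W (ob Y j)" "v = (f i \<cdot> w) \<boxplus> (df Y j \<cdot> t)"
        using covX_diff[OF cv[OF Y], of j v W "f i \<cdot> w"] v e i by (auto simp: in_homs)
      then show ?thesis using Suc w by auto
    qed
  qed
qed

text \<open>The dual of \<open>po_pb_elt\<close>. With an identity in degree 0 the relevant square
  lives in degrees 1 to \<open>n + 1\<close>, hence the segments.\<close>

lemma pb_po_elt:
  assumes X: "X \<in> XX" and Y: "Y \<in> XX" and f: "cmap D (Suc n) X Y f" "f 0 = Ide D (ob X 0)"
  shows "po_elt D n (segment 1 (n + 1) X) (segment 1 (n + 1) Y) (segment_map 1 (n + 1) f)" (is "po_elt D n ?X ?Y ?f")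
    and "pb_elt D n (segment 1 (n + 1) X) (segment 1 (n + 1) Y) (segment_map 1 (n + 1) f)"
proof -
  interpret op: nx "opcat D" n "opc (Suc n) ` XX" by (rule nx_op)
  have f': "cmap (opcat D) (Suc n) (opc (Suc n) Y) (opc (Suc n) X) (opf (Suc n) f)" by (rule opf_cmap[OF f(1)])
  have o: "ob Y 0 = ob X 0" using cmap_type[OF f(1), of 0] f(2) cpxD(1)[OF cp[OF X], of 0] by simp
  have *: "po_elt (opcat D) n (opc (Suc n) Y) (opc (Suc n) X) (opf (Suc n) f)"
    "pb_elt (opcat D) n (opc (Suc n) Y) (opc (Suc n) X) (opf (Suc n) f)"
    using op.po_pb_elt[OF _ _ f'] X Y f(2) o by simp_all
  \<comment> \<open>In degrees up to \<open>n\<close>, the reversed complex agrees with the reversal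
    of the segment that starts in degree 1.\<close>
  have "po_elt (opcat D) n (opc (Suc n) Y) (opc (Suc n) X) (opf (Suc n) f) \<longleftrightarrow> po_elt (opcat D) n (opc n ?Y) (opc n ?X) (opf n ?f)"
    by (rule po_elt_cong[OF n]) (auto simp: segment_def segment_map_def Suc_diff_le Suc_diff_Suc)
  then show "pb_elt D n ?X ?Y ?f" using *(1) unfolding po_elt_op[OF n] by blast
  have "po_elt D n ?X ?Y ?f \<longleftrightarrow> po_elt (opcat (opcat D)) n (opc n (opc (Suc n) X)) (opc n (opc (Suc n) Y)) (opf n (opf (Suc n) f))"
    unfolding opcat_simps
    by (rule po_elt_cong[OF n]) (auto simp: segment_def segment_map_def Suc_diff_le)
  then show "po_elt D n ?X ?Y ?f" using *(2) unfolding po_elt_op[OF n] by blast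
qed

end

section \<open>Exactness of cones\<close>

context acat
begin

lemma row_cases:
  assumes "f \<in> homs D (dsum D A B) W" "A \<in> Obj D" "B \<in> Obj D"
  obtains u v where "u \<in> homs D A W" "v \<in> homs D B W" "f = row D u v"
proof -
  have f: "f \<in> Arr D" "Dom D f = dsum D A B" "Cod D f = W" using assms(1) by (auto simp: in_homs)
  show thesis by (rule row_ex[OF f(1) assms(2,3) f(2), unfolded f(3)]) (rule that)
qed

lemma col_cases:
  assumes "f \<in> homs D W (dsum D A B)" "A \<in> Obj D" "B \<in> Obj D"
  obtains u v where "u \<in> homs D W A" "v \<in> homs D W B" "f = col D u v"
proof -
  have f: "f \<in> Arr D" "Cod D f = dsum D A B" "Dom D f = W" using assms(1) by (auto simp: in_homs)
  show thesis by (rule col_ex[OF f(1) assms(2,3) f(2), unfolded f(3)]) (rule that)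
qed

lemma neg_inj: "a \<in> Arr D \<Longrightarrow> b \<in> Arr D \<Longrightarrow> neg D a = neg D b \<longleftrightarrow> a = b"
  using neg_neg by metis

lemma neg_eq_Zero: "a \<in> Arr D \<Longrightarrow> A \<in> Obj D \<Longrightarrow> B \<in> Obj D \<Longrightarrow> neg D a = Zero D A B \<longleftrightarrow> a = Zero D A B"
  using neg_inj[of a "Zero D A B"] by simp

lemma neg_col:
  "u \<in> Arr D \<Longrightarrow> v \<in> Arr D \<Longrightarrow> Dom D u = Dom D v \<Longrightarrow> neg D (col D u v) = col D (neg D u) (neg D v)"
  by (rule neg_unique[symmetric]) (simp_all add: col_plus col_Zero)

text \<open>Passing to differences gives the usual form with kernels, which is the one comparable
  with \<open>contra_left_exact\<close>.\<close>

lemma contraX_iff: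
  assumes X: "cpx D (Suc n) X"
  shows "contraX D n X \<longleftrightarrow> (\<forall>W.
     (\<forall>x\<in>homs D (ob X (Suc n)) W. x \<cdot> df X n = Zero D (ob X n) W \<longrightarrow> x = Zero D (ob X (Suc n)) W) \<and>
     (\<forall>i<n. \<forall>x\<in>homs D (ob X (Suc i)) W. x \<cdot> df X i = Zero D (ob X i) W \<longrightarrow>
        (\<exists>t\<in>homs D (ob X (Suc (Suc i))) W. x = t \<cdot> df X (Suc i))))" (is "?L \<longleftrightarrow> ?R")
proof
  note [simp] = cpx_type[OF X]
  assume L: ?L
  show ?R
  proof (intro allI conjI ballI impI)
    fix W x assume x: "x \<in> homs D (ob X (Suc n)) W" and e: "x \<cdot> df X n = Zero D (ob X n) W"
    have [simp]: "W \<in> Obj D" using homs_obj[OF x] by simp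
    show "x = Zero D (ob X (Suc n)) W"
      by (rule contraX_epi[OF L x]) (use e in \<open>simp_all add: in_homs\<close>)
  next
    fix W x i assume i: "i < n" and x: "x \<in> homs D (ob X (Suc i)) W" and e: "x \<cdot> df X i = Zero D (ob X i) W"
    have [simp]: "W \<in> Obj D" using homs_obj[OF x] by simp
    have "x \<cdot> df X i = Zero D (ob X (Suc i)) W \<cdot> df X i" using e i by simp
    then obtain t where "t \<in> homs D (ob X (Suc (Suc i))) W" "x = Zero D (ob X (Suc i)) W \<boxplus> (t \<cdot> df X (Suc i))"
      using contraX_diff[OF L i x Zero_homs] i by auto
    then show "\<exists>t\<in>homs D (ob X (Suc (Suc i))) W. x = t \<cdot> df X (Suc i)" using i by (auto simp: in_homs)
  qed
next
  note [simp] = cpx_type[OF X]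
  assume R: ?R
  show ?L unfolding contraX_def
  proof (intro allI conjI ballI impI)
    fix W x y assume x: "x \<in> homs D (ob X (Suc n)) W" "y \<in> homs D (ob X (Suc n)) W" and e: "x \<cdot> df X n = y \<cdot> df X n"
    note [simp] = x[unfolded in_homs]
    have "(x \<boxplus> neg D y) \<cdot> df X n = Zero D (ob X n) W" using e by (simp add: distr)
    then have "x \<boxplus> neg D y = Zero D (ob X (Suc n)) W" using R by (simp add: in_homs)
    then show "x = y" by (subst eq_iff_diff) auto
  next
    fix W x y i assume i: "i < n" and x: "x \<in> homs D (ob X (Suc i)) W" "y \<in> homs D (ob X (Suc i)) W" and e: "x \<cdot> df X i = y \<cdot> df X i"
    note [simp] = x[unfolded in_homs]
    have "(x \<boxplus> neg D y) \<cdot> df X i = Zero D (ob X i) W" using e i by (simp add: distr)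
    then obtain t where "t \<in> homs D (ob X (Suc (Suc i))) W" "x \<boxplus> neg D y = t \<cdot> df X (Suc i)"
      using R i by (fastforce simp: in_homs)
    then show "\<exists>t\<in>homs D (ob X (Suc (Suc i))) W. x = y \<boxplus> (t \<cdot> df X (Suc i))"
      using i by (intro bexI[of _ t], subst eq_Plus_iff) (auto simp: in_homs)
  qed
qed

lemma covX_iff:
  assumes X: "cpx D (Suc n) X"
  shows "covX D n X \<longleftrightarrow> (\<forall>W.
     (\<forall>x\<in>homs D W (ob X 0). df X 0 \<cdot> x = Zero D W (ob X (Suc 0)) \<longrightarrow> x = Zero D W (ob X 0)) \<and>
     (\<forall>i<n. \<forall>x\<in>homs D W (ob X (Suc i)). df X (Suc i) \<cdot> x = Zero D W (ob X (Suc (Suc i))) \<longrightarrow>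
        (\<exists>t\<in>homs D W (ob X i). x = df X i \<cdot> t)))" (is "?L \<longleftrightarrow> ?R")
proof
  note [simp] = cpx_type[OF X]
  assume L: ?L
  show ?R
  proof (intro allI conjI ballI impI)
    fix W x assume x: "x \<in> homs D W (ob X 0)" and e: "df X 0 \<cdot> x = Zero D W (ob X (Suc 0))"
    have [simp]: "W \<in> Obj D" using homs_obj[OF x] by simp
    show "x = Zero D W (ob X 0)"
      by (rule covX_mono[OF L x]) (use e in \<open>simp_all add: in_homs\<close>)
  next
    fix W x i assume i: "i < n" and x: "x \<in> homs D W (ob X (Suc i))" and e: "df X (Suc i) \<cdot> x = Zero D W (ob X (Suc (Suc i)))"
    have [simp]: "W \<in> Obj D" using homs_obj[OF x] by simp
    have "df X (Suc i) \<cdot> x = df X (Suc i) \<cdot> Zero D W (ob X (Suc i))" using e i by simp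
    then obtain t where "t \<in> homs D W (ob X i)" "x = Zero D W (ob X (Suc i)) \<boxplus> (df X i \<cdot> t)"
      using covX_diff[OF L i x Zero_homs] i by auto
    then show "\<exists>t\<in>homs D W (ob X i). x = df X i \<cdot> t" using i by (auto simp: in_homs)
  qed
next
  note [simp] = cpx_type[OF X]
  assume R: ?R
  show ?L unfolding covX_def
  proof (intro allI conjI ballI impI)
    fix W x y assume x: "x \<in> homs D W (ob X 0)" "y \<in> homs D W (ob X 0)" and e: "df X 0 \<cdot> x = df X 0 \<cdot> y"
    note [simp] = x[unfolded in_homs]
    have "df X 0 \<cdot> (x \<boxplus> neg D y) = Zero D W (ob X (Suc 0))" using e by (simp add: distr)
    then have "x \<boxplus> neg D y = Zero D W (ob X 0)" using R by (simp add: in_homs)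
    then show "x = y" by (subst eq_iff_diff) auto
  next
    fix W x y i assume i: "i < n" and x: "x \<in> homs D W (ob X (Suc i))" "y \<in> homs D W (ob X (Suc i))" and e: "df X (Suc i) \<cdot> x = df X (Suc i) \<cdot> y"
    note [simp] = x[unfolded in_homs]
    have "df X (Suc i) \<cdot> (x \<boxplus> neg D y) = Zero D W (ob X (Suc (Suc i)))" using e i by (simp add: distr)
    then obtain t where "t \<in> homs D W (ob X i)" "x \<boxplus> neg D y = df X i \<cdot> t"
      using R i by (fastforce simp: in_homs)
    then show "\<exists>t\<in>homs D W (ob X i). x = y \<boxplus> (df X i \<cdot> t)"
      using i by (intro bexI[of _ t], subst eq_Plus_iff) (auto simp: in_homs)
  qed
qed

lemma homgrp_hom:
  "A \<in> Obj D \<Longrightarrow> d \<in> homs D B C \<Longrightarrow> (\<lambda>g. d \<cdot> g) \<in> hom (homgrp D A B) (homgrp D A C)"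
  "A \<in> Obj D \<Longrightarrow> d \<in> homs D B C \<Longrightarrow> (\<lambda>g. g \<cdot> d) \<in> hom (homgrp D C A) (homgrp D B A)"
  by (auto simp: hom_def in_homs distr)

lemma contra_left_exact_iff:
  assumes X: "cpx D (Suc n) X" and n: "1 \<le> n"
  shows "contra_left_exact D n X \<longleftrightarrow> contraX D n X"
proof -
  note [simp] = cpx_type[OF X]
  have "exact_at (homgrp D (ob X (i + 2)) W) (\<lambda>g. g \<cdot> df X (i + 1)) (homgrp D (ob X (i + 1)) W) (\<lambda>g. g \<cdot> df X i) (homgrp D (ob X i) W)
     \<longleftrightarrow> (\<forall>x\<in>homs D (ob X (Suc i)) W. x \<cdot> df X i = Zero D (ob X i) W \<longrightarrow> (\<exists>t\<in>homs D (ob X (Suc (Suc i))) W. x = t \<cdot> df X (Suc i)))"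
    if "i < n" "W \<in> Obj D" for i W
  proof -
    have "(t \<cdot> df X (Suc i)) \<cdot> df X i = Zero D (ob X i) W" if "t \<in> homs D (ob X (Suc (Suc i))) W" for t
      using that \<open>i < n\<close> by (auto simp: in_homs assoc)
    moreover have "t \<cdot> df X (Suc i) \<in> homs D (ob X (Suc i)) W" if "t \<in> homs D (ob X (Suc (Suc i))) W" for t
      using that \<open>i < n\<close> by (simp add: in_homs)
    moreover have "df X (Suc i) \<in> homs D (ob X (Suc i)) (ob X (Suc (Suc i)))" "df X i \<in> homs D (ob X i) (ob X (Suc i))"
      using \<open>i < n\<close> by (simp_all add: in_homs)
    ultimately show ?thesis using that
      by (auto simp: exact_at_def kernel_def homgrp_hom image_iff)
  qed
  then have e1: "contra_exact D (n + 2) X W \<longleftrightarrow> (\<forall>i<n. \<forall>x\<in>homs D (ob X (Suc i)) W. x \<cdot> df X i = Zero D (ob X i) W \<longrightarrow>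
    (\<exists>t\<in>homs D (ob X (Suc (Suc i))) W. x = t \<cdot> df X (Suc i)))" if "W \<in> Obj D" for W
    using that by (simp add: contra_exact_def)
  have e2: "kernel (homgrp D (ob X (n + 1)) W) (homgrp D (ob X n) W) (\<lambda>g. g \<cdot> df X n) = {Zero D (ob X (n + 1)) W} \<longleftrightarrow>
    (\<forall>x\<in>homs D (ob X (Suc n)) W. x \<cdot> df X n = Zero D (ob X n) W \<longrightarrow> x = Zero D (ob X (Suc n)) W)" if W: "W \<in> Obj D" for W
  proof -
    have "Zero D (ob X (Suc n)) W \<in> homs D (ob X (Suc n)) W" "Zero D (ob X (Suc n)) W \<cdot> df X n = Zero D (ob X n) W"
      using W by (simp_all add: Zero_homs)
    then show ?thesis by (auto simp: kernel_def)
  qed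
  \<comment> \<open>\<open>contraX\<close> quantifies over every \<open>W\<close> and
    \<open>contra_left_exact\<close> over objects only; outside \<open>Obj D\<close> there are no
    arrows to test.\<close>
  have 3: "homs D A W = {} \<and> homs D W A = {}" if "W \<notin> Obj D" for A W using that homs_obj by blast
  show ?thesis
    unfolding contra_left_exact_def contraX_iff[OF X]
  proof (intro iffI allI ballI, goal_cases)
    case (1 W)
    then show ?case
    proof (cases "W \<in> Obj D")
      case True show ?thesis using bspec[OF 1 True] unfolding e1[OF True] e2[OF True] .
    qed (simp add: 3)
  next
    case (2 W)
    show ?case using spec[OF 2(1), of W] unfolding e1[OF 2(2)] e2[OF 2(2)] .
  qed
qed

lemma cov_left_exact_iff:
  assumes X: "cpx D (Suc n) X" and n: "1 \<le> n"
  shows "cov_left_exact D n X \<longleftrightarrow> covX D n X"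
proof -
  note [simp] = cpx_type[OF X]
  have "exact_at (homgrp D W (ob X i)) (\<lambda>g. df X i \<cdot> g) (homgrp D W (ob X (i + 1))) (\<lambda>g. df X (i + 1) \<cdot> g) (homgrp D W (ob X (i + 2)))
     \<longleftrightarrow> (\<forall>x\<in>homs D W (ob X (Suc i)). df X (Suc i) \<cdot> x = Zero D W (ob X (Suc (Suc i))) \<longrightarrow> (\<exists>t\<in>homs D W (ob X i). x = df X i \<cdot> t))"
    if "i < n" "W \<in> Obj D" for i W
  proof -
    have "df X (Suc i) \<cdot> (df X i \<cdot> t) = Zero D W (ob X (Suc (Suc i)))" if "t \<in> homs D W (ob X i)" for t
      using that \<open>i < n\<close> reassoc1[OF cpx_type(5)[OF X, of i], of t] by (auto simp: in_homs)
    moreover have "df X i \<cdot> t \<in> homs D W (ob X (Suc i))" if "t \<in> homs D W (ob X i)" for t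
      using that \<open>i < n\<close> by (simp add: in_homs)
    moreover have "df X (Suc i) \<in> homs D (ob X (Suc i)) (ob X (Suc (Suc i)))" "df X i \<in> homs D (ob X i) (ob X (Suc i))"
      using \<open>i < n\<close> by (simp_all add: in_homs)
    ultimately show ?thesis using that
      by (auto simp: exact_at_def kernel_def homgrp_hom image_iff)
  qed
  then have e1: "cov_exact D (n + 2) X W \<longleftrightarrow> (\<forall>i<n. \<forall>x\<in>homs D W (ob X (Suc i)). df X (Suc i) \<cdot> x = Zero D W (ob X (Suc (Suc i))) \<longrightarrow>
    (\<exists>t\<in>homs D W (ob X i). x = df X i \<cdot> t))" if "W \<in> Obj D" for W
    using that by (simp add: cov_exact_def)
  have e2: "kernel (homgrp D W (ob X 0)) (homgrp D W (ob X 1)) (\<lambda>g. df X 0 \<cdot> g) = {Zero D W (ob X 0)} \<longleftrightarrow>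
    (\<forall>x\<in>homs D W (ob X 0). df X 0 \<cdot> x = Zero D W (ob X (Suc 0)) \<longrightarrow> x = Zero D W (ob X 0))" if W: "W \<in> Obj D" for W
  proof -
    have "Zero D W (ob X 0) \<in> homs D W (ob X 0)" "df X 0 \<cdot> Zero D W (ob X 0) = Zero D W (ob X (Suc 0))"
      using W by (simp_all add: Zero_homs)
    then show ?thesis by (auto simp: kernel_def)
  qed
  have 3: "homs D A W = {} \<and> homs D W A = {}" if "W \<notin> Obj D" for A W using that homs_obj by blast
  show ?thesis
    unfolding cov_left_exact_def covX_iff[OF X]
  proof (intro iffI allI ballI, goal_cases)
    case (1 W)
    then show ?case
    proof (cases "W \<in> Obj D")
      case True show ?thesis using bspec[OF 1 True] unfolding e1[OF True] e2[OF True] .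
    qed (simp add: 3)
  next
    case (2 W)
    show ?case using spec[OF 2(1), of W] unfolding e1[OF 2(2)] e2[OF 2(2)] .
  qed
qed

lemma n_exact_sequences_iff: "1 \<le> n \<Longrightarrow> X \<in> n_exact_sequences D n \<longleftrightarrow> nex D n X"
  unfolding n_exact_sequences_def nex_def complexes_cpx mem_Collect_eq
  using contra_left_exact_iff cov_left_exact_iff by blast

end

section \<open>The cone of a chain map between complexes with n + 1 terms\<close>

locale partial_map = acat +
  fixes n :: nat and X Y :: "('a, 'b) cplx" and f :: "nat \<Rightarrow> 'b"
  assumes n: "1 \<le> n" and X: "cpx D n X" and Y: "cpx D n Y" and f: "cmap D n X Y f"
begin

abbreviation "C \<equiv> cone D n X Y f"

lemma ob_C[simp]: "ob C 0 = ob X 0" "i < n \<Longrightarrow> ob C (Suc i) = dsum D (ob X (Suc i)) (ob Y i)" "ob C (Suc n) = ob Y n"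
  by (auto simp: cone_def)

lemma df_C: "df C 0 = col D (neg D (df X 0)) (f 0)" "df C n = row D (f n) (df Y (n - 1))"
   "Suc i < n \<Longrightarrow> df C (Suc i) = mat22 D (neg D (df X (Suc i))) (Zero D (ob Y i) (ob X (Suc (Suc i)))) (f (Suc i)) (df Y i)"
  using n by (auto simp: cone_def)

lemmas tps = cpx_type[OF X] cpx_type[OF Y] cmap_type[OF f]

lemma fd: "i < n \<Longrightarrow> f (Suc i) \<cdot> df X i = df Y i \<cdot> f i" by (rule cmapD(2)[OF f])

lemma row_C:
  assumes i: "i < n" and u: "u \<in> homs D (ob X (Suc i)) W" and v: "v \<in> homs D (ob Y i) W"
  shows "row D u v \<cdot> df C i = Zero D (ob C i) W \<longleftrightarrow> u \<cdot> df X i = v \<cdot> f i \<and> (0 < i \<longrightarrow> v \<cdot> df Y (i - 1) = Zero D (ob Y (i - 1)) W)"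
proof -
  note [simp] = tps u[unfolded in_homs] v[unfolded in_homs]
  have [simp]: "W \<in> Obj D" using homs_obj[OF u] by simp
  have e: "neg D (u \<cdot> df X i) \<boxplus> (v \<cdot> f i) = Zero D (ob X i) W \<longleftrightarrow> u \<cdot> df X i = v \<cdot> f i"
    using i eq_iff_diff[of "v \<cdot> f i" "u \<cdot> df X i"] Plus_comm[of "v \<cdot> f i" "neg D (u \<cdot> df X i)"] by auto
  show ?thesis
  proof (cases i)
    case 0 then show ?thesis using e n by (simp add: df_C row_col distr)
  next
    case (Suc j)
    then have "row D u v \<cdot> df C i = row D (neg D (u \<cdot> df X i) \<boxplus> (v \<cdot> f i)) (v \<cdot> df Y j)"
      using i by (simp add: df_C row_mat22 distr)
    also have "\<dots> = Zero D (ob C i) W \<longleftrightarrow> neg D (u \<cdot> df X i) \<boxplus> (v \<cdot> f i) = Zero D (ob X i) W \<and> v \<cdot> df Y j = Zero D (ob Y j) W"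
      using Suc i by (simp add: row_Zero[symmetric] row_inj)
    finally show ?thesis using e Suc by simp
  qed
qed

text \<open>The sign of the cone differential is hidden by replacing \<open>t\<close> with
  \<open>-t\<close>. The top term of the cone is the single summand \<open>Y\<^sub>n\<close>, which
  explains the case distinction.\<close>

lemma row_C_image:
  assumes i: "i < n" and u: "u \<in> homs D (ob X (Suc i)) W" and v: "v \<in> homs D (ob Y i) W"
  shows "(\<exists>t\<in>homs D (ob C (Suc (Suc i))) W. row D u v = t \<cdot> df C (Suc i)) \<longleftrightarrow>
     (\<exists>w\<in>homs D (ob Y (Suc i)) W. v = w \<cdot> df Y i \<and>
        (if Suc i < n then \<exists>t\<in>homs D (ob X (Suc (Suc i))) W. u = (w \<cdot> f (Suc i)) \<boxplus> (t \<cdot> df X (Suc i))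
           else u = w \<cdot> f (Suc i)))"
proof -
  note [simp] = tps u[unfolded in_homs] v[unfolded in_homs]
  have [simp]: "W \<in> Obj D" using homs_obj[OF u] by simp
  show ?thesis
  proof (cases "Suc i = n")
    case True
    have "row D u v = t \<cdot> df C n \<longleftrightarrow> v = t \<cdot> df Y i \<and> u = t \<cdot> f n" if "t \<in> homs D (ob Y n) W" for t
    proof -
      note [simp] = that[unfolded in_homs]
      have "df C n = row D (f n) (df Y i)" using True df_C(2) by auto
      then show ?thesis using True by (auto simp: Comp_row row_inj)
    qed
    then show ?thesis using True by auto
  next
    case False
    then have i': "Suc i < n" using i by simp
    have *: "row D u v = row D t w \<cdot> df C (Suc i) \<longleftrightarrow> v = w \<cdot> df Y i \<and> u = (w \<cdot> f (Suc i)) \<boxplus> (neg D t \<cdot> df X (Suc i))"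
      if "t \<in> homs D (ob X (Suc (Suc i))) W" "w \<in> homs D (ob Y (Suc i)) W" for t w
    proof -
      note [simp] = that[unfolded in_homs]
      have "row D t w \<cdot> df C (Suc i) = row D ((w \<cdot> f (Suc i)) \<boxplus> (neg D t \<cdot> df X (Suc i))) (w \<cdot> df Y i)"
        using i' by (simp add: df_C row_mat22 distr Plus_comm[of "w \<cdot> f (Suc i)"])
      then show ?thesis using i' by (auto simp: row_inj)
    qed
    show ?thesis (is "?L \<longleftrightarrow> ?R")
    proof
      assume ?L
      then obtain s where s: "s \<in> homs D (dsum D (ob X (Suc (Suc i))) (ob Y (Suc i))) W" "row D u v = s \<cdot> df C (Suc i)" using i' by auto
      obtain t w where "t \<in> homs D (ob X (Suc (Suc i))) W" "w \<in> homs D (ob Y (Suc i)) W" "s = row D t w"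
        by (rule row_cases[OF s(1)]) (use i' in auto)
      then show ?R using *[of t w] s(2) i' neg_homs[of t] by auto
    next
      assume ?R
      then obtain w t where wt: "w \<in> homs D (ob Y (Suc i)) W" "v = w \<cdot> df Y i" "t \<in> homs D (ob X (Suc (Suc i))) W"
        "u = (w \<cdot> f (Suc i)) \<boxplus> (t \<cdot> df X (Suc i))" using i' by auto
      then have "row D u v = row D (neg D t) w \<cdot> df C (Suc i)" using *[of "neg D t" w] neg_homs[of t] by (auto simp: in_homs)
      moreover have "row D (neg D t) w \<in> homs D (ob C (Suc (Suc i))) W" using i' wt(1,3) by (auto simp: in_homs)
      ultimately show ?L by blast
    qed
  qed
qed

text \<open>The column is taken as \<open>u\<close> over \<open>-v\<close>: this sign turns the
  vanishing of the sum into the commutation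
  \<open>df Y i \<cdot> v = f (i + 1) \<cdot> u\<close>.\<close>

lemma C_col:
  assumes i: "i < n" and u: "u \<in> homs D W (ob X (Suc i))" and v: "v \<in> homs D W (ob Y i)"
  shows "df C (Suc i) \<cdot> col D u (neg D v) = Zero D W (ob C (Suc (Suc i))) \<longleftrightarrow>
    df Y i \<cdot> v = f (Suc i) \<cdot> u \<and> (Suc i < n \<longrightarrow> df X (Suc i) \<cdot> u = Zero D W (ob X (Suc (Suc i))))"
proof -
  note [simp] = tps u[unfolded in_homs] v[unfolded in_homs]
  have [simp]: "W \<in> Obj D" using homs_obj[OF u] by simp
  have e: "(f (Suc i) \<cdot> u) \<boxplus> neg D (df Y i \<cdot> v) = Zero D W (ob Y (Suc i)) \<longleftrightarrow> df Y i \<cdot> v = f (Suc i) \<cdot> u"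
    using i eq_iff_diff[of "f (Suc i) \<cdot> u" "df Y i \<cdot> v"] by auto
  show ?thesis
  proof (cases "Suc i = n")
    case True
    have "df C n = row D (f n) (df Y i)" using True df_C(2) by auto
    then show ?thesis using e n True by (auto simp add: row_col distr)
  next
    case False
    then have i': "Suc i < n" using i by simp
    have z: "neg D (df X (Suc i) \<cdot> u) = Zero D W (ob X (Suc (Suc i))) \<longleftrightarrow> df X (Suc i) \<cdot> u = Zero D W (ob X (Suc (Suc i)))"
      using i' by (simp add: neg_eq_Zero)
    have "df C (Suc i) \<cdot> col D u (neg D v) = col D (neg D (df X (Suc i) \<cdot> u)) ((f (Suc i) \<cdot> u) \<boxplus> neg D (df Y i \<cdot> v))"
      using i' by (simp add: df_C mat22_col distr)
    also have "\<dots> = Zero D W (ob C (Suc (Suc i))) \<longleftrightarrow> neg D (df X (Suc i) \<cdot> u) = Zero D W (ob X (Suc (Suc i))) \<and> (f (Suc i) \<cdot> u) \<boxplus> neg D (df Y i \<cdot> v) = Zero D W (ob Y (Suc i))"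
      using i' by (simp add: col_Zero[symmetric] col_inj)
    finally show ?thesis using e i' z by auto
  qed
qed

lemma C_col_image:
  assumes i: "i < n" and u: "u \<in> homs D W (ob X (Suc i))" and v: "v \<in> homs D W (ob Y i)"
  shows "(\<exists>t\<in>homs D W (ob C i). col D u (neg D v) = df C i \<cdot> t) \<longleftrightarrow>
     (\<exists>w\<in>homs D W (ob X i). u = df X i \<cdot> w \<and>
          (if 0 < i then \<exists>t\<in>homs D W (ob Y (i - 1)). v = (f i \<cdot> w) \<boxplus> (df Y (i - 1) \<cdot> t)
           else v = f i \<cdot> w))"
proof -
  note [simp] = tps u[unfolded in_homs] v[unfolded in_homs]
  have [simp]: "W \<in> Obj D" using homs_obj[OF u] by simp
  show ?thesis
  proof (cases i)
    case 0
    have *: "col D u (neg D v) = df C 0 \<cdot> neg D w \<longleftrightarrow> u = df X 0 \<cdot> w \<and> v = f 0 \<cdot> w" if "w \<in> homs D W (ob X 0)" for w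
    proof -
      note [simp] = that[unfolded in_homs]
      have "df C 0 \<cdot> neg D w = col D (df X 0 \<cdot> w) (neg D (f 0 \<cdot> w))" using i by (simp add: df_C col_Comp distr neg_col)
      moreover have "neg D v = neg D (f 0 \<cdot> w) \<longleftrightarrow> v = f 0 \<cdot> w"
        using 0 by (simp add: neg_inj)
      ultimately show ?thesis using 0 i by (auto simp: col_inj)
    qed
    have "(\<exists>t\<in>homs D W (ob C 0). col D u (neg D v) = df C 0 \<cdot> t) \<longleftrightarrow> (\<exists>w\<in>homs D W (ob X 0). col D u (neg D v) = df C 0 \<cdot> neg D w)"
      using neg_homs[of _ W "ob X 0"] neg_neg by (metis in_homs ob_C(1))
    then show ?thesis using 0 * by simp
  next
    case (Suc j)
    then have j: "Suc j < n" using i by simp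
    have *: "col D u (neg D v) = df C (Suc j) \<cdot> col D (neg D w) (neg D t) \<longleftrightarrow> u = df X (Suc j) \<cdot> w \<and> v = (f (Suc j) \<cdot> w) \<boxplus> (df Y j \<cdot> t)"
      if "w \<in> homs D W (ob X (Suc j))" "t \<in> homs D W (ob Y j)" for w t
    proof -
      note [simp] = that[unfolded in_homs]
      let ?r = "(f (Suc j) \<cdot> w) \<boxplus> (df Y j \<cdot> t)"
      have r: "?r \<in> Arr D" "Dom D ?r = W" "Cod D ?r = ob Y (Suc j)" using j by auto
      have "df C (Suc j) \<cdot> col D (neg D w) (neg D t) = col D (df X (Suc j) \<cdot> w) (neg D ?r)"
        using j by (simp add: df_C mat22_col distr)
      moreover have "neg D v = neg D ?r \<longleftrightarrow> v = ?r"
        using r(1) by (simp add: neg_inj)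
      ultimately show ?thesis using Suc j r by (auto simp: col_inj)
    qed
    show ?thesis (is "?L \<longleftrightarrow> ?R")
    proof
      assume ?L
      then obtain s where s: "s \<in> homs D W (dsum D (ob X (Suc j)) (ob Y j))" "col D u (neg D v) = df C (Suc j) \<cdot> s" using Suc i by auto
      obtain w t where wt: "w \<in> homs D W (ob X (Suc j))" "t \<in> homs D W (ob Y j)" "s = col D w t"
        by (rule col_cases[OF s(1)]) (use j in auto)
      have "col D (neg D (neg D w)) (neg D (neg D t)) = s" using wt by (simp add: in_homs)
      then show ?R using *[OF neg_homs[OF wt(1)] neg_homs[OF wt(2)]] s(2) Suc neg_homs[OF wt(1)] neg_homs[OF wt(2)] by auto
    next
      assume ?R
      then obtain w t where wt: "w \<in> homs D W (ob X (Suc j))" "u = df X (Suc j) \<cdot> w" "t \<in> homs D W (ob Y j)"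
        "v = (f (Suc j) \<cdot> w) \<boxplus> (df Y j \<cdot> t)" using Suc by auto
      then have "col D u (neg D v) = df C i \<cdot> col D (neg D w) (neg D t)" using * Suc by auto
      moreover have "col D (neg D w) (neg D t) \<in> homs D W (ob C i)" using i Suc wt(1,3) by (auto simp: in_homs)
      ultimately show ?L by blast
    qed
  qed
qed

lemma df_C_type: assumes "i \<le> n" shows "df C i \<in> homs D (ob C i) (ob C (Suc i))"
proof -
  note [simp] = tps
  consider "i = 0" | "0 < i" "i < n" | "i = n" "0 < i" using n assms by linarith
  then show ?thesis
  proof cases
    case 1 then show ?thesis using n by (simp add: df_C in_homs)
  next
    case 2 then obtain j where "i = Suc j" by (cases i) auto
    then show ?thesis using 2 by (simp add: df_C in_homs)
  next
    case 3
    have "ob C n = dsum D (ob X n) (ob Y (n - 1))" using ob_C(2)[of "n - 1"] n by simp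
    then show ?thesis using 3 n by (simp add: df_C in_homs)
  qed
qed

lemma cpx_cone: "cpx D (Suc n) C"
proof (rule cpxI)
  note [simp] = tps
  fix i assume "i \<le> Suc n" then show "ob C i \<in> Obj D"
    by (cases i; cases "i = Suc n") auto
next
  fix i assume "i < Suc n"
  then show "df C i \<in> homs D (ob C i) (ob C (Suc i))" by (simp add: df_C_type)
next
  note [simp] = tps
  fix i assume i: "Suc i < Suc n"
  show "df C (Suc i) \<cdot> df C i = Zero D (ob C i) (ob C (Suc (Suc i)))"
  proof (cases i)
    case 0
    have [simp]: "ob C (Suc (Suc 0)) \<in> Obj D" using homs_obj(2)[OF df_C_type[of "Suc 0"]] n by simp
    \<comment> \<open>The first differential of the cone is minus the column with entries
      \<open>df X 0\<close> and \<open>-f 0\<close>, so \<open>C_col\<close> already computes the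
      composite.\<close>
    have "df C (Suc 0) \<cdot> col D (df X 0 \<cdot> Ide D (ob X 0)) (neg D (f 0)) = Zero D (ob X 0) (ob C (Suc (Suc 0)))"
      by (rule iffD2[OF C_col]) (use n i 0 fd[of 0] in \<open>auto simp: in_homs\<close>)
    moreover have "neg D (col D (df X 0) (neg D (f 0))) = df C 0"
      using n by (intro neg_unique[symmetric]) (simp_all add: df_C col_plus col_Zero)
    moreover have "df C (Suc 0) \<in> homs D (ob C (Suc 0)) (ob C (Suc (Suc 0)))"
      using n by (intro df_C_type) simp
    ultimately show ?thesis using 0 n Comp_neg[of "col D (df X 0) (neg D (f 0))" "df C (Suc 0)"]
      by (auto simp: in_homs dest: homs_obj)
  next
    case (Suc j)
    have j: "Suc j < n" using i Suc by simp
    have dC: "df C (Suc (Suc j)) \<in> homs D (ob C (Suc (Suc j))) (ob C (Suc (Suc (Suc j))))"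
      using j by (intro df_C_type) simp
    note [simp] = dC[unfolded in_homs]
    have [simp]: "ob C (Suc (Suc (Suc j))) \<in> Obj D" using homs_obj[OF dC] by simp
    have 1: "df C (Suc (Suc j)) \<cdot> col D (neg D (df X (Suc j))) (f (Suc j)) = Zero D (ob X (Suc j)) (ob C (Suc (Suc (Suc j))))"
    proof -
      have "df C (Suc (Suc j)) \<cdot> col D (neg D (df X (Suc j))) (neg D (neg D (f (Suc j)))) = Zero D (ob X (Suc j)) (ob C (Suc (Suc (Suc j))))"
        by (rule iffD2[OF C_col]) (use j fd[of "Suc j"] in \<open>auto simp: in_homs distr\<close>)
      then show ?thesis using j by simp
    qed
    have 2: "df C (Suc (Suc j)) \<cdot> col D (Zero D (ob Y j) (ob X (Suc (Suc j)))) (df Y j) = Zero D (ob Y j) (ob C (Suc (Suc (Suc j))))"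
    proof -
      have "df C (Suc (Suc j)) \<cdot> col D (Zero D (ob Y j) (ob X (Suc (Suc j)))) (neg D (neg D (df Y j))) = Zero D (ob Y j) (ob C (Suc (Suc (Suc j))))"
        by (rule iffD2[OF C_col]) (use j in \<open>auto simp: in_homs distr\<close>)
      then show ?thesis using j by simp
    qed
    \<comment> \<open>The middle differential is read as a row of two columns, each of which is
      annihilated by \<open>1\<close> and \<open>2\<close>.\<close>
    have m: "df C (Suc j) = row D (col D (neg D (df X (Suc j))) (f (Suc j))) (col D (Zero D (ob Y j) (ob X (Suc (Suc j)))) (df Y j))"
      unfolding df_C(3)[OF j] mat22_def
      by (rule row_eta[symmetric, of _ "ob X (Suc j)" "ob Y j", THEN trans]) (use j in \<open>auto simp: col_Comp\<close>)
    show ?thesis unfolding Suc m using j 1 2 by (subst Comp_row) (auto simp: row_Zero)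
  qed
qed (auto simp: cone_def)

lemma contraX_cone: "contraX D n C \<longleftrightarrow> po_elt D n X Y f"
proof -
  note [simp] = tps
  obtain m where m: "n = Suc m" using n by (cases n) auto
  have dn: "df C n = row D (f n) (df Y (n - 1))" by (rule df_C)
  have obn: "ob C n = dsum D (ob X n) (ob Y (n - 1))" using ob_C(2)[of m] unfolding m by simp
  have nn: "n - 1 < n" "Suc (n - 1) = n" using n by auto
  have 1: "(\<forall>x\<in>homs D (ob C (Suc n)) W. x \<cdot> df C n = Zero D (ob C n) W \<longrightarrow> x = Zero D (ob C (Suc n)) W) \<longleftrightarrow>
    (\<forall>s\<in>homs D (ob Y n) W. \<forall>s'\<in>homs D (ob Y n) W. s \<cdot> f n = s' \<cdot> f n \<and> s \<cdot> df Y (n - 1) = s' \<cdot> df Y (n - 1) \<longrightarrow> s = s')"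
    (is "?L \<longleftrightarrow> ?R") for W
  proof -
    have e: "x \<cdot> df C n = Zero D (ob C n) W \<longleftrightarrow> x \<cdot> f n = Zero D (ob X n) W \<and> x \<cdot> df Y (n - 1) = Zero D (ob Y (n - 1)) W"
      if x: "x \<in> homs D (ob Y n) W" for x
    proof -
      note [simp] = x[unfolded in_homs]
      have [simp]: "W \<in> Obj D" using homs_obj[OF x] by simp
      show ?thesis unfolding dn obn using nn by (simp add: Comp_row row_Zero[symmetric] row_inj)
    qed
    show ?thesis
    proof
      assume L: ?L
      show ?R
      proof (intro ballI impI)
        fix s s' assume s: "s \<in> homs D (ob Y n) W" "s' \<in> homs D (ob Y n) W" and eq: "s \<cdot> f n = s' \<cdot> f n \<and> s \<cdot> df Y (n - 1) = s' \<cdot> df Y (n - 1)"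
        note [simp] = s[unfolded in_homs]
        have h: "s \<boxplus> neg D s' \<in> homs D (ob Y n) W" by (simp add: in_homs)
        have "(s \<boxplus> neg D s') \<cdot> f n = Zero D (ob X n) W" "(s \<boxplus> neg D s') \<cdot> df Y (n - 1) = Zero D (ob Y (n - 1)) W"
          using eq nn by (simp_all add: distr)
        then have "s \<boxplus> neg D s' = Zero D (ob Y n) W"
          using L e[OF h] h by simp
        then show "s = s'" by (subst eq_iff_diff) auto
      qed
    next
      assume R: ?R
      show ?L
      proof (intro ballI impI)
        fix x assume x: "x \<in> homs D (ob C (Suc n)) W" and "x \<cdot> df C n = Zero D (ob C n) W"
        then have "x \<cdot> f n = Zero D (ob X n) W" "x \<cdot> df Y (n - 1) = Zero D (ob Y (n - 1)) W" using e by auto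
        moreover have "W \<in> Obj D" using homs_obj[OF x] by simp
        ultimately show "x = Zero D (ob C (Suc n)) W"
          using R[rule_format, of x "Zero D (ob Y n) W"] x nn by (simp add: in_homs)
      qed
    qed
  qed
  have 2: "(\<forall>x\<in>homs D (ob C (Suc i)) W. x \<cdot> df C i = Zero D (ob C i) W \<longrightarrow> (\<exists>t\<in>homs D (ob C (Suc (Suc i))) W. x = t \<cdot> df C (Suc i))) \<longleftrightarrow>
    (\<forall>u\<in>homs D (ob X (Suc i)) W. \<forall>v\<in>homs D (ob Y i) W.
        u \<cdot> df X i = v \<cdot> f i \<and> (0 < i \<longrightarrow> v \<cdot> df Y (i - 1) = Zero D (ob Y (i - 1)) W) \<longrightarrow>
        (\<exists>w\<in>homs D (ob Y (Suc i)) W. v = w \<cdot> df Y i \<and>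
          (if Suc i < n then \<exists>t\<in>homs D (ob X (Suc (Suc i))) W. u = (w \<cdot> f (Suc i)) \<boxplus> (t \<cdot> df X (Suc i))
           else u = w \<cdot> f (Suc i))))" (is "?L \<longleftrightarrow> ?R") if i: "i < n" for i W
  proof -
    have "?L \<longleftrightarrow> (\<forall>u\<in>homs D (ob X (Suc i)) W. \<forall>v\<in>homs D (ob Y i) W. row D u v \<cdot> df C i = Zero D (ob C i) W \<longrightarrow>
        (\<exists>t\<in>homs D (ob C (Suc (Suc i))) W. row D u v = t \<cdot> df C (Suc i)))" (is "_ \<longleftrightarrow> ?M")
    proof
      assume ?L then show ?M using i by (auto simp: in_homs)
    next
      assume M: ?M show ?L
      proof
        fix x assume x: "x \<in> homs D (ob C (Suc i)) W"
        obtain u v where "u \<in> homs D (ob X (Suc i)) W" "v \<in> homs D (ob Y i) W" "x = row D u v"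
          by (rule row_cases[of x "ob X (Suc i)" "ob Y i" W]) (use x i in auto)
        then show "x \<cdot> df C i = Zero D (ob C i) W \<longrightarrow> (\<exists>t\<in>homs D (ob C (Suc (Suc i))) W. x = t \<cdot> df C (Suc i))"
          using M by blast
      qed
    qed
    also have "\<dots> \<longleftrightarrow> ?R" by (intro ball_cong refl) (simp only: row_C[OF i] row_C_image[OF i])
    finally show ?thesis .
  qed
  show ?thesis unfolding contraX_iff[OF cpx_cone] po_elt_def using 1 2 by simp
qed

lemma covX_cone: "covX D n C \<longleftrightarrow> pb_elt D n X Y f"
proof -
  note [simp] = tps
  obtain m where m: "n = Suc m" using n by (cases n) auto
  have dn: "df C 0 = col D (neg D (df X 0)) (f 0)" by (rule df_C)
  have 1: "(\<forall>x\<in>homs D W (ob C 0). df C 0 \<cdot> x = Zero D W (ob C (Suc 0)) \<longrightarrow> x = Zero D W (ob C 0)) \<longleftrightarrow>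
    (\<forall>s\<in>homs D W (ob X 0). \<forall>s'\<in>homs D W (ob X 0). f 0 \<cdot> s = f 0 \<cdot> s' \<and> df X 0 \<cdot> s = df X 0 \<cdot> s' \<longrightarrow> s = s')"
    (is "?L \<longleftrightarrow> ?R") for W
  proof -
    have e: "df C 0 \<cdot> x = Zero D W (ob C (Suc 0)) \<longleftrightarrow> f 0 \<cdot> x = Zero D W (ob Y 0) \<and> df X 0 \<cdot> x = Zero D W (ob X (Suc 0))"
      if x: "x \<in> homs D W (ob X 0)" for x
    proof -
      note [simp] = x[unfolded in_homs]
      have [simp]: "W \<in> Obj D" using homs_obj[OF x] by simp
      have "neg D (df X 0 \<cdot> x) = Zero D W (ob X (Suc 0)) \<longleftrightarrow> df X 0 \<cdot> x = Zero D W (ob X (Suc 0))"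
        using n by (simp add: neg_eq_Zero)
      then show ?thesis unfolding dn using n by (auto simp add: col_Comp col_Zero[symmetric] col_inj distr)
    qed
    show ?thesis
    proof
      assume L: ?L
      show ?R
      proof (intro ballI impI)
        fix s s' assume s: "s \<in> homs D W (ob X 0)" "s' \<in> homs D W (ob X 0)" and eq: "f 0 \<cdot> s = f 0 \<cdot> s' \<and> df X 0 \<cdot> s = df X 0 \<cdot> s'"
        note [simp] = s[unfolded in_homs]
        have h: "s \<boxplus> neg D s' \<in> homs D W (ob X 0)" by (simp add: in_homs)
        have "f 0 \<cdot> (s \<boxplus> neg D s') = Zero D W (ob Y 0)" "df X 0 \<cdot> (s \<boxplus> neg D s') = Zero D W (ob X (Suc 0))"
          using eq n by (simp_all add: distr)
        then have "s \<boxplus> neg D s' = Zero D W (ob X 0)"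
          using L e[OF h] h by simp
        then show "s = s'" by (subst eq_iff_diff) auto
      qed
    next
      assume R: ?R
      show ?L
      proof (intro ballI impI)
        fix x assume x: "x \<in> homs D W (ob C 0)" and "df C 0 \<cdot> x = Zero D W (ob C (Suc 0))"
        then have "f 0 \<cdot> x = Zero D W (ob Y 0)" "df X 0 \<cdot> x = Zero D W (ob X (Suc 0))" using e by auto
        moreover have "W \<in> Obj D" using homs_obj[OF x] by simp
        ultimately show "x = Zero D W (ob C 0)"
          using R[rule_format, of x "Zero D W (ob X 0)"] x n by (simp add: in_homs)
      qed
    qed
  qed
  have 2: "(\<forall>x\<in>homs D W (ob C (Suc i)). df C (Suc i) \<cdot> x = Zero D W (ob C (Suc (Suc i))) \<longrightarrow> (\<exists>t\<in>homs D W (ob C i). x = df C i \<cdot> t)) \<longleftrightarrow>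
    (\<forall>u\<in>homs D W (ob X (Suc i)). \<forall>v\<in>homs D W (ob Y i).
        df Y i \<cdot> v = f (Suc i) \<cdot> u \<and> (Suc i < n \<longrightarrow> df X (Suc i) \<cdot> u = Zero D W (ob X (Suc (Suc i)))) \<longrightarrow>
        (\<exists>w\<in>homs D W (ob X i). u = df X i \<cdot> w \<and>
          (if 0 < i then \<exists>t\<in>homs D W (ob Y (i - 1)). v = (f i \<cdot> w) \<boxplus> (df Y (i - 1) \<cdot> t)
           else v = f i \<cdot> w)))" (is "?L \<longleftrightarrow> ?R") if i: "i < n" for i W
  proof -
    have "?L \<longleftrightarrow> (\<forall>u\<in>homs D W (ob X (Suc i)). \<forall>v\<in>homs D W (ob Y i). df C (Suc i) \<cdot> col D u (neg D v) = Zero D W (ob C (Suc (Suc i))) \<longrightarrow>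
        (\<exists>t\<in>homs D W (ob C i). col D u (neg D v) = df C i \<cdot> t))" (is "_ \<longleftrightarrow> ?M")
    proof
      assume ?L then show ?M using i by (auto simp: in_homs)
    next
      assume M: ?M show ?L
      proof
        fix x assume x: "x \<in> homs D W (ob C (Suc i))"
        obtain u v where uv: "u \<in> homs D W (ob X (Suc i))" "v \<in> homs D W (ob Y i)" "x = col D u v"
          by (rule col_cases[of x W "ob X (Suc i)" "ob Y i"]) (use x i in auto)
        have x': "x = col D u (neg D (neg D v))" using uv by (simp add: in_homs)
        show "df C (Suc i) \<cdot> x = Zero D W (ob C (Suc (Suc i))) \<longrightarrow> (\<exists>t\<in>homs D W (ob C i). x = df C i \<cdot> t)"
          unfolding x' by (intro impI M[rule_format, OF uv(1) neg_homs[OF uv(2)]])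
      qed
    qed
    also have "\<dots> \<longleftrightarrow> ?R" by (intro ball_cong refl) (simp only: C_col[OF i] C_col_image[OF i])
    finally show ?thesis .
  qed
  show ?thesis unfolding covX_iff[OF cpx_cone] pb_elt_def using 1 2 by simp
qed

end

text \<open>The signs in \<open>N_cone\<close> are opposite to those in \<open>cone\<close>.
  Negating all differentials of both complexes turns one into the other, and exactness does not see
  the change.\<close>

definition negc :: "('o, 'm) precat \<Rightarrow> nat \<Rightarrow> ('o, 'm) cplx \<Rightarrow> ('o, 'm) cplx" where
  "negc D m X = \<lparr>ob = ob X, df = (\<lambda>i\<in>{..<m}. neg D (df X i))\<rparr>"

lemma negc_simps[simp]: "ob (negc D m X) = ob X" "i < m \<Longrightarrow> df (negc D m X) i = neg D (df X i)"
  by (auto simp: negc_def)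

lemma segment_simps[simp]: "i \<le> n \<Longrightarrow> ob (segment s (n + 1) X) i = ob X (i + s)" "i < n \<Longrightarrow> df (segment s (n + 1) X) i = df X (i + s)"
  "i \<le> n \<Longrightarrow> segment_map s (n + 1) f i = f (i + s)"
  by (auto simp: segment_def segment_map_def)

context acat
begin

lemma negc_cpx: "cpx D m X \<Longrightarrow> cpx D m (negc D m X)"
  using cpxD(4,5)[of D m X]
  by (intro cpxI) (auto simp: cpx_type distr in_homs, auto simp: negc_def)

lemma negc_negc: "cpx D m X \<Longrightarrow> negc D m (negc D m X) = X"
  by (rule cpx_ext[OF negc_cpx[OF negc_cpx]]) (auto simp: cpx_type)

lemma negc_cmap: assumes "cpx D m X" "cpx D m Y" "cmap D m X Y f" shows "cmap D m (negc D m X) (negc D m Y) f"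
  using assms(3) unfolding cmap_def chain_maps_def
  by (auto simp: PiE_def Pi_def cpx_type[OF assms(1)] cpx_type[OF assms(2)] cmap_type[OF assms(3)] distr)

text \<open>For the pushout property apply the given one to \<open>-u\<close> and negate the
  resulting \<open>w\<close>; for the pullback property do the same with \<open>-v\<close>.\<close>

lemma neg_elt:
  assumes X: "cpx D n X" and Y: "cpx D n Y" and f: "cmap D n X Y f" and n: "1 \<le> n"
  shows "po_elt D n X Y f \<Longrightarrow> po_elt D n (negc D n X) (negc D n Y) f"
    and "pb_elt D n X Y f \<Longrightarrow> pb_elt D n (negc D n X) (negc D n Y) f"
proof -
  note [simp] = cpx_type[OF X] cpx_type[OF Y] cmap_type[OF f]
  obtain m where m: "n = Suc m" using n by (cases n) auto
  note ni = neg_inj and nz = neg_eq_Zero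
  {
    assume po: "po_elt D n X Y f"
    note A = po[unfolded po_elt_def, rule_format, THEN conjunct1, rule_format]
    note B = po[unfolded po_elt_def, rule_format, THEN conjunct2, rule_format]
    show "po_elt D n (negc D n X) (negc D n Y) f"
      unfolding po_elt_def
    proof (intro allI conjI ballI impI)
      fix W s s' assume s: "s \<in> homs D (ob (negc D n Y) n) W" "s' \<in> homs D (ob (negc D n Y) n) W"
        and e: "s \<cdot> f n = s' \<cdot> f n \<and> s \<cdot> df (negc D n Y) (n - 1) = s' \<cdot> df (negc D n Y) (n - 1)"
      note [simp] = s[unfolded in_homs negc_simps]
      show "s = s'" using s by (intro A[of s W s']) (use e m in \<open>auto simp: distr ni\<close>)
    next
      fix W i u v assume i: "i < n" and u: "u \<in> homs D (ob (negc D n X) (Suc i)) W" and v: "v \<in> homs D (ob (negc D n Y) i) W"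
        and e: "u \<cdot> df (negc D n X) i = v \<cdot> f i \<and> (0 < i \<longrightarrow> v \<cdot> df (negc D n Y) (i - 1) = Zero D (ob (negc D n Y) (i - 1)) W)"
      note [simp] = u[unfolded in_homs negc_simps] v[unfolded in_homs negc_simps]
      have [simp]: "W \<in> Obj D" using homs_obj[OF u] by simp
      have e1: "neg D u \<cdot> df X i = v \<cdot> f i" using e i by (simp add: distr)
      have e2: "v \<cdot> df Y (i - 1) = Zero D (ob Y (i - 1)) W" if "0 < i"
      proof -
        have "i - 1 < n" "Suc (i - 1) = i" using i that by auto
        then show ?thesis using e i that by (simp add: distr nz)
      qed
      obtain w where w: "w \<in> homs D (ob Y (Suc i)) W" "v = w \<cdot> df Y i"
        "if Suc i < n then \<exists>t\<in>homs D (ob X (Suc (Suc i))) W. neg D u = (w \<cdot> f (Suc i)) \<boxplus> (t \<cdot> df X (Suc i)) else neg D u = w \<cdot> f (Suc i)"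
        using B[OF i, of "neg D u" W v] e1 e2 i by (auto simp: in_homs)
      note [simp] = w(1)[unfolded in_homs]
      have "if Suc i < n then \<exists>t\<in>homs D (ob X (Suc (Suc i))) W. u = (neg D w \<cdot> f (Suc i)) \<boxplus> (t \<cdot> neg D (df X (Suc i))) else u = neg D w \<cdot> f (Suc i)"
      proof (cases "Suc i < n")
        case True
        then obtain t where t: "t \<in> homs D (ob X (Suc (Suc i))) W" "neg D u = (w \<cdot> f (Suc i)) \<boxplus> (t \<cdot> df X (Suc i))" using w(3) by auto
        note [simp] = t(1)[unfolded in_homs]
        have "u = neg D ((w \<cdot> f (Suc i)) \<boxplus> (t \<cdot> df X (Suc i)))" using t(2)[symmetric] by simp
        then show ?thesis using True t(1) by (auto simp: distr intro!: bexI[of _ t])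
      next
        case False
        then have nu: "neg D u = w \<cdot> f (Suc i)" using w(3) by simp
        have "u = neg D (w \<cdot> f (Suc i))" using nu[symmetric] by simp
        then show ?thesis using False i by (auto simp: distr)
      qed
      moreover have "v = neg D w \<cdot> df (negc D n Y) i" using w(2) i by (simp add: distr)
      ultimately show "\<exists>w\<in>homs D (ob (negc D n Y) (Suc i)) W. v = w \<cdot> df (negc D n Y) i \<and>
          (if Suc i < n then \<exists>t\<in>homs D (ob (negc D n X) (Suc (Suc i))) W. u = (w \<cdot> f (Suc i)) \<boxplus> (t \<cdot> df (negc D n X) (Suc i))
           else u = w \<cdot> f (Suc i))"
        by (intro bexI[of _ "neg D w"]) (auto simp: in_homs)
    qed
  }
  {
    assume pb: "pb_elt D n X Y f"
    note A = pb[unfolded pb_elt_def, rule_format, THEN conjunct1, rule_format]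
    note B = pb[unfolded pb_elt_def, rule_format, THEN conjunct2, rule_format]
    show "pb_elt D n (negc D n X) (negc D n Y) f"
      unfolding pb_elt_def
    proof (intro allI conjI ballI impI)
      fix W s s' assume s: "s \<in> homs D W (ob (negc D n X) 0)" "s' \<in> homs D W (ob (negc D n X) 0)"
        and e: "f 0 \<cdot> s = f 0 \<cdot> s' \<and> df (negc D n X) 0 \<cdot> s = df (negc D n X) 0 \<cdot> s'"
      note [simp] = s[unfolded in_homs negc_simps]
      show "s = s'" using s by (intro A[of s W s']) (use e m in \<open>auto simp: distr ni\<close>)
    next
      fix W i u v assume i: "i < n" and u: "u \<in> homs D W (ob (negc D n X) (Suc i))" and v: "v \<in> homs D W (ob (negc D n Y) i)"
        and e: "df (negc D n Y) i \<cdot> v = f (Suc i) \<cdot> u \<and> (Suc i < n \<longrightarrow> df (negc D n X) (Suc i) \<cdot> u = Zero D W (ob (negc D n X) (Suc (Suc i))))"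
      note [simp] = u[unfolded in_homs negc_simps] v[unfolded in_homs negc_simps]
      have [simp]: "W \<in> Obj D" using homs_obj[OF u] by simp
      have e1: "df Y i \<cdot> neg D v = f (Suc i) \<cdot> u" using e i by (simp add: distr)
      have e2: "df X (Suc i) \<cdot> u = Zero D W (ob X (Suc (Suc i)))" if "Suc i < n"
        using e i that by (simp add: distr nz)
      obtain w where w: "w \<in> homs D W (ob X i)" "u = df X i \<cdot> w"
        "if 0 < i then \<exists>t\<in>homs D W (ob Y (i - 1)). neg D v = (f i \<cdot> w) \<boxplus> (df Y (i - 1) \<cdot> t) else neg D v = f i \<cdot> w"
        using B[OF i, of u W "neg D v"] e1 e2 i by (auto simp: in_homs)
      note [simp] = w(1)[unfolded in_homs]
      have "if 0 < i then \<exists>t\<in>homs D W (ob Y (i - 1)). v = (f i \<cdot> neg D w) \<boxplus> (neg D (df Y (i - 1)) \<cdot> t) else v = f i \<cdot> neg D w"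
      proof (cases i)
        case (Suc j)
        then obtain t where t: "t \<in> homs D W (ob Y j)" "neg D v = (f i \<cdot> w) \<boxplus> (df Y j \<cdot> t)" using w(3) by auto
        note [simp] = t(1)[unfolded in_homs]
        have "v = neg D ((f i \<cdot> w) \<boxplus> (df Y j \<cdot> t))" using t(2)[symmetric] by simp
        then show ?thesis using Suc i t(1) by (auto simp: distr intro!: bexI[of _ t])
      next
        case 0
        then have nv: "neg D v = f i \<cdot> w" using w(3) by simp
        have "v = neg D (f i \<cdot> w)" using nv[symmetric] by simp
        then show ?thesis using 0 i by (auto simp: distr)
      qed
      moreover have "u = df (negc D n X) i \<cdot> neg D w" using w(2) i by (simp add: distr)
      ultimately show "\<exists>w\<in>homs D W (ob (negc D n X) i). u = df (negc D n X) i \<cdot> w \<and>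
          (if 0 < i then \<exists>t\<in>homs D W (ob (negc D n Y) (i - 1)). v = (f i \<cdot> w) \<boxplus> (df (negc D n Y) (i - 1) \<cdot> t)
           else v = f i \<cdot> w)"
        using i by (intro bexI[of _ "neg D w"]) (auto simp: in_homs)
    qed
  }
qed

lemma segment_cpx: "cpx D (Suc n) X \<Longrightarrow> s \<le> 1 \<Longrightarrow> cpx D n (segment s (n + 1) X)"
  by (intro cpxI) (auto simp: cpx_type in_homs segment_def)

lemma segment_cmap: "cmap D (Suc n) X Y f \<Longrightarrow> s \<le> 1 \<Longrightarrow> cmap D n (segment s (n + 1) X) (segment s (n + 1) Y) (segment_map s (n + 1) f)"
  unfolding segment_map_def Suc_eq_plus1[symmetric]
  by (rule cmapI) (auto simp: cmap_type in_homs segment_def cmapD)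

lemma partial_mapI: "1 \<le> n \<Longrightarrow> cpx D n X \<Longrightarrow> cpx D n Y \<Longrightarrow> cmap D n X Y f \<Longrightarrow> partial_map D n X Y f"
  by unfold_locales

lemma n_pushout_iff: "1 \<le> n \<Longrightarrow> n_pushout_diagram D n X Y f \<longleftrightarrow> cpx D n X \<and> cpx D n Y \<and> cmap D n X Y f \<and> po_elt D n X Y f"
  unfolding n_pushout_diagram_def complexes_cpx chain_maps_cmap
  using contra_left_exact_iff[OF partial_map.cpx_cone] partial_map.contraX_cone partial_mapI by blast

lemma n_pullback_iff: "1 \<le> n \<Longrightarrow> n_pullback_diagram D n X Y f \<longleftrightarrow> cpx D n X \<and> cpx D n Y \<and> cmap D n X Y f \<and> pb_elt D n X Y f"
  unfolding n_pullback_diagram_def complexes_cpx chain_maps_cmap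
  using cov_left_exact_iff[OF partial_map.cpx_cone] partial_map.covX_cone partial_mapI by blast

lemma M_cone_eq: "1 \<le> n \<Longrightarrow> M_cone D n X Y f = cone D n (segment 1 (n + 1) X) (segment 1 (n + 1) Y) (segment_map 1 (n + 1) f)"
  unfolding M_cone_def cone_def
  by (intro cplx.equality) (auto simp: segment_def segment_map_def fun_eq_iff restrict_def)

lemma N_cone_eq:
  assumes X: "cpx D (Suc n) X" and Y: "cpx D (Suc n) Y" and n: "1 \<le> n"
  shows "N_cone D n X Y f = cone D n (negc D n (segment 0 (n + 1) X)) (negc D n (segment 0 (n + 1) Y)) (segment_map 0 (n + 1) f)"
  unfolding N_cone_def cone_def using n
  by (intro cplx.equality) (auto simp: segment_def segment_map_def fun_eq_iff restrict_def cpx_type[OF X] cpx_type[OF Y])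

text \<open>The complex of (EA2) is literally the cone of the part in degrees 1 to
  \<open>n + 1\<close>, so the two halves of its exactness are the pushout and the pullback property
  of that part.\<close>

lemma nex_M_cone:
  assumes X: "cpx D (Suc n) X" and Y: "cpx D (Suc n) Y" and f: "cmap D (Suc n) X Y f" and n: "1 \<le> n"
  shows "nex D n (M_cone D n X Y f) \<longleftrightarrow>
    po_elt D n (segment 1 (n + 1) X) (segment 1 (n + 1) Y) (segment_map 1 (n + 1) f) \<and>
    pb_elt D n (segment 1 (n + 1) X) (segment 1 (n + 1) Y) (segment_map 1 (n + 1) f)"
proof -
  interpret partial_map D n "segment 1 (n + 1) X" "segment 1 (n + 1) Y" "segment_map 1 (n + 1) f"
    by (intro partial_mapI n segment_cpx segment_cmap X Y f) auto
  show ?thesis unfolding M_cone_eq[OF n] nex_def using cpx_cone contraX_cone covX_cone by simp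
qed

lemma nex_N_cone:
  assumes cX: "cpx D (Suc n) X" and cY: "cpx D (Suc n) Y" and cf: "cmap D (Suc n) X Y f" and cn: "1 \<le> n"
  shows "nex D n (N_cone D n X Y f) \<longleftrightarrow>
    po_elt D n (segment 0 (n + 1) X) (segment 0 (n + 1) Y) (segment_map 0 (n + 1) f) \<and>
    pb_elt D n (segment 0 (n + 1) X) (segment 0 (n + 1) Y) (segment_map 0 (n + 1) f)"
proof -
  have *: "cpx D n (segment 0 (n + 1) X)" "cpx D n (segment 0 (n + 1) Y)" "cmap D n (segment 0 (n + 1) X) (segment 0 (n + 1) Y) (segment_map 0 (n + 1) f)"
    by (intro segment_cpx segment_cmap cX cY cf; simp)+
  note neg = negc_cpx[OF *(1)] negc_cpx[OF *(2)] negc_cmap[OF *]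
  interpret partial_map D n "negc D n (segment 0 (n + 1) X)" "negc D n (segment 0 (n + 1) Y)" "segment_map 0 (n + 1) f"
    by (intro partial_mapI cn neg)
  show ?thesis unfolding N_cone_eq[OF cX cY cn] nex_def using cpx_cone contraX_cone covX_cone
      neg_elt[OF * cn] neg_elt[OF neg cn] negc_negc[OF *(1)] negc_negc[OF *(2)] by metis
qed

end

section \<open>Direct sums and trivial complexes\<close>

lemma dsum_cplx_simps[simp]:
  "i \<le> Suc n \<Longrightarrow> ob (dsum_cplx D (n + 2) X Y) i = dsum D (ob X i) (ob Y i)"
  "i \<le> n \<Longrightarrow> df (dsum_cplx D (n + 2) X Y) i =
     mat22 D (df X i) (Zero D (ob Y i) (ob X (Suc i))) (Zero D (ob X i) (ob Y (Suc i))) (df Y i)"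
  by (auto simp: dsum_cplx_def)

lemma triv_simps:
  "j \<le> Suc n \<Longrightarrow> j = i \<or> j = Suc i \<Longrightarrow> ob (triv D n i X) j = X"
  "j \<le> Suc n \<Longrightarrow> j \<noteq> i \<Longrightarrow> j \<noteq> Suc i \<Longrightarrow> ob (triv D n i X) j = zero_obj D"
  "i \<le> n \<Longrightarrow> df (triv D n i X) i = Ide D X"
  "j \<le> n \<Longrightarrow> j \<noteq> i \<Longrightarrow> df (triv D n i X) j = Zero D (ob (triv D n i X) j) (ob (triv D n i X) (Suc j))"
  by (auto simp: triv_def Let_def)

context acat
begin

lemma mat_col:
  assumes "a \<in> homs D A A'" "b \<in> homs D B B'" "u \<in> homs D W A" "v \<in> homs D W B"
  shows "mat22 D a (Zero D B A') (Zero D A B') b \<cdot> col D u v = col D (a \<cdot> u) (b \<cdot> v)"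
  using assms homs_obj[OF assms(1)] homs_obj[OF assms(2)] by (simp add: in_homs mat22_col)

lemma row_mat:
  assumes "a \<in> homs D A A'" "b \<in> homs D B B'" "u \<in> homs D A' W" "v \<in> homs D B' W"
  shows "row D u v \<cdot> mat22 D a (Zero D B A') (Zero D A B') b = row D (u \<cdot> a) (v \<cdot> b)"
  using assms homs_obj[OF assms(1)] homs_obj[OF assms(2)] by (simp add: in_homs row_mat22)

lemma cpx_dsum:
  assumes X: "cpx D (Suc n) X" and Y: "cpx D (Suc n) Y"
  shows "cpx D (Suc n) (dsum_cplx D (n + 2) X Y)"
proof (rule cpxI)
  note [simp] = cpx_type[OF X] cpx_type[OF Y]
  fix i assume "Suc i < Suc n"
  then show "df (dsum_cplx D (n + 2) X Y) (Suc i) \<cdot> df (dsum_cplx D (n + 2) X Y) i =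
     Zero D (ob (dsum_cplx D (n + 2) X Y) i) (ob (dsum_cplx D (n + 2) X Y) (Suc (Suc i)))"
    by (simp add: mat22_mat22 mat22_Zero del: add_2_eq_Suc')
next
  note [simp] = cpx_type[OF X] cpx_type[OF Y]
  fix i assume "i < Suc n"
  then show "df (dsum_cplx D (n + 2) X Y) i \<in> homs D (ob (dsum_cplx D (n + 2) X Y) i) (ob (dsum_cplx D (n + 2) X Y) (Suc i))"
    by (simp add: in_homs del: add_2_eq_Suc')
next
  note [simp] = cpx_type[OF X] cpx_type[OF Y]
  fix i assume "i \<le> Suc n"
  then show "ob (dsum_cplx D (n + 2) X Y) i \<in> Obj D"
    by (simp add: in_homs del: add_2_eq_Suc')
qed (auto simp: dsum_cplx_def)

text \<open>Arrows out of a direct sum are rows and arrows into it are columns, so exactness is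
  tested in each component separately.\<close>

lemma nex_dsum:
  assumes "nex D n X" and "nex D n Y"
  shows "nex D n (dsum_cplx D (n + 2) X Y)"
proof -
  let ?S = "dsum_cplx D (n + 2) X Y"
  have X: "cpx D (Suc n) X" "contraX D n X" "covX D n X" using assms(1) by (auto simp: nex_def)
  have Y: "cpx D (Suc n) Y" "contraX D n Y" "covX D n Y" using assms(2) by (auto simp: nex_def)
  note [simp] = cpx_type[OF X(1)] cpx_type[OF Y(1)]
  note [simp del] = add_2_eq_Suc'
  have d: "i \<le> n \<Longrightarrow> df X i \<in> homs D (ob X i) (ob X (Suc i))" "i \<le> n \<Longrightarrow> df Y i \<in> homs D (ob Y i) (ob Y (Suc i))" for i
    by (auto simp: in_homs)
  have r: "row D u v \<cdot> df ?S i = row D (u \<cdot> df X i) (v \<cdot> df Y i)"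
    if "i \<le> n" "u \<in> homs D (ob X (Suc i)) W" "v \<in> homs D (ob Y (Suc i)) W" for i u v W
    using row_mat[OF d(1)[OF that(1)] d(2)[OF that(1)] that(2,3)] that(1) by simp
  have c: "df ?S i \<cdot> col D u v = col D (df X i \<cdot> u) (df Y i \<cdot> v)"
    if "i \<le> n" "u \<in> homs D W (ob X i)" "v \<in> homs D W (ob Y i)" for i u v W
    using mat_col[OF d(1)[OF that(1)] d(2)[OF that(1)] that(2,3)] that(1) by simp
  have "contraX D n ?S"
    unfolding contraX_def
  proof (intro allI conjI ballI impI)
    fix W x y assume x: "x \<in> homs D (ob ?S (Suc n)) W" and y: "y \<in> homs D (ob ?S (Suc n)) W" and e: "x \<cdot> df ?S n = y \<cdot> df ?S n"
    obtain u v where u: "u \<in> homs D (ob X (Suc n)) W" "v \<in> homs D (ob Y (Suc n)) W" "x = row D u v"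
      by (rule row_cases[of x "ob X (Suc n)" "ob Y (Suc n)" W]) (use x in auto)
    obtain u' v' where u': "u' \<in> homs D (ob X (Suc n)) W" "v' \<in> homs D (ob Y (Suc n)) W" "y = row D u' v'"
      by (rule row_cases[of y "ob X (Suc n)" "ob Y (Suc n)" W]) (use y in auto)
    note [simp] = u(1,2)[unfolded in_homs] u'(1,2)[unfolded in_homs]
    have "row D (u \<cdot> df X n) (v \<cdot> df Y n) = row D (u' \<cdot> df X n) (v' \<cdot> df Y n)"
      using e r[OF order_refl u(1,2)] r[OF order_refl u'(1,2)] u(3) u'(3) by simp
    then have "u \<cdot> df X n = u' \<cdot> df X n" "v \<cdot> df Y n = v' \<cdot> df Y n" by (auto simp: row_inj)
    then show "x = y" using contraX_epi[OF X(2) u(1) u'(1)] contraX_epi[OF Y(2) u(2) u'(2)] u(3) u'(3) by simp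
  next
    fix W x y i assume i: "i < n" and x: "x \<in> homs D (ob ?S (Suc i)) W" and y: "y \<in> homs D (ob ?S (Suc i)) W" and e: "x \<cdot> df ?S i = y \<cdot> df ?S i"
    have i': "i \<le> n" "Suc i \<le> n" using i by auto
    obtain u v where u: "u \<in> homs D (ob X (Suc i)) W" "v \<in> homs D (ob Y (Suc i)) W" "x = row D u v"
      by (rule row_cases[of x "ob X (Suc i)" "ob Y (Suc i)" W]) (use x i in auto)
    obtain u' v' where u': "u' \<in> homs D (ob X (Suc i)) W" "v' \<in> homs D (ob Y (Suc i)) W" "y = row D u' v'"
      by (rule row_cases[of y "ob X (Suc i)" "ob Y (Suc i)" W]) (use y i in auto)
    note [simp] = u(1,2)[unfolded in_homs] u'(1,2)[unfolded in_homs]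
    have "row D (u \<cdot> df X i) (v \<cdot> df Y i) = row D (u' \<cdot> df X i) (v' \<cdot> df Y i)"
      using e r[OF i'(1) u(1,2)] r[OF i'(1) u'(1,2)] u(3) u'(3) by simp
    then have "u \<cdot> df X i = u' \<cdot> df X i" "v \<cdot> df Y i = v' \<cdot> df Y i" using i by (auto simp: row_inj)
    then obtain s t where s: "s \<in> homs D (ob X (Suc (Suc i))) W" "u = u' \<boxplus> (s \<cdot> df X (Suc i))"
      and t: "t \<in> homs D (ob Y (Suc (Suc i))) W" "v = v' \<boxplus> (t \<cdot> df Y (Suc i))"
      using contraX_diff[OF X(2) i u(1) u'(1)] contraX_diff[OF Y(2) i u(2) u'(2)] by metis
    note [simp] = s(1)[unfolded in_homs] t(1)[unfolded in_homs]
    have "row D (u' \<boxplus> (s \<cdot> df X (Suc i))) (v' \<boxplus> (t \<cdot> df Y (Suc i))) = y \<boxplus> (row D s t \<cdot> df ?S (Suc i))"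
      using r[OF i'(2) s(1) t(1)] u'(3) i by (simp add: row_plus)
    then have "x = y \<boxplus> (row D s t \<cdot> df ?S (Suc i))" using u(3) s(2) t(2) by simp
    moreover have "row D s t \<in> homs D (ob ?S (Suc (Suc i))) W" using i by (simp add: in_homs)
    ultimately show "\<exists>t\<in>homs D (ob ?S (Suc (Suc i))) W. x = y \<boxplus> (t \<cdot> df ?S (Suc i))" by blast
  qed
  moreover have "covX D n ?S"
    unfolding covX_def
  proof (intro allI conjI ballI impI)
    fix W x y assume x: "x \<in> homs D W (ob ?S 0)" and y: "y \<in> homs D W (ob ?S 0)" and e: "df ?S 0 \<cdot> x = df ?S 0 \<cdot> y"
    obtain u v where u: "u \<in> homs D W (ob X 0)" "v \<in> homs D W (ob Y 0)" "x = col D u v"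
      by (rule col_cases[of x W "ob X 0" "ob Y 0"]) (use x in auto)
    obtain u' v' where u': "u' \<in> homs D W (ob X 0)" "v' \<in> homs D W (ob Y 0)" "y = col D u' v'"
      by (rule col_cases[of y W "ob X 0" "ob Y 0"]) (use y in auto)
    note [simp] = u(1,2)[unfolded in_homs] u'(1,2)[unfolded in_homs]
    have "col D (df X 0 \<cdot> u) (df Y 0 \<cdot> v) = col D (df X 0 \<cdot> u') (df Y 0 \<cdot> v')"
      using e c[OF le0 u(1,2)] c[OF le0 u'(1,2)] u(3) u'(3) by simp
    then have "df X 0 \<cdot> u = df X 0 \<cdot> u'" "df Y 0 \<cdot> v = df Y 0 \<cdot> v'" by (auto simp: col_inj)
    then show "x = y" using covX_mono[OF X(3) u(1) u'(1)] covX_mono[OF Y(3) u(2) u'(2)] u(3) u'(3) by simp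
  next
    fix W x y i assume i: "i < n" and x: "x \<in> homs D W (ob ?S (Suc i))" and y: "y \<in> homs D W (ob ?S (Suc i))" and e: "df ?S (Suc i) \<cdot> x = df ?S (Suc i) \<cdot> y"
    have i': "i \<le> n" "Suc i \<le> n" using i by auto
    obtain u v where u: "u \<in> homs D W (ob X (Suc i))" "v \<in> homs D W (ob Y (Suc i))" "x = col D u v"
      by (rule col_cases[of x W "ob X (Suc i)" "ob Y (Suc i)"]) (use x i in auto)
    obtain u' v' where u': "u' \<in> homs D W (ob X (Suc i))" "v' \<in> homs D W (ob Y (Suc i))" "y = col D u' v'"
      by (rule col_cases[of y W "ob X (Suc i)" "ob Y (Suc i)"]) (use y i in auto)
    note [simp] = u(1,2)[unfolded in_homs] u'(1,2)[unfolded in_homs]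
    have "col D (df X (Suc i) \<cdot> u) (df Y (Suc i) \<cdot> v) = col D (df X (Suc i) \<cdot> u') (df Y (Suc i) \<cdot> v')"
      using e c[OF i'(2) u(1,2)] c[OF i'(2) u'(1,2)] u(3) u'(3) by simp
    then have "df X (Suc i) \<cdot> u = df X (Suc i) \<cdot> u'" "df Y (Suc i) \<cdot> v = df Y (Suc i) \<cdot> v'" using i by (auto simp: col_inj)
    then obtain s t where s: "s \<in> homs D W (ob X i)" "u = u' \<boxplus> (df X i \<cdot> s)"
      and t: "t \<in> homs D W (ob Y i)" "v = v' \<boxplus> (df Y i \<cdot> t)"
      using covX_diff[OF X(3) i u(1) u'(1)] covX_diff[OF Y(3) i u(2) u'(2)] by metis
    note [simp] = s(1)[unfolded in_homs] t(1)[unfolded in_homs]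
    have "col D (u' \<boxplus> (df X i \<cdot> s)) (v' \<boxplus> (df Y i \<cdot> t)) = y \<boxplus> (df ?S i \<cdot> col D s t)"
      using c[OF i'(1) s(1) t(1)] u'(3) i by (simp add: col_plus)
    then have "x = y \<boxplus> (df ?S i \<cdot> col D s t)" using u(3) s(2) t(2) by simp
    moreover have "col D s t \<in> homs D W (ob ?S i)" using i by (simp add: in_homs)
    ultimately show "\<exists>t\<in>homs D W (ob ?S i). x = y \<boxplus> (df ?S i \<cdot> t)" by blast
  qed
  ultimately show ?thesis using cpx_dsum[OF X(1) Y(1)] by (simp add: nex_def)
qed

lemma emap_col:
  assumes X: "cpx D (Suc n) X" and Y: "cpx D (Suc n) Y" and T: "cpx D (Suc n) T"
    and f: "emap D n T X a c" and g: "emap D n T Y a' c'"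
  shows "emap D n T (dsum_cplx D (n + 2) X Y) (col D a a') (col D c c')"
proof -
  note [simp] = cpx_type[OF X(1)] cpx_type[OF Y(1)] cpx_type[OF T]
  note [simp del] = add_2_eq_Suc'
  obtain f where f: "cmap D (Suc n) T X f" "f 0 = a" "f (Suc n) = c" using emapE[OF f] .
  obtain g where g: "cmap D (Suc n) T Y g" "g 0 = a'" "g (Suc n) = c'" using emapE[OF g] .
  note [simp] = cmap_type[OF f(1)] cmap_type[OF g(1)]
  have "cmap D (Suc n) T (dsum_cplx D (n + 2) X Y) (\<lambda>i\<in>{..<Suc (Suc n)}. col D (f i) (g i))"
  proof (rule cmapI)
    fix i assume "i \<le> Suc n" then show "col D (f i) (g i) \<in> homs D (ob T i) (ob (dsum_cplx D (n + 2) X Y) i)"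
      by (simp add: in_homs)
  next
    fix i assume i: "i < Suc n"
    then show "col D (f (Suc i)) (g (Suc i)) \<cdot> df T i = df (dsum_cplx D (n + 2) X Y) i \<cdot> col D (f i) (g i)"
      using cmapD(2)[OF f(1) i] cmapD(2)[OF g(1) i] by (simp add: mat22_col col_Comp)
  qed
  then show ?thesis using emapI f g by fastforce
qed

lemma emap_row:
  assumes X: "cpx D (Suc n) X" and Y: "cpx D (Suc n) Y" and T: "cpx D (Suc n) T"
    and f: "emap D n X T a c" and g: "emap D n Y T a' c'"
  shows "emap D n (dsum_cplx D (n + 2) X Y) T (row D a a') (row D c c')"
proof -
  note [simp] = cpx_type[OF X(1)] cpx_type[OF Y(1)] cpx_type[OF T]
  note [simp del] = add_2_eq_Suc'
  obtain f where f: "cmap D (Suc n) X T f" "f 0 = a" "f (Suc n) = c" using emapE[OF f] .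
  obtain g where g: "cmap D (Suc n) Y T g" "g 0 = a'" "g (Suc n) = c'" using emapE[OF g] .
  note [simp] = cmap_type[OF f(1)] cmap_type[OF g(1)]
  have "cmap D (Suc n) (dsum_cplx D (n + 2) X Y) T (\<lambda>i\<in>{..<Suc (Suc n)}. row D (f i) (g i))"
  proof (rule cmapI)
    fix i assume "i \<le> Suc n" then show "row D (f i) (g i) \<in> homs D (ob (dsum_cplx D (n + 2) X Y) i) (ob T i)"
      by (simp add: in_homs)
  next
    fix i assume i: "i < Suc n"
    then show "row D (f (Suc i)) (g (Suc i)) \<cdot> df (dsum_cplx D (n + 2) X Y) i = df T i \<cdot> row D (f i) (g i)"
      using cmapD(2)[OF f(1) i] cmapD(2)[OF g(1) i] by (simp add: row_mat22 Comp_row)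
  qed
  then show ?thesis using emapI f g by fastforce
qed

lemma emap_zero: "cpx D (Suc n) X \<Longrightarrow> cpx D (Suc n) Y \<Longrightarrow> emap D n X Y (Zero D (ob X 0) (ob Y 0)) (Zero D (ob X (Suc n)) (ob Y (Suc n)))"
  using emapI[OF cmap_zero, of n X Y] by simp

lemma row_Ide_Zero: "A \<in> Obj D \<Longrightarrow> B \<in> Obj D \<Longrightarrow> row D (Ide D A) (Zero D B A) = Pr1 (biprod D A B)"
  "A \<in> Obj D \<Longrightarrow> B \<in> Obj D \<Longrightarrow> row D (Zero D A B) (Ide D B) = Pr2 (biprod D A B)"
  by (simp_all add: row_def)

lemma col_row_Ide: "A \<in> Obj D \<Longrightarrow> B \<in> Obj D \<Longrightarrow>
    col D (row D (Ide D A) (Zero D B A)) (row D (Zero D A B) (Ide D B)) = Ide D (dsum D A B)"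
  using col_eta[of "Ide D (dsum D A B)" A B] by (simp add: row_Ide_Zero)

text \<open>Meant for sums with a trivial complex whose right end is a zero object: the right end of
  the sum is then unchanged up to isomorphism.\<close>

lemma iso_col:
  assumes A: "A \<in> Obj D"
  shows "is_iso_arr D (col D (Ide D A) (Zero D A (zero_obj D)))" "is_iso_arr D (col D (Zero D A (zero_obj D)) (Ide D A))"
proof -
  have z: "Ide D (zero_obj D) = Zero D (zero_obj D) (zero_obj D)" by (rule from_zero_obj) (simp add: in_homs)
  show "is_iso_arr D (col D (Ide D A) (Zero D A (zero_obj D)))"
    by (rule isoI[of _ A "dsum D A (zero_obj D)" "row D (Ide D A) (Zero D (zero_obj D) A)"])
      (use A col_row_Ide[OF A zero_obj_Obj] z in \<open>simp_all add: in_homs row_col col_Comp row_Zero\<close>)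
  show "is_iso_arr D (col D (Zero D A (zero_obj D)) (Ide D A))"
    by (rule isoI[of _ A "dsum D (zero_obj D) A" "row D (Zero D (zero_obj D) A) (Ide D A)"])
      (use A col_row_Ide[OF zero_obj_Obj A] z in \<open>simp_all add: in_homs row_col col_Comp row_Zero\<close>)
qed

text \<open>An arrow annihilated by a differential is zero unless it sits next to the identity of
  \<open>B\<close>, and then it factors through that identity.\<close>

lemma nex_triv:
  assumes B: "B \<in> Obj D" and i: "i \<le> n"
  shows "nex D n (triv D n i B)"
proof -
  let ?T = "triv D n i B"
  note s = triv_simps[where i = i and n = n and D = D and X = B]
  have o: "ob ?T j \<in> Obj D" if "j \<le> Suc n" for j using s(1,2)[OF that] B by (cases "j = i \<or> j = Suc i") auto
  have d: "df ?T j \<in> homs D (ob ?T j) (ob ?T (Suc j))" if "j \<le> n" for j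
  proof (cases "j = i")
    case True then show ?thesis using s(1)[of j] s(1)[of "Suc j"] s(3) that B by (simp add: in_homs)
  next
    case False then show ?thesis using s(4)[of j] o that by (simp add: in_homs)
  qed
  have T: "cpx D (Suc n) ?T"
  proof (rule cpxI)
    fix j assume j: "Suc j < Suc n"
    show "df ?T (Suc j) \<cdot> df ?T j = Zero D (ob ?T j) (ob ?T (Suc (Suc j)))"
    proof (cases "j = i")
      case True
      then have "df ?T (Suc j) = Zero D (ob ?T (Suc j)) (ob ?T (Suc (Suc j)))" using s(4)[of "Suc j"] j by simp
      then show ?thesis using d[of j] o j by (simp add: in_homs)
    next
      case False
      then have "df ?T j = Zero D (ob ?T j) (ob ?T (Suc j))" using s(4)[of "j"] j by simp
      then show ?thesis using d[of "Suc j"] o j by (simp add: in_homs)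
    qed
  qed (use o d in \<open>auto simp: triv_def Let_def\<close>)
  have "contraX D n ?T" unfolding contraX_iff[OF T]
  proof (intro allI conjI ballI impI)
    fix W x assume x: "x \<in> homs D (ob ?T (Suc n)) W" and e: "x \<cdot> df ?T n = Zero D (ob ?T n) W"
    show "x = Zero D (ob ?T (Suc n)) W"
    proof (cases "i = n")
      case True then show ?thesis using x e s(1)[of n] s(1)[of "Suc n"] s(3) by (simp add: in_homs)
    next
      case False then show ?thesis using x s(2)[of "Suc n"] i from_zero_obj by simp
    qed
  next
    fix W x j assume j: "j < n" and x: "x \<in> homs D (ob ?T (Suc j)) W" and e: "x \<cdot> df ?T j = Zero D (ob ?T j) W"
    have W: "W \<in> Obj D" using homs_obj[OF x] by simp
    have "x = Zero D (ob ?T (Suc j)) W \<or> Suc j = i"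
    proof (cases "j = i")
      case True then show ?thesis using x e s(1)[of j] s(1)[of "Suc j"] s(3) j by (simp add: in_homs)
    next
      case False then show ?thesis using x s(2)[of "Suc j"] j from_zero_obj by auto
    qed
    then show "\<exists>t\<in>homs D (ob ?T (Suc (Suc j))) W. x = t \<cdot> df ?T (Suc j)"
    proof
      assume "x = Zero D (ob ?T (Suc j)) W"
      then show ?thesis using d[of "Suc j"] j o W by (intro bexI[of _ "Zero D (ob ?T (Suc (Suc j))) W"]) (auto simp: in_homs)
    next
      assume "Suc j = i"
      then show ?thesis using x s(1)[of "Suc j"] s(1)[of "Suc (Suc j)"] s(3) j by (intro bexI[of _ x]) (auto simp: in_homs)
    qed
  qed
  moreover have "covX D n ?T" unfolding covX_iff[OF T]
  proof (intro allI conjI ballI impI)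
    fix W x assume x: "x \<in> homs D W (ob ?T 0)" and e: "df ?T 0 \<cdot> x = Zero D W (ob ?T (Suc 0))"
    show "x = Zero D W (ob ?T 0)"
    proof (cases "i = 0")
      case True then show ?thesis using x e s(1)[of 0] s(1)[of "Suc 0"] s(3) by (simp add: in_homs)
    next
      case False then show ?thesis using x s(2)[of 0] i to_zero_obj by simp
    qed
  next
    fix W x j assume j: "j < n" and x: "x \<in> homs D W (ob ?T (Suc j))" and e: "df ?T (Suc j) \<cdot> x = Zero D W (ob ?T (Suc (Suc j)))"
    have W: "W \<in> Obj D" using homs_obj[OF x] by simp
    have "x = Zero D W (ob ?T (Suc j)) \<or> j = i"
    proof (cases "Suc j = i")
      case True then show ?thesis using x e s(1)[of "Suc j"] s(1)[of "Suc (Suc j)"] s(3) j by (simp add: in_homs)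
    next
      case False then show ?thesis using x s(2)[of "Suc j"] j to_zero_obj by auto
    qed
    then show "\<exists>t\<in>homs D W (ob ?T j). x = df ?T j \<cdot> t"
    proof
      assume "x = Zero D W (ob ?T (Suc j))"
      then show ?thesis using d[of j] j o W by (intro bexI[of _ "Zero D W (ob ?T j)"]) (auto simp: in_homs)
    next
      assume "j = i"
      then show ?thesis using x s(1)[of j] s(1)[of "Suc j"] s(3) j by (intro bexI[of _ x]) (auto simp: in_homs)
    qed
  qed
  ultimately show ?thesis using T by (simp add: nex_def)
qed

end

section \<open>The extension groups of an \<open>n\<close>-exact structure\<close>

text \<open>Adds what direct sums call for: recognising a member from its first two degrees
  (\<open>weak01\<close>), a starting point (\<open>zero_mem\<close>) and the composition of
  admissible monomorphisms.\<close>

locale nxs = nx +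
  assumes weak01: "X \<in> XX \<Longrightarrow> nex D n Y \<Longrightarrow> cmap D (Suc n) Y X f \<Longrightarrow> is_iso_arr D (f 0) \<Longrightarrow> is_iso_arr D (f (Suc 0)) \<Longrightarrow> Y \<in> XX"
    and zero_mem: "zero_cplx D n \<in> XX"
    and monos_comp: "closed_under_comp D (admissible_monos XX)"
begin

lemma zero_cplx_simps: "i \<le> Suc n \<Longrightarrow> ob (zero_cplx D n) i = zero_obj D"
  by (simp add: zero_cplx_def)

lemma iso_zero_obj: "is_iso_arr D (Zero D (zero_obj D) (zero_obj D))"
proof -
  have "Ide D (zero_obj D) = Zero D (zero_obj D) (zero_obj D)" by (rule from_zero_obj) (simp add: in_homs)
  then show ?thesis using iso_Ide[OF zero_obj_Obj] by simp
qed

text \<open>The zero map between a trivial complex and the zero complex has an isomorphism of zero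
  objects at one end, so the closure lemmas apply.\<close>

lemma triv_mem:
  assumes B: "B \<in> Obj D"
  shows "triv D n 0 B \<in> XX" "triv D n n B \<in> XX"
proof -
  have t: "nex D n (triv D n 0 B)" "nex D n (triv D n n B)" using nex_triv[OF B] by auto
  then have c: "cpx D (Suc n) (triv D n 0 B)" "cpx D (Suc n) (triv D n n B)" by (auto simp: nex_def)
  show "triv D n 0 B \<in> XX"
    by (rule closed_push[OF zero_mem t(1) emap_zero[OF cp[OF zero_mem] c(1)]])
      (use n iso_zero_obj in \<open>simp add: zero_cplx_simps triv_simps\<close>)
  show "triv D n n B \<in> XX"
    by (rule closed_pull[OF zero_mem t(2) emap_zero[OF c(2) cp[OF zero_mem]]])
      (use n iso_zero_obj in \<open>simp add: zero_cplx_simps triv_simps\<close>)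
qed

text \<open>The first differential of \<open>X \<oplus> Y\<close> is the composite of those of
  \<open>X \<oplus> triv\<^sub>0(Y\<^sub>0)\<close> and
  \<open>triv\<^sub>0(X\<^sub>1) \<oplus> Y\<close>. These two are members by
  \<open>closed_push\<close>, as their right ends only gain a zero object. By (E1) the composite
  begins some member \<open>Z\<close>, and \<open>X \<oplus> Y\<close> maps to \<open>Z\<close> with
  identities in degrees 0 and 1.\<close>

lemma dsum_mem:
  assumes X: "X \<in> XX" and Y: "Y \<in> XX"
  shows "dsum_cplx D (n + 2) X Y \<in> XX"
proof -
  note [simp] = cpx_type[OF cp[OF X]] cpx_type[OF cp[OF Y]]
  note [simp del] = add_2_eq_Suc'
  let ?T1 = "triv D n 0 (ob Y 0)" and ?T2 = "triv D n 0 (ob X (Suc 0))"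
  let ?S1 = "dsum_cplx D (n + 2) X ?T1" and ?S2 = "dsum_cplx D (n + 2) ?T2 Y" and ?S = "dsum_cplx D (n + 2) X Y"
  have T: "nex D n ?T1" "nex D n ?T2" by (simp_all add: nex_triv)
  then have cT: "cpx D (Suc n) ?T1" "cpx D (Suc n) ?T2" by (auto simp: nex_def)
  have oT: "ob ?T1 (Suc n) = zero_obj D" "ob ?T2 (Suc n) = zero_obj D" using n by (auto simp: triv_simps)
  have tT: "ob ?T1 0 = ob Y 0" "ob ?T1 (Suc 0) = ob Y 0" "df ?T1 0 = Ide D (ob Y 0)"
    "ob ?T2 0 = ob X (Suc 0)" "ob ?T2 (Suc 0) = ob X (Suc 0)" "df ?T2 0 = Ide D (ob X (Suc 0))"
    by (auto simp: triv_simps)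
  have S1: "?S1 \<in> XX"
    by (rule closed_push[OF X nex_dsum[OF nex[OF X] T(1)] emap_col[OF cp[OF X] cT(1) cp[OF X] emap_id[OF cp[OF X]] emap_zero[OF cp[OF X] cT(1)]]])
       (simp add: oT iso_col)
  have S2: "?S2 \<in> XX"
    by (rule closed_push[OF Y nex_dsum[OF T(2) nex[OF Y]] emap_col[OF cT(2) cp[OF Y] cp[OF Y] emap_zero[OF cp[OF Y] cT(2)] emap_id[OF cp[OF Y]]]])
       (simp add: oT iso_col)
  have "df ?S2 0 \<cdot> df ?S1 0 = df ?S 0"
    by (simp add: tT mat22_mat22)
  moreover have "Cod D (df ?S1 0) = Dom D (df ?S2 0)" by (simp add: tT)
  ultimately have "df ?S 0 \<in> admissible_monos XX"
    using monos_comp S1 S2 unfolding closed_under_comp_def admissible_monos_def by (metis imageI)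
  then obtain Z where Z: "Z \<in> XX" "df Z 0 = df ?S 0" by (auto simp: admissible_monos_def)
  have S: "nex D n ?S" by (rule nex_dsum[OF nex[OF X] nex[OF Y]])
  then have cS: "cpx D (Suc n) ?S" "contraX D n ?S" by (auto simp: nex_def)
  have o: "ob Z 0 = ob ?S 0" "ob Z (Suc 0) = ob ?S (Suc 0)"
    using Z(2) cpx_type(3,4)[OF cp[OF Z(1)], of 0] cpx_type(3,4)[OF cS(1), of 0] by (metis zero_less_Suc)+
  have oS: "ob ?S 0 \<in> Obj D" "ob ?S (Suc 0) \<in> Obj D" using cpxD(1)[OF cS(1)] by auto
  have e: "Ide D (ob ?S (Suc 0)) \<cdot> df ?S 0 = df Z 0 \<cdot> Ide D (ob ?S 0)"
    using Z(2) cpx_type(2,3,4)[OF cS(1), of 0] by simp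
  have i: "Ide D (ob ?S 0) \<in> homs D (ob ?S 0) (ob Z 0)" "Ide D (ob ?S (Suc 0)) \<in> homs D (ob ?S (Suc 0)) (ob Z (Suc 0))"
    unfolding o using oS by (auto intro: Ide_in)
  obtain f where f: "cmap D (Suc n) ?S Z f" "f 0 = Ide D (ob ?S 0)" "f (Suc 0) = Ide D (ob ?S (Suc 0))"
    by (rule lift_from[OF cS cp[OF Z(1)] le0 disjI1[OF refl] i e])
  show ?thesis by (rule weak01[OF Z(1) S f(1)]) (use f oS iso_Ide in simp_all)
qed

section \<open>Pushout and pullback of classes\<close>

abbreviation "cl \<equiv> htpy_class D n"
abbreviation "pu \<equiv> X_push D n XX"
abbreviation "pl \<equiv> X_pull D n XX"
abbreviation "EC \<equiv> ext_classes D n XX"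
abbreviation "bs \<equiv> baer_sum D n XX"

lemma ECI: "X \<in> XX \<Longrightarrow> cl X \<in> EC (ob X (Suc n)) (ob X 0)"
  using cp by (auto simp: ext_classes_def ends_complexes_def cpx_def)

lemma ECE:
  assumes "E \<in> EC C A"
  obtains X where "X \<in> XX" "E = cl X" "ob X 0 = A" "ob X (Suc n) = C"
  using assms by (auto simp: ext_classes_def ends_complexes_def)

lemma EC_obj: "E \<in> EC C A \<Longrightarrow> A \<in> Obj D" "E \<in> EC C A \<Longrightarrow> C \<in> Obj D"
  using cpxD(1)[OF cp] by (metis ECE le0 , metis ECE order_refl)

lemma cl_ends:
  assumes "X \<in> XX" "Y \<in> XX" "cl X = cl Y"
  shows "ob X 0 = ob Y 0" "ob X (Suc n) = ob Y (Suc n)"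
  using eq_class[OF assms(1,2)] assms(3) emap_type[of D n X Y] cpxD(1)[OF cp[OF assms(1)]] by fastforce+

text \<open>Evaluates the definite description: a chain map with an identity at the right end is a
  pushout diagram by \<open>po_pb_elt\<close>, and \<open>push_unique\<close> makes the resulting
  class independent of all choices.\<close>

lemma pu_eq:
  assumes X: "X \<in> XX" and Y: "Y \<in> XX" and e: "emap D n X Y a (Ide D (ob X (Suc n)))"
  shows "pu a (cl X) = cl Y"
  unfolding X_push_def
proof (rule the_equality)
  note [simp] = cpx_type[OF cp[OF X]]
  obtain f where f: "cmap D (Suc n) X Y f" "f 0 = a" "f (Suc n) = Ide D (ob X (Suc n))" using emapE[OF e] .
  have o: "ob Y (Suc n) = ob X (Suc n)" "Cod D a = ob Y 0" using emap_type[OF e] by auto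
  have "po_elt D n (segment 0 (n + 1) X) (segment 0 (n + 1) Y) (segment_map 0 (n + 1) f)"
    using po_pb_elt(1)[OF X Y f(1,3)] by (subst po_elt_cong[OF n, where X' = X and Y' = Y and f' = f]) (auto simp: segment_def segment_map_def)
  then have "n_pushout_diagram D n (segment 0 (n + 1) X) (segment 0 (n + 1) Y) (segment_map 0 (n + 1) f)"
    unfolding n_pushout_iff[OF n] using segment_cpx[OF cp[OF X]] segment_cpx[OF cp[OF Y]] segment_cmap[OF f(1)] by auto
  then show "\<exists>X'\<in>XX. \<exists>Y'\<in>XX \<inter> ends_complexes D n (Cod D a) (ob X' (n + 1)). \<exists>f\<in>chain_maps D (n + 2) X' Y'.
         cl X = cl X' \<and> cl Y = cl Y' \<and> f 0 = a \<and> f (n + 1) = Ide D (ob X' (n + 1)) \<and>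
         n_pushout_diagram D n (segment 0 (n + 1) X') (segment 0 (n + 1) Y') (segment_map 0 (n + 1) f)"
    using X Y cp[OF Y] f o unfolding chain_maps_cmap ends_complexes_def complexes_cpx
    by - (rule bexI[of _ X], rule bexI[of _ Y], rule bexI[of _ f], auto simp: cmap_def)
next
  fix E' assume "\<exists>X'\<in>XX. \<exists>Y'\<in>XX \<inter> ends_complexes D n (Cod D a) (ob X' (n + 1)). \<exists>f\<in>chain_maps D (n + 2) X' Y'.
         cl X = cl X' \<and> E' = cl Y' \<and> f 0 = a \<and> f (n + 1) = Ide D (ob X' (n + 1)) \<and>
         n_pushout_diagram D n (segment 0 (n + 1) X') (segment 0 (n + 1) Y') (segment_map 0 (n + 1) f)"
  then obtain X' Y' f where *: "X' \<in> XX" "Y' \<in> XX" "cl X = cl X'" "E' = cl Y'" "cmap D (Suc n) X' Y' f" "f 0 = a" "f (Suc n) = Ide D (ob X' (Suc n))"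
    by (auto simp: cmap_def)
  have o: "ob X' 0 = ob X 0" "ob X' (Suc n) = ob X (Suc n)" using cl_ends[OF X *(1,3)] by auto
  have "emap D n X X' (Ide D (ob X 0)) (Ide D (ob X (Suc n)))" using eq_class[OF X *(1)] *(3) by simp
  from ecomp[OF X *(1,2) this emapI[OF *(5)]] have "emap D n X Y' a (Ide D (ob X (Suc n)))"
    using *(6,7) o emap_type[OF e] cpxD(1)[OF cp[OF X]] by simp
  then show "E' = cl Y" using push_unique[OF X *(2) Y _ e] *(4) by simp
qed

lemma pl_eq:
  assumes X: "X \<in> XX" and Y: "Y \<in> XX" and e: "emap D n Y X (Ide D (ob X 0)) c"
  shows "pl c (cl X) = cl Y"
  unfolding X_pull_def
proof (rule the_equality)
  note [simp] = cpx_type[OF cp[OF X]]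
  obtain f where f: "cmap D (Suc n) Y X f" "f 0 = Ide D (ob X 0)" "f (Suc n) = c" using emapE[OF e] .
  have o: "ob Y 0 = ob X 0" "Dom D c = ob Y (Suc n)" using emap_type[OF e] by auto
  have "pb_elt D n (segment 1 (n + 1) Y) (segment 1 (n + 1) X) (segment_map 1 (n + 1) f)"
    using pb_po_elt(2)[OF Y X f(1)] f(2) o by simp
  then have "n_pullback_diagram D n (segment 1 (n + 1) Y) (segment 1 (n + 1) X) (segment_map 1 (n + 1) f)"
    unfolding n_pullback_iff[OF n] using segment_cpx[OF cp[OF X]] segment_cpx[OF cp[OF Y]] segment_cmap[OF f(1)] by auto
  then show "\<exists>X'\<in>XX. \<exists>Y'\<in>XX \<inter> ends_complexes D n (ob X' 0) (Dom D c). \<exists>f\<in>chain_maps D (n + 2) Y' X'.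
         cl X = cl X' \<and> cl Y = cl Y' \<and> f 0 = Ide D (ob X' 0) \<and> f (n + 1) = c \<and>
         n_pullback_diagram D n (segment 1 (n + 1) Y') (segment 1 (n + 1) X') (segment_map 1 (n + 1) f)"
    using X Y cp[OF Y] f o unfolding chain_maps_cmap ends_complexes_def complexes_cpx
    by - (rule bexI[of _ X], rule bexI[of _ Y], rule bexI[of _ f], auto simp: cmap_def)
next
  fix E' assume "\<exists>X'\<in>XX. \<exists>Y'\<in>XX \<inter> ends_complexes D n (ob X' 0) (Dom D c). \<exists>f\<in>chain_maps D (n + 2) Y' X'.
         cl X = cl X' \<and> E' = cl Y' \<and> f 0 = Ide D (ob X' 0) \<and> f (n + 1) = c \<and>
         n_pullback_diagram D n (segment 1 (n + 1) Y') (segment 1 (n + 1) X') (segment_map 1 (n + 1) f)"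
  then obtain X' Y' f where *: "X' \<in> XX" "Y' \<in> XX" "cl X' = cl X" "E' = cl Y'" "cmap D (Suc n) Y' X' f" "f 0 = Ide D (ob X' 0)" "f (Suc n) = c"
    by (auto simp: cmap_def)
  have o: "ob X' 0 = ob X 0" "ob X' (Suc n) = ob X (Suc n)" using cl_ends[OF *(1) X *(3)] by auto
  have "emap D n X' X (Ide D (ob X 0)) (Ide D (ob X (Suc n)))" using eq_class[OF *(1) X] *(3) o by simp
  from ecomp[OF *(2,1) X emapI[OF *(5)] this] have "emap D n Y' X (Ide D (ob X 0)) c"
    using *(6,7) o emap_type[OF e] cpxD(1)[OF cp[OF X]] by simp
  then show "E' = cl Y" using pull_unique[OF X *(2) Y _ e] *(4) by simp
qed

lemma pu_obtain:
  assumes X: "X \<in> XX" and a: "a \<in> homs D (ob X 0) B"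
  obtains Y where "Y \<in> XX" "emap D n X Y a (Ide D (ob X (Suc n)))" "pu a (cl X) = cl Y" "ob Y 0 = B" "ob Y (Suc n) = ob X (Suc n)"
proof -
  obtain Y where Y: "Y \<in> XX" "emap D n X Y a (Ide D (ob X (Suc n)))" using push_ex[OF X a] by auto
  then show thesis using that[OF Y pu_eq[OF X Y]] a emap_type[OF Y(2)] cpxD(1)[OF cp[OF X]] by (auto simp: in_homs)
qed

lemma pl_obtain:
  assumes X: "X \<in> XX" and c: "c \<in> homs D B (ob X (Suc n))"
  obtains Y where "Y \<in> XX" "emap D n Y X (Ide D (ob X 0)) c" "pl c (cl X) = cl Y" "ob Y 0 = ob X 0" "ob Y (Suc n) = B"
proof -
  obtain Y where Y: "Y \<in> XX" "emap D n Y X (Ide D (ob X 0)) c" using pull_ex[OF X c] by auto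
  then show thesis using that[OF Y pl_eq[OF X Y]] c emap_type[OF Y(2)] cpxD(1)[OF cp[OF X]] by (auto simp: in_homs)
qed

lemma pu_in: "E \<in> EC C A \<Longrightarrow> a \<in> homs D A B \<Longrightarrow> pu a E \<in> EC C B"
  by (metis ECE ECI pu_obtain)

lemma pl_in: "E \<in> EC C A \<Longrightarrow> c \<in> homs D B C \<Longrightarrow> pl c E \<in> EC B A"
  by (metis ECE ECI pl_obtain)

text \<open>Both sides are the class of the intermediate sequence of
  \<open>push_pull\<close>.\<close>

lemma pu_pl_emap:
  assumes X: "X \<in> XX" and Y: "Y \<in> XX" and e: "emap D n X Y a c"
  shows "pu a (cl X) = pl c (cl Y)"
proof -
  obtain Z where "Z \<in> XX" "emap D n X Z a (Ide D (ob X (Suc n)))" "emap D n Z Y (Ide D (ob Y 0)) c"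
    by (rule push_pull[OF X Y e])
  then show ?thesis using pu_eq[OF X] pl_eq[OF Y] by simp
qed

lemma pu_comp:
  assumes E: "E \<in> EC C A" and a: "a \<in> homs D A B" and b: "b \<in> homs D B B'"
  shows "pu (b \<cdot> a) E = pu b (pu a E)"
proof -
  obtain X where X: "X \<in> XX" "E = cl X" "ob X 0 = A" "ob X (Suc n) = C" using ECE[OF E] .
  obtain Y where Y: "Y \<in> XX" "emap D n X Y a (Ide D C)" "pu a E = cl Y" "ob Y 0 = B" "ob Y (Suc n) = C"
    using pu_obtain[OF X(1)] a X by metis
  obtain Z where Z: "Z \<in> XX" "emap D n Y Z b (Ide D C)" "pu b (cl Y) = cl Z" using pu_obtain[OF Y(1)] b Y by metis
  have "emap D n X Z (b \<cdot> a) (Ide D C)"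
    using ecomp[OF X(1) Y(1) Z(1) Y(2) Z(2)] EC_obj[OF E] by simp
  then show ?thesis using pu_eq[OF X(1) Z(1)] X Y Z by simp
qed

lemma pl_comp:
  assumes E: "E \<in> EC C A" and c: "c \<in> homs D B C" and b: "b \<in> homs D B' B"
  shows "pl (c \<cdot> b) E = pl b (pl c E)"
proof -
  obtain X where X: "X \<in> XX" "E = cl X" "ob X 0 = A" "ob X (Suc n) = C" using ECE[OF E] .
  obtain Y where Y: "Y \<in> XX" "emap D n Y X (Ide D A) c" "pl c E = cl Y" "ob Y 0 = A" "ob Y (Suc n) = B"
    using pl_obtain[OF X(1)] c X by metis
  obtain Z where Z: "Z \<in> XX" "emap D n Z Y (Ide D A) b" "pl b (cl Y) = cl Z" using pl_obtain[OF Y(1)] b Y by metis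
  have "emap D n Z X (Ide D A) (c \<cdot> b)"
    using ecomp[OF Z(1) Y(1) X(1) Z(2) Y(2)] EC_obj[OF E] by simp
  then show ?thesis using pl_eq[OF X(1) Z(1)] X Y Z by simp
qed

lemma pu_id: assumes E: "E \<in> EC C A" shows "pu (Ide D A) E = E"
proof -
  obtain X where X: "X \<in> XX" "E = cl X" "ob X 0 = A" "ob X (Suc n) = C" using ECE[OF E] .
  then show ?thesis using pu_eq[OF X(1) X(1)] emap_id[OF cp[OF X(1)]] by simp
qed

lemma pl_id: assumes E: "E \<in> EC C A" shows "pl (Ide D C) E = E"
proof -
  obtain X where X: "X \<in> XX" "E = cl X" "ob X 0 = A" "ob X (Suc n) = C" using ECE[OF E] .
  then show ?thesis using pl_eq[OF X(1) X(1)] emap_id[OF cp[OF X(1)]] by simp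
qed

lemma pu_pl:
  assumes E: "E \<in> EC C A" and a: "a \<in> homs D A B" and c: "c \<in> homs D C' C"
  shows "pu a (pl c E) = pl c (pu a E)"
proof -
  obtain X where X: "X \<in> XX" "E = cl X" "ob X 0 = A" "ob X (Suc n) = C" using ECE[OF E] .
  obtain V where V: "V \<in> XX" "emap D n V X (Ide D A) c" "pl c E = cl V" "ob V 0 = A"
    using pl_obtain[OF X(1)] c X by metis
  obtain Z where Z: "Z \<in> XX" "emap D n X Z a (Ide D C)" "pu a E = cl Z"
    using pu_obtain[OF X(1)] a X by metis
  have "emap D n V Z a c"
    using ecomp[OF V(1) X(1) Z(1) V(2) Z(2)] a c EC_obj[OF E] by (simp add: in_homs)
  then show ?thesis using pu_pl_emap[OF V(1) Z(1)] V Z by simp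
qed

section \<open>The Baer sum and the group structure\<close>

lemma bs_eq:
  assumes X: "X \<in> XX" "ob X 0 = A" "ob X (Suc n) = C" and Y: "Y \<in> XX" "ob Y 0 = A" "ob Y (Suc n) = C"
  shows "bs C A (cl X) (cl Y) = pu (codiagonal D A) (pl (diagonal D C) (cl (dsum_cplx D (n + 2) X Y)))"
  unfolding baer_sum_def X_map_def
proof (rule the_equality)
  show "\<exists>X'\<in>XX \<inter> ends_complexes D n A C. \<exists>Y'\<in>XX \<inter> ends_complexes D n A C.
      cl X = cl X' \<and> cl Y = cl Y' \<and> pu (codiagonal D A) (pl (diagonal D C) (cl (dsum_cplx D (n + 2) X Y))) =
       pu (codiagonal D A) (pl (diagonal D C) (cl (dsum_cplx D (n + 2) X' Y')))"
    using X Y cp[OF X(1)] cp[OF Y(1)] unfolding ends_complexes_def complexes_cpx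
    by - (rule bexI[of _ X], rule bexI[of _ Y], auto)
next
  fix E assume "\<exists>X'\<in>XX \<inter> ends_complexes D n A C. \<exists>Y'\<in>XX \<inter> ends_complexes D n A C.
      cl X = cl X' \<and> cl Y = cl Y' \<and> E = pu (codiagonal D A) (pl (diagonal D C) (cl (dsum_cplx D (n + 2) X' Y')))"
  then obtain X' Y' where *: "X' \<in> XX" "Y' \<in> XX" "cl X = cl X'" "cl Y = cl Y'"
     "E = pu (codiagonal D A) (pl (diagonal D C) (cl (dsum_cplx D (n + 2) X' Y')))" by auto
  note [simp] = cpx_type[OF cp[OF X(1)]] cpx_type[OF cp[OF Y(1)]]
  note [simp del] = add_2_eq_Suc'
  have o: "ob X' 0 = ob X 0" "ob X' (Suc n) = ob X (Suc n)" "ob Y' 0 = ob Y 0" "ob Y' (Suc n) = ob Y (Suc n)"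
    using cl_ends[OF X(1) *(1,3)] cl_ends[OF Y(1) *(2,4)] by auto
  let ?S = "dsum_cplx D (n + 2) X Y" and ?S' = "dsum_cplx D (n + 2) X' Y'"
  have S: "?S \<in> XX" "?S' \<in> XX" using dsum_mem X Y * by auto
  \<comment> \<open>The two projections, followed by the chain maps to the other representatives,
    combine to a chain map between the direct sums with identity ends.\<close>
  have p1: "emap D n ?S X' (row D (Ide D (ob X 0)) (Zero D (ob Y 0) (ob X 0))) (row D (Ide D (ob X (Suc n))) (Zero D (ob Y (Suc n)) (ob X (Suc n))))"
    using emap_row[OF cp[OF X(1)] cp[OF Y(1)] cp[OF *(1)], of "Ide D (ob X 0)" "Ide D (ob X (Suc n))"] eq_class[OF X(1) *(1)] *(3) o
      emap_zero[OF cp[OF Y(1)] cp[OF *(1)]] by simp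
  have p2: "emap D n ?S Y' (row D (Zero D (ob X 0) (ob Y 0)) (Ide D (ob Y 0))) (row D (Zero D (ob X (Suc n)) (ob Y (Suc n))) (Ide D (ob Y (Suc n))))"
    using emap_row[OF cp[OF X(1)] cp[OF Y(1)] cp[OF *(2)], of _ _ "Ide D (ob Y 0)" "Ide D (ob Y (Suc n))"] eq_class[OF Y(1) *(2)] *(4) o
      emap_zero[OF cp[OF X(1)] cp[OF *(2)]] by simp
  have "emap D n ?S ?S' (Ide D (ob ?S 0)) (Ide D (ob ?S (Suc n)))"
    using emap_col[OF cp[OF *(1)] cp[OF *(2)] cp[OF S(1)] p1 p2] by (simp add: col_row_Ide)
  then show "E = pu (codiagonal D A) (pl (diagonal D C) (cl (dsum_cplx D (n + 2) X Y)))"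
    using eq_class[OF S] *(5) by simp
qed

lemma diag_homs: "C \<in> Obj D \<Longrightarrow> diagonal D C \<in> homs D C (dsum D C C)" "C \<in> Obj D \<Longrightarrow> codiagonal D C \<in> homs D (dsum D C C) C"
  by (simp_all add: diagonal_def codiagonal_def in_homs)

text \<open>The chain maps to \<open>X\<close> and \<open>Y\<close> combine to one from
  \<open>T\<close> to \<open>X \<oplus> Y\<close> whose ends are the column of \<open>x\<close> and
  \<open>y\<close> and the diagonal. So pulling the direct sum back along the diagonal is pushing
  \<open>T\<close> out along that column, and the codiagonal adds its entries.\<close>

lemma bs_push:
  assumes E: "E \<in> EC C A" and x: "x \<in> homs D A B" and y: "y \<in> homs D A B"
  shows "bs C B (pu x E) (pu y E) = pu (x \<boxplus> y) E"
proof -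
  note [simp] = x[unfolded in_homs] y[unfolded in_homs]
  note [simp del] = add_2_eq_Suc'
  have [simp]: "A \<in> Obj D" "B \<in> Obj D" "C \<in> Obj D" using EC_obj[OF E] homs_obj[OF x] by auto
  obtain T where T: "T \<in> XX" "E = cl T" "ob T 0 = A" "ob T (Suc n) = C" using ECE[OF E] .
  obtain X where X: "X \<in> XX" "emap D n T X x (Ide D C)" "pu x E = cl X" "ob X 0 = B" "ob X (Suc n) = C"
    using pu_obtain[OF T(1)] x T by metis
  obtain Y where Y: "Y \<in> XX" "emap D n T Y y (Ide D C)" "pu y E = cl Y" "ob Y 0 = B" "ob Y (Suc n) = C"
    using pu_obtain[OF T(1)] y T by metis
  let ?S = "dsum_cplx D (n + 2) X Y"
  have S: "?S \<in> XX" using dsum_mem X Y by auto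
  have "emap D n T ?S (col D x y) (diagonal D C)"
    using emap_col[OF cp[OF X(1)] cp[OF Y(1)] cp[OF T(1)] X(2) Y(2)] by (simp add: diagonal_def)
  then have "pl (diagonal D C) (cl ?S) = pu (col D x y) E" using pu_pl_emap[OF T(1) S] T by simp
  then have "bs C B (pu x E) (pu y E) = pu (codiagonal D B) (pu (col D x y) E)"
    using bs_eq[OF X(1,4,5) Y(1,4,5)] X(3) Y(3) by simp
  also have "\<dots> = pu (codiagonal D B \<cdot> col D x y) E"
    by (rule pu_comp[OF E, symmetric, of _ "dsum D B B"]) (use diag_homs in \<open>simp_all add: in_homs\<close>)
  also have "codiagonal D B \<cdot> col D x y = x \<boxplus> y" by (simp add: codiagonal_def row_col)
  finally show ?thesis .
qed

text \<open>Mirror image of \<open>bs_push\<close>, with a chain map from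
  \<open>X \<oplus> Y\<close> over the codiagonal; \<open>pu_pl\<close> first brings the codiagonal
  next to the direct sum.\<close>

lemma bs_pull:
  assumes E: "E \<in> EC C A" and c: "c \<in> homs D B C" and c': "c' \<in> homs D B C"
  shows "bs B A (pl c E) (pl c' E) = pl (c \<boxplus> c') E"
proof -
  note [simp] = c[unfolded in_homs] c'[unfolded in_homs]
  note [simp del] = add_2_eq_Suc'
  have [simp]: "A \<in> Obj D" "B \<in> Obj D" "C \<in> Obj D" using EC_obj[OF E] homs_obj[OF c] by auto
  obtain T where T: "T \<in> XX" "E = cl T" "ob T 0 = A" "ob T (Suc n) = C" using ECE[OF E] .
  obtain X where X: "X \<in> XX" "emap D n X T (Ide D A) c" "pl c E = cl X" "ob X 0 = A" "ob X (Suc n) = B"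
    using pl_obtain[OF T(1)] c T by metis
  obtain Y where Y: "Y \<in> XX" "emap D n Y T (Ide D A) c'" "pl c' E = cl Y" "ob Y 0 = A" "ob Y (Suc n) = B"
    using pl_obtain[OF T(1)] c' T by metis
  let ?S = "dsum_cplx D (n + 2) X Y"
  have S: "?S \<in> XX" using dsum_mem X Y by auto
  have cS: "cl ?S \<in> EC (dsum D B B) (dsum D A A)" using ECI[OF S] X Y by simp
  have "emap D n ?S T (codiagonal D A) (row D c c')"
    using emap_row[OF cp[OF X(1)] cp[OF Y(1)] cp[OF T(1)] X(2) Y(2)] by (simp add: codiagonal_def)
  then have "pu (codiagonal D A) (cl ?S) = pl (row D c c') E" using pu_pl_emap[OF S T(1)] T by simp
  then have "bs B A (pl c E) (pl c' E) = pl (diagonal D B) (pl (row D c c') E)"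
    using bs_eq[OF X(1,4,5) Y(1,4,5)] X(3) Y(3) pu_pl[OF cS diag_homs(2) diag_homs(1)] by simp
  also have "\<dots> = pl (row D c c' \<cdot> diagonal D B) E"
    by (rule pl_comp[OF E, symmetric, of _ "dsum D B B"]) (use diag_homs in \<open>simp_all add: in_homs\<close>)
  also have "row D c c' \<cdot> diagonal D B = c \<boxplus> c'" by (simp add: diagonal_def row_col)
  finally show ?thesis .
qed

text \<open>Any two classes are pushouts of a common one, namely of the pullback of their direct sum along the
  diagonal. This reduces the group axioms to those of the Hom groups.\<close>

lemma common_source:
  assumes E: "E \<in> EC C A" and E': "E' \<in> EC C A'"
  obtains B T x y where "T \<in> EC C B" "x \<in> homs D B A" "y \<in> homs D B A'" "E = pu x T" "E' = pu y T"
proof -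
  note [simp del] = add_2_eq_Suc'
  have [simp]: "A \<in> Obj D" "A' \<in> Obj D" "C \<in> Obj D" using EC_obj[OF E] EC_obj[OF E'] by auto
  obtain X where X: "X \<in> XX" "E = cl X" "ob X 0 = A" "ob X (Suc n) = C" using ECE[OF E] .
  obtain Y where Y: "Y \<in> XX" "E' = cl Y" "ob Y 0 = A'" "ob Y (Suc n) = C" using ECE[OF E'] .
  let ?S = "dsum_cplx D (n + 2) X Y"
  have S: "?S \<in> XX" using dsum_mem X Y by auto
  obtain T where T: "T \<in> XX" "emap D n T ?S (Ide D (dsum D A A')) (diagonal D C)" "ob T 0 = dsum D A A'" "ob T (Suc n) = C"
  proof -
    have o: "ob ?S 0 = dsum D A A'" and h: "diagonal D C \<in> homs D C (ob ?S (Suc n))" using X Y diag_homs by simp_all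
    show ?thesis using pl_obtain[OF S h, unfolded o] that by metis
  qed
  have "emap D n ?S X (row D (Ide D A) (Zero D A' A)) (row D (Ide D C) (Zero D C C))"
    using emap_row[OF cp[OF X(1)] cp[OF Y(1)] cp[OF X(1)] emap_id[OF cp[OF X(1)]] emap_zero[OF cp[OF Y(1)] cp[OF X(1)]]] X Y by simp
  from ecomp[OF T(1) S X(1) T(2) this] have 1: "emap D n T X (row D (Ide D A) (Zero D A' A)) (Ide D C)"
    by (simp add: diagonal_def row_col)
  have "emap D n ?S Y (row D (Zero D A A') (Ide D A')) (row D (Zero D C C) (Ide D C))"
    using emap_row[OF cp[OF X(1)] cp[OF Y(1)] cp[OF Y(1)] emap_zero[OF cp[OF X(1)] cp[OF Y(1)]] emap_id[OF cp[OF Y(1)]]] X Y by simp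
  from ecomp[OF T(1) S Y(1) T(2) this] have 2: "emap D n T Y (row D (Zero D A A') (Ide D A')) (Ide D C)"
    by (simp add: diagonal_def row_col)
  show thesis
    using that[OF ECI[OF T(1), unfolded T(3,4)], of "row D (Ide D A) (Zero D A' A)" "row D (Zero D A A') (Ide D A')"]
      pu_eq[OF T(1) X(1)] pu_eq[OF T(1) Y(1)] 1 2 T X Y by (simp add: in_homs)
qed

text \<open>Both are the pushout of a common source along the zero arrow. This class will be the
  neutral element.\<close>

lemma pu_Zero_eq:
  assumes E: "E \<in> EC C A" and E': "E' \<in> EC C A'" and B: "B \<in> Obj D"
  shows "pu (Zero D A B) E = pu (Zero D A' B) E'"
proof -
  obtain A0 T x y where T: "T \<in> EC C A0" "x \<in> homs D A0 A" "y \<in> homs D A0 A'" "E = pu x T" "E' = pu y T"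
    by (rule common_source[OF E E'])
  note [simp] = T(2,3)[unfolded in_homs] B
  have [simp]: "A \<in> Obj D" "A' \<in> Obj D" using EC_obj E E' by auto
  have "pu (Zero D A B) E = pu (Zero D A B \<cdot> x) T" "pu (Zero D A' B) E' = pu (Zero D A' B \<cdot> y) T"
    using pu_comp[OF T(1,2) Zero_homs[OF _ B]] pu_comp[OF T(1,3) Zero_homs[OF _ B]] T(4,5) by simp_all
  then show ?thesis by simp
qed

text \<open>\<open>triv\<^sub>n(C)\<close> starts at a zero object and can be pushed out to any
  \<open>A\<close>.\<close>

lemma EC_nonempty:
  assumes "A \<in> Obj D" "C \<in> Obj D"
  obtains E where "E \<in> EC C A"
proof -
  have "cl (triv D n n C) \<in> EC C (zero_obj D)"
    using ECI[OF triv_mem(2)[OF assms(2)]] n by (simp add: triv_simps)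
  then show thesis using that pu_in[OF _ Zero_homs[OF zero_obj_Obj assms(1)]] by blast
qed

lemma bs_in: assumes "E \<in> EC C A" "E' \<in> EC C A" shows "bs C A E E' \<in> EC C A"
proof -
  obtain B T x y where T: "T \<in> EC C B" "x \<in> homs D B A" "y \<in> homs D B A" "E = pu x T" "E' = pu y T"
    by (rule common_source[OF assms])
  then show ?thesis using bs_push[OF T(1-3)] pu_in[OF T(1) Plus_homs[OF T(2,3)]] by simp
qed

lemma bs_unit: assumes E: "E \<in> EC C A" and F: "F \<in> EC C A"
  shows "bs C A (pu (Zero D A A) F) E = E" "bs C A E (pu (Zero D A A) F) = E"
proof -
  have A: "A \<in> Obj D" using EC_obj[OF E] by simp
  have "pu (Zero D A A) F = pu (Zero D A A) E" by (rule pu_Zero_eq[OF F E A])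
  then show "bs C A (pu (Zero D A A) F) E = E" "bs C A E (pu (Zero D A A) F) = E"
    using bs_push[OF E Zero_homs[OF A A] Ide_in[OF A]] bs_push[OF E Ide_in[OF A] Zero_homs[OF A A]] pu_id[OF E] A by simp_all
qed

text \<open>A neutral element is unique, so the description in \<open>baer_zero\<close> picks the
  zero pushout of any class whatsoever.\<close>

lemma baer_zero_eq: assumes F: "F \<in> EC C A'" and A: "A \<in> Obj D" shows "baer_zero D n XX C A = pu (Zero D A' A) F"
proof -
  obtain F' where F': "F' \<in> EC C A" using EC_nonempty[OF A] EC_obj(2)[OF F] by blast
  have e: "pu (Zero D A' A) F = pu (Zero D A A) F'" by (rule pu_Zero_eq[OF F F' A])
  show ?thesis unfolding baer_zero_def e
  proof (rule the_equality)
    show "pu (Zero D A A) F' \<in> EC C A \<and> (\<forall>E'\<in>EC C A. bs C A (pu (Zero D A A) F') E' = E' \<and> bs C A E' (pu (Zero D A A) F') = E')"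
      using bs_unit[OF _ F'] pu_in[OF F' Zero_homs[OF A A]] by blast
    fix E assume "E \<in> EC C A \<and> (\<forall>E'\<in>EC C A. bs C A E E' = E' \<and> bs C A E' E = E')"
    then show "E = pu (Zero D A A) F'" using bs_unit[OF _ F'] pu_in[OF F' Zero_homs[OF A A]] by metis
  qed
qed

lemma group_EC:
  assumes A: "A \<in> Obj D" and C: "C \<in> Obj D"
  shows "comm_group \<lparr>carrier = EC C A, mult = bs C A, one = baer_zero D n XX C A\<rparr>"
proof (rule comm_groupI)
  obtain F where F: "F \<in> EC C A" using EC_nonempty[OF A C] .
  have z: "baer_zero D n XX C A = pu (Zero D A A) F" by (rule baer_zero_eq[OF F A])
  show "\<one>\<^bsub>\<lparr>carrier = EC C A, mult = bs C A, one = baer_zero D n XX C A\<rparr>\<^esub> \<in> carrier \<lparr>carrier = EC C A, mult = bs C A, one = baer_zero D n XX C A\<rparr>"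
    using pu_in[OF F Zero_homs[OF A A]] z by simp
  fix E1 assume "E1 \<in> carrier \<lparr>carrier = EC C A, mult = bs C A, one = baer_zero D n XX C A\<rparr>"
  then have E1: "E1 \<in> EC C A" by simp
  show "\<one>\<^bsub>\<lparr>carrier = EC C A, mult = bs C A, one = baer_zero D n XX C A\<rparr>\<^esub> \<otimes>\<^bsub>\<lparr>carrier = EC C A, mult = bs C A, one = baer_zero D n XX C A\<rparr>\<^esub> E1 = E1"
    using bs_unit[OF E1 F] z by simp
  \<comment> \<open>The inverse is the pushout along minus the identity.\<close>
  have "bs C A (pu (neg D (Ide D A)) E1) E1 = baer_zero D n XX C A"
    using bs_push[OF E1 neg_homs[OF Ide_in[OF A]] Ide_in[OF A]] pu_id[OF E1] A baer_zero_eq[OF E1 A] by simp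
  then show "\<exists>y\<in>carrier \<lparr>carrier = EC C A, mult = bs C A, one = baer_zero D n XX C A\<rparr>.
      y \<otimes>\<^bsub>\<lparr>carrier = EC C A, mult = bs C A, one = baer_zero D n XX C A\<rparr>\<^esub> E1 = \<one>\<^bsub>\<lparr>carrier = EC C A, mult = bs C A, one = baer_zero D n XX C A\<rparr>\<^esub>"
    using pu_in[OF E1 neg_homs[OF Ide_in[OF A]]] by auto
  fix E2 assume "E2 \<in> carrier \<lparr>carrier = EC C A, mult = bs C A, one = baer_zero D n XX C A\<rparr>"
  then have E2: "E2 \<in> EC C A" by simp
  show "E1 \<otimes>\<^bsub>\<lparr>carrier = EC C A, mult = bs C A, one = baer_zero D n XX C A\<rparr>\<^esub> E2 \<in> carrier \<lparr>carrier = EC C A, mult = bs C A, one = baer_zero D n XX C A\<rparr>"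
    using bs_in[OF E1 E2] by simp
  obtain B T x y where T: "T \<in> EC C B" "x \<in> homs D B A" "y \<in> homs D B A" "E1 = pu x T" "E2 = pu y T"
    by (rule common_source[OF E1 E2])
  note xy = T(2,3)[unfolded in_homs]
  show "E1 \<otimes>\<^bsub>\<lparr>carrier = EC C A, mult = bs C A, one = baer_zero D n XX C A\<rparr>\<^esub> E2 = E2 \<otimes>\<^bsub>\<lparr>carrier = EC C A, mult = bs C A, one = baer_zero D n XX C A\<rparr>\<^esub> E1"
    using bs_push[OF T(1-3)] bs_push[OF T(1,3,2)] T(4,5) Plus_comm[of x y] xy by simp
  fix E3 assume "E3 \<in> carrier \<lparr>carrier = EC C A, mult = bs C A, one = baer_zero D n XX C A\<rparr>"
  then have E3: "E3 \<in> EC C A" by simp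
  \<comment> \<open>A common source of \<open>T\<close> and \<open>E3\<close> is one of all three
    classes, which reduces associativity to that of addition in \<open>homs D B' A\<close>.\<close>
  obtain B' T' t z where T': "T' \<in> EC C B'" "t \<in> homs D B' B" "z \<in> homs D B' A" "T = pu t T'" "E3 = pu z T'"
    by (rule common_source[OF T(1) E3])
  note [simp] = T(2,3)[unfolded in_homs] T'(2,3)[unfolded in_homs]
  have h: "x \<cdot> t \<in> homs D B' A" "y \<cdot> t \<in> homs D B' A" by (simp_all add: in_homs)
  have e: "E1 = pu (x \<cdot> t) T'" "E2 = pu (y \<cdot> t) T'" using pu_comp[OF T'(1,2)] T T' by auto
  show "E1 \<otimes>\<^bsub>\<lparr>carrier = EC C A, mult = bs C A, one = baer_zero D n XX C A\<rparr>\<^esub> E2 \<otimes>\<^bsub>\<lparr>carrier = EC C A, mult = bs C A, one = baer_zero D n XX C A\<rparr>\<^esub> E3 =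
     E1 \<otimes>\<^bsub>\<lparr>carrier = EC C A, mult = bs C A, one = baer_zero D n XX C A\<rparr>\<^esub> (E2 \<otimes>\<^bsub>\<lparr>carrier = EC C A, mult = bs C A, one = baer_zero D n XX C A\<rparr>\<^esub> E3)"
    using bs_push[OF T'(1) h] bs_push[OF T'(1) Plus_homs[OF h] T'(3)] bs_push[OF T'(1) h(2) T'(3)]
      bs_push[OF T'(1) h(1) Plus_homs[OF h(2) T'(3)]] e T'(5) by (simp add: Plus_assoc)
qed

lemma pu_bs:
  assumes "E \<in> EC C A" "E' \<in> EC C A" and a: "a \<in> homs D A B"
  shows "pu a (bs C A E E') = bs C B (pu a E) (pu a E')"
proof -
  obtain A' T x y where T: "T \<in> EC C A'" "x \<in> homs D A' A" "y \<in> homs D A' A" "E = pu x T" "E' = pu y T"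
    by (rule common_source[OF assms(1,2)])
  note [simp] = T(2,3)[unfolded in_homs] a[unfolded in_homs]
  have h: "a \<cdot> x \<in> homs D A' B" "a \<cdot> y \<in> homs D A' B" by (simp_all add: in_homs)
  show ?thesis
    using bs_push[OF T(1-3)] bs_push[OF T(1) h] pu_comp[OF T(1,2) a] pu_comp[OF T(1,3) a] pu_comp[OF T(1) Plus_homs[OF T(2,3)] a] T(4,5)
    by (simp add: distr)
qed

lemma pl_bs:
  assumes "E \<in> EC C A" "E' \<in> EC C A" and c: "c \<in> homs D B C"
  shows "pl c (bs C A E E') = bs B A (pl c E) (pl c E')"
proof -
  obtain A' T x y where T: "T \<in> EC C A'" "x \<in> homs D A' A" "y \<in> homs D A' A" "E = pu x T" "E' = pu y T"
    by (rule common_source[OF assms(1,2)])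
  show ?thesis
    using bs_push[OF T(1-3)] bs_push[OF pl_in[OF T(1) c] T(2,3)] pu_pl[OF T(1,2) c] pu_pl[OF T(1,3) c]
      pu_pl[OF T(1) Plus_homs[OF T(2,3)] c] T(4,5) by simp
qed

end

section \<open>From \<open>n\<close>-exact to \<open>n\<close>-exangulated structures\<close>

lemma pb_elt_cong:
  assumes "n \<ge> 1" "\<And>i. i \<le> n \<Longrightarrow> ob X i = ob X' i" "\<And>i. i \<le> n \<Longrightarrow> ob Y i = ob Y' i" "\<And>i. i < n \<Longrightarrow> df X i = df X' i"
    "\<And>i. i < n \<Longrightarrow> df Y i = df Y' i" "\<And>i. i \<le> n \<Longrightarrow> f i = f' i"
  shows "pb_elt D n X Y f \<longleftrightarrow> pb_elt D n X' Y' f'"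
  unfolding pb_elt_def using assms
  by (intro all_cong1 conj_cong refl all_cong ball_cong imp_cong bex_cong if_cong) auto

context acat
begin

text \<open>Weak isomorphisms are used in three positions: \<open>k = 0\<close>,
  \<open>k = n\<close> and the cyclic \<open>k = n + 1\<close>. (E2) is completed to full chain maps
  by \<open>push_from_po_elt\<close>, and its dual by the same lemma in the opposite
  category.\<close>

lemma nxs_of_n_exact_structure:
  assumes n: "1 \<le> n" and XX: "n_exact_structure D n XX"
  shows "nxs D n XX"
proof -
  have sub: "nex D n X" if "X \<in> XX" for X
    using XX that n_exact_sequences_iff[OF n] unfolding n_exact_structure_def by auto
  have wk: "X \<in> XX \<longleftrightarrow> Y \<in> XX" if "nex D n X" "nex D n Y" "cmap D (Suc n) X Y f" "k \<le> n + 1" "is_iso_arr D (f k)" "is_iso_arr D (f ((k + 1) mod (n + 2)))" for X Y f k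
  proof -
    have "X \<in> n_exact_sequences D n" "Y \<in> n_exact_sequences D n" using that(1,2) n_exact_sequences_iff[OF n] by auto
    moreover have "weak_iso D n X Y f" using that(3-6) unfolding weak_iso_def chain_maps_cmap by blast
    ultimately show ?thesis using XX unfolding n_exact_structure_def by blast
  qed
  have wk0: "Y \<in> XX" if "X \<in> XX" "nex D n Y" "cmap D (Suc n) Y X f" "is_iso_arr D (f 0)" "is_iso_arr D (f (Suc 0))" for X Y f
    using wk[OF that(2) sub[OF that(1)] that(3), of 0] that by simp
  have wkn: "Y \<in> XX" if "X \<in> XX" "nex D n Y" "cmap D (Suc n) X Y f" "is_iso_arr D (f n)" "is_iso_arr D (f (Suc n))" for X Y f
    using wk[OF sub[OF that(1)] that(2,3), of n] that by simp
  have push: "\<exists>Z\<in>XX. emap D n X Z a (Ide D (ob X (Suc n)))" if X: "X \<in> XX" and a: "a \<in> homs D (ob X 0) B" for X a B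
  proof -
    obtain Y f where f: "n_pushout_diagram D n (segment 0 (n + 1) X) Y f" "f 0 = a" "df Y 0 \<in> admissible_monos XX"
      using XX X a homs_obj[OF a] unfolding n_exact_structure_def by blast
    then obtain Y' where Y': "Y' \<in> XX" "df Y' 0 = df Y 0" by (auto simp: admissible_monos_def)
    have *: "cpx D n Y" "cmap D n (segment 0 (n + 1) X) Y f" "po_elt D n (segment 0 (n + 1) X) Y f"
      using f(1) unfolding n_pushout_iff[OF n] by auto
    have "po_elt D n X Y f" using *(3) by (subst po_elt_cong[OF n, where X' = "segment 0 (n + 1) X" and Y' = Y and f' = f]) (auto simp: segment_def)
    moreover have "f i \<in> homs D (ob X i) (ob Y i)" if "i \<le> n" for i
      using cmapD(1)[OF *(2), of i] that segment_simps(1)[of i n 0 X] by simp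
    moreover have "f (Suc i) \<cdot> df X i = df Y i \<cdot> f i" if "i < n" for i
      using cmapD(2)[OF *(2), of i] that segment_simps(2)[of i n 0 X] by simp
    ultimately have "\<exists>Z\<in>XX. emap D n X Z (f 0) (Ide D (ob X (Suc n)))"
      by (intro push_from_po_elt[OF n sub wk0 X *(1) Y'])
    then show ?thesis using f(2) by simp
  qed
  have pull: "\<exists>Z\<in>XX. emap D n Z X (Ide D (ob X 0)) c" if X: "X \<in> XX" and c: "c \<in> homs D B (ob X (Suc n))" for X c B
  proof -
    interpret op: acat "opcat D" by (rule acat_op)
    have cpxX: "cpx D (Suc n) X" using sub[OF X] by (simp add: nex_def)
    obtain Y f where f: "n_pullback_diagram D n Y (segment 1 (n + 1) X) f" "f n = c" "df Y (n - 1) \<in> admissible_epis n XX"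
      using XX X c homs_obj[OF c] unfolding n_exact_structure_def by fastforce
    then obtain Y' where Y': "Y' \<in> XX" "df Y' n = df Y (n - 1)" by (auto simp: admissible_epis_def)
    have *: "cpx D n Y" "cmap D n Y (segment 1 (n + 1) X) f" "pb_elt D n Y (segment 1 (n + 1) X) f"
      using f(1) unfolding n_pullback_iff[OF n] by auto
    have "po_elt (opcat D) n (opc n (segment 1 (n + 1) X)) (opc n Y) (opf n f)"
      using *(3) po_elt_op[OF n] by blast
    then have 1: "po_elt (opcat D) n (opc (Suc n) X) (opc n Y) (opf n f)"
      by (subst po_elt_cong[OF n, where X' = "opc n (segment 1 (n + 1) X)" and Y' = "opc n Y" and f' = "opf n f"])
        (auto simp: segment_def Suc_diff_le Suc_diff_Suc)
    have 2: "cmap (opcat D) n (opc n (segment 1 (n + 1) X)) (opc n Y) (opf n f)" by (rule opf_cmap[OF *(2)])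
    have 3: "opf n f i \<in> homs (opcat D) (ob (opc (Suc n) X) i) (ob (opc n Y) i)" if "i \<le> n" for i
      using cmapD(1)[OF 2, of i] that by (simp add: segment_def Suc_diff_le less_Suc_eq_le)
    have 4: "opf n f (Suc i) \<cdot>\<^bsub>opcat D\<^esub> df (opc (Suc n) X) i = df (opc n Y) i \<cdot>\<^bsub>opcat D\<^esub> opf n f i" if "i < n" for i
    proof -
      have "Suc (n - Suc i) = n - i" using that by simp
      then show ?thesis using cmapD(2)[OF 2, of i] that by (simp add: segment_def)
    qed
    have m: "T \<in> opc (Suc n) ` XX \<longleftrightarrow> opc (Suc n) T \<in> XX" if "nex (opcat D) n T" for T
      using opc_opc[of "opcat D" "Suc n" T] opc_opc[of D "Suc n"] sub that unfolding nex_def by (metis (full_types) imageE imageI)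
    have "\<exists>Z\<in>opc (Suc n) ` XX. emap (opcat D) n (opc (Suc n) X) Z (opf n f 0) (Ide (opcat D) (ob (opc (Suc n) X) (Suc n)))"
    proof (rule op.push_from_po_elt[OF n _ _ _ opc_cpx[OF *(1)] _ _ 3 4 1])
      show "nex (opcat D) n T" if "T \<in> opc (Suc n) ` XX" for T using that sub nex_op by auto
      show "opc (Suc n) X \<in> opc (Suc n) ` XX" "opc (Suc n) Y' \<in> opc (Suc n) ` XX" using X Y' by auto
      show "df (opc (Suc n) Y') 0 = df (opc n Y) 0" using Y' n by simp
    next
      \<comment> \<open>Reversal turns isomorphisms in degrees 0 and 1 into isomorphisms in degrees
        \<open>n + 1\<close> and \<open>n\<close>, which is the case \<open>wkn\<close>.\<close>
      fix T T' g assume T: "T \<in> opc (Suc n) ` XX" "nex (opcat D) n T'" "cmap (opcat D) (Suc n) T' T g"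
        "is_iso_arr (opcat D) (g 0)" "is_iso_arr (opcat D) (g (Suc 0))"
      then obtain T0 where T0: "T0 \<in> XX" "T = opc (Suc n) T0" by auto
      have "cpx D (Suc n) T0" using sub[OF T0(1)] by (simp add: nex_def)
      then have g: "cmap D (Suc n) T0 (opc (Suc n) T') (opf (Suc n) g)"
        using opf_cmap[OF T(3)] T0(2) by (simp add: opc_opc)
      have "opc (Suc n) T' \<in> XX"
        by (rule wkn[OF T0(1) _ g]) (use nex_op[OF T(2)] T(4,5) in simp_all)
      then show "T' \<in> opc (Suc n) ` XX" using m[OF T(2)] by simp
    qed
    then obtain Z where Z: "Z \<in> XX" "emap (opcat D) n (opc (Suc n) X) (opc (Suc n) Z) c (Ide D (ob X 0))"
      using f(2) by auto
    then show ?thesis using emap_opD[OF Z(2) _ cpxX] sub[OF Z(1)] by (auto simp: nex_def)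
  qed
  show ?thesis
  proof (intro nxs.intro nx.intro nx_axioms.intro nxs_axioms.intro)
    show "acat D" by unfold_locales
    show "1 \<le> n" by (rule n)
    show "nex D n X" if "X \<in> XX" for X by (rule sub[OF that])
    show "X \<in> XX \<longleftrightarrow> Y \<in> XX" if t: "nex D n X" "nex D n Y" "emap D n X Y a c" "is_iso_arr D a" "is_iso_arr D c" for X Y a c
    proof -
      obtain f where f: "cmap D (Suc n) X Y f" "f 0 = a" "f (Suc n) = c" by (rule emapE[OF t(3)])
      \<comment> \<open>For \<open>k = n + 1\<close> the next index wraps around to 0.\<close>
      show ?thesis by (rule wk[OF t(1,2) f(1), of "Suc n"]) (use f t(4,5) in simp_all)
    qed
    show "\<exists>Y\<in>XX. emap D n X Y a (Ide D (ob X (Suc n)))" if "X \<in> XX" "a \<in> homs D (ob X 0) B" for X a B by (rule push[OF that])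
    show "\<exists>Y\<in>XX. emap D n Y X (Ide D (ob X 0)) c" if "X \<in> XX" "c \<in> homs D B (ob X (Suc n))" for X c B by (rule pull[OF that])
    show "Y \<in> XX" if "X \<in> XX" "nex D n Y" "cmap D (Suc n) Y X f" "is_iso_arr D (f 0)" "is_iso_arr D (f (Suc 0))" for X Y f
      by (rule wk0[OF that])
    show "zero_cplx D n \<in> XX" "closed_under_comp D (admissible_monos XX)" using XX unfolding n_exact_structure_def by blast+
  qed
qed

text \<open>Serves complexes not yet known to be n-exact, where \<open>htpy_class_iff\<close> is out
  of reach; the zero homotopy is given directly.\<close>

lemma htpy_class_refl:
  assumes X: "cpx D (Suc n) X"
  shows "X \<in> htpy_class D n X"
proof -
  note [simp] = cpx_type[OF X]
  have I: "(\<lambda>i\<in>{..<n + 2}. cid D (Suc n) X i \<cdot> cid D (Suc n) X i) = (\<lambda>i\<in>{..<n + 2}. Ide D (ob X i))"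
    by (auto simp: fun_eq_iff restrict_def)
  have ho: "homotopic D (n + 2) X X (\<lambda>i\<in>{..<n + 2}. Ide D (ob X i)) (\<lambda>i\<in>{..<n + 2}. Ide D (ob X i))"
    unfolding homotopic_def null_homotopic_def
    by (intro exI[of _ "\<lambda>i. Zero D (ob X i) (ob X (i - 1))"]) (auto simp: in_homs)
  have "cid D (Suc n) X \<in> ends_maps D n (ob X 0) (ob X (n + 1)) X X"
    using cmap_id[OF X] by (auto simp: ends_maps_def cmap_def)
  then show ?thesis
    unfolding htpy_class_def htpy_equivalent_def using X I ho
    by (auto simp: ends_complexes_def cpx_def intro!: bexI[of _ "cid D (Suc n) X"])
qed

text \<open>The inclusion of \<open>Y\<close> as second summand. It presents the cone as the pushout
  of \<open>Y\<close> along \<open>df X 0\<close>, which gives both its membership and its class in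
  (EA2).\<close>

lemma emap_M_cone:
  assumes X: "cpx D (Suc n) X" and Y: "cpx D (Suc n) Y" and f: "cmap D (Suc n) X Y f" "f 0 = Ide D (ob X 0)" and n: "1 \<le> n"
  shows "emap D n Y (M_cone D n X Y f) (df X 0) (Ide D (ob Y (Suc n)))"
proof -
  note [simp] = cpx_type[OF X] cpx_type[OF Y] cmap_type[OF f(1)]
  let ?M = "M_cone D n X Y f"
  let ?j = "\<lambda>i. if i = 0 then df X 0 else if i = Suc n then Ide D (ob Y (Suc n)) else col D (Zero D (ob Y i) (ob X (Suc i))) (Ide D (ob Y i))"
  have o: "ob X 0 = ob Y 0" using cmap_type[OF f(1), of 0] f(2) by simp
  have M: "ob ?M 0 = ob X (Suc 0)" "ob ?M (Suc n) = ob Y (Suc n)" "\<And>i. 0 < i \<Longrightarrow> i \<le> n \<Longrightarrow> ob ?M i = dsum D (ob X (Suc i)) (ob Y i)"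
    "df ?M 0 = col D (neg D (df X (Suc 0))) (f (Suc 0))" "df ?M n = row D (f (Suc n)) (df Y n)"
    "\<And>i. 0 < i \<Longrightarrow> i < n \<Longrightarrow> df ?M i = mat22 D (neg D (df X (Suc i))) (Zero D (ob Y i) (ob X (Suc (Suc i)))) (f (Suc i)) (df Y i)"
    using n by (auto simp: M_cone_def)
  have "cmap D (Suc n) Y ?M (\<lambda>i\<in>{..<Suc (Suc n)}. ?j i)"
  proof (rule cmapI)
    fix i assume "i \<le> Suc n"
    then consider "i = 0" | "i = Suc n" | "0 < i" "i \<le> n" by linarith
    then show "?j i \<in> homs D (ob Y i) (ob ?M i)" using o by cases (auto simp: M in_homs)
  next
    fix i assume "i < Suc n"
    then consider "i = 0" | "i = n" "0 < i" | "0 < i" "i < n" by linarith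
    then show "?j (Suc i) \<cdot> df Y i = df ?M i \<cdot> ?j i"
    proof cases
      case 1
      have "df ?M 0 \<cdot> df X 0 = col D (Zero D (ob X 0) (ob X (Suc (Suc 0)))) (df Y 0)"
        using n cmapD(2)[OF f(1), of 0] f(2) o by (simp add: M col_Comp distr)
      moreover have "?j (Suc 0) \<cdot> df Y 0 = col D (Zero D (ob X 0) (ob X (Suc (Suc 0)))) (df Y 0)"
        using n o by (simp add: col_Comp)
      ultimately show ?thesis using 1 n by simp
    next
      case 2 then show ?thesis by (simp add: M row_col)
    next
      case 3 then show ?thesis by (simp add: M mat22_col col_Comp)
    qed
  qed
  from emapI[OF this] show ?thesis by simp
qed

text \<open>The projection to the first summand. It presents the cone as the pullback of
  \<open>X\<close> along \<open>df Y n\<close>.\<close>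

lemma emap_N_cone:
  assumes X: "cpx D (Suc n) X" and Y: "cpx D (Suc n) Y" and f: "cmap D (Suc n) X Y f" "f (Suc n) = Ide D (ob X (Suc n))" and n: "1 \<le> n"
  shows "emap D n (N_cone D n X Y f) X (Ide D (ob X 0)) (df Y n)"
proof -
  note [simp] = cpx_type[OF X] cpx_type[OF Y] cmap_type[OF f(1)]
  let ?M = "N_cone D n X Y f"
  let ?j = "\<lambda>i. if i = 0 then Ide D (ob X 0) else if i = Suc n then df Y n else row D (Ide D (ob X i)) (Zero D (ob Y (i - 1)) (ob X i))"
  have o: "ob Y (Suc n) = ob X (Suc n)" using cmap_type[OF f(1), of "Suc n"] f(2) by simp
  have M: "ob ?M 0 = ob X 0" "ob ?M (Suc n) = ob Y n" "\<And>i. 0 < i \<Longrightarrow> i \<le> n \<Longrightarrow> ob ?M i = dsum D (ob X i) (ob Y (i - 1))"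
    "df ?M 0 = col D (df X 0) (f 0)" "df ?M n = row D (f n) (neg D (df Y (n - 1)))"
    "\<And>i. 0 < i \<Longrightarrow> i < n \<Longrightarrow> df ?M i = mat22 D (df X i) (Zero D (ob Y (i - 1)) (ob X (Suc i))) (f i) (neg D (df Y (i - 1)))"
    using n by (auto simp: N_cone_def)
  have "cmap D (Suc n) ?M X (\<lambda>i\<in>{..<Suc (Suc n)}. ?j i)"
  proof (rule cmapI)
    fix i assume "i \<le> Suc n"
    then consider "i = 0" | "i = Suc n" | "0 < i" "i \<le> n" by linarith
    then show "?j i \<in> homs D (ob ?M i) (ob X i)" using o by cases (auto simp: M in_homs)
  next
    fix i assume "i < Suc n"
    then consider "i = 0" | "i = n" "0 < i" | "0 < i" "i < n" by linarith
    then show "?j (Suc i) \<cdot> df ?M i = df X i \<cdot> ?j i"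
    proof cases
      case 1 then show ?thesis using n by (auto simp: M row_col)
    next
      case 2
      then obtain m where m: "n = Suc m" by (cases n) auto
      have "df Y n \<cdot> df Y m = Zero D (ob Y m) (ob X (Suc n))" using m o cpx_type(5)[OF Y, of m] by simp
      then show ?thesis using 2 cmapD(2)[OF f(1), of n] f(2) o M(5) m by (simp add: Comp_row distr)
    next
      case 3
      then obtain m where m: "i = Suc m" by (cases i) auto
      then show ?thesis using 3 M(6)[of i] by (simp add: row_mat22 Comp_row)
    qed
  qed
  from emapI[OF this] show ?thesis by simp
qed

end

context nxs
begin

abbreviation "Gx \<equiv> G_of D n XX"

lemma Gx_simps[simp]: "carrier (GObj Gx C A) = EC C A" "mult (GObj Gx C A) = bs C A" "one (GObj Gx C A) = baer_zero D n XX C A"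
  "GMap Gx c a E = pu a (pl c E)"
  by (simp_all add: G_of_def X_map_def)

lemma biadditive_Gx: "biadditive_functor D Gx"
  unfolding biadditive_functor_def
proof (intro conjI ballI impI allI, goal_cases)
  case (1 C A) then show ?case using group_EC[of A C] by (simp add: G_of_def)
next
  case (2 c a)
  then have h: "c \<in> homs D (Dom D c) (Cod D c)" "a \<in> homs D (Dom D a) (Cod D a)" by (auto simp: in_homs)
  show ?case
    using pu_in[OF pl_in[OF _ h(1)] h(2)] pl_bs[OF _ _ h(1)] pu_bs[OF pl_in[OF _ h(1)] pl_in[OF _ h(1)] h(2)]
    by (auto simp: hom_def)
next
  case (3 C A d) then show ?case using pu_id pl_id by simp
next
  case (4 c c' a a' d)
  then have h: "c \<in> homs D (Dom D c) (Cod D c)" "c' \<in> homs D (Dom D c') (Dom D c)"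
    "a \<in> homs D (Dom D a) (Cod D a)" "a' \<in> homs D (Cod D a) (Cod D a')" and d: "d \<in> EC (Cod D c) (Dom D a)" by (auto simp: in_homs)
  then show ?case
    using pl_comp[OF d h(1,2)] pu_comp[OF pl_in[OF pl_in[OF d h(1)] h(2)] h(3,4)] pu_pl[OF pl_in[OF d h(1)] h(3,2)] by simp
next
  case (5 C C' c c' a d)
  then have h: "a \<in> homs D (Dom D a) (Cod D a)" and d: "d \<in> EC C (Dom D a)" and c: "c \<in> homs D C' C" "c' \<in> homs D C' C" by (auto simp: in_homs)
  show ?case using bs_pull[OF d c] pu_bs[OF pl_in[OF d c(1)] pl_in[OF d c(2)] h] by simp
next
  case (6 A A' a a' c d)
  then have h: "c \<in> homs D (Dom D c) (Cod D c)" and d: "d \<in> EC (Cod D c) A" and a: "a \<in> homs D A A'" "a' \<in> homs D A A'" by (auto simp: in_homs)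
  show ?case using bs_push[OF pl_in[OF d h] a] by simp
qed

text \<open>A complex in the class of a member is linked to it by a chain map with identity ends, so
  \<open>weak\<close> makes it a member itself.\<close>

lemma distinguished_Gx: "distinguished D n Gx r_of X \<delta> \<longleftrightarrow> X \<in> XX \<and> \<delta> = cl X"
proof
  assume "distinguished D n Gx r_of X \<delta>"
  then have X: "cpx D (Suc n) X" "\<delta> \<in> EC (ob X (Suc n)) (ob X 0)" "\<delta> = cl X"
    by (auto simp: distinguished_def r_of_def cpx_def)
  obtain X' where X': "X' \<in> XX" "\<delta> = cl X'" by (rule ECE[OF X(2)])
  have "X \<in> cl X'" using X X' htpy_class_refl[OF X(1)] by simp
  then have *: "nex D n X" "emap D n X X' (Ide D (ob X' 0)) (Ide D (ob X' (Suc n)))" using htpy_class_iff[OF n nex[OF X'(1)]] by auto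
  then have "X \<in> XX" using weak[OF *(1) nex[OF X'(1)] *(2)] iso_Ide cpxD(1)[OF cp[OF X'(1)]] X'(1) by simp
  then show "X \<in> XX \<and> \<delta> = cl X" using X by simp
next
  assume "X \<in> XX \<and> \<delta> = cl X" then show "distinguished D n Gx r_of X \<delta>"
    using cp[of X] ECI[of X] by (auto simp: distinguished_def r_of_def cpx_def)
qed

lemma conflations_Gx: "conflations D n Gx r_of = XX"
  by (auto simp: conflations_def distinguished_Gx)

text \<open>Either splitting makes an end of the identity of \<open>X\<close> factor through a
  differential; \<open>emap_null_down\<close> and \<open>emap_null_up\<close> then factor the other
  end.\<close>

lemma split_iff:
  assumes X: "X \<in> XX"
  shows "(\<exists>h\<in>homs D (ob X (Suc n)) (ob X n). df X n \<cdot> h = Ide D (ob X (Suc n))) \<longleftrightarrow>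
    (\<exists>r\<in>homs D (ob X (Suc 0)) (ob X 0). r \<cdot> df X 0 = Ide D (ob X 0))"
proof
  assume "\<exists>h\<in>homs D (ob X (Suc n)) (ob X n). df X n \<cdot> h = Ide D (ob X (Suc n))"
  then obtain h where h: "h \<in> homs D (ob X (Suc n)) (ob X n)" "df X n \<cdot> h = Ide D (ob X (Suc n))" by blast
  have e: "emap D n X X (Ide D (ob X 0)) (df X n \<cdot> h)" using emap_id[OF cp[OF X]] h(2) by simp
  obtain r where "r \<in> homs D (ob X (Suc 0)) (ob X 0)" "Ide D (ob X 0) = r \<cdot> df X 0"
    by (rule emap_null_down[OF cp[OF X] cp[OF X] cv[OF X] e h(1)])
  then show "\<exists>r\<in>homs D (ob X (Suc 0)) (ob X 0). r \<cdot> df X 0 = Ide D (ob X 0)" by force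
next
  assume "\<exists>r\<in>homs D (ob X (Suc 0)) (ob X 0). r \<cdot> df X 0 = Ide D (ob X 0)"
  then obtain r where r: "r \<in> homs D (ob X (Suc 0)) (ob X 0)" "r \<cdot> df X 0 = Ide D (ob X 0)" by blast
  have e: "emap D n X X (r \<cdot> df X 0) (Ide D (ob X (Suc n)))" using emap_id[OF cp[OF X]] r(2) by simp
  obtain h where "h \<in> homs D (ob X (Suc n)) (ob X n)" "Ide D (ob X (Suc n)) = df X n \<cdot> h"
    by (rule emap_null_up[OF cp[OF X] co[OF X] cp[OF X] e r(1)])
  then show "\<exists>h\<in>homs D (ob X (Suc n)) (ob X n). df X n \<cdot> h = Ide D (ob X (Suc n))" by force
qed

text \<open>A zero class gives a chain map \<open>X \<rightarrow> X\<close> with left end 0 and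
  right end an identity. The zero end extends over \<open>df X 0\<close>, so the identity factors
  through \<open>df X n\<close>. Conversely, adding \<open>df X n \<cdot> h\<close> to the right end
  of the zero map produces such a chain map.\<close>

lemma zero_iff_epi:
  assumes X: "X \<in> XX"
  shows "cl X = baer_zero D n XX (ob X (Suc n)) (ob X 0) \<longleftrightarrow> (\<exists>h\<in>homs D (ob X (Suc n)) (ob X n). df X n \<cdot> h = Ide D (ob X (Suc n)))" (is "?L \<longleftrightarrow> ?R")
proof -
  note [simp] = cpx_type[OF cp[OF X]]
  have z: "baer_zero D n XX (ob X (Suc n)) (ob X 0) = pu (Zero D (ob X 0) (ob X 0)) (cl X)"
    by (rule baer_zero_eq[OF ECI[OF X]]) simp
  have h0: "Zero D (ob X 0) (ob X 0) \<in> homs D (ob X 0) (ob X 0)" by (simp add: in_homs)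
  show ?thesis
  proof
    assume ?L
    obtain Y where Y: "Y \<in> XX" "emap D n X Y (Zero D (ob X 0) (ob X 0)) (Ide D (ob X (Suc n)))" "pu (Zero D (ob X 0) (ob X 0)) (cl X) = cl Y"
      "ob Y 0 = ob X 0" "ob Y (Suc n) = ob X (Suc n)" by (rule pu_obtain[OF X h0])
    have "emap D n Y X (Ide D (ob X 0)) (Ide D (ob X (Suc n)))"
      using eq_class[OF Y(1) X] trans[OF \<open>?L\<close> trans[OF z Y(3)]] Y(4,5) by simp
    from ecomp[OF X Y(1) X Y(2) this] have e: "emap D n X X (Zero D (ob X (Suc 0)) (ob X 0) \<cdot> df X 0) (Ide D (ob X (Suc n)))"
      by simp
    show ?R by (rule emap_null_up[OF cp[OF X] co[OF X] cp[OF X] e]) (auto simp: in_homs)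
  next
    assume ?R
    then obtain h where h: "h \<in> homs D (ob X (Suc n)) (ob X n)" "df X n \<cdot> h = Ide D (ob X (Suc n))" by blast
    have "emap D n X X (Zero D (ob X 0) (ob X 0)) (Zero D (ob X (Suc n)) (ob X (Suc n)) \<boxplus> (df X n \<cdot> h))"
      by (rule emap_adjust_end[OF cp[OF X] cp[OF X] n emap_zero[OF cp[OF X] cp[OF X]] h(1)])
    then have "pu (Zero D (ob X 0) (ob X 0)) (cl X) = cl X" by (intro pu_eq[OF X X]) (simp add: h(2))
    then show ?L using z by simp
  qed
qed

text \<open>By \<open>zero_iff_epi\<close> the question is whether the pullback \<open>V\<close>
  splits. The chain map from \<open>V\<close> to \<open>X\<close> has ends an identity and
  \<open>c\<close>, and a factorisation of one end forces one of the other.\<close>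

lemma pl_zero_iff:
  assumes X: "X \<in> XX" and c: "c \<in> homs D W (ob X (Suc n))"
  shows "pl c (cl X) = baer_zero D n XX W (ob X 0) \<longleftrightarrow> (\<exists>t\<in>homs D W (ob X n). c = df X n \<cdot> t)"
proof -
  note [simp] = cpx_type[OF cp[OF X]]
  obtain V where V: "V \<in> XX" "emap D n V X (Ide D (ob X 0)) c" "pl c (cl X) = cl V" "ob V 0 = ob X 0" "ob V (Suc n) = W" by (rule pl_obtain[OF X c])
  have e: "pl c (cl X) = baer_zero D n XX W (ob X 0) \<longleftrightarrow> (\<exists>r\<in>homs D (ob V (Suc 0)) (ob X 0). r \<cdot> df V 0 = Ide D (ob X 0))"
    using zero_iff_epi[OF V(1)] split_iff[OF V(1)] V(3-5) by simp
  show ?thesis unfolding e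
  proof
    assume "\<exists>r\<in>homs D (ob V (Suc 0)) (ob X 0). r \<cdot> df V 0 = Ide D (ob X 0)"
    then obtain r where r: "r \<in> homs D (ob V (Suc 0)) (ob X 0)" "r \<cdot> df V 0 = Ide D (ob X 0)" by blast
    have em: "emap D n V X (r \<cdot> df V 0) c" using V(2) r(2) by simp
    obtain t where "t \<in> homs D (ob V (Suc n)) (ob X n)" "c = df X n \<cdot> t"
      by (rule emap_null_up[OF cp[OF V(1)] co[OF V(1)] cp[OF X] em r(1)])
    then show "\<exists>t\<in>homs D W (ob X n). c = df X n \<cdot> t" using V(5) by blast
  next
    assume "\<exists>t\<in>homs D W (ob X n). c = df X n \<cdot> t"
    then obtain t where t: "t \<in> homs D (ob V (Suc n)) (ob X n)" "c = df X n \<cdot> t" using V(5) by blast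
    have em: "emap D n V X (Ide D (ob X 0)) (df X n \<cdot> t)" using V(2) t(2) by simp
    obtain r where "r \<in> homs D (ob V (Suc 0)) (ob X 0)" "Ide D (ob X 0) = r \<cdot> df V 0"
      by (rule emap_null_down[OF cp[OF V(1)] cp[OF X] cv[OF X] em t(1)])
    then show "\<exists>r\<in>homs D (ob V (Suc 0)) (ob X 0). r \<cdot> df V 0 = Ide D (ob X 0)" by force
  qed
qed

lemma pu_zero_iff:
  assumes X: "X \<in> XX" and a: "a \<in> homs D (ob X 0) W"
  shows "pu a (cl X) = baer_zero D n XX (ob X (Suc n)) W \<longleftrightarrow> (\<exists>t\<in>homs D (ob X (Suc 0)) W. a = t \<cdot> df X 0)"
proof -
  note [simp] = cpx_type[OF cp[OF X]]
  obtain V where V: "V \<in> XX" "emap D n X V a (Ide D (ob X (Suc n)))" "pu a (cl X) = cl V" "ob V 0 = W" "ob V (Suc n) = ob X (Suc n)" by (rule pu_obtain[OF X a])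
  have e: "pu a (cl X) = baer_zero D n XX (ob X (Suc n)) W \<longleftrightarrow> (\<exists>h\<in>homs D (ob X (Suc n)) (ob V n). df V n \<cdot> h = Ide D (ob X (Suc n)))"
    using zero_iff_epi[OF V(1)] V(3-5) by simp
  show ?thesis unfolding e
  proof
    assume "\<exists>t\<in>homs D (ob X (Suc 0)) W. a = t \<cdot> df X 0"
    then obtain t where t: "t \<in> homs D (ob X (Suc 0)) (ob V 0)" "a = t \<cdot> df X 0" using V(4) by blast
    have em: "emap D n X V (t \<cdot> df X 0) (Ide D (ob X (Suc n)))" using V(2) t(2) by simp
    obtain h where "h \<in> homs D (ob X (Suc n)) (ob V n)" "Ide D (ob X (Suc n)) = df V n \<cdot> h"
      by (rule emap_null_up[OF cp[OF X] co[OF X] cp[OF V(1)] em t(1)])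
    then show "\<exists>h\<in>homs D (ob X (Suc n)) (ob V n). df V n \<cdot> h = Ide D (ob X (Suc n))" by force
  next
    assume "\<exists>h\<in>homs D (ob X (Suc n)) (ob V n). df V n \<cdot> h = Ide D (ob X (Suc n))"
    then obtain h where h: "h \<in> homs D (ob X (Suc n)) (ob V n)" "df V n \<cdot> h = Ide D (ob X (Suc n))" by blast
    have em: "emap D n X V a (df V n \<cdot> h)" using V(2) h(2) by simp
    obtain t where "t \<in> homs D (ob X (Suc 0)) (ob V 0)" "a = t \<cdot> df X 0"
      by (rule emap_null_down[OF cp[OF X] cp[OF V(1)] cv[OF V(1)] em h(1)])
    then show "\<exists>t\<in>homs D (ob X (Suc 0)) W. a = t \<cdot> df X 0" using V(4) by blast
  qed
qed

lemma push_Gx: "\<delta> \<in> EC C A \<Longrightarrow> push D Gx C a \<delta> = pu a \<delta>"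
  by (simp add: push_def pl_id)

lemma pull_Gx: "\<delta> \<in> EC C A \<Longrightarrow> c \<in> homs D B C \<Longrightarrow> pull D Gx A c \<delta> = pl c \<delta>"
  using pu_id[OF pl_in] by (simp add: pull_def)

lemma exangle_Gx:
  assumes X: "X \<in> XX"
  shows "is_n_exangle D n Gx X (cl X)"
  unfolding is_n_exangle_def
proof (intro conjI ballI)
  note [simp] = cpx_type[OF cp[OF X]]
  note E = ECI[OF X]
  show "X \<in> complexes D (n + 2)" using cp[OF X] by (simp add: cpx_def)
  show "cl X \<in> carrier (GObj Gx (ob X (n + 1)) (ob X 0))" using E by simp
  have "pu (df X 0) (cl X) = baer_zero D n XX (ob X (Suc n)) (ob X (Suc 0))"
    using pu_zero_iff[OF X, of "df X 0" "ob X (Suc 0)"] by (auto simp: in_homs intro!: bexI[of _ "Ide D (ob X (Suc 0))"])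
  then show "push D Gx (ob X (n + 1)) (df X 0) (cl X) = \<one>\<^bsub>GObj Gx (ob X (n + 1)) (ob X 1)\<^esub>" using push_Gx[OF E] by simp
  have "pl (df X n) (cl X) = baer_zero D n XX (ob X n) (ob X 0)"
    using pl_zero_iff[OF X, of "df X n" "ob X n"] by (auto simp: in_homs intro!: bexI[of _ "Ide D (ob X n)"])
  then show "pull D Gx (ob X 0) (df X n) (cl X) = \<one>\<^bsub>GObj Gx (ob X n) (ob X 0)\<^esub>"
    using pull_Gx[OF E, of "df X n" "ob X n"] by (simp add: in_homs)
  fix W assume W: "W \<in> Obj D"
  show "cov_exact D (n + 2) X W" using cov_left_exact_iff[OF cp[OF X] n] cv[OF X] W unfolding cov_left_exact_def by blast
  show "contra_exact D (n + 2) X W" using contra_left_exact_iff[OF cp[OF X] n] co[OF X] W unfolding contra_left_exact_def by blast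
  have dn: "df X n \<in> homs D (ob X n) (ob X (n + 1))" "df X 0 \<in> homs D (ob X 0) (ob X 1)" by (simp_all add: in_homs)
  have 1: "pull D Gx (ob X 0) c (cl X) = pl c (cl X)" if "c \<in> homs D W (ob X (Suc n))" for c using pull_Gx[OF E that] .
  show "exact_at (homgrp D W (ob X n)) (\<lambda>g. df X n \<cdot> g) (homgrp D W (ob X (n + 1))) (\<lambda>c. pull D Gx (ob X 0) c (cl X)) (GObj Gx W (ob X 0))"
    unfolding exact_at_def
  proof (intro conjI)
    show "(\<lambda>g. df X n \<cdot> g) \<in> hom (homgrp D W (ob X n)) (homgrp D W (ob X (n + 1)))" by (rule homgrp_hom(1)[OF W dn(1)])
    show "(\<lambda>c. pull D Gx (ob X 0) c (cl X)) \<in> hom (homgrp D W (ob X (n + 1))) (GObj Gx W (ob X 0))"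
      using pl_in[OF E, of _ W] bs_pull[OF E, of _ W] Plus_homs[of _ W "ob X (Suc n)"] by (auto simp: hom_def 1)
    have "df X n \<cdot> t \<in> homs D W (ob X (Suc n))" if "t \<in> homs D W (ob X n)" for t using that by (simp add: in_homs)
    then have "x \<in> (\<lambda>g. df X n \<cdot> g) ` homs D W (ob X n) \<longleftrightarrow> x \<in> homs D W (ob X (Suc n)) \<and> pl x (cl X) = baer_zero D n XX W (ob X 0)" for x
      using pl_zero_iff[OF X, of x W] by blast
    then show "(\<lambda>g. df X n \<cdot> g) ` carrier (homgrp D W (ob X n)) = kernel (homgrp D W (ob X (n + 1))) (GObj Gx W (ob X 0)) (\<lambda>c. pull D Gx (ob X 0) c (cl X))"
      by (simp add: kernel_def set_eq_iff 1 cong: conj_cong)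
  qed
  have 2: "push D Gx (ob X (n + 1)) a (cl X) = pu a (cl X)" for a using push_Gx[OF E] by simp
  show "exact_at (homgrp D (ob X 1) W) (\<lambda>g. g \<cdot> df X 0) (homgrp D (ob X 0) W) (\<lambda>a. push D Gx (ob X (n + 1)) a (cl X)) (GObj Gx (ob X (n + 1)) W)"
    unfolding exact_at_def 2
  proof (intro conjI)
    show "(\<lambda>g. g \<cdot> df X 0) \<in> hom (homgrp D (ob X 1) W) (homgrp D (ob X 0) W)" by (rule homgrp_hom(2)[OF W dn(2)])
    show "(\<lambda>a. pu a (cl X)) \<in> hom (homgrp D (ob X 0) W) (GObj Gx (ob X (n + 1)) W)"
      using pu_in[OF E, of _ W] bs_push[OF E, of _ W] Plus_homs[of _ "ob X 0" W] by (auto simp: hom_def)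
    have "t \<cdot> df X 0 \<in> homs D (ob X 0) W" if "t \<in> homs D (ob X (Suc 0)) W" for t using that by (simp add: in_homs)
    then have "x \<in> (\<lambda>g. g \<cdot> df X 0) ` homs D (ob X (Suc 0)) W \<longleftrightarrow> x \<in> homs D (ob X 0) W \<and> pu x (cl X) = baer_zero D n XX (ob X (Suc n)) W" for x
      using pu_zero_iff[OF X, of x W] by blast
    then show "(\<lambda>g. g \<cdot> df X 0) ` carrier (homgrp D (ob X 1) W) = kernel (homgrp D (ob X 0) W) (GObj Gx (ob X (n + 1)) W) (\<lambda>a. pu a (cl X))"
      by (simp add: kernel_def set_eq_iff)
  qed
qed

text \<open>The content of (R0): the pushout of \<open>X\<close> and the pullback of
  \<open>Y\<close> have the same class, and the chain maps through them compose.\<close>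

lemma lift_Gx:
  assumes X: "X \<in> XX" and Y: "Y \<in> XX" and a: "a \<in> homs D (ob X 0) (ob Y 0)" and c: "c \<in> homs D (ob X (Suc n)) (ob Y (Suc n))"
    and e: "pu a (cl X) = pl c (cl Y)"
  shows "emap D n X Y a c"
proof -
  obtain Z where Z: "Z \<in> XX" "emap D n X Z a (Ide D (ob X (Suc n)))" "pu a (cl X) = cl Z" "ob Z 0 = ob Y 0" "ob Z (Suc n) = ob X (Suc n)" by (rule pu_obtain[OF X a])
  obtain V where V: "V \<in> XX" "emap D n V Y (Ide D (ob Y 0)) c" "pl c (cl Y) = cl V" "ob V 0 = ob Y 0" "ob V (Suc n) = ob X (Suc n)" by (rule pl_obtain[OF Y c])
  have "emap D n Z V (Ide D (ob Y 0)) (Ide D (ob X (Suc n)))" using eq_class[OF Z(1) V(1)] e Z V by simp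
  from ecomp[OF X V(1) Y ecomp[OF X Z(1) V(1) Z(2) this] V(2)] show ?thesis
    using a c cpxD(1)[OF cp[OF X]] cpxD(1)[OF cp[OF Y]] by (simp add: in_homs)
qed

lemma realisation_Gx: "exact_realisation D n Gx r_of"
  unfolding exact_realisation_def
proof (intro conjI ballI allI impI, goal_cases)
  case (1 C A d) then show ?case by (auto simp: r_of_def ext_classes_def)
next
  case (2 X Y d d' a c)
  then have XY: "X \<in> XX" "d = cl X" "Y \<in> XX" "d' = cl Y" by (auto simp: distinguished_Gx)
  have ac: "a \<in> homs D (ob X 0) (ob Y 0)" "c \<in> homs D (ob X (Suc n)) (ob Y (Suc n))" using 2 by auto
  have "emap D n X Y a c"
    using lift_Gx[OF XY(1,3) ac] 2 push_Gx[OF ECI[OF XY(1)], of a] pull_Gx[OF ECI[OF XY(3)] ac(2)] XY by simp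
  then show ?case unfolding emap_def cmap_def by auto
next
  case (3 X d) then show ?case using exangle_Gx by (auto simp: distinguished_Gx)
next
  case (4 A)
  note t = triv_mem(1)[OF 4]
  have o: "ob (triv D n 0 A) 0 = A" "ob (triv D n 0 A) (Suc 0) = A" "ob (triv D n 0 A) (Suc n) = zero_obj D" "df (triv D n 0 A) 0 = Ide D A"
    using n by (auto simp: triv_simps)
  have "cl (triv D n 0 A) = baer_zero D n XX (zero_obj D) A"
    using zero_iff_epi[OF t] split_iff[OF t] o 4 by (auto simp: in_homs intro!: bexI[of _ "Ide D A"])
  then show ?case by (simp add: r_of_def)
next
  case (5 C)
  note t = triv_mem(2)[OF 5]
  have o: "ob (triv D n n C) 0 = zero_obj D" "ob (triv D n n C) n = C" "ob (triv D n n C) (Suc n) = C" "df (triv D n n C) n = Ide D C"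
    using n by (auto simp: triv_simps)
  have "cl (triv D n n C) = baer_zero D n XX C (zero_obj D)"
    using zero_iff_epi[OF t] o 5 by (auto simp: in_homs intro!: bexI[of _ "Ide D C"])
  then show ?case by (simp add: r_of_def)
qed

text \<open>In (EA2) and its dual every lift serves: a chain map in \<open>XX\<close> with an
  identity at one end is automatically a pushout and a pullback, so its cone is n-exact.\<close>

lemma exangulated_Gx:
  assumes epis_comp: "closed_under_comp D (admissible_epis n XX)"
  shows "n_exangulated D n Gx r_of"
  unfolding n_exangulated_def
proof (intro conjI allI impI, goal_cases)
  case 1 show ?case by unfold_locales
next
  case 2 show ?case by (rule biadditive_Gx)
next
  case 3 show ?case by (rule realisation_Gx)
next
  case 4 show ?case using monos_comp by (simp add: inflations_def conflations_Gx admissible_monos_def)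
next
  case 5 show ?case using epis_comp by (simp add: deflations_def conflations_Gx admissible_epis_def)
next
  case (6 X Y c d)
  then have c: "c \<in> homs D (ob X (Suc n)) (ob Y (Suc n))" and o: "ob X 0 = ob Y 0" and Y: "Y \<in> XX" "d = cl Y"
    and X: "X \<in> XX" "pull D Gx (ob Y 0) c d = cl X" by (auto simp: distinguished_Gx)
  note [simp] = cpx_type[OF cp[OF X(1)]] cpx_type[OF cp[OF Y(1)]]
  have "pu (Ide D (ob Y 0)) (cl X) = pl c (cl Y)"
    using X(2) Y(2) pull_Gx[OF ECI[OF Y(1)] c] pu_id[OF ECI[OF X(1)]] o by simp
  then have e: "emap D n X Y (Ide D (ob X 0)) c" using lift_Gx[OF X(1) Y(1), of "Ide D (ob Y 0)" c] c o by (simp add: in_homs)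
  obtain f where f: "cmap D (Suc n) X Y f" "f 0 = Ide D (ob X 0)" "f (Suc n) = c" by (rule emapE[OF e])
  let ?M = "M_cone D n X Y f"
  have M: "nex D n ?M" using nex_M_cone[OF cp[OF X(1)] cp[OF Y(1)] f(1) n] pb_po_elt[OF X(1) Y(1) f(1,2)] by simp
  have j: "emap D n Y ?M (df X 0) (Ide D (ob Y (Suc n)))" by (rule emap_M_cone[OF cp[OF X(1)] cp[OF Y(1)] f(1,2) n])
  have "?M \<in> XX" by (rule closed_push[OF Y(1) M j]) (simp add: iso_Ide)
  then have "distinguished D n Gx r_of ?M (push D Gx (ob Y (n + 1)) (df X 0) d)"
    unfolding distinguished_Gx using pu_eq[OF Y(1) _ j] push_Gx[OF ECI[OF Y(1)]] Y(2) by simp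
  then show ?case using f unfolding cmap_def by auto
next
  case (7 X Y a d)
  then have a: "a \<in> homs D (ob X 0) (ob Y 0)" and o: "ob X (Suc n) = ob Y (Suc n)" and X: "X \<in> XX" "d = cl X"
    and Y: "Y \<in> XX" "push D Gx (ob X (Suc n)) a d = cl Y" unfolding distinguished_Gx Suc_eq_plus1 by blast+
  note [simp] = cpx_type[OF cp[OF X(1)]] cpx_type[OF cp[OF Y(1)]]
  have "pu a (cl X) = pl (Ide D (ob X (Suc n))) (cl Y)"
    using Y(2) X(2) push_Gx[OF ECI[OF X(1)], of a] pl_id[OF ECI[OF Y(1)]] o by simp
  then have e: "emap D n X Y a (Ide D (ob X (Suc n)))" using lift_Gx[OF X(1) Y(1) a, of "Ide D (ob X (Suc n))"] o by (simp add: in_homs)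
  obtain f where f: "cmap D (Suc n) X Y f" "f 0 = a" "f (Suc n) = Ide D (ob X (Suc n))" by (rule emapE[OF e])
  let ?N = "N_cone D n X Y f"
  have "po_elt D n (segment 0 (n + 1) X) (segment 0 (n + 1) Y) (segment_map 0 (n + 1) f)"
    using po_pb_elt(1)[OF X(1) Y(1) f(1,3)] by (subst po_elt_cong[OF n, where X' = X and Y' = Y and f' = f]) (auto simp: segment_def segment_map_def)
  moreover have "pb_elt D n (segment 0 (n + 1) X) (segment 0 (n + 1) Y) (segment_map 0 (n + 1) f)"
    using po_pb_elt(2)[OF X(1) Y(1) f(1,3)] by (subst pb_elt_cong[OF n, where X' = X and Y' = Y and f' = f]) (auto simp: segment_def segment_map_def)
  ultimately have N: "nex D n ?N" using nex_N_cone[OF cp[OF X(1)] cp[OF Y(1)] f(1) n] by simp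
  have j: "emap D n ?N X (Ide D (ob X 0)) (df Y n)" by (rule emap_N_cone[OF cp[OF X(1)] cp[OF Y(1)] f(1,3) n])
  have "?N \<in> XX" by (rule closed_pull[OF X(1) N j]) (simp add: iso_Ide)
  then have "distinguished D n Gx r_of ?N (pull D Gx (ob X 0) (df Y n) d)"
    unfolding distinguished_Gx using pl_eq[OF X(1) _ j] pull_Gx[OF ECI[OF X(1)], of "df Y n" "ob Y n"] X(2) o by (simp add: in_homs)
  then show ?case using f unfolding cmap_def by auto
qed

lemma monic_epic_Gx: "X \<in> XX \<Longrightarrow> is_monic D (df X 0)" "X \<in> XX \<Longrightarrow> is_epic D (df X n)"
  using covX_mono[OF cv] contraX_epi[OF co] cpx_type[OF cp] by (auto simp: is_monic_def is_epic_def)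

lemma exangulated_structures_Gx:
  assumes "closed_under_comp D (admissible_epis n XX)"
  shows "(Gx, r_of) \<in> exangulated_structures D n"
  using exangulated_Gx[OF assms] monic_epic_Gx
  by (auto simp: exangulated_structures_def inflations_def deflations_def conflations_Gx)

end

section \<open>From \<open>n\<close>-exangulated to \<open>n\<close>-exact structures\<close>

locale biadd = acat +
  fixes G :: "('a, 'b, 'e) bifun"
  assumes bi: "biadditive_functor D G"
begin

abbreviation "EG C A \<equiv> carrier (GObj G C A)"
abbreviation "ps C \<equiv> push D G C"
abbreviation "pb A \<equiv> pull D G A"

lemma grpG: "C \<in> Obj D \<Longrightarrow> A \<in> Obj D \<Longrightarrow> comm_group (GObj G C A)"
  by (rule bi[unfolded biadditive_functor_def, THEN conjunct1, rule_format])

lemma grpG': "C \<in> Obj D \<Longrightarrow> A \<in> Obj D \<Longrightarrow> group (GObj G C A)"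
  using grpG comm_group.axioms(2) by blast

lemma GMap_hom: "c \<in> Arr D \<Longrightarrow> a \<in> Arr D \<Longrightarrow> GMap G c a \<in> hom (GObj G (Cod D c) (Dom D a)) (GObj G (Dom D c) (Cod D a))"
  by (rule bi[unfolded biadditive_functor_def, THEN conjunct2, THEN conjunct1, rule_format])

lemma GMap_id: "C \<in> Obj D \<Longrightarrow> A \<in> Obj D \<Longrightarrow> \<delta> \<in> EG C A \<Longrightarrow> GMap G (Ide D C) (Ide D A) \<delta> = \<delta>"
  by (rule bi[unfolded biadditive_functor_def, THEN conjunct2, THEN conjunct2, THEN conjunct1, rule_format])

lemma GMap_comp: "c \<in> Arr D \<Longrightarrow> c' \<in> Arr D \<Longrightarrow> a \<in> Arr D \<Longrightarrow> a' \<in> Arr D \<Longrightarrow> Cod D c' = Dom D c \<Longrightarrow> Cod D a = Dom D a' \<Longrightarrow>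
    \<delta> \<in> EG (Cod D c) (Dom D a) \<Longrightarrow> GMap G (c \<cdot> c') (a' \<cdot> a) \<delta> = GMap G c' a' (GMap G c a \<delta>)"
  by (rule bi[unfolded biadditive_functor_def, THEN conjunct2, THEN conjunct2, THEN conjunct2, THEN conjunct1, rule_format]) auto

lemma GMap_plus_left: "c \<in> homs D C' C \<Longrightarrow> c' \<in> homs D C' C \<Longrightarrow> a \<in> homs D A A' \<Longrightarrow> \<delta> \<in> EG C A \<Longrightarrow>
    GMap G (c \<boxplus> c') a \<delta> = GMap G c a \<delta> \<otimes>\<^bsub>GObj G C' A'\<^esub> GMap G c' a \<delta>"
  using bi[unfolded biadditive_functor_def, THEN conjunct2, THEN conjunct2, THEN conjunct2, THEN conjunct2, THEN conjunct1, rule_format] homs_obj[of c]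
  by (auto simp: in_homs)

lemma GMap_plus_right: "a \<in> homs D A A' \<Longrightarrow> a' \<in> homs D A A' \<Longrightarrow> c \<in> homs D C' C \<Longrightarrow> \<delta> \<in> EG C A \<Longrightarrow>
    GMap G c (a \<boxplus> a') \<delta> = GMap G c a \<delta> \<otimes>\<^bsub>GObj G C' A'\<^esub> GMap G c a' \<delta>"
  using bi[unfolded biadditive_functor_def, THEN conjunct2, THEN conjunct2, THEN conjunct2, THEN conjunct2, THEN conjunct2, rule_format] homs_obj[of a]
  by (auto simp: in_homs)

lemma ps_hom: "a \<in> homs D A B \<Longrightarrow> C \<in> Obj D \<Longrightarrow> ps C a \<in> hom (GObj G C A) (GObj G C B)"
  using GMap_hom[of "Ide D C" a] by (simp add: push_def[abs_def] in_homs)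

lemma pb_hom: "c \<in> homs D B C \<Longrightarrow> A \<in> Obj D \<Longrightarrow> pb A c \<in> hom (GObj G C A) (GObj G B A)"
  using GMap_hom[of c "Ide D A"] by (simp add: pull_def[abs_def] in_homs)

lemma ps_in: "\<delta> \<in> EG C A \<Longrightarrow> a \<in> homs D A B \<Longrightarrow> C \<in> Obj D \<Longrightarrow> ps C a \<delta> \<in> EG C B"
  using ps_hom[of a A B C] by (auto simp: hom_def)

lemma pb_in: "\<delta> \<in> EG C A \<Longrightarrow> c \<in> homs D B C \<Longrightarrow> A \<in> Obj D \<Longrightarrow> pb A c \<delta> \<in> EG B A"
  using pb_hom[of c B C A] by (auto simp: hom_def)

lemma ps_one: "a \<in> homs D A B \<Longrightarrow> C \<in> Obj D \<Longrightarrow> ps C a \<one>\<^bsub>GObj G C A\<^esub> = \<one>\<^bsub>GObj G C B\<^esub>"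
  using hom_one[OF ps_hom grpG' grpG'] homs_obj by blast

lemma pb_one: "c \<in> homs D B C \<Longrightarrow> A \<in> Obj D \<Longrightarrow> pb A c \<one>\<^bsub>GObj G C A\<^esub> = \<one>\<^bsub>GObj G B A\<^esub>"
  using hom_one[OF pb_hom grpG' grpG'] homs_obj by blast

lemma ps_mult: "\<delta> \<in> EG C A \<Longrightarrow> \<rho> \<in> EG C A \<Longrightarrow> a \<in> homs D A B \<Longrightarrow> C \<in> Obj D \<Longrightarrow>
   ps C a (\<delta> \<otimes>\<^bsub>GObj G C A\<^esub> \<rho>) = ps C a \<delta> \<otimes>\<^bsub>GObj G C B\<^esub> ps C a \<rho>"
  using hom_mult[OF ps_hom] by blast

lemma pb_mult: "\<delta> \<in> EG C A \<Longrightarrow> \<rho> \<in> EG C A \<Longrightarrow> c \<in> homs D B C \<Longrightarrow> A \<in> Obj D \<Longrightarrow>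
   pb A c (\<delta> \<otimes>\<^bsub>GObj G C A\<^esub> \<rho>) = pb A c \<delta> \<otimes>\<^bsub>GObj G B A\<^esub> pb A c \<rho>"
  using hom_mult[OF pb_hom] by blast

lemma ps_id: "\<delta> \<in> EG C A \<Longrightarrow> C \<in> Obj D \<Longrightarrow> A \<in> Obj D \<Longrightarrow> ps C (Ide D A) \<delta> = \<delta>"
  by (simp add: push_def GMap_id)

lemma pb_id: "\<delta> \<in> EG C A \<Longrightarrow> C \<in> Obj D \<Longrightarrow> A \<in> Obj D \<Longrightarrow> pb A (Ide D C) \<delta> = \<delta>"
  by (simp add: pull_def GMap_id)

lemma ps_comp: "\<delta> \<in> EG C A \<Longrightarrow> a \<in> homs D A B \<Longrightarrow> b \<in> homs D B B' \<Longrightarrow> C \<in> Obj D \<Longrightarrow> ps C (b \<cdot> a) \<delta> = ps C b (ps C a \<delta>)"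
  using GMap_comp[of "Ide D C" "Ide D C" a b \<delta>] by (simp add: push_def in_homs)

lemma pb_comp: "\<delta> \<in> EG C A \<Longrightarrow> c \<in> homs D B C \<Longrightarrow> b \<in> homs D B' B \<Longrightarrow> A \<in> Obj D \<Longrightarrow> pb A (c \<cdot> b) \<delta> = pb A b (pb A c \<delta>)"
  using GMap_comp[of c b "Ide D A" "Ide D A" \<delta>] by (simp add: pull_def in_homs)

lemma GMap_eq: "\<delta> \<in> EG C A \<Longrightarrow> a \<in> homs D A B \<Longrightarrow> c \<in> homs D C' C \<Longrightarrow> GMap G c a \<delta> = ps C' a (pb A c \<delta>)"
  using GMap_comp[of c "Ide D C'" "Ide D A" a \<delta>] homs_obj[of a A B] homs_obj[of c C' C] by (simp add: push_def pull_def in_homs)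

lemma ps_pb: "\<delta> \<in> EG C A \<Longrightarrow> a \<in> homs D A B \<Longrightarrow> c \<in> homs D C' C \<Longrightarrow> ps C' a (pb A c \<delta>) = pb B c (ps C a \<delta>)"
  using GMap_comp[of "Ide D C" c a "Ide D B" \<delta>] homs_obj[of a A B] homs_obj[of c C' C] GMap_eq[of \<delta> C A a B c C']
  by (simp add: push_def pull_def in_homs)

lemma ps_plus: "\<delta> \<in> EG C A \<Longrightarrow> a \<in> homs D A B \<Longrightarrow> b \<in> homs D A B \<Longrightarrow> C \<in> Obj D \<Longrightarrow>
   ps C (a \<boxplus> b) \<delta> = ps C a \<delta> \<otimes>\<^bsub>GObj G C B\<^esub> ps C b \<delta>"
  unfolding push_def by (rule GMap_plus_right[OF _ _ Ide_in])

lemma pb_plus: "\<delta> \<in> EG C A \<Longrightarrow> c \<in> homs D B C \<Longrightarrow> b \<in> homs D B C \<Longrightarrow> A \<in> Obj D \<Longrightarrow>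
   pb A (c \<boxplus> b) \<delta> = pb A c \<delta> \<otimes>\<^bsub>GObj G B A\<^esub> pb A b \<delta>"
  unfolding pull_def by (rule GMap_plus_left[OF _ _ Ide_in])

lemma pb_Zero:
  assumes d: "\<delta> \<in> EG C A" and o: "A \<in> Obj D" "B \<in> Obj D" "C \<in> Obj D"
  shows "pb A (Zero D B C) \<delta> = \<one>\<^bsub>GObj G B A\<^esub>"
proof -
  have z: "Zero D B C \<in> homs D B C" using o by (simp add: in_homs)
  have "pb A (Zero D B C) \<delta> \<otimes>\<^bsub>GObj G B A\<^esub> pb A (Zero D B C) \<delta> = pb A (Zero D B C) \<delta>"
    using pb_plus[OF d z z o(1)] o by simp
  then show ?thesis using group.l_cancel_one'[OF grpG'[OF o(2,1)] pb_in[OF d z o(1)] pb_in[OF d z o(1)]] by simp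
qed

end

locale exg = biadd +
  fixes n :: nat and r :: "('a, 'b, 'c) realisation"
  assumes n: "1 \<le> n" and exg: "n_exangulated D n G r"
    and mono: "f \<in> inflations D n G r \<Longrightarrow> is_monic D f"
    and epi: "f \<in> deflations D n G r \<Longrightarrow> is_epic D f"
begin

abbreviation "dist \<equiv> distinguished D n G r"
abbreviation "conf \<equiv> conflations D n G r"

lemma re: "exact_realisation D n G r"
  using exg unfolding n_exangulated_def by blast

lemma dist_complex: "dist X \<delta> \<Longrightarrow> cpx D (Suc n) X" "dist X \<delta> \<Longrightarrow> \<delta> \<in> EG (ob X (Suc n)) (ob X 0)"
  by (auto simp: distinguished_def cpx_def)

lemma dist_obj: "dist X \<delta> \<Longrightarrow> ob X 0 \<in> Obj D" "dist X \<delta> \<Longrightarrow> ob X (Suc n) \<in> Obj D"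
  using cpxD(1)[OF dist_complex(1)] by auto

lemma exangle: "dist X \<delta> \<Longrightarrow> is_n_exangle D n G X \<delta>"
  using re unfolding exact_realisation_def by blast

lemma realise:
  assumes "\<delta> \<in> EG C A" "C \<in> Obj D" "A \<in> Obj D"
  obtains X where "dist X \<delta>" "ob X 0 = A" "ob X (Suc n) = C"
proof -
  have "r C A \<delta> \<in> htpy_class D n ` ends_complexes D n A C" using re assms unfolding exact_realisation_def by blast
  then show thesis using that assms by (auto simp: distinguished_def ends_complexes_def)
qed

lemma conf_mono: "dist X \<delta> \<Longrightarrow> is_monic D (df X 0)" and conf_epi: "dist X \<delta> \<Longrightarrow> is_epic D (df X n)"
  using mono epi by (auto simp: inflations_def deflations_def conflations_def)

lemma dist_nex: assumes d: "dist X \<delta>" shows "nex D n X"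
proof -
  note c = dist_complex(1)[OF d]
  note [simp] = cpx_type[OF c]
  have "cov_left_exact D n X"
    unfolding cov_left_exact_def
  proof (intro ballI conjI)
    fix W assume W: "W \<in> Obj D"
    show "cov_exact D (n + 2) X W" using exangle[OF d] W unfolding is_n_exangle_def by blast
    have "g = Zero D W (ob X 0)" if "g \<in> homs D W (ob X 0)" "df X 0 \<cdot> g = Zero D W (ob X (Suc 0))" for g
    proof -
      have "df X 0 \<cdot> g = df X 0 \<cdot> Zero D W (ob X 0)" using that W by simp
      moreover have "Zero D W (ob X 0) \<in> homs D W (ob X 0)" using W by (simp add: in_homs)
      ultimately show ?thesis using conf_mono[OF d] that(1) W unfolding is_monic_def by simp
    qed
    moreover have "Zero D W (ob X 0) \<in> homs D W (ob X 0)" "df X 0 \<cdot> Zero D W (ob X 0) = Zero D W (ob X (Suc 0))" using W by (simp_all add: in_homs)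
    ultimately show "kernel (homgrp D W (ob X 0)) (homgrp D W (ob X 1)) (\<lambda>g. df X 0 \<cdot> g) = {Zero D W (ob X 0)}"
      unfolding kernel_def homgrp_simps One_nat_def by blast
  qed
  moreover have "contra_left_exact D n X"
    unfolding contra_left_exact_def
  proof (intro ballI conjI)
    fix W assume W: "W \<in> Obj D"
    show "contra_exact D (n + 2) X W" using exangle[OF d] W unfolding is_n_exangle_def by blast
    have "g = Zero D (ob X (Suc n)) W" if "g \<in> homs D (ob X (Suc n)) W" "g \<cdot> df X n = Zero D (ob X n) W" for g
    proof -
      have "g \<cdot> df X n = Zero D (ob X (Suc n)) W \<cdot> df X n" using that W by simp
      moreover have "Zero D (ob X (Suc n)) W \<in> homs D (ob X (Suc n)) W" using W by (simp add: in_homs)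
      ultimately show ?thesis using conf_epi[OF d] that(1) W unfolding is_epic_def by simp
    qed
    moreover have "Zero D (ob X (Suc n)) W \<in> homs D (ob X (Suc n)) W" "Zero D (ob X (Suc n)) W \<cdot> df X n = Zero D (ob X n) W" using W by (simp_all add: in_homs)
    ultimately show "kernel (homgrp D (ob X (n + 1)) W) (homgrp D (ob X n) W) (\<lambda>g. g \<cdot> df X n) = {Zero D (ob X (n + 1)) W}"
      unfolding kernel_def homgrp_simps Suc_eq_plus1[symmetric] by blast
  qed
  ultimately show ?thesis using cov_left_exact_iff[OF c n] contra_left_exact_iff[OF c n] c by (simp add: nex_def)
qed

lemma dist_contra: "dist X \<delta> \<Longrightarrow> contraX D n X" and dist_cov: "dist X \<delta> \<Longrightarrow> covX D n X"
  using dist_nex by (auto simp: nex_def)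

lemma lift: "dist X \<delta> \<Longrightarrow> dist Y \<rho> \<Longrightarrow> a \<in> homs D (ob X 0) (ob Y 0) \<Longrightarrow> c \<in> homs D (ob X (Suc n)) (ob Y (Suc n)) \<Longrightarrow>
    ps (ob X (Suc n)) a \<delta> = pb (ob Y 0) c \<rho> \<Longrightarrow> emap D n X Y a c"
proof -
  assume *: "dist X \<delta>" "dist Y \<rho>" "a \<in> homs D (ob X 0) (ob Y 0)" "c \<in> homs D (ob X (Suc n)) (ob Y (Suc n))"
    "ps (ob X (Suc n)) a \<delta> = pb (ob Y 0) c \<rho>"
  have "\<forall>X Y \<delta> \<rho>. distinguished D n G r X \<delta> \<and> distinguished D n G r Y \<rho> \<longrightarrow>
        (\<forall>a\<in>homs D (ob X 0) (ob Y 0). \<forall>c\<in>homs D (ob X (n + 1)) (ob Y (n + 1)).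
           push D G (ob X (n + 1)) a \<delta> = pull D G (ob Y 0) c \<rho> \<longrightarrow>
           (\<exists>f\<in>chain_maps D (n + 2) X Y. f 0 = a \<and> f (n + 1) = c))"
    using re unfolding exact_realisation_def by blast
  then show "emap D n X Y a c" using * unfolding emap_def cmap_def by simp blast
qed

lemma dist_zero: assumes "dist X \<delta>"
  shows "ps (ob X (Suc n)) (df X 0) \<delta> = \<one>\<^bsub>GObj G (ob X (Suc n)) (ob X (Suc 0))\<^esub>"
    "pb (ob X 0) (df X n) \<delta> = \<one>\<^bsub>GObj G (ob X n) (ob X 0)\<^esub>"
  using exangle[OF assms] unfolding is_n_exangle_def by auto

lemma pb_exact:
  assumes d: "dist X \<delta>" and c: "c \<in> homs D W (ob X (Suc n))" and z: "pb (ob X 0) c \<delta> = \<one>\<^bsub>GObj G W (ob X 0)\<^esub>"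
  obtains t where "t \<in> homs D W (ob X n)" "c = df X n \<cdot> t"
proof -
  have "(\<lambda>g. df X n \<cdot> g) ` homs D W (ob X n) = kernel (homgrp D W (ob X (n + 1))) (GObj G W (ob X 0)) (\<lambda>c. pb (ob X 0) c \<delta>)"
    using exangle[OF d] homs_obj(1)[OF c] unfolding is_n_exangle_def exact_at_def by simp
  moreover have "c \<in> kernel (homgrp D W (ob X (n + 1))) (GObj G W (ob X 0)) (\<lambda>c. pb (ob X 0) c \<delta>)"
    using c z by (simp add: kernel_def)
  ultimately show thesis using that by blast
qed

lemma ps_exact:
  assumes d: "dist X \<delta>" and a: "a \<in> homs D (ob X 0) W" and z: "ps (ob X (Suc n)) a \<delta> = \<one>\<^bsub>GObj G (ob X (Suc n)) W\<^esub>"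
  obtains t where "t \<in> homs D (ob X (Suc 0)) W" "a = t \<cdot> df X 0"
proof -
  have "(\<lambda>g. g \<cdot> df X 0) ` homs D (ob X 1) W = kernel (homgrp D (ob X 0) W) (GObj G (ob X (n + 1)) W) (\<lambda>a. ps (ob X (n + 1)) a \<delta>)"
    using exangle[OF d] homs_obj(2)[OF a] unfolding is_n_exangle_def exact_at_def by simp
  moreover have "a \<in> kernel (homgrp D (ob X 0) W) (GObj G (ob X (n + 1)) W) (\<lambda>a. ps (ob X (n + 1)) a \<delta>)"
    using a z by (simp add: kernel_def)
  ultimately show thesis using that by auto
qed

lemma ps_factor_zero:
  assumes d: "dist X \<delta>" and u: "u \<in> homs D (ob X (Suc 0)) W"
  shows "ps (ob X (Suc n)) (u \<cdot> df X 0) \<delta> = \<one>\<^bsub>GObj G (ob X (Suc n)) W\<^esub>"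
  using ps_comp[OF dist_complex(2)[OF d] cpxD(2)[OF dist_complex(1)[OF d]] u dist_obj(2)[OF d]] dist_zero(1)[OF d] ps_one[OF u dist_obj(2)[OF d]] by simp

lemma pb_factor_zero:
  assumes d: "dist X \<delta>" and u: "u \<in> homs D W (ob X n)"
  shows "pb (ob X 0) (df X n \<cdot> u) \<delta> = \<one>\<^bsub>GObj G W (ob X 0)\<^esub>"
  using pb_comp[OF dist_complex(2)[OF d] cpxD(2)[OF dist_complex(1)[OF d]] u dist_obj(1)[OF d]] dist_zero(2)[OF d] pb_one[OF u dist_obj(1)[OF d]] by simp

lemma dist_transfer:
  assumes d: "dist X \<delta>" and Y: "nex D n Y" and e: "emap D n X Y (Ide D (ob X 0)) (Ide D (ob X (Suc n)))"
    "emap D n Y X (Ide D (ob X 0)) (Ide D (ob X (Suc n)))"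
  shows "dist Y \<delta>"
proof -
  have "ob Y 0 = ob X 0" "ob Y (Suc n) = ob X (Suc n)" using emap_type[OF e(1)] dist_obj[OF d] by auto
  then show ?thesis using d Y htpy_class_eq[OF n dist_nex[OF d] Y] e by (auto simp: distinguished_def nex_def cpx_def)
qed

text \<open>The kernel of \<open>(d\<^sub>0\<^sup>X)\<^sub>*\<close>: apply (EA2) to the inclusion \<open>C \<rightarrow> C \<oplus> W\<close> and the extension
  with components \<open>\<delta>\<close> and \<open>\<rho>\<close>; the resulting cone is split.\<close>

lemma ps_kernel:
  assumes d: "dist X \<delta>" and rho: "\<rho> \<in> EG W (ob X 0)" and W: "W \<in> Obj D" and z: "ps W (df X 0) \<rho> = \<one>\<^bsub>GObj G W (ob X (Suc 0))\<^esub>"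
  obtains c where "c \<in> homs D W (ob X (Suc n))" "\<rho> = pb (ob X 0) c \<delta>"
proof -
  let ?A = "ob X 0" and ?C = "ob X (Suc n)"
  let ?P = "biprod D ?C W" and ?S = "dsum D ?C W"
  note cX = dist_complex(1)[OF d] and dX = dist_complex(2)[OF d]
  note [simp] = cpx_type[OF cX] W
  have A: "?A \<in> Obj D" "?C \<in> Obj D" "?S \<in> Obj D" by auto
  have h: "Pr1 ?P \<in> homs D ?S ?C" "Pr2 ?P \<in> homs D ?S W" "In1 ?P \<in> homs D ?C ?S" "In2 ?P \<in> homs D W ?S" by (auto simp: in_homs)
  \<comment> \<open>The extension on \<open>C \<oplus> W\<close> with components \<delta> and
    \<rho>; restricting it to the summands recovers them in \<open>p1\<close> and
    \<open>p2\<close>.\<close>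
  define \<theta> where "\<theta> = pb ?A (Pr1 ?P) \<delta> \<otimes>\<^bsub>GObj G ?S ?A\<^esub> pb ?A (Pr2 ?P) \<rho>"
  have in1: "pb ?A (Pr1 ?P) \<delta> \<in> EG ?S ?A" "pb ?A (Pr2 ?P) \<rho> \<in> EG ?S ?A"
    using pb_in[OF dX h(1) A(1)] pb_in[OF rho h(2) A(1)] by auto
  have th: "\<theta> \<in> EG ?S ?A" unfolding \<theta>_def using monoid.m_closed[OF group.is_monoid[OF grpG'[OF A(3,1)]] in1] .
  interpret gC: group "GObj G ?C ?A" by (rule grpG'[OF A(2,1)])
  interpret gW: group "GObj G W ?A" by (rule grpG'[OF W A(1)])
  have "pb ?A (In1 ?P) \<theta> = pb ?A (Pr1 ?P \<cdot> In1 ?P) \<delta> \<otimes>\<^bsub>GObj G ?C ?A\<^esub> pb ?A (Pr2 ?P \<cdot> In1 ?P) \<rho>"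
    unfolding \<theta>_def using pb_mult[OF in1 h(3) A(1)] pb_comp[OF dX h(1,3) A(1)] pb_comp[OF rho h(2,3) A(1)] by simp
  then have p1: "pb ?A (In1 ?P) \<theta> = \<delta>"
    using pb_id[OF dX A(2,1)] pb_Zero[OF rho A(1,2) W] dX by simp
  have "pb ?A (In2 ?P) \<theta> = pb ?A (Pr1 ?P \<cdot> In2 ?P) \<delta> \<otimes>\<^bsub>GObj G W ?A\<^esub> pb ?A (Pr2 ?P \<cdot> In2 ?P) \<rho>"
    unfolding \<theta>_def using pb_mult[OF in1 h(4) A(1)] pb_comp[OF dX h(1,4) A(1)] pb_comp[OF rho h(2,4) A(1)] by simp
  then have p2: "pb ?A (In2 ?P) \<theta> = \<rho>"
    using pb_id[OF rho W A(1)] pb_Zero[OF dX A(1) W A(2)] rho by simp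
  obtain T where T: "dist T \<theta>" "ob T 0 = ?A" "ob T (Suc n) = ?S" by (rule realise[OF th A(3,1)])
  note cT = dist_complex(1)[OF T(1)]
  note [simp] = cpx_type[OF cT]
  have ea: "\<forall>X Y c \<rho>. ob X 0 = ob Y 0 \<and> c \<in> homs D (ob X (n + 1)) (ob Y (n + 1)) \<and>
        distinguished D n G r Y \<rho> \<and> distinguished D n G r X (pull D G (ob Y 0) c \<rho>) \<longrightarrow>
        (\<exists>f\<in>chain_maps D (n + 2) X Y. f 0 = Ide D (ob X 0) \<and> f (n + 1) = c \<and>
           distinguished D n G r (M_cone D n X Y f) (push D G (ob Y (n + 1)) (df X 0) \<rho>))"
    using exg unfolding n_exangulated_def by blast
  obtain f where f: "f (Suc n) = In1 ?P" and M: "dist (M_cone D n X T f) (ps ?S (df X 0) \<theta>)"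
    using ea[rule_format, of X T "In1 ?P" \<theta>] T d p1 h(3) by auto
  have dh: "df X 0 \<in> homs D ?A (ob X (Suc 0))" by (simp add: in_homs)
  have "ps ?S (df X 0) \<theta> = ps ?S (df X 0) (pb ?A (Pr1 ?P) \<delta>) \<otimes>\<^bsub>GObj G ?S (ob X (Suc 0))\<^esub> ps ?S (df X 0) (pb ?A (Pr2 ?P) \<rho>)"
    unfolding \<theta>_def by (rule ps_mult[OF in1 dh A(3)])
  also have "ps ?S (df X 0) (pb ?A (Pr1 ?P) \<delta>) = \<one>\<^bsub>GObj G ?S (ob X (Suc 0))\<^esub>"
    using ps_pb[OF dX dh h(1)] dist_zero(1)[OF d] pb_one[OF h(1)] by simp
  also have "ps ?S (df X 0) (pb ?A (Pr2 ?P) \<rho>) = \<one>\<^bsub>GObj G ?S (ob X (Suc 0))\<^esub>"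
    using ps_pb[OF rho dh h(2)] z pb_one[OF h(2)] by simp
  finally have zero: "ps ?S (df X 0) \<theta> = \<one>\<^bsub>GObj G ?S (ob X (Suc 0))\<^esub>"
    using monoid.l_one[OF group.is_monoid[OF grpG'[OF A(3)]]] monoid.one_closed[OF group.is_monoid[OF grpG'[OF A(3)]]] by simp
  let ?M = "M_cone D n X T f"
  have M': "ob ?M 0 = ob X (Suc 0)" "ob ?M (Suc n) = ?S" "ob ?M n = dsum D ?C (ob T n)" "df ?M n = row D (In1 ?P) (df T n)"
    using n f T(3) by (auto simp: M_cone_def)
  have IS: "Ide D ?S \<in> homs D ?S ?S" by (simp add: in_homs)
  have "pb (ob ?M 0) (Ide D ?S) (ps ?S (df X 0) \<theta>) = \<one>\<^bsub>GObj G ?S (ob ?M 0)\<^esub>"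
    unfolding zero M' using pb_one[OF IS] by simp
  \<comment> \<open>The cone carries the zero extension, so the identity of
    \<open>C \<oplus> W\<close> factors through its last differential.\<close>
  then obtain s where s: "s \<in> homs D ?S (dsum D ?C (ob T n))" "Ide D ?S = row D (In1 ?P) (df T n) \<cdot> s"
    using pb_exact[OF M, of "Ide D ?S" ?S] IS M' by metis
  obtain s1 s2 where s12: "s1 \<in> homs D ?S ?C" "s2 \<in> homs D ?S (ob T n)" "s = col D s1 s2"
    by (rule col_cases[OF s(1)]) auto
  note [simp] = s12(1,2)[unfolded in_homs]
  have I: "Ide D ?S = (In1 ?P \<cdot> s1) \<boxplus> (df T n \<cdot> s2)"
    using s(2) s12(3) T(3) by (simp add: row_col)
  \<comment> \<open>Restrict to \<open>W\<close> and pull \<theta> back: the part through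
    \<open>df T n\<close> contributes nothing, and the other part is the pullback of \<delta> along
    \<open>s1 \<cdot> In2 ?P\<close>.\<close>
  have "In2 ?P = Ide D ?S \<cdot> In2 ?P" by simp
  also have "\<dots> = (In1 ?P \<cdot> (s1 \<cdot> In2 ?P)) \<boxplus> (df T n \<cdot> (s2 \<cdot> In2 ?P))"
    unfolding I using T(3) by (simp add: distr assoc)
  finally have I2: "In2 ?P = (In1 ?P \<cdot> (s1 \<cdot> In2 ?P)) \<boxplus> (df T n \<cdot> (s2 \<cdot> In2 ?P))" .
  have hh: "In1 ?P \<cdot> (s1 \<cdot> In2 ?P) \<in> homs D W ?S" "df T n \<cdot> (s2 \<cdot> In2 ?P) \<in> homs D W ?S"
    "s1 \<cdot> In2 ?P \<in> homs D W ?C" "s2 \<cdot> In2 ?P \<in> homs D W (ob T n)" using T(3) by (auto simp: in_homs)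
  have "\<rho> = pb ?A (In1 ?P \<cdot> (s1 \<cdot> In2 ?P)) \<theta> \<otimes>\<^bsub>GObj G W ?A\<^esub> pb ?A (df T n \<cdot> (s2 \<cdot> In2 ?P)) \<theta>"
    using p2 I2 pb_plus[OF th hh(1,2) A(1)] by simp
  also have "pb ?A (df T n \<cdot> (s2 \<cdot> In2 ?P)) \<theta> = \<one>\<^bsub>GObj G W ?A\<^esub>"
    using pb_factor_zero[OF T(1) hh(4)] T(2) by simp
  also have "pb ?A (In1 ?P \<cdot> (s1 \<cdot> In2 ?P)) \<theta> = pb ?A (s1 \<cdot> In2 ?P) \<delta>"
    using pb_comp[OF th h(3) hh(3) A(1)] p1 by simp
  finally have "\<rho> = pb ?A (s1 \<cdot> In2 ?P) \<delta>" using pb_in[OF dX hh(3) A(1)] by simp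
  then show thesis using that hh(3) by blast
qed

text \<open>The pushout of \<delta> along \<open>a\<close> is killed by
  \<open>d\<^sub>0\<^sup>Y\<close>, since \<open>d\<^sub>0\<^sup>Y a\<close> extends over
  \<open>d\<^sub>0\<^sup>X\<close>; by \<open>ps_kernel\<close> it is the pullback of \<rho> along
  some \<open>k\<close>. Lifting gives a chain map with ends \<open>a\<close> and \<open>k\<close>,
  so \<open>c\<close> and \<open>k\<close> differ by a map through \<open>d\<^sub>n\<^sup>Y\<close>,
  along which \<rho> pulls back to zero.\<close>

lemma emap_morphism:
  assumes X: "dist X \<delta>" and Y: "dist Y \<rho>" and e: "emap D n X Y a c"
  shows "ps (ob X (Suc n)) a \<delta> = pb (ob Y 0) c \<rho>"
proof -
  note cX = dist_complex[OF X] and cY = dist_complex[OF Y]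
  note [simp] = cpx_type[OF cX(1)] cpx_type[OF cY(1)] emap_type[OF e]
  obtain f where f: "cmap D (Suc n) X Y f" "f 0 = a" "f (Suc n) = c" by (rule emapE[OF e])
  note [simp] = cmap_type[OF f(1)]
  let ?z = "ps (ob X (Suc n)) a \<delta>"
  have z: "?z \<in> EG (ob X (Suc n)) (ob Y 0)" by (rule ps_in[OF cX(2) emap_homs(1)[OF e]]) simp
  obtain Z where Z: "dist Z ?z" "ob Z 0 = ob Y 0" "ob Z (Suc n) = ob X (Suc n)" by (rule realise[OF z]) auto
  have 1: "emap D n X Z a (Ide D (ob X (Suc n)))"
    using lift[OF X Z(1), of a "Ide D (ob X (Suc n))"] Z emap_homs(1)[OF e] pb_id[OF z] by (simp add: in_homs)
  have "ps (ob X (Suc n)) (df Y 0) ?z = ps (ob X (Suc n)) (df Y 0 \<cdot> a) \<delta>"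
    using ps_comp[OF cX(2) emap_homs(1)[OF e], of "df Y 0" "ob Y (Suc 0)"] by (simp add: in_homs)
  also have "df Y 0 \<cdot> a = f (Suc 0) \<cdot> df X 0" using cmapD(2)[OF f(1), of 0] f(2) by simp
  finally have "ps (ob X (Suc n)) (df Y 0) ?z = \<one>\<^bsub>GObj G (ob X (Suc n)) (ob Y (Suc 0))\<^esub>"
    using ps_factor_zero[OF X, of "f (Suc 0)" "ob Y (Suc 0)"] by (simp add: in_homs)
  then obtain k where k: "k \<in> homs D (ob X (Suc n)) (ob Y (Suc n))" "?z = pb (ob Y 0) k \<rho>"
    using ps_kernel[OF Y z] by auto
  have "emap D n Z Y (Ide D (ob Y 0)) k"
    using lift[OF Z(1) Y, of "Ide D (ob Y 0)" k] Z k ps_id[OF z] by (simp add: in_homs)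
  from emap_comp[OF cX(1) dist_complex(1)[OF Z(1)] cY(1) 1 this] have "emap D n X Y a k" using k(1) by (simp add: in_homs)
  then obtain h where h: "h \<in> homs D (ob X (Suc n)) (ob Y n)" "c = k \<boxplus> (df Y n \<cdot> h)"
    by (rule emap_diff_up[OF cX(1) dist_contra[OF X] cY(1) e])
  have dh: "df Y n \<cdot> h \<in> homs D (ob X (Suc n)) (ob Y (Suc n))" using h(1) by (simp add: in_homs)
  interpret group "GObj G (ob X (Suc n)) (ob Y 0)" by (rule grpG') auto
  have "pb (ob Y 0) c \<rho> = ?z"
    unfolding h(2) using pb_plus[OF cY(2) k(1) dh] pb_factor_zero[OF Y h(1)] k(2) z by simp
  then show ?thesis by simp
qed

text \<open>The identity of \<open>X\<close> has to be a morphism between the two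
  extensions.\<close>

lemma dist_unique: assumes "dist X \<delta>" "dist X \<delta>'" shows "\<delta> = \<delta>'"
  using emap_morphism[OF assms emap_id[OF dist_complex(1)[OF assms(1)]]] dist_obj[OF assms(1)]
    ps_id[OF dist_complex(2)[OF assms(1)]] pb_id[OF dist_complex(2)[OF assms(2)]] by simp

section \<open>Closure of conflations under weak isomorphisms\<close>

lemma confE: assumes "X \<in> conf" obtains \<delta> where "dist X \<delta>"
  using assms by (auto simp: conflations_def)

text \<open>A chain map back is constructed. The realisation \<open>V\<close> of the pullback of
  \<delta> along \<open>df T n\<close> maps through \<open>Y\<close> to \<open>T\<close> with ends
  an identity and \<open>df T n\<close>, so this pullback vanishes and \<open>df T n\<close> factors
  through \<open>df Y n\<close>. Lifting downwards and correcting degree 0 yields the chain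
  map.\<close>

lemma conf_from_left:
  assumes Y: "dist Y \<delta>" and T: "nex D n T" and e: "emap D n Y T (Ide D (ob Y 0)) (Ide D (ob Y (Suc n)))"
  shows "dist T \<delta>"
proof -
  note cY = dist_complex[OF Y]
  have cT: "cpx D (Suc n) T" "contraX D n T" "covX D n T" using T by (auto simp: nex_def)
  note [simp] = cpx_type[OF cY(1)] cpx_type[OF cT(1)]
  have o: "ob T 0 = ob Y 0" "ob T (Suc n) = ob Y (Suc n)" using emap_type[OF e] by auto
  let ?A = "ob Y 0"
  have dT: "df T n \<in> homs D (ob T n) (ob Y (Suc n))" using o by (simp add: in_homs)
  let ?e = "pb ?A (df T n) \<delta>"
  have ei: "?e \<in> EG (ob T n) ?A" by (rule pb_in[OF cY(2) dT]) simp
  obtain V where V: "dist V ?e" "ob V 0 = ?A" "ob V (Suc n) = ob T n" by (rule realise[OF ei]) auto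
  have IA: "Ide D ?A \<in> homs D ?A ?A" by (simp add: in_homs)
  have "emap D n V Y (Ide D ?A) (df T n)"
    using lift[OF V(1) Y, of "Ide D ?A" "df T n"] V dT IA ps_id[OF ei] by simp
  from emap_comp[OF dist_complex(1)[OF V(1)] cY(1) cT(1) this e]
  have "emap D n V T (Ide D ?A) (df T n \<cdot> Ide D (ob T n))" using o by simp
  then obtain h where h: "h \<in> homs D (ob V (Suc 0)) (ob T 0)" "Ide D ?A = h \<cdot> df V 0"
    by (rule emap_null_down[OF dist_complex(1)[OF V(1)] cT(1,3)]) (use V(3) in \<open>auto simp: in_homs\<close>)
  have "?e = \<one>\<^bsub>GObj G (ob T n) ?A\<^esub>"
    using ps_factor_zero[OF V(1) h(1)] h(2) V(3) o ps_id[OF ei] by simp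
  then obtain t where t: "t \<in> homs D (ob T n) (ob Y n)" "df T n = df Y n \<cdot> t"
    by (rule pb_exact[OF Y dT])
  have i: "Ide D (ob Y (Suc n)) \<in> homs D (ob T (Suc n)) (ob Y (Suc n))" using o by (simp add: in_homs)
  have "Ide D (ob Y (Suc n)) \<cdot> df T n = df Y n \<cdot> t" using o t(2)[symmetric] by simp
  then obtain f where f: "cmap D (Suc n) T Y f" "f (Suc n) = Ide D (ob Y (Suc n))"
    by (rule lift_from[OF cT(1,2) cY(1) order_refl disjI2[OF dist_cov[OF Y]] t(1) i])
  have f': "emap D n T Y (f 0) (Ide D (ob Y (Suc n)))" using emapI[OF f(1)] f(2) by simp
  note [simp] = emap_type[OF f']
  from emap_comp[OF cT(1) cY(1) cT(1) f' e] have a: "emap D n T T (f 0) (Ide D (ob Y (Suc n)))" by simp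
  have b: "emap D n T T (Ide D ?A) (Ide D (ob Y (Suc n)))" using emap_id[OF cT(1)] o by simp
  obtain h where h: "h \<in> homs D (ob T (Suc 0)) (ob T 0)" "Ide D ?A = f 0 \<boxplus> (h \<cdot> df T 0)"
    by (rule emap_diff_down[OF cT(1) cT(1,3) b a])
  have "emap D n T Y (Ide D ?A) (Ide D (ob Y (Suc n)))"
    using emap_adjust_start[OF cT(1) cY(1) n f', of h] h o by simp
  then show ?thesis using dist_transfer[OF Y T e] by simp
qed

text \<open>Mirror image of \<open>conf_from_left\<close>: here the pushout of \<delta> along
  \<open>df T 0\<close> vanishes, and the chain map back is lifted upwards.\<close>

lemma conf_from_right:
  assumes Y: "dist Y \<delta>" and T: "nex D n T" and e: "emap D n T Y (Ide D (ob Y 0)) (Ide D (ob Y (Suc n)))"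
  shows "dist T \<delta>"
proof -
  note cY = dist_complex[OF Y]
  have cT: "cpx D (Suc n) T" "contraX D n T" "covX D n T" using T by (auto simp: nex_def)
  note [simp] = cpx_type[OF cY(1)] cpx_type[OF cT(1)]
  have o: "ob T 0 = ob Y 0" "ob T (Suc n) = ob Y (Suc n)" using emap_type[OF e] by auto
  let ?C = "ob Y (Suc n)"
  have dT: "df T 0 \<in> homs D (ob Y 0) (ob T (Suc 0))" using o by (simp add: in_homs)
  let ?e = "ps ?C (df T 0) \<delta>"
  have ei: "?e \<in> EG ?C (ob T (Suc 0))" by (rule ps_in[OF cY(2) dT]) simp
  obtain V where V: "dist V ?e" "ob V 0 = ob T (Suc 0)" "ob V (Suc n) = ?C" by (rule realise[OF ei]) auto
  have IC: "Ide D ?C \<in> homs D ?C ?C" by (simp add: in_homs)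
  have "emap D n Y V (df T 0) (Ide D ?C)"
    using lift[OF Y V(1), of "df T 0" "Ide D ?C"] V dT IC pb_id[OF ei] by simp
  from emap_comp[OF cT(1) cY(1) dist_complex(1)[OF V(1)] e this]
  have "emap D n T V (Ide D (ob T (Suc 0)) \<cdot> df T 0) (Ide D ?C)" using o by simp
  then obtain h where h: "h \<in> homs D (ob T (Suc n)) (ob V n)" "Ide D ?C = df V n \<cdot> h"
    by (rule emap_null_up[OF cT(1,2) dist_complex(1)[OF V(1)]]) (use V(2) in \<open>auto simp: in_homs\<close>)
  have "?e = \<one>\<^bsub>GObj G ?C (ob T (Suc 0))\<^esub>"
    using pb_factor_zero[OF V(1) h(1)] h(2) V(2) o pb_id[OF ei] by simp
  then obtain t where t: "t \<in> homs D (ob Y (Suc 0)) (ob T (Suc 0))" "df T 0 = t \<cdot> df Y 0"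
    by (rule ps_exact[OF Y dT])
  have i: "Ide D (ob Y 0) \<in> homs D (ob Y 0) (ob T 0)" using o by (simp add: in_homs)
  have "t \<cdot> df Y 0 = df T 0 \<cdot> Ide D (ob Y 0)" using o t(2)[symmetric] by simp
  then obtain f where f: "cmap D (Suc n) Y T f" "f 0 = Ide D (ob Y 0)"
    by (rule lift_from[OF cY(1) dist_contra[OF Y] cT(1) le0 disjI1[OF refl] i t(1)])
  have f': "emap D n Y T (Ide D (ob Y 0)) (f (Suc n))" using emapI[OF f(1)] f(2) by simp
  note [simp] = emap_type[OF f']
  from emap_comp[OF cT(1) cY(1) cT(1) e f'] have a: "emap D n T T (Ide D (ob Y 0)) (f (Suc n))" by simp
  have b: "emap D n T T (Ide D (ob Y 0)) (Ide D ?C)" using emap_id[OF cT(1)] o by simp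
  obtain h where h: "h \<in> homs D (ob T (Suc n)) (ob T n)" "Ide D ?C = f (Suc n) \<boxplus> (df T n \<cdot> h)"
    by (rule emap_diff_up[OF cT(1,2) cT(1) b a])
  have "emap D n Y T (Ide D (ob Y 0)) (Ide D ?C)"
    using emap_adjust_end[OF cY(1) cT(1) n f', of h] h o by simp
  then show ?thesis using dist_transfer[OF Y T _ e] by simp
qed

text \<open>The extension that \<open>T\<close> must realise is \<delta> pushed out along
  \<open>a\<close> and pulled back along the inverse \<open>e\<close> of \<open>c\<close>; let
  \<open>Y\<close> realise it. The extension is killed by \<open>df T 0\<close>, which therefore
  extends over \<open>df Y 0\<close>, and \<open>extend_along\<close> produces a chain map from
  \<open>Y\<close> to \<open>T\<close> with identity ends.\<close>

lemma conf_push: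
  assumes X: "dist X \<delta>" and T: "nex D n T" and f: "emap D n X T a c" and c: "is_iso_arr D c"
  shows "T \<in> conf"
proof -
  note cX = dist_complex[OF X]
  have cT: "cpx D (Suc n) T" "contraX D n T" "covX D n T" using T by (auto simp: nex_def)
  note [simp] = cpx_type[OF cX(1)] cpx_type[OF cT(1)] emap_type[OF f]
  note h = emap_homs[OF f]
  obtain e where e: "e \<in> homs D (ob T (Suc n)) (ob X (Suc n))" "e \<cdot> c = Ide D (ob X (Suc n))" "c \<cdot> e = Ide D (ob T (Suc n))"
    by (rule isoD[OF c h(2)])
  note [simp] = e(1)[unfolded in_homs]
  obtain f' where f': "cmap D (Suc n) X T f'" "f' 0 = a" "f' (Suc n) = c" by (rule emapE[OF f])
  note [simp] = cmap_type[OF f'(1)]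
  have p: "ps (ob X (Suc n)) a \<delta> \<in> EG (ob X (Suc n)) (ob T 0)" by (rule ps_in[OF cX(2) h(1)]) simp
  let ?d = "pb (ob T 0) e (ps (ob X (Suc n)) a \<delta>)"
  have dd: "?d \<in> EG (ob T (Suc n)) (ob T 0)" by (rule pb_in[OF p e(1)]) simp
  obtain Y where Y: "dist Y ?d" "ob Y 0 = ob T 0" "ob Y (Suc n) = ob T (Suc n)" by (rule realise[OF dd]) auto
  note cY = dist_complex[OF Y(1)]
  note [simp] = cpx_type[OF cY(1)]
  have "pb (ob T 0) c ?d = ps (ob X (Suc n)) a \<delta>"
    using pb_comp[OF p e(1) h(2)] e(2) pb_id[OF p] by simp
  then have g: "emap D n X Y a c" using lift[OF X Y(1), of a c] h Y by simp
  obtain g' where g': "cmap D (Suc n) X Y g'" "g' 0 = a" "g' (Suc n) = c" by (rule emapE[OF g])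
  have dT: "df T 0 \<in> homs D (ob T 0) (ob T (Suc 0))" by (simp add: in_homs)
  have "ps (ob T (Suc n)) (df T 0) ?d = pb (ob T (Suc 0)) e (ps (ob X (Suc n)) (df T 0) (ps (ob X (Suc n)) a \<delta>))"
    by (rule ps_pb[OF p dT e(1)])
  also have "ps (ob X (Suc n)) (df T 0) (ps (ob X (Suc n)) a \<delta>) = ps (ob X (Suc n)) (f' (Suc 0) \<cdot> df X 0) \<delta>"
    using ps_comp[OF cX(2) h(1) dT] cmapD(2)[OF f'(1), of 0] f'(2) by simp
  also have "\<dots> = \<one>\<^bsub>GObj G (ob X (Suc n)) (ob T (Suc 0))\<^esub>" by (rule ps_factor_zero[OF X]) (simp add: in_homs)
  also have "pb (ob T (Suc 0)) e \<dots> = \<one>\<^bsub>GObj G (ob T (Suc n)) (ob T (Suc 0))\<^esub>" by (rule pb_one[OF e(1)]) simp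
  finally have zz: "ps (ob Y (Suc n)) (df T 0) ?d = \<one>\<^bsub>GObj G (ob Y (Suc n)) (ob T (Suc 0))\<^esub>" using Y by simp
  have dT': "df T 0 \<in> homs D (ob Y 0) (ob T (Suc 0))" using Y by (simp add: in_homs)
  obtain w where w: "w \<in> homs D (ob Y (Suc 0)) (ob T (Suc 0))" "df T 0 = w \<cdot> df Y 0"
    by (rule ps_exact[OF Y(1) dT' zz])
  have I: "Ide D (ob T 0) \<in> homs D (ob Y 0) (ob T 0)" "Ide D (ob T 0) \<cdot> g' 0 = f' 0" using Y g' f' by (simp_all add: in_homs)
  have w2: "df T 0 \<cdot> Ide D (ob T 0) = w \<cdot> df Y 0" using w(2)[symmetric] by simp
  have e': "e \<in> homs D (ob Y (Suc n)) (ob X (Suc n))" "g' (Suc n) \<cdot> e = Ide D (ob Y (Suc n))" using e Y g' by simp_all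
  obtain k where k: "cmap D (Suc n) Y T k" "k 0 = Ide D (ob T 0)" "k (Suc n) = f' (Suc n) \<cdot> e"
    by (rule extend_along[OF n cX(1) dist_contra[OF X] cY(1) dist_contra[OF Y(1)] cT(1) g'(1) f'(1) I w(1) w2 e'])
  have "emap D n Y T (Ide D (ob Y 0)) (Ide D (ob Y (Suc n)))" using emapI[OF k(1)] k f' e Y by simp
  then show ?thesis using conf_from_left[OF Y(1) T] by (auto simp: conflations_def)
qed

text \<open>The candidate is \<delta> pulled back along \<open>c\<close> and pushed out along the
  inverse \<open>e\<close> of \<open>a\<close>. The comparison \<open>k\<close> from
  \<open>T\<close> to its realisation is the identity at the right end; comparing
  \<open>a \<cdot> k 0\<close> with \<open>a\<close> and cancelling \<open>a\<close> by means of
  \<open>e\<close> shows how to correct its left end.\<close>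

lemma conf_pull:
  assumes X: "dist X \<delta>" and T: "nex D n T" and f: "emap D n T X a c" and a: "is_iso_arr D a"
  shows "T \<in> conf"
proof -
  note cX = dist_complex[OF X]
  have cT: "cpx D (Suc n) T" "contraX D n T" "covX D n T" using T by (auto simp: nex_def)
  note [simp] = cpx_type[OF cX(1)] cpx_type[OF cT(1)] emap_type[OF f]
  note h = emap_homs[OF f]
  obtain e where e: "e \<in> homs D (ob X 0) (ob T 0)" "e \<cdot> a = Ide D (ob T 0)" "a \<cdot> e = Ide D (ob X 0)"
    by (rule isoD[OF a h(1)])
  note [simp] = e(1)[unfolded in_homs]
  obtain f' where f': "cmap D (Suc n) T X f'" "f' 0 = a" "f' (Suc n) = c" by (rule emapE[OF f])
  note [simp] = cmap_type[OF f'(1)]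
  have p: "pb (ob X 0) c \<delta> \<in> EG (ob T (Suc n)) (ob X 0)" by (rule pb_in[OF cX(2) h(2)]) simp
  let ?d = "ps (ob T (Suc n)) e (pb (ob X 0) c \<delta>)"
  have dd: "?d \<in> EG (ob T (Suc n)) (ob T 0)" by (rule ps_in[OF p e(1)]) simp
  obtain Y where Y: "dist Y ?d" "ob Y 0 = ob T 0" "ob Y (Suc n) = ob T (Suc n)" by (rule realise[OF dd]) auto
  note cY = dist_complex[OF Y(1)]
  note [simp] = cpx_type[OF cY(1)]
  have "ps (ob T (Suc n)) a ?d = pb (ob X 0) c \<delta>"
    using ps_comp[OF p e(1) h(1)] e(3) ps_id[OF p] by simp
  then have g: "emap D n Y X a c" using lift[OF Y(1) X, of a c] h Y by simp
  have dT: "df T n \<in> homs D (ob T n) (ob T (Suc n))" by (simp add: in_homs)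
  have "pb (ob T 0) (df T n) ?d = ps (ob T n) e (pb (ob X 0) (df T n) (pb (ob X 0) c \<delta>))"
    by (rule ps_pb[OF p e(1) dT, symmetric])
  also have "pb (ob X 0) (df T n) (pb (ob X 0) c \<delta>) = pb (ob X 0) (df X n \<cdot> f' n) \<delta>"
    using pb_comp[OF cX(2) h(2) dT] cmapD(2)[OF f'(1), of n] f'(3) by simp
  also have "\<dots> = \<one>\<^bsub>GObj G (ob T n) (ob X 0)\<^esub>" by (rule pb_factor_zero[OF X]) (simp add: in_homs)
  also have "ps (ob T n) e \<dots> = \<one>\<^bsub>GObj G (ob T n) (ob T 0)\<^esub>" by (rule ps_one[OF e(1)]) simp
  finally have zz: "pb (ob Y 0) (df T n) ?d = \<one>\<^bsub>GObj G (ob T n) (ob Y 0)\<^esub>" using Y by simp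
  have dT': "df T n \<in> homs D (ob T n) (ob Y (Suc n))" using Y by (simp add: in_homs)
  obtain w where w: "w \<in> homs D (ob T n) (ob Y n)" "df T n = df Y n \<cdot> w"
    by (rule pb_exact[OF Y(1) dT' zz])
  have i: "Ide D (ob Y (Suc n)) \<in> homs D (ob T (Suc n)) (ob Y (Suc n))" using Y by (simp add: in_homs)
  have "Ide D (ob Y (Suc n)) \<cdot> df T n = df Y n \<cdot> w" using Y w(2)[symmetric] by simp
  then obtain k where k: "cmap D (Suc n) T Y k" "k (Suc n) = Ide D (ob Y (Suc n))"
    by (rule lift_from[OF cT(1,2) cY(1) order_refl disjI2[OF dist_cov[OF Y(1)]] w(1) i])
  have k': "emap D n T Y (k 0) (Ide D (ob Y (Suc n)))" using emapI[OF k(1)] k(2) by simp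
  note [simp] = emap_type[OF k']
  from emap_comp[OF cT(1) cY(1) cX(1) k' g] have a: "emap D n T X (a \<cdot> k 0) c" using Y by simp
  obtain m where m: "m \<in> homs D (ob T (Suc 0)) (ob X 0)" "a = (a \<cdot> k 0) \<boxplus> (m \<cdot> df T 0)"
    by (rule emap_diff_down[OF cT(1) cX(1) dist_cov[OF X] f a])
  note [simp] = m(1)[unfolded in_homs]
  have "e \<cdot> a = e \<cdot> ((a \<cdot> k 0) \<boxplus> (m \<cdot> df T 0))" using m(2) by (rule arg_cong)
  also have "\<dots> = ((e \<cdot> a) \<cdot> k 0) \<boxplus> ((e \<cdot> m) \<cdot> df T 0)" using Y by (simp add: distr assoc)
  finally have "e \<cdot> a = ((e \<cdot> a) \<cdot> k 0) \<boxplus> ((e \<cdot> m) \<cdot> df T 0)" .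
  then have ee: "Ide D (ob T 0) = k 0 \<boxplus> ((e \<cdot> m) \<cdot> df T 0)" using e(2) Y by simp
  have "emap D n T Y (k 0 \<boxplus> ((e \<cdot> m) \<cdot> df T 0)) (Ide D (ob Y (Suc n)))"
    by (rule emap_adjust_start[OF cT(1) cY(1) n k']) (use Y in \<open>simp add: in_homs\<close>)
  then have "emap D n T Y (Ide D (ob Y 0)) (Ide D (ob Y (Suc n)))" using ee Y by simp
  then show ?thesis using conf_from_right[OF Y(1) T] by (auto simp: conflations_def)
qed

text \<open>Inverses of two neighbouring components commute with the differential between them, and
  this square lifts to all degrees by exactness.\<close>

lemma weak_iso_inverse:
  assumes X: "nex D n X" and T: "nex D n T" and f: "cmap D (Suc n) X T f" and k: "k \<le> n" "is_iso_arr D (f k)" "is_iso_arr D (f (Suc k))"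
  obtains g where "cmap D (Suc n) T X g" "g k \<in> homs D (ob T k) (ob X k)" "g (Suc k) \<in> homs D (ob T (Suc k)) (ob X (Suc k))"
    "f k \<cdot> g k = Ide D (ob T k)" "is_iso_arr D (g k)" "is_iso_arr D (g (Suc k))"
proof -
  have cX: "cpx D (Suc n) X" "covX D n X" and cT: "cpx D (Suc n) T" "contraX D n T" using X T by (auto simp: nex_def)
  note [simp] = cpx_type[OF cX(1)] cpx_type[OF cT(1)] cmap_type[OF f]
  have kk: "k \<le> Suc n" "k < Suc n" using k by auto
  obtain a where a: "a \<in> homs D (ob T k) (ob X k)" "a \<cdot> f k = Ide D (ob X k)" "f k \<cdot> a = Ide D (ob T k)"
    by (rule isoD[OF k(2) cmapD(1)[OF f kk(1)]])
  obtain b where b: "b \<in> homs D (ob T (Suc k)) (ob X (Suc k))" "b \<cdot> f (Suc k) = Ide D (ob X (Suc k))" "f (Suc k) \<cdot> b = Ide D (ob T (Suc k))"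
    by (rule isoD[OF k(3) cmapD(1)[OF f]]) (use k in simp)
  note [simp] = a(1)[unfolded in_homs] b(1)[unfolded in_homs]
  have "b \<cdot> df T k = b \<cdot> (df T k \<cdot> (f k \<cdot> a))" using a(3) k(1) by simp
  also have "df T k \<cdot> (f k \<cdot> a) = f (Suc k) \<cdot> (df X k \<cdot> a)"
    using reassoc[OF cmapD(2)[OF f kk(2), symmetric], of a] k(1) by simp
  also have "b \<cdot> (f (Suc k) \<cdot> (df X k \<cdot> a)) = df X k \<cdot> a"
    using reassoc1[OF b(2), of "df X k \<cdot> a"] k(1) by simp
  finally have e: "b \<cdot> df T k = df X k \<cdot> a" .
  obtain g where g: "cmap D (Suc n) T X g" "g k = a" "g (Suc k) = b"
    by (rule lift_from[OF cT cX(1) k(1) disjI2[OF cX(2)] a(1) b(1) e])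
  have "is_iso_arr D a" "is_iso_arr D b"
    by (rule isoI[OF a(1) cmapD(1)[OF f kk(1)] a(3,2)], rule isoI[OF b(1) cmapD(1)[OF f] b(3,2)]) (use k in simp)
  then show thesis using that[OF g(1)] g a b by simp
qed

text \<open>Reduces to \<open>conf_push\<close>. The composite of \<open>g\<close> and
  \<open>f\<close> is the identity in degree \<open>k\<close>, so its right end is the identity up
  to a map through \<open>df T n\<close>. Hence the pullback \<open>V\<close> of \<open>X\<close>
  along the right end of \<open>g\<close> maps to \<open>T\<close> with an identity as corrected
  right end.\<close>

lemma conf_weak_iso_inner:
  assumes X: "dist X \<delta>" and T: "nex D n T" and f: "cmap D (Suc n) X T f" and k: "k \<le> n" "is_iso_arr D (f k)" "is_iso_arr D (f (Suc k))"
  shows "T \<in> conf"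
proof -
  note cX = dist_complex[OF X]
  have cT: "cpx D (Suc n) T" "contraX D n T" "covX D n T" using T by (auto simp: nex_def)
  obtain g where g: "cmap D (Suc n) T X g" "f k \<cdot> g k = Ide D (ob T k)"
    by (rule weak_iso_inverse[OF dist_nex[OF X] T f k])
  note [simp] = cpx_type[OF cX(1)] cpx_type[OF cT(1)] cmap_type[OF f] cmap_type[OF g(1)]
  have fg: "cmap D (Suc n) T T (ccomp D (Suc n) f g)" by (rule cmap_comp[OF cT(1) cX(1) cT(1) g(1) f])
  have z: "Zero D (ob T (Suc k)) (ob T k) \<in> homs D (ob T (Suc k)) (ob T k)" using k(1) by (simp add: in_homs)
  have zk: "cid D (Suc n) T k = ccomp D (Suc n) f g k \<boxplus> (Zero D (ob T (Suc k)) (ob T k) \<cdot> df T k)"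
    using k(1) g(2) by simp
  obtain h where h: "h \<in> homs D (ob T (Suc n)) (ob T n)" "cid D (Suc n) T (Suc n) = ccomp D (Suc n) f g (Suc n) \<boxplus> (df T n \<cdot> h)"
    by (rule ends_up[OF cT(1,2) cT(1) cmap_id[OF cT(1)] fg k(1) z zk])
  have gh: "g (Suc n) \<in> homs D (ob T (Suc n)) (ob X (Suc n))" by (rule cmapD(1)[OF g(1)]) simp
  have p: "pb (ob X 0) (g (Suc n)) \<delta> \<in> EG (ob T (Suc n)) (ob X 0)" by (rule pb_in[OF cX(2) gh]) simp
  obtain V where V: "dist V (pb (ob X 0) (g (Suc n)) \<delta>)" "ob V 0 = ob X 0" "ob V (Suc n) = ob T (Suc n)"
    by (rule realise[OF p]) auto
  note cV = dist_complex[OF V(1)]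
  have "emap D n V X (Ide D (ob X 0)) (g (Suc n))"
    using lift[OF V(1) X, of "Ide D (ob X 0)" "g (Suc n)"] V gh ps_id[OF p] by (simp add: in_homs)
  from emap_comp[OF cV(1) cX(1) cT(1) this emapI[OF f]] have "emap D n V T (f 0) (f (Suc n) \<cdot> g (Suc n))" by simp
  from emap_adjust_end[OF cV(1) cT(1) n this, of h] have "emap D n V T (f 0) (Ide D (ob T (Suc n)))"
    using h V by simp
  then show ?thesis using conf_push[OF V(1) T] iso_Ide by simp
qed

lemma conf_weak_iso:
  assumes X: "nex D n X" and Y: "nex D n Y" and f: "weak_iso D n X Y f"
  shows "X \<in> conf \<longleftrightarrow> Y \<in> conf"
proof -
  obtain k where f: "cmap D (Suc n) X Y f" and k: "k \<le> n + 1" "is_iso_arr D (f k)" "is_iso_arr D (f ((k + 1) mod (n + 2)))"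
    using f unfolding weak_iso_def chain_maps_cmap by blast
  show ?thesis
  proof (cases "k \<le> n")
    case True
    then have k': "is_iso_arr D (f (Suc k))" using k(3) by simp
    obtain g where g: "cmap D (Suc n) Y X g" "is_iso_arr D (g k)" "is_iso_arr D (g (Suc k))"
      by (rule weak_iso_inverse[OF X Y f True k(2) k'])
    show ?thesis using conf_weak_iso_inner[OF _ Y f True k(2) k'] conf_weak_iso_inner[OF _ X g(1) True g(2,3)] by (auto simp: conflations_def)
  next
    case False
    then have "k = Suc n" using k by simp
    then have "is_iso_arr D (f 0)" "is_iso_arr D (f (Suc n))" using k by auto
    then show ?thesis using conf_push[OF _ Y emapI[OF f]] conf_pull[OF _ X emapI[OF f]] by (auto simp: conflations_def)
  qed
qed

lemma zero_cplx_conf: "zero_cplx D n \<in> conf"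
proof -
  let ?Z = "zero_obj D"
  have z: "Ide D ?Z = Zero D ?Z ?Z" by (rule from_zero_obj) (simp add: in_homs)
  \<comment> \<open>(R2) speaks of trivial complexes only; the zero complex is the trivial one on a
    zero object.\<close>
  have e: "triv D n 0 ?Z = zero_cplx D n"
    unfolding triv_def zero_cplx_def Let_def by (intro cplx.equality) (auto simp: z fun_eq_iff restrict_def)
  have "r ?Z ?Z \<one>\<^bsub>GObj G ?Z ?Z\<^esub> = htpy_class D n (triv D n 0 ?Z)"
    using re zero_obj_Obj unfolding exact_realisation_def by blast
  moreover have "cpx D (Suc n) (zero_cplx D n)" using nex_triv[of ?Z 0 n] e by (simp add: nex_def)
  moreover have "ob (zero_cplx D n) 0 = ?Z" "ob (zero_cplx D n) (Suc n) = ?Z" by (auto simp: zero_cplx_def)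
  ultimately have "dist (zero_cplx D n) \<one>\<^bsub>GObj G ?Z ?Z\<^esub>"
    using e monoid.one_closed[OF group.is_monoid[OF grpG']] by (simp add: distinguished_def cpx_def)
  then show ?thesis by (auto simp: conflations_def)
qed

text \<open>The cones in (EA2) and its dual are conflations, hence n-exact. Through
  \<open>nex_M_cone\<close> and \<open>nex_N_cone\<close> this gives the pullback and the pushout
  property that (E2) and its dual demand.\<close>

lemma n_exact_structure_conf: "n_exact_structure D n conf"
  unfolding n_exact_structure_def
proof (intro conjI)
  show "conf \<subseteq> n_exact_sequences D n" using dist_nex n_exact_sequences_iff[OF n] by (auto simp: conflations_def)
  show "\<forall>X\<in>n_exact_sequences D n. \<forall>Y\<in>n_exact_sequences D n. (\<exists>f. weak_iso D n X Y f) \<longrightarrow> (X \<in> conf \<longleftrightarrow> Y \<in> conf)"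
    using conf_weak_iso n_exact_sequences_iff[OF n] by blast
  show "zero_cplx D n \<in> conf" by (rule zero_cplx_conf)
  show "closed_under_comp D (admissible_monos conf)" "closed_under_comp D (admissible_epis n conf)"
    using exg unfolding n_exangulated_def inflations_def deflations_def admissible_monos_def admissible_epis_def by blast+
  show "\<forall>X\<in>conf. \<forall>B\<in>Obj D. \<forall>a\<in>homs D (ob X 0) B.
        \<exists>Y f. n_pushout_diagram D n (segment 0 (n + 1) X) Y f \<and> f 0 = a \<and> df Y 0 \<in> admissible_monos conf"
  proof (intro ballI)
    fix X B a assume "X \<in> conf" and B: "B \<in> Obj D" and a: "a \<in> homs D (ob X 0) B"
    then obtain \<delta> where X: "dist X \<delta>" using confE by blast
    note cX = dist_complex[OF X]
    have p: "ps (ob X (Suc n)) a \<delta> \<in> EG (ob X (Suc n)) B" by (rule ps_in[OF cX(2) a dist_obj(2)[OF X]])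
    obtain Y where Y: "dist Y (ps (ob X (Suc n)) a \<delta>)" "ob Y 0 = B" "ob Y (Suc n) = ob X (Suc n)" by (rule realise[OF p dist_obj(2)[OF X] B])
    note cY = dist_complex[OF Y(1)]
    have "\<forall>X Y a \<delta>. ob X (n + 1) = ob Y (n + 1) \<and> a \<in> homs D (ob X 0) (ob Y 0) \<and>
        distinguished D n G r X \<delta> \<and> distinguished D n G r Y (push D G (ob X (n + 1)) a \<delta>) \<longrightarrow>
        (\<exists>f\<in>chain_maps D (n + 2) X Y. f 0 = a \<and> f (n + 1) = Ide D (ob X (n + 1)) \<and>
           distinguished D n G r (N_cone D n X Y f) (pull D G (ob X 0) (df Y n) \<delta>))"
      using exg unfolding n_exangulated_def by blast
    from this[rule_format, of X Y a \<delta>] obtain f where f: "cmap D (Suc n) X Y f" "f 0 = a"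
      and N: "dist (N_cone D n X Y f) (pb (ob X 0) (df Y n) \<delta>)"
      using X Y a by (auto simp: cmap_def)
    have "po_elt D n (segment 0 (n + 1) X) (segment 0 (n + 1) Y) (segment_map 0 (n + 1) f)"
      using dist_nex[OF N] nex_N_cone[OF cX(1) cY(1) f(1) n] by simp
    then have "n_pushout_diagram D n (segment 0 (n + 1) X) (segment 0 (n + 1) Y) (segment_map 0 (n + 1) f)"
      unfolding n_pushout_iff[OF n] using segment_cpx[OF cX(1)] segment_cpx[OF cY(1)] segment_cmap[OF f(1)] by auto
    moreover have "segment_map 0 (n + 1) f 0 = a" "df (segment 0 (n + 1) Y) 0 = df Y 0" using f(2) n by (auto simp: segment_def segment_map_def)
    moreover have "df Y 0 \<in> admissible_monos conf" using Y(1) by (auto simp: admissible_monos_def conflations_def)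
    ultimately show "\<exists>Y f. n_pushout_diagram D n (segment 0 (n + 1) X) Y f \<and> f 0 = a \<and> df Y 0 \<in> admissible_monos conf" by metis
  qed
  show "\<forall>X\<in>conf. \<forall>B\<in>Obj D. \<forall>c\<in>homs D B (ob X (n + 1)).
        \<exists>Y f. n_pullback_diagram D n Y (segment 1 (n + 1) X) f \<and> f n = c \<and> df Y (n - 1) \<in> admissible_epis n conf"
  proof (intro ballI)
    fix X B c assume "X \<in> conf" and B: "B \<in> Obj D" and "c \<in> homs D B (ob X (n + 1))"
    then obtain \<delta> where X: "dist X \<delta>" and c: "c \<in> homs D B (ob X (Suc n))" using confE by auto
    note cX = dist_complex[OF X]
    have p: "pb (ob X 0) c \<delta> \<in> EG B (ob X 0)" by (rule pb_in[OF cX(2) c dist_obj(1)[OF X]])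
    obtain Y where Y: "dist Y (pb (ob X 0) c \<delta>)" "ob Y 0 = ob X 0" "ob Y (Suc n) = B" by (rule realise[OF p B dist_obj(1)[OF X]])
    note cY = dist_complex[OF Y(1)]
    have "\<forall>X Y c \<rho>. ob X 0 = ob Y 0 \<and> c \<in> homs D (ob X (n + 1)) (ob Y (n + 1)) \<and>
        distinguished D n G r Y \<rho> \<and> distinguished D n G r X (pull D G (ob Y 0) c \<rho>) \<longrightarrow>
        (\<exists>f\<in>chain_maps D (n + 2) X Y. f 0 = Ide D (ob X 0) \<and> f (n + 1) = c \<and>
           distinguished D n G r (M_cone D n X Y f) (push D G (ob Y (n + 1)) (df X 0) \<rho>))"
      using exg unfolding n_exangulated_def by blast
    from this[rule_format, of Y X c \<delta>] obtain f where f: "cmap D (Suc n) Y X f" "f (Suc n) = c"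
      and M: "dist (M_cone D n Y X f) (ps (ob X (Suc n)) (df Y 0) \<delta>)"
      using X Y c by (auto simp: cmap_def)
    have "pb_elt D n (segment 1 (n + 1) Y) (segment 1 (n + 1) X) (segment_map 1 (n + 1) f)"
      using dist_nex[OF M] nex_M_cone[OF cY(1) cX(1) f(1) n] by simp
    then have "n_pullback_diagram D n (segment 1 (n + 1) Y) (segment 1 (n + 1) X) (segment_map 1 (n + 1) f)"
      unfolding n_pullback_iff[OF n] using segment_cpx[OF cX(1)] segment_cpx[OF cY(1)] segment_cmap[OF f(1)] by auto
    moreover have "segment_map 1 (n + 1) f n = c" "df (segment 1 (n + 1) Y) (n - 1) = df Y n" using f(2) n by (auto simp: segment_def segment_map_def)
    moreover have "df Y n \<in> admissible_epis n conf" using Y(1) by (auto simp: admissible_epis_def conflations_def)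
    ultimately show "\<exists>Y f. n_pullback_diagram D n Y (segment 1 (n + 1) X) f \<and> f n = c \<and> df Y (n - 1) \<in> admissible_epis n conf" by metis
  qed
qed

text \<open>Choosing for each class an extension that it realises is injective, because
  \<open>r C A\<close> recovers the class.\<close>

lemma small_conf: "small_extension_groups TYPE('c) D n conf"
  unfolding small_extension_groups_def
proof (intro ballI)
  fix A C assume "A \<in> Obj D" "C \<in> Obj D"
  have ex: "\<exists>\<delta>. r C A \<delta> = E" if "E \<in> ext_classes D n conf C A" for E
    using that by (auto simp: ext_classes_def ends_complexes_def conflations_def distinguished_def)
  have "inj_on (\<lambda>E. SOME \<delta>. r C A \<delta> = E) (ext_classes D n conf C A)"
  proof (rule inj_onI)
    fix E E' assume E: "E \<in> ext_classes D n conf C A" "E' \<in> ext_classes D n conf C A" and e: "(SOME \<delta>. r C A \<delta> = E) = (SOME \<delta>. r C A \<delta> = E')"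
    show "E = E'" using someI_ex[OF ex[OF E(1)]] someI_ex[OF ex[OF E(2)]] e by metis
  qed
  then show "\<exists>\<iota> :: ('a, 'b) cplx set \<Rightarrow> 'c. inj_on \<iota> (ext_classes D n conf C A)" by blast
qed

end

text \<open>Makes the calculus of classes available for conflations. From here on \<open>Gx\<close>
  is the extension functor built from \<open>conf\<close>, to be compared with
  \<open>G\<close>.\<close>

sublocale exg \<subseteq> nxs D n conf
  by (rule nxs_of_n_exact_structure[OF n n_exact_structure_conf])

section \<open>The natural isomorphism from classes of conflations to the given functor\<close>

context exg
begin

text \<open>The inverse of the realisation: a class of conflations is realised from some extension,
  and \<open>dist_unique\<close> leaves only one.\<close>

definition Gam :: "'a \<Rightarrow> 'a \<Rightarrow> ('a, 'b) cplx set \<Rightarrow> 'c" where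
  "Gam C A E = (THE \<delta>. \<delta> \<in> EG C A \<and> r C A \<delta> = E)"

lemma Gam_eq: assumes "dist X \<delta>" shows "Gam (ob X (Suc n)) (ob X 0) (cl X) = \<delta>"
  unfolding Gam_def
proof (rule the_equality)
  show "\<delta> \<in> EG (ob X (Suc n)) (ob X 0) \<and> r (ob X (Suc n)) (ob X 0) \<delta> = cl X" using assms by (auto simp: distinguished_def)
  fix \<rho> assume "\<rho> \<in> EG (ob X (Suc n)) (ob X 0) \<and> r (ob X (Suc n)) (ob X 0) \<rho> = cl X"
  then have "dist X \<rho>" using assms by (auto simp: distinguished_def)
  then show "\<rho> = \<delta>" using dist_unique[OF assms] by simp
qed

lemma Gam_cases: assumes "E \<in> EC C A"
  obtains X \<delta> where "dist X \<delta>" "E = cl X" "ob X 0 = A" "ob X (Suc n) = C" "Gam C A E = \<delta>"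
proof -
  obtain X where X: "X \<in> conf" "E = cl X" "ob X 0 = A" "ob X (Suc n) = C" by (rule ECE[OF assms])
  obtain \<delta> where "dist X \<delta>" by (rule confE[OF X(1)])
  then show thesis using that X Gam_eq by blast
qed

lemma Gam_in: assumes "E \<in> EC C A" shows "Gam C A E \<in> EG C A" "r C A (Gam C A E) = E"
  by (rule Gam_cases[OF assms], auto simp: distinguished_def)+

lemma Gam_bij: assumes "C \<in> Obj D" "A \<in> Obj D" shows "bij_betw (Gam C A) (EC C A) (EG C A)"
proof (rule bij_betwI')
  fix E E' assume "E \<in> EC C A" "E' \<in> EC C A"
  then show "(Gam C A E = Gam C A E') = (E = E')" using Gam_in(2) by metis
next
  fix E assume "E \<in> EC C A" then show "Gam C A E \<in> EG C A" by (rule Gam_in)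
next
  fix \<delta> assume d: "\<delta> \<in> EG C A"
  obtain X where X: "dist X \<delta>" "ob X 0 = A" "ob X (Suc n) = C" by (rule realise[OF d assms])
  then have "cl X \<in> EC C A" "Gam C A (cl X) = \<delta>" using ECI[of X] Gam_eq[OF X(1)] by (auto simp: conflations_def)
  then show "\<exists>E\<in>EC C A. \<delta> = Gam C A E" by blast
qed

lemma Gam_pu: assumes E: "E \<in> EC C A" and a: "a \<in> homs D A B" shows "Gam C B (pu a E) = ps C a (Gam C A E)"
proof -
  obtain X \<delta> where X: "dist X \<delta>" "E = cl X" "ob X 0 = A" "ob X (Suc n) = C" "Gam C A E = \<delta>" by (rule Gam_cases[OF E])
  have Xc: "X \<in> conf" using X(1) by (auto simp: conflations_def)
  obtain Y where Y: "Y \<in> conf" "emap D n X Y a (Ide D C)" "pu a E = cl Y" "ob Y 0 = B" "ob Y (Suc n) = C"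
    using pu_obtain[OF Xc] a X by metis
  obtain \<rho> where rho: "dist Y \<rho>" by (rule confE[OF Y(1)])
  have "ps C a \<delta> = \<rho>"
    using emap_morphism[OF X(1) rho Y(2)] X Y pb_id[OF dist_complex(2)[OF rho] dist_obj(2,1)[OF rho]] by simp
  then show ?thesis using X(5) Y Gam_eq[OF rho] by simp
qed

lemma Gam_pl: assumes E: "E \<in> EC C A" and c: "c \<in> homs D B C" shows "Gam B A (pl c E) = pb A c (Gam C A E)"
proof -
  obtain X \<delta> where X: "dist X \<delta>" "E = cl X" "ob X 0 = A" "ob X (Suc n) = C" "Gam C A E = \<delta>" by (rule Gam_cases[OF E])
  have Xc: "X \<in> conf" using X(1) by (auto simp: conflations_def)
  obtain Y where Y: "Y \<in> conf" "emap D n Y X (Ide D A) c" "pl c E = cl Y" "ob Y 0 = A" "ob Y (Suc n) = B"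
    using pl_obtain[OF Xc] c X by metis
  obtain \<rho> where rho: "dist Y \<rho>" by (rule confE[OF Y(1)])
  have "pb A c \<delta> = \<rho>"
    using emap_morphism[OF rho X(1) Y(2)] X Y ps_id[OF dist_complex(2)[OF rho] dist_obj(2,1)[OF rho]] by simp
  then show ?thesis using X(5) Y Gam_eq[OF rho] by simp
qed

text \<open>Over a common source both sums are pushouts along \<open>x + y\<close>, on one side by
  \<open>bs_push\<close>, on the other by biadditivity of \<open>G\<close>.\<close>

lemma Gam_hom: assumes "C \<in> Obj D" "A \<in> Obj D" shows "Gam C A \<in> hom (GObj Gx C A) (GObj G C A)"
proof (rule homI)
  fix E assume "E \<in> carrier (GObj Gx C A)" then show "Gam C A E \<in> EG C A" using Gam_in by simp
next
  fix E E' assume "E \<in> carrier (GObj Gx C A)" "E' \<in> carrier (GObj Gx C A)"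
  then have E: "E \<in> EC C A" "E' \<in> EC C A" by simp_all
  obtain B T x y where T: "T \<in> EC C B" "x \<in> homs D B A" "y \<in> homs D B A" "E = pu x T" "E' = pu y T"
    by (rule common_source[OF E])
  show "Gam C A (E \<otimes>\<^bsub>GObj Gx C A\<^esub> E') = Gam C A E \<otimes>\<^bsub>GObj G C A\<^esub> Gam C A E'"
    using bs_push[OF T(1-3)] Gam_pu[OF T(1,2)] Gam_pu[OF T(1,3)] Gam_pu[OF T(1) Plus_homs[OF T(2,3)]] ps_plus[OF Gam_in(1)[OF T(1)] T(2,3) assms(1)] T(4,5)
    by simp
qed

end

section \<open>Isomorphisms of extension functors over the identity\<close>

text \<open>An n-exangulated equivalence over the identity with the functor part stripped off:
  compatibility with realisations becomes \<open>r' \<circ> \<Gamma> = r\<close>. The two sides may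
  have extensions of different types.\<close>

definition ext_iso :: "('o, 'm) precat \<Rightarrow> ('o, 'm, 'e) bifun \<times> ('o, 'm, 'e) realisation \<Rightarrow>
    ('o, 'm, 'f) bifun \<times> ('o, 'm, 'f) realisation \<Rightarrow> ('o \<Rightarrow> 'o \<Rightarrow> 'e \<Rightarrow> 'f) \<Rightarrow> bool" where
  "ext_iso D S S' \<Gamma> \<longleftrightarrow>
     (\<forall>C\<in>Obj D. \<forall>A\<in>Obj D. \<Gamma> C A \<in> iso (GObj (fst S) C A) (GObj (fst S') C A)) \<and>
     (\<forall>c\<in>Arr D. \<forall>a\<in>Arr D. \<forall>\<delta>\<in>carrier (GObj (fst S) (Cod D c) (Dom D a)).
        \<Gamma> (Dom D c) (Cod D a) (GMap (fst S) c a \<delta>) = GMap (fst S') c a (\<Gamma> (Cod D c) (Dom D a) \<delta>)) \<and>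
     (\<forall>C\<in>Obj D. \<forall>A\<in>Obj D. \<forall>\<delta>\<in>carrier (GObj (fst S) C A). snd S' C A (\<Gamma> C A \<delta>) = snd S C A \<delta>)"

lemma ext_isoD:
  assumes "ext_iso D (G, r) (G', r') \<Gamma>"
  shows "C \<in> Obj D \<Longrightarrow> A \<in> Obj D \<Longrightarrow> \<Gamma> C A \<in> iso (GObj G C A) (GObj G' C A)"
    and "c \<in> Arr D \<Longrightarrow> a \<in> Arr D \<Longrightarrow> \<delta> \<in> carrier (GObj G (Cod D c) (Dom D a)) \<Longrightarrow>
      \<Gamma> (Dom D c) (Cod D a) (GMap G c a \<delta>) = GMap G' c a (\<Gamma> (Cod D c) (Dom D a) \<delta>)"
    and "C \<in> Obj D \<Longrightarrow> A \<in> Obj D \<Longrightarrow> \<delta> \<in> carrier (GObj G C A) \<Longrightarrow> r' C A (\<Gamma> C A \<delta>) = r C A \<delta>"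
  using assms unfolding ext_iso_def by auto

lemma map_cplx_id: "X \<in> complexes D k \<Longrightarrow> map_cplx k id_func X = X"
proof -
  assume "X \<in> complexes D k"
  then have "restrict (ob X) {..<k} = ob X" "restrict (df X) {..<k - 1} = df X"
    unfolding complexes_def by (auto intro!: extensional_restrict simp: PiE_def)
  then show ?thesis by (simp add: map_cplx_def id_func_def)
qed

context acat
begin

lemma id_func: "is_additive_functor D D id_func" "is_equivalence_functor D D id_func"
proof -
  have f: "is_functor D D id_func" by (auto simp: is_functor_def id_func_def in_homs)
  then show "is_additive_functor D D id_func" by (auto simp: is_additive_functor_def id_func_def)
  have i: "is_iso_arr D (Ide D A)" if "A \<in> Obj D" for A
    unfolding is_iso_arr_def using that by (auto simp: in_homs intro!: bexI[of _ "Ide D A"])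
  have c: "comp_func id_func id_func = (id_func :: ('a, 'b, 'a, 'b) func)" by (simp add: comp_func_def id_func_def)
  have "is_nat_iso D D id_func id_func (Ide D)" using i by (auto simp: is_nat_iso_def id_func_def in_homs)
  then show "is_equivalence_functor D D id_func"
    unfolding is_equivalence_functor_def using f c by metis
qed

text \<open>\<open>exact_realisation\<close> provides a complex whose class is
  \<open>r C A \<delta>\<close>, without which the condition on functors would be vacuous at
  \<delta>.\<close>

lemma id_equivalent_iff:
  assumes re: "exact_realisation D n G r"
  shows "id_equivalent D n (G, r) (G', r') \<longleftrightarrow> (\<exists>\<Gamma>. ext_iso D (G, r) (G', r') \<Gamma>)"
proof -
  have ex: "\<exists>X\<in>ends_complexes D n A C. r C A \<delta> = htpy_class D n X"
    if "C \<in> Obj D" "A \<in> Obj D" "\<delta> \<in> carrier (GObj G C A)" for C A \<delta>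
    using re that unfolding exact_realisation_def by blast
  have m: "map_cplx (n + 2) id_func X = X" if "X \<in> ends_complexes D n A C" for X A C
    using that map_cplx_id by (auto simp: ends_complexes_def simp del: add_2_eq_Suc')
  have nt: "is_nat_trans_ext D G G' id_func \<Gamma> \<longleftrightarrow>
     (\<forall>C\<in>Obj D. \<forall>A\<in>Obj D. \<Gamma> C A \<in> hom (GObj G C A) (GObj G' C A)) \<and>
     (\<forall>c\<in>Arr D. \<forall>a\<in>Arr D. \<forall>\<delta>\<in>carrier (GObj G (Cod D c) (Dom D a)).
        \<Gamma> (Dom D c) (Cod D a) (GMap G c a \<delta>) = GMap G' c a (\<Gamma> (Cod D c) (Dom D a) \<delta>))" for \<Gamma>
    by (simp add: is_nat_trans_ext_def id_func_def)
  have "n_exangulated_equivalence n D G r D G' r' id_func \<Gamma> \<longleftrightarrow> ext_iso D (G, r) (G', r') \<Gamma>" for \<Gamma>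
  proof
    assume l: "n_exangulated_equivalence n D G r D G' r' id_func \<Gamma>"
    then have l': "n_exangulated_functor n D G r D G' r' id_func \<Gamma>"
      and li: "\<forall>C\<in>Obj D. \<forall>A\<in>Obj D. \<Gamma> C A \<in> iso (GObj G C A) (GObj G' C A)"
      unfolding n_exangulated_equivalence_def by (auto simp: id_func_def)
    have "r' C A (\<Gamma> C A \<delta>) = r C A \<delta>" if d: "C \<in> Obj D" "A \<in> Obj D" "\<delta> \<in> carrier (GObj G C A)" for C A \<delta>
    proof -
      obtain X where X: "X \<in> ends_complexes D n A C" "r C A \<delta> = htpy_class D n X" using ex[OF d] by blast
      show ?thesis
        using l'[unfolded n_exangulated_functor_def, THEN conjunct2, THEN conjunct2, rule_format, OF d X] X(2)
        unfolding m[OF X(1)] by (simp add: id_func_def)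
    qed
    then show "ext_iso D (G, r) (G', r') \<Gamma>"
      using li l' nt[of \<Gamma>] unfolding ext_iso_def n_exangulated_functor_def by simp
  next
    assume r: "ext_iso D (G, r) (G', r') \<Gamma>"
    show "n_exangulated_equivalence n D G r D G' r' id_func \<Gamma>"
      unfolding n_exangulated_equivalence_def n_exangulated_functor_def
    proof (intro conjI ballI impI)
      show "is_nat_trans_ext D G G' id_func \<Gamma>" unfolding nt using r by (auto simp: ext_iso_def iso_def)
    next
      fix C A \<delta> X
      assume d: "C \<in> Obj D" "A \<in> Obj D" "\<delta> \<in> carrier (GObj G C A)" and X: "X \<in> ends_complexes D n A C" "r C A \<delta> = htpy_class D n X"
      show "r' (OMap id_func C) (OMap id_func A) (\<Gamma> C A \<delta>) = htpy_class D n (map_cplx (n + 2) id_func X)"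
        unfolding m[OF X(1)] using ext_isoD(3)[OF r d] X(2) by (simp add: id_func_def)
    next
      fix C A assume "C \<in> Obj D" "A \<in> Obj D"
      from ext_isoD(1)[OF r this] show "\<Gamma> C A \<in> iso (GObj G C A) (GObj G' (OMap id_func C) (OMap id_func A))"
        by (simp add: id_func_def)
    qed (rule id_func)+
  qed
  then show ?thesis by (simp add: id_equivalent_def)
qed

lemma ext_iso_refl: "ext_iso D S S (\<lambda>C A \<delta>. \<delta>)"
  by (simp add: ext_iso_def iso_def hom_def bij_betw_def)

lemma ext_iso_trans:
  assumes "ext_iso D (G, r) (G', r') \<Gamma>" "ext_iso D (G', r') (G'', r'') \<Gamma>'"
  shows "ext_iso D (G, r) (G'', r'') (\<lambda>C A. \<Gamma>' C A \<circ> \<Gamma> C A)"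
proof -
  note I = ext_isoD[OF assms(1)] and I' = ext_isoD[OF assms(2)]
  have m: "\<Gamma> C A \<delta> \<in> carrier (GObj G' C A)" if "\<delta> \<in> carrier (GObj G C A)" "C \<in> Obj D" "A \<in> Obj D" for C A \<delta>
    using I(1)[OF that(2,3)] that(1) by (auto simp: iso_def hom_def)
  show ?thesis unfolding ext_iso_def fst_conv snd_conv
  proof (intro conjI ballI)
    fix C A assume "C \<in> Obj D" "A \<in> Obj D"
    then show "\<Gamma>' C A \<circ> \<Gamma> C A \<in> iso (GObj G C A) (GObj G'' C A)"
      using iso_set_trans[OF I(1) I'(1)] by (simp add: compose_def comp_def)
  qed (simp_all add: I(2,3) I'(2,3) m)
qed

lemma ext_iso_sym:
  assumes bi: "biadditive_functor D G" and I: "ext_iso D (G, r) (G', r') \<Gamma>"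
  shows "ext_iso D (G', r') (G, r) (\<lambda>C A. inv_into (carrier (GObj G C A)) (\<Gamma> C A))"
    (is "ext_iso D _ _ ?I")
proof -
  note I = ext_isoD[OF I]
  have b: "bij_betw (\<Gamma> C A) (carrier (GObj G C A)) (carrier (GObj G' C A))" if "C \<in> Obj D" "A \<in> Obj D" for C A
    using I(1)[OF that] by (simp add: iso_def)
  interpret biadd D G by unfold_locales (rule bi)
  have g: "GMap G c a \<delta> \<in> carrier (GObj G (Dom D c) (Cod D a))"
    if "c \<in> Arr D" "a \<in> Arr D" "\<delta> \<in> carrier (GObj G (Cod D c) (Dom D a))" for c a \<delta>
    using hom_carrier[OF GMap_hom[OF that(1,2)]] that(3) by blast
  have inv: "?I C A (\<Gamma> C A \<delta>) = \<delta>" if "\<delta> \<in> carrier (GObj G C A)" "C \<in> Obj D" "A \<in> Obj D" for C A \<delta>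
    using bij_betw_inv_into_left[OF b[OF that(2,3)] that(1)] .
  have obt: "\<exists>\<delta>\<in>carrier (GObj G C A). \<epsilon> = \<Gamma> C A \<delta>" if "\<epsilon> \<in> carrier (GObj G' C A)" "C \<in> Obj D" "A \<in> Obj D" for C A \<epsilon>
    using b[OF that(2,3)] that(1) by (auto simp: bij_betw_def)
  show ?thesis unfolding ext_iso_def fst_conv snd_conv
  proof (intro conjI ballI)
    fix C A assume o: "C \<in> Obj D" "A \<in> Obj D"
    show "?I C A \<in> iso (GObj G' C A) (GObj G C A)" by (rule group.iso_set_sym[OF grpG'[OF o] I(1)[OF o]])
  next
    fix c a \<epsilon> assume h: "c \<in> Arr D" "a \<in> Arr D" "\<epsilon> \<in> carrier (GObj G' (Cod D c) (Dom D a))"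
    obtain \<delta> where d: "\<delta> \<in> carrier (GObj G (Cod D c) (Dom D a))" "\<epsilon> = \<Gamma> (Cod D c) (Dom D a) \<delta>"
      using obt[OF h(3)] h by auto
    then show "?I (Dom D c) (Cod D a) (GMap G' c a \<epsilon>) = GMap G c a (?I (Cod D c) (Dom D a) \<epsilon>)"
      using h g[OF h(1,2) d(1)] by (simp add: I(2)[symmetric] inv)
  next
    fix C A \<epsilon> assume o: "C \<in> Obj D" "A \<in> Obj D" and "\<epsilon> \<in> carrier (GObj G' C A)"
    then obtain \<delta> where "\<delta> \<in> carrier (GObj G C A)" "\<epsilon> = \<Gamma> C A \<delta>" using obt by blast
    then show "r C A (?I C A \<epsilon>) = r' C A \<epsilon>" using o by (simp add: I(3) inv)
  qed
qed

lemma exangulated_structuresD: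
  assumes "(G, r) \<in> exangulated_structures D n"
  shows "n_exangulated D n G r" "biadditive_functor D G" "exact_realisation D n G r"
  using assms by (auto simp: exangulated_structures_def n_exangulated_def)

lemma id_equivalent_refl: "S \<in> exangulated_structures D n \<Longrightarrow> id_equivalent D n S S"
  using id_equivalent_iff[OF exangulated_structuresD(3)] ext_iso_refl by (cases S) blast

lemma id_equivalent_sym:
  assumes S: "(G, r) \<in> exangulated_structures D n" "(G', r') \<in> exangulated_structures D n"
    and e: "id_equivalent D n (G, r) (G', r')"
  shows "id_equivalent D n (G', r') (G, r)"
proof -
  obtain \<Gamma> where "ext_iso D (G, r) (G', r') \<Gamma>" using e id_equivalent_iff[OF exangulated_structuresD(3)[OF S(1)]] by blast
  from ext_iso_sym[OF exangulated_structuresD(2)[OF S(1)] this] show ?thesis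
    using id_equivalent_iff[OF exangulated_structuresD(3)[OF S(2)]] by blast
qed

lemma id_equivalent_trans:
  assumes S: "(G, r) \<in> exangulated_structures D n" "(G', r') \<in> exangulated_structures D n"
    and e: "id_equivalent D n (G, r) (G', r')" "id_equivalent D n (G', r') (G'', r'')"
  shows "id_equivalent D n (G, r) (G'', r'')"
proof -
  obtain \<Gamma> where g: "ext_iso D (G, r) (G', r') \<Gamma>" using e(1) id_equivalent_iff[OF exangulated_structuresD(3)[OF S(1)]] by blast
  obtain \<Gamma>' where g': "ext_iso D (G', r') (G'', r'') \<Gamma>'" using e(2) id_equivalent_iff[OF exangulated_structuresD(3)[OF S(2)]] by blast
  show ?thesis using ext_iso_trans[OF g g'] id_equivalent_iff[OF exangulated_structuresD(3)[OF S(1)]] by blast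
qed

end

text \<open>\<open>G'\<close> is not yet known to consist of groups, so preservation of units does
  not follow from the isomorphisms and is assumed as \<open>one\<close>; the group axioms of
  \<open>G'\<close> are then derived in \<open>grp_img\<close>.\<close>

locale transport = biadd +
  fixes r :: "('a, 'b, 'c) realisation"
    and G' :: "('a, 'b, 'f) bifun" and r' :: "('a, 'b, 'f) realisation" and \<Gamma> :: "'a \<Rightarrow> 'a \<Rightarrow> 'c \<Rightarrow> 'f"
  assumes ext_iso: "ext_iso D (G, r) (G', r') \<Gamma>"
    and one: "C \<in> Obj D \<Longrightarrow> A \<in> Obj D \<Longrightarrow> \<one>\<^bsub>GObj G' C A\<^esub> = \<Gamma> C A \<one>\<^bsub>GObj G C A\<^esub>"
begin

lemmas iso = ext_isoD(1)[OF ext_iso] and natural = ext_isoD(2)[OF ext_iso] and real = ext_isoD(3)[OF ext_iso]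

lemma img: "C \<in> Obj D \<Longrightarrow> A \<in> Obj D \<Longrightarrow> carrier (GObj G' C A) = \<Gamma> C A ` carrier (GObj G C A)"
  using iso[of C A] by (simp add: iso_def bij_betw_def)

lemma inj: "C \<in> Obj D \<Longrightarrow> A \<in> Obj D \<Longrightarrow> inj_on (\<Gamma> C A) (carrier (GObj G C A))"
  using iso[of C A] by (simp add: iso_def bij_betw_def)

lemma mult: "C \<in> Obj D \<Longrightarrow> A \<in> Obj D \<Longrightarrow> x \<in> carrier (GObj G C A) \<Longrightarrow> y \<in> carrier (GObj G C A) \<Longrightarrow>
    \<Gamma> C A (x \<otimes>\<^bsub>GObj G C A\<^esub> y) = \<Gamma> C A x \<otimes>\<^bsub>GObj G' C A\<^esub> \<Gamma> C A y"
  using iso[of C A] by (simp add: iso_def hom_mult)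

lemma grp_img: assumes "C \<in> Obj D" "A \<in> Obj D" shows "comm_group (GObj G' C A)"
proof -
  interpret comm_group "GObj G C A" by (rule grpG[OF assms])
  have "GObj G' C A\<lparr>one := \<Gamma> C A \<one>\<^bsub>GObj G C A\<^esub>\<rparr> = GObj G' C A" unfolding one[OF assms, symmetric] by simp
  then have "group (GObj G' C A)" using iso_imp_img_group[OF iso[OF assms]] by simp
  then show ?thesis using iso_imp_comm_group[of "GObj G' C A"] iso[OF assms] group.is_monoid by (auto simp: is_iso_def)
qed

lemma one_iff: "C \<in> Obj D \<Longrightarrow> A \<in> Obj D \<Longrightarrow> x \<in> carrier (GObj G C A) \<Longrightarrow>
    \<Gamma> C A x = \<one>\<^bsub>GObj G' C A\<^esub> \<longleftrightarrow> x = \<one>\<^bsub>GObj G C A\<^esub>"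
  using one inj[of C A] comm_group.axioms(1)[OF grpG, THEN comm_monoid.axioms(1), THEN monoid.one_closed] by (auto dest: inj_onD)

lemma GMap_in: "c \<in> Arr D \<Longrightarrow> a \<in> Arr D \<Longrightarrow> \<delta> \<in> carrier (GObj G (Cod D c) (Dom D a)) \<Longrightarrow>
    GMap G c a \<delta> \<in> carrier (GObj G (Dom D c) (Cod D a))"
  using hom_carrier[OF GMap_hom] by blast

lemma natural': "c \<in> homs D C' C \<Longrightarrow> a \<in> homs D A A' \<Longrightarrow> \<delta> \<in> carrier (GObj G C A) \<Longrightarrow>
    GMap G' c a (\<Gamma> C A \<delta>) = \<Gamma> C' A' (GMap G c a \<delta>)"
  using natural by (auto simp: in_homs)

lemma biadditive: "biadditive_functor D G'"
  unfolding biadditive_functor_def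
proof (intro conjI ballI impI allI, goal_cases)
  case (1 C A) then show ?case by (rule grp_img)
next
  case (2 c a)
  note h = GMap_hom[OF 2]
  note hh = 2 obj_Dom[OF 2(1)] obj_Cod[OF 2(1)] obj_Dom[OF 2(2)] obj_Cod[OF 2(2)]
  show ?case
  proof (rule homI)
    fix x assume "x \<in> carrier (GObj G' (Cod D c) (Dom D a))"
    then show "GMap G' c a x \<in> carrier (GObj G' (Dom D c) (Cod D a))"
      using hh by (auto simp: img natural[symmetric] GMap_in)
  next
    fix x y assume "x \<in> carrier (GObj G' (Cod D c) (Dom D a))" "y \<in> carrier (GObj G' (Cod D c) (Dom D a))"
    then obtain x' y' where x: "x' \<in> carrier (GObj G (Cod D c) (Dom D a))" "x = \<Gamma> (Cod D c) (Dom D a) x'"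
      and y: "y' \<in> carrier (GObj G (Cod D c) (Dom D a))" "y = \<Gamma> (Cod D c) (Dom D a) y'" using hh by (auto simp: img)
    have xy: "x' \<otimes>\<^bsub>GObj G (Cod D c) (Dom D a)\<^esub> y' \<in> carrier (GObj G (Cod D c) (Dom D a))"
      using grpG[OF hh(4,5)] x y by (meson comm_group.axioms(1) comm_monoid.axioms(1) monoid.m_closed)
    show "GMap G' c a (x \<otimes>\<^bsub>GObj G' (Cod D c) (Dom D a)\<^esub> y) = GMap G' c a x \<otimes>\<^bsub>GObj G' (Dom D c) (Cod D a)\<^esub> GMap G' c a y"
      unfolding x y mult[OF hh(4,5) x(1) y(1), symmetric] natural[OF 2 xy, symmetric] natural[OF 2 x(1), symmetric] natural[OF 2 y(1), symmetric]
        hom_mult[OF h x(1) y(1)]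
      by (rule mult[OF hh(3,6) GMap_in[OF 2 x(1)] GMap_in[OF 2 y(1)]])
  qed
next
  case (3 C A \<delta>)
  then obtain x where x: "x \<in> carrier (GObj G C A)" "\<delta> = \<Gamma> C A x" by (auto simp: img)
  have "GMap G (Ide D C) (Ide D A) x = x" by (rule GMap_id[OF 3(1,2) x(1)])
  then show ?case using natural'[OF Ide_in[OF 3(1)] Ide_in[OF 3(2)] x(1)] x(2) by simp
next
  case (4 c c' a a' \<delta>)
  then have o: "Cod D c \<in> Obj D" "Dom D a \<in> Obj D" and q: "Cod D c' = Dom D c" "Cod D a = Dom D a'" by auto
  obtain x where x: "x \<in> carrier (GObj G (Cod D c) (Dom D a))" "\<delta> = \<Gamma> (Cod D c) (Dom D a) x"
    using 4(6) by (auto simp: img[OF o])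
  have e: "GMap G (c \<cdot> c') (a' \<cdot> a) x = GMap G c' a' (GMap G c a x)" by (rule GMap_comp[OF 4(1-4) q x(1)])
  have h: "c \<cdot> c' \<in> homs D (Dom D c') (Cod D c)" "a' \<cdot> a \<in> homs D (Dom D a) (Cod D a')"
    "c \<in> homs D (Dom D c) (Cod D c)" "a \<in> homs D (Dom D a) (Cod D a)"
    "c' \<in> homs D (Dom D c') (Dom D c)" "a' \<in> homs D (Cod D a) (Cod D a')"
    using 4(1-4) q Comp_homs by (auto simp: in_homs)
  show ?case
    unfolding x(2) natural'[OF h(1,2) x(1)] natural'[OF h(3,4) x(1)] natural'[OF h(5,6) GMap_in[OF 4(1,3) x(1)]] e ..
next
  case (5 C C' c c' a \<delta>)
  then have o: "Dom D a \<in> Obj D" "Cod D a \<in> Obj D" by auto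
  obtain x where x: "x \<in> carrier (GObj G C (Dom D a))" "\<delta> = \<Gamma> C (Dom D a) x"
    using 5(6) by (auto simp: img[OF 5(1) o(1)])
  have e: "GMap G (c \<boxplus> c') a x = GMap G c a x \<otimes>\<^bsub>GObj G C' (Cod D a)\<^esub> GMap G c' a x"
    by (rule GMap_plus_left[OF 5(3,4) _ x(1)]) (use 5 in \<open>simp add: in_homs\<close>)
  have a: "a \<in> homs D (Dom D a) (Cod D a)" using 5 by (simp add: in_homs)
  have m: "GMap G c a x \<in> carrier (GObj G C' (Cod D a))" "GMap G c' a x \<in> carrier (GObj G C' (Cod D a))"
    using GMap_in[of c a x] GMap_in[of c' a x] 5(3-5) x(1) by (auto simp: in_homs)
  show ?case
    unfolding x(2) natural'[OF Plus_homs[OF 5(3,4)] a x(1)] natural'[OF 5(3) a x(1)] natural'[OF 5(4) a x(1)] e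
    by (rule mult[OF 5(2) o(2) m])
next
  case (6 A A' a a' c \<delta>)
  then have o: "Cod D c \<in> Obj D" "Dom D c \<in> Obj D" by auto
  obtain x where x: "x \<in> carrier (GObj G (Cod D c) A)" "\<delta> = \<Gamma> (Cod D c) A x"
    using 6(6) by (auto simp: img[OF o(1) 6(1)])
  have e: "GMap G c (a \<boxplus> a') x = GMap G c a x \<otimes>\<^bsub>GObj G (Dom D c) A'\<^esub> GMap G c a' x"
    by (rule GMap_plus_right[OF 6(3,4) _ x(1)]) (use 6 in \<open>simp add: in_homs\<close>)
  have c: "c \<in> homs D (Dom D c) (Cod D c)" using 6 by (simp add: in_homs)
  have m: "GMap G c a x \<in> carrier (GObj G (Dom D c) A')" "GMap G c a' x \<in> carrier (GObj G (Dom D c) A')"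
    using GMap_in[of c a x] GMap_in[of c a' x] 6(3-5) x(1) by (auto simp: in_homs)
  show ?case
    unfolding x(2) natural'[OF c Plus_homs[OF 6(3,4)] x(1)] natural'[OF c 6(3) x(1)] natural'[OF c 6(4) x(1)] e
    by (rule mult[OF o(2) 6(2) m])
qed

lemma push_eq: "\<delta> \<in> carrier (GObj G C A) \<Longrightarrow> a \<in> homs D A B \<Longrightarrow> C \<in> Obj D \<Longrightarrow>
    push D G' C a (\<Gamma> C A \<delta>) = \<Gamma> C B (push D G C a \<delta>)"
  unfolding push_def by (rule natural'[OF Ide_in])

lemma pull_eq: "\<delta> \<in> carrier (GObj G C A) \<Longrightarrow> c \<in> homs D B C \<Longrightarrow> A \<in> Obj D \<Longrightarrow>
    pull D G' A c (\<Gamma> C A \<delta>) = \<Gamma> B A (pull D G A c \<delta>)"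
  unfolding pull_def by (rule natural'[OF _ Ide_in])

lemma push_in: "\<delta> \<in> carrier (GObj G C A) \<Longrightarrow> a \<in> homs D A B \<Longrightarrow> C \<in> Obj D \<Longrightarrow> push D G C a \<delta> \<in> carrier (GObj G C B)"
  using GMap_in[of "Ide D C" a \<delta>] by (auto simp: push_def in_homs)

lemma pull_in: "\<delta> \<in> carrier (GObj G C A) \<Longrightarrow> c \<in> homs D B C \<Longrightarrow> A \<in> Obj D \<Longrightarrow> pull D G A c \<delta> \<in> carrier (GObj G B A)"
  using GMap_in[of c "Ide D A" \<delta>] by (auto simp: pull_def in_homs)

lemma ends_obj: "X \<in> complexes D (n + 2) \<Longrightarrow> ob X (n + 1) \<in> Obj D" "X \<in> complexes D (n + 2) \<Longrightarrow> ob X 0 \<in> Obj D"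
  unfolding complexes_def by (auto simp: PiE_def Pi_def)

lemma distinguished_iff:
  "distinguished D n G' r' X \<epsilon> \<longleftrightarrow> (\<exists>\<delta>. \<epsilon> = \<Gamma> (ob X (n + 1)) (ob X 0) \<delta> \<and> distinguished D n G r X \<delta>)"
proof (cases "X \<in> complexes D (n + 2)")
  case True
  show ?thesis
    unfolding distinguished_def img[OF ends_obj[OF True]] using real[OF ends_obj[OF True]] by blast
qed (simp add: distinguished_def)

lemma conflations_eq: "conflations D n G' r' = conflations D n G r"
  by (auto simp: conflations_def distinguished_iff)

text \<open>Following the last map by an isomorphism leaves its kernel as it is.\<close>

lemma exact_at_iso:
  assumes o: "C \<in> Obj D" "A \<in> Obj D" and e: "exact_at H f K g (GObj G C A)"
    and g': "\<And>x. x \<in> carrier K \<Longrightarrow> g' x = \<Gamma> C A (g x)" and K: "monoid K"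
  shows "exact_at H f K g' (GObj G' C A)"
proof -
  have g: "g \<in> hom K (GObj G C A)" using e by (simp add: exact_at_def)
  have gx: "g x \<in> carrier (GObj G C A)" if "x \<in> carrier K" for x using g that by (auto simp: hom_def)
  have "g' \<in> hom K (GObj G' C A)"
    using g gx g' monoid.m_closed[OF K] by (intro homI) (auto simp: img[OF o] mult[OF o] hom_mult[OF g])
  moreover have "g' x = \<one>\<^bsub>GObj G' C A\<^esub> \<longleftrightarrow> g x = \<one>\<^bsub>GObj G C A\<^esub>" if "x \<in> carrier K" for x
    using g'[OF that] one_iff[OF o gx[OF that]] by simp
  then have "kernel K (GObj G' C A) g' = kernel K (GObj G C A) g" by (auto simp: kernel_def)
  ultimately show ?thesis using e by (simp add: exact_at_def)
qed

lemma is_n_exangle: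
  assumes n: "1 \<le> n" and e: "is_n_exangle D n G X \<delta>"
  shows "is_n_exangle D n G' X (\<Gamma> (ob X (n + 1)) (ob X 0) \<delta>)"
proof -
  have X: "X \<in> complexes D (n + 2)" and d: "\<delta> \<in> carrier (GObj G (ob X (n + 1)) (ob X 0))"
    using e unfolding is_n_exangle_def by blast+
  have h: "df X 0 \<in> homs D (ob X 0) (ob X 1)" "df X n \<in> homs D (ob X n) (ob X (n + 1))"
    using X unfolding complexes_def by (auto simp: PiE_def Pi_def)
  note o = ends_obj[OF X] homs_obj(2)[OF h(1)] homs_obj(1)[OF h(2)]
  have m: "monoid (homgrp D A B)" if "A \<in> Obj D" "B \<in> Obj D" for A B using grp[OF that] by (rule group.is_monoid)
  show ?thesis unfolding is_n_exangle_def
  proof (intro conjI ballI)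
    show "\<Gamma> (ob X (n + 1)) (ob X 0) \<delta> \<in> carrier (GObj G' (ob X (n + 1)) (ob X 0))"
      unfolding img[OF o(1,2)] using d by (rule imageI)
    show "push D G' (ob X (n + 1)) (df X 0) (\<Gamma> (ob X (n + 1)) (ob X 0) \<delta>) = \<one>\<^bsub>GObj G' (ob X (n + 1)) (ob X 1)\<^esub>"
      unfolding push_eq[OF d h(1) o(1)] one[OF o(1,3)] using e unfolding is_n_exangle_def by metis
    show "pull D G' (ob X 0) (df X n) (\<Gamma> (ob X (n + 1)) (ob X 0) \<delta>) = \<one>\<^bsub>GObj G' (ob X n) (ob X 0)\<^esub>"
      unfolding pull_eq[OF d h(2) o(2)] one[OF o(4,2)] using e unfolding is_n_exangle_def by metis
    fix W assume W: "W \<in> Obj D"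
    have E: "cov_exact D (n + 2) X W \<and>
        exact_at (homgrp D W (ob X n)) (\<lambda>g. df X n \<cdot> g)
                 (homgrp D W (ob X (n + 1))) (\<lambda>c. pull D G (ob X 0) c \<delta>)
                 (GObj G W (ob X 0)) \<and>
        contra_exact D (n + 2) X W \<and>
        exact_at (homgrp D (ob X 1) W) (\<lambda>g. g \<cdot> df X 0)
                 (homgrp D (ob X 0) W) (\<lambda>a. push D G (ob X (n + 1)) a \<delta>)
                 (GObj G (ob X (n + 1)) W)"
      using e W unfolding is_n_exangle_def by blast
    then show "cov_exact D (n + 2) X W" "contra_exact D (n + 2) X W" by blast+
    show "exact_at (homgrp D W (ob X n)) (\<lambda>g. df X n \<cdot> g) (homgrp D W (ob X (n + 1)))
       (\<lambda>c. pull D G' (ob X 0) c (\<Gamma> (ob X (n + 1)) (ob X 0) \<delta>)) (GObj G' W (ob X 0))"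
      by (rule exact_at_iso[OF W o(2) E[THEN conjunct2, THEN conjunct1] _ m[OF W o(1)]]) (simp only: homgrp_simps, rule pull_eq[OF d _ o(2)])
    show "exact_at (homgrp D (ob X 1) W) (\<lambda>g. g \<cdot> df X 0) (homgrp D (ob X 0) W)
       (\<lambda>a. push D G' (ob X (n + 1)) a (\<Gamma> (ob X (n + 1)) (ob X 0) \<delta>)) (GObj G' (ob X (n + 1)) W)"
      by (rule exact_at_iso[OF o(1) W E[THEN conjunct2, THEN conjunct2, THEN conjunct2] _ m[OF o(2) W]]) (simp only: homgrp_simps, rule push_eq[OF d _ o(1)])
  qed (rule X)
qed

lemma distinguishedD:
  assumes "distinguished D n G r X \<delta>"
  shows "ob X (n + 1) \<in> Obj D" "ob X 0 \<in> Obj D" "\<delta> \<in> carrier (GObj G (ob X (n + 1)) (ob X 0))"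
  using assms ends_obj[of X n] by (simp_all add: distinguished_def)

lemma distinguished_img: "distinguished D n G r X \<delta> \<Longrightarrow> ob X (n + 1) = C \<Longrightarrow> ob X 0 = A \<Longrightarrow> distinguished D n G' r' X (\<Gamma> C A \<delta>)"
  using distinguished_iff by blast

lemma distinguished_img':
  assumes X: "distinguished D n G' r' X (\<Gamma> C A \<delta>)" "ob X (n + 1) = C" "ob X 0 = A" and d: "\<delta> \<in> carrier (GObj G C A)"
  shows "distinguished D n G r X \<delta>"
proof -
  obtain \<delta>' where d': "\<Gamma> C A \<delta> = \<Gamma> C A \<delta>'" "distinguished D n G r X \<delta>'" using X distinguished_iff by metis
  have o: "C \<in> Obj D" "A \<in> Obj D" "\<delta>' \<in> carrier (GObj G C A)" using distinguishedD[OF d'(2)] X by simp_all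
  show ?thesis using inj_onD[OF inj[OF o(1,2)] d'(1) d o(3)] d'(2) by simp
qed

lemma exact_realisation:
  assumes n: "1 \<le> n" and re: "exact_realisation D n G r"
  shows "exact_realisation D n G' r'"
  unfolding exact_realisation_def
proof (intro conjI ballI allI impI, goal_cases)
  case (1 C A \<epsilon>)
  then obtain \<delta> where d: "\<delta> \<in> carrier (GObj G C A)" "\<epsilon> = \<Gamma> C A \<delta>" by (auto simp: img)
  have "r C A \<delta> \<in> htpy_class D n ` ends_complexes D n A C" using re 1(1,2) d(1) unfolding exact_realisation_def by blast
  then show ?case unfolding d(2) real[OF 1(1,2) d(1)] .
next
  case (2 X Y \<epsilon> \<eta> a c)
  obtain \<delta> where d: "\<epsilon> = \<Gamma> (ob X (n + 1)) (ob X 0) \<delta>" "distinguished D n G r X \<delta>" using 2(1) distinguished_iff by blast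
  obtain \<rho> where q: "\<eta> = \<Gamma> (ob Y (n + 1)) (ob Y 0) \<rho>" "distinguished D n G r Y \<rho>" using 2(1) distinguished_iff by blast
  note oX = distinguishedD[OF d(2)] and oY = distinguishedD[OF q(2)]
  have "push D G (ob X (n + 1)) a \<delta> = pull D G (ob Y 0) c \<rho>"
    using 2(4) unfolding d(1) q(1) push_eq[OF oX(3) 2(2) oX(1)] pull_eq[OF oY(3) 2(3) oY(2)]
    by (rule inj_onD[OF inj[OF oX(1) oY(2)] _ push_in[OF oX(3) 2(2) oX(1)] pull_in[OF oY(3) 2(3) oY(2)]])
  then show ?case using re d(2) q(2) 2(2,3) unfolding exact_realisation_def by blast
next
  case (3 X \<epsilon>)
  then obtain \<delta> where d: "\<epsilon> = \<Gamma> (ob X (n + 1)) (ob X 0) \<delta>" "distinguished D n G r X \<delta>" using distinguished_iff by blast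
  then have "is_n_exangle D n G X \<delta>" using re unfolding exact_realisation_def by blast
  then show ?case unfolding d(1) by (rule is_n_exangle[OF n])
next
  case (4 A)
  have o: "zero_obj D \<in> Obj D" by simp
  have "r (zero_obj D) A \<one>\<^bsub>GObj G (zero_obj D) A\<^esub> = htpy_class D n (triv D n 0 A)"
    using re 4 unfolding exact_realisation_def by blast
  then show ?case unfolding one[OF o 4] real[OF o 4 monoid.one_closed[OF comm_monoid.axioms(1)[OF comm_group.axioms(1)[OF grpG[OF o 4]]]]] .
next
  case (5 C)
  have o: "zero_obj D \<in> Obj D" by simp
  have "r C (zero_obj D) \<one>\<^bsub>GObj G C (zero_obj D)\<^esub> = htpy_class D n (triv D n n C)"
    using re 5 unfolding exact_realisation_def by blast
  then show ?case unfolding one[OF 5 o] real[OF 5 o monoid.one_closed[OF comm_monoid.axioms(1)[OF comm_group.axioms(1)[OF grpG[OF 5 o]]]]] .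
qed

lemma n_exangulated:
  assumes n: "1 \<le> n" and ex: "n_exangulated D n G r"
  shows "n_exangulated D n G' r'"
  unfolding n_exangulated_def
proof (intro conjI allI impI, goal_cases)
  case 1 show ?case by unfold_locales
next
  case 2 show ?case by (rule biadditive)
next
  case 3 show ?case using exact_realisation[OF n] ex unfolding n_exangulated_def by blast
next
  case 4 show ?case using ex unfolding n_exangulated_def inflations_def conflations_eq by blast
next
  case 5 show ?case using ex unfolding n_exangulated_def deflations_def conflations_eq by blast
next
  case (6 X Y c \<eta>)
  then have q: "ob X 0 = ob Y 0" and c: "c \<in> homs D (ob X (n + 1)) (ob Y (n + 1))" by blast+
  obtain \<rho> where r: "\<eta> = \<Gamma> (ob Y (n + 1)) (ob Y 0) \<rho>" "distinguished D n G r Y \<rho>" using 6 distinguished_iff by blast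
  note oY = distinguishedD[OF r(2)]
  have "distinguished D n G' r' X (\<Gamma> (ob X (n + 1)) (ob Y 0) (pull D G (ob Y 0) c \<rho>))"
    using 6 unfolding r(1) pull_eq[OF oY(3) c oY(2)] by blast
  then have X: "distinguished D n G r X (pull D G (ob Y 0) c \<rho>)"
    by (rule distinguished_img'[OF _ refl q pull_in[OF oY(3) c oY(2)]])
  obtain f where f: "f\<in>chain_maps D (n + 2) X Y" "f 0 = Ide D (ob X 0)" "f (n + 1) = c"
     "distinguished D n G r (M_cone D n X Y f) (push D G (ob Y (n + 1)) (df X 0) \<rho>)"
    using ex q c r(2) X unfolding n_exangulated_def by blast
  have dX: "df X 0 \<in> homs D (ob Y 0) (ob X 1)"
    using X q unfolding distinguished_def complexes_def by (auto simp: PiE_def Pi_def)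
  have "distinguished D n G' r' (M_cone D n X Y f) (push D G' (ob Y (n + 1)) (df X 0) \<eta>)"
    unfolding r(1) push_eq[OF oY(3) dX oY(1)] by (rule distinguished_img[OF f(4)]) (simp_all add: M_cone_def)
  then show ?case using f by blast
next
  case (7 X Y a \<epsilon>)
  then have q: "ob Y (n + 1) = ob X (n + 1)" and a: "a \<in> homs D (ob X 0) (ob Y 0)" by simp_all
  obtain \<delta> where r: "\<epsilon> = \<Gamma> (ob X (n + 1)) (ob X 0) \<delta>" "distinguished D n G r X \<delta>" using 7 distinguished_iff by blast
  note oX = distinguishedD[OF r(2)]
  have "distinguished D n G' r' Y (\<Gamma> (ob X (n + 1)) (ob Y 0) (push D G (ob X (n + 1)) a \<delta>))"
    using 7 unfolding r(1) push_eq[OF oX(3) a oX(1)] by blast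
  then have Y: "distinguished D n G r Y (push D G (ob X (n + 1)) a \<delta>)"
    by (rule distinguished_img'[OF _ q refl push_in[OF oX(3) a oX(1)]])
  obtain f where f: "f\<in>chain_maps D (n + 2) X Y" "f 0 = a" "f (n + 1) = Ide D (ob X (n + 1))"
     "distinguished D n G r (N_cone D n X Y f) (pull D G (ob X 0) (df Y n) \<delta>)"
    using ex q[symmetric] a r(2) Y unfolding n_exangulated_def by blast
  have dY: "df Y n \<in> homs D (ob Y n) (ob X (n + 1))"
    using Y q unfolding distinguished_def complexes_def by (auto simp: PiE_def Pi_def)
  have "distinguished D n G' r' (N_cone D n X Y f) (pull D G' (ob X 0) (df Y n) \<epsilon>)"
    unfolding r(1) pull_eq[OF oX(3) dY oX(2)] by (rule distinguished_img[OF f(4)]) (simp_all add: N_cone_def)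
  then show ?case using f by blast
qed

lemma exangulated_structures:
  "1 \<le> n \<Longrightarrow> (G, r) \<in> exangulated_structures D n \<Longrightarrow> (G', r') \<in> exangulated_structures D n"
  using n_exangulated by (simp add: exangulated_structures_def inflations_def deflations_def conflations_eq)

end

text \<open>Transport of structure: every operation is computed in \<open>G\<close> and carried over
  by \<open>\<iota>\<close>, so that \<open>\<iota>\<close> is an isomorphism by construction as
  soon as it is injective.\<close>

definition image_bifun :: "('o, 'm) precat \<Rightarrow> ('o, 'm, 'e) bifun \<Rightarrow> ('o \<Rightarrow> 'o \<Rightarrow> 'e \<Rightarrow> 'f) \<Rightarrow> ('o, 'm, 'f) bifun" where
  "image_bifun D G \<iota> =
     (let \<kappa> = (\<lambda>C A. inv_into (carrier (GObj G C A)) (\<iota> C A)) in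
     \<lparr>GObj = (\<lambda>C A. \<lparr>carrier = \<iota> C A ` carrier (GObj G C A),
                     mult = (\<lambda>x y. \<iota> C A (\<kappa> C A x \<otimes>\<^bsub>GObj G C A\<^esub> \<kappa> C A y)),
                     one = \<iota> C A \<one>\<^bsub>GObj G C A\<^esub>\<rparr>),
      GMap = (\<lambda>c a x. \<iota> (Dom D c) (Cod D a) (GMap G c a (\<kappa> (Cod D c) (Dom D a) x)))\<rparr>)"

lemma (in biadd) ext_iso_image:
  assumes inj: "\<And>C A. C \<in> Obj D \<Longrightarrow> A \<in> Obj D \<Longrightarrow> inj_on (\<iota> C A) (EG C A)"
  shows "ext_iso D (G, r) (image_bifun D G \<iota>, \<lambda>C A. r C A \<circ> inv_into (EG C A) (\<iota> C A)) \<iota>"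
  unfolding ext_iso_def fst_conv snd_conv
proof (intro conjI ballI)
  fix C A assume "C \<in> Obj D" "A \<in> Obj D"
  from inj[OF this] show "\<iota> C A \<in> iso (GObj G C A) (GObj (image_bifun D G \<iota>) C A)"
    by (auto simp: iso_def hom_def bij_betw_def image_bifun_def Let_def)
next
  fix c a \<delta> assume h: "c \<in> Arr D" "a \<in> Arr D" "\<delta> \<in> EG (Cod D c) (Dom D a)"
  show "\<iota> (Dom D c) (Cod D a) (GMap G c a \<delta>) = GMap (image_bifun D G \<iota>) c a (\<iota> (Cod D c) (Dom D a) \<delta>)"
    using inv_into_f_f[OF inj h(3)] h by (simp add: image_bifun_def Let_def)
next
  fix C A \<delta> assume h: "C \<in> Obj D" "A \<in> Obj D" "\<delta> \<in> EG C A"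
  show "(r C A \<circ> inv_into (EG C A) (\<iota> C A)) (\<iota> C A \<delta>) = r C A \<delta>"
    using inv_into_f_f[OF inj[OF h(1,2)] h(3)] by simp
qed

lemma (in biadd) transport_image:
  assumes "\<And>C A. C \<in> Obj D \<Longrightarrow> A \<in> Obj D \<Longrightarrow> inj_on (\<iota> C A) (EG C A)"
  shows "transport D G r (image_bifun D G \<iota>) (\<lambda>C A. r C A \<circ> inv_into (EG C A) (\<iota> C A)) \<iota>"
  by unfold_locales (rule ext_iso_image[OF assms], simp_all add: image_bifun_def Let_def)

section \<open>The correspondence between the two kinds of structures\<close>

context acat
begin

text \<open>With groups on both sides units are preserved, so the equivalence is a
  \<open>transport\<close>, under which the conflations do not change.\<close>

lemma id_equivalent_conflations:
  assumes S: "(G, r) \<in> exangulated_structures D n" "(G', r') \<in> exangulated_structures D n"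
    and e: "id_equivalent D n (G, r) (G', r')"
  shows "conflations D n G' r' = conflations D n G r"
proof -
  obtain \<Gamma> where g: "ext_iso D (G, r) (G', r') \<Gamma>" using e id_equivalent_iff[OF exangulated_structuresD(3)[OF S(1)]] by blast
  interpret G: biadd D G by unfold_locales (rule exangulated_structuresD(2)[OF S(1)])
  interpret G': biadd D G' by unfold_locales (rule exangulated_structuresD(2)[OF S(2)])
  interpret transport D G r G' r' \<Gamma>
  proof unfold_locales
    fix C A assume o: "C \<in> Obj D" "A \<in> Obj D"
    have "\<Gamma> C A \<in> hom (GObj G C A) (GObj G' C A)" using ext_isoD(1)[OF g o] by (simp add: iso_def)
    then show "\<one>\<^bsub>GObj G' C A\<^esub> = \<Gamma> C A \<one>\<^bsub>GObj G C A\<^esub>" using hom_one[OF _ G.grpG'[OF o] G'.grpG'[OF o]] by metis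
  qed (rule g)
  show ?thesis by (rule conflations_eq)
qed

text \<open>Keeps the equivalence class assigned to a small n-exact structure from being empty,
  since \<open>G_of\<close> itself has homotopy classes as extensions instead of elements of
  \<open>'e\<close>.\<close>

lemma ex_id_equivalent:
  assumes n: "1 \<le> n" and X: "\<X> \<in> exact_structures TYPE('e) D n"
  obtains G r where "(G :: ('o, 'm, 'e) bifun, r) \<in> exangulated_structures D n"
    "id_equivalent D n (G_of D n \<X>, r_of) (G, r)"
proof -
  have ns: "n_exact_structure D n \<X>" and sm: "small_extension_groups TYPE('e) D n \<X>"
    using X by (simp_all add: exact_structures_def)
  interpret nxs D n \<X> by (rule nxs_of_n_exact_structure[OF n ns])
  have Gx: "(Gx, r_of) \<in> exangulated_structures D n"
    using ns by (intro exangulated_structures_Gx) (simp add: n_exact_structure_def)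
  \<comment> \<open>Smallness supplies an injection into \<open>'e\<close> for each pair of
    objects.\<close>
  define \<iota> :: "'o \<Rightarrow> 'o \<Rightarrow> ('o, 'm) cplx set \<Rightarrow> 'e" where "\<iota> = (\<lambda>C A. SOME h. inj_on h (EC C A))"
  have inj: "inj_on (\<iota> C A) (carrier (GObj Gx C A))" if o: "C \<in> Obj D" "A \<in> Obj D" for C A
  proof -
    have "\<exists>h :: ('o, 'm) cplx set \<Rightarrow> 'e. inj_on h (EC C A)" using sm o unfolding small_extension_groups_def by blast
    then show ?thesis unfolding \<iota>_def Gx_simps by (rule someI_ex)
  qed
  interpret Gx: biadd D Gx by unfold_locales (rule biadditive_Gx)
  interpret transport D Gx r_of "image_bifun D Gx \<iota>" "\<lambda>C A. r_of C A \<circ> inv_into (carrier (GObj Gx C A)) (\<iota> C A)" \<iota>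
    by (rule Gx.transport_image[OF inj])
  show thesis
    using that exangulated_structures[OF n Gx] ext_iso id_equivalent_iff[OF exangulated_structuresD(3)[OF Gx]] by blast
qed

lemma exg_of_structure:
  assumes "1 \<le> n" "(G, r) \<in> exangulated_structures D n"
  shows "exg D G n r"
  using assms exangulated_structuresD[OF assms(2)]
  by unfold_locales (auto simp: exangulated_structures_def)

lemma conflations_mem:
  assumes "1 \<le> n" "(G :: ('o, 'm, 'e) bifun, r) \<in> exangulated_structures D n"
  shows "conflations D n G r \<in> exact_structures TYPE('e) D n"
proof -
  interpret exg D G n r by (rule exg_of_structure[OF assms])
  show ?thesis using n_exact_structure_conf small_conf by (simp add: exact_structures_def)
qed

lemma exact_structure_Gx:
  assumes "1 \<le> n" "\<X> \<in> exact_structures TYPE('e) D n"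
  shows "(G_of D n \<X>, r_of) \<in> exangulated_structures D n" "conflations D n (G_of D n \<X>) r_of = \<X>"
proof -
  have ns: "n_exact_structure D n \<X>" using assms(2) by (simp add: exact_structures_def)
  interpret nxs D n \<X> by (rule nxs_of_n_exact_structure[OF assms(1) ns])
  show "(Gx, r_of) \<in> exangulated_structures D n"
    using ns by (intro exangulated_structures_Gx) (simp add: n_exact_structure_def)
  show "conflations D n Gx r_of = \<X>" by (rule conflations_Gx)
qed

lemma id_equivalent_of_conflations:
  assumes "1 \<le> n" "(G, r) \<in> exangulated_structures D n"
  shows "id_equivalent D n (G_of D n (conflations D n G r), r_of) (G, r)"
proof -
  interpret exg D G n r by (rule exg_of_structure[OF assms])
  have Gx: "(Gx, r_of) \<in> exangulated_structures D n"
    using n_exact_structure_conf by (intro exangulated_structures_Gx) (simp add: n_exact_structure_def)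
  have "ext_iso D (Gx, r_of) (G, r) Gam" unfolding ext_iso_def fst_conv snd_conv
  proof (intro conjI ballI)
    fix C A assume o: "C \<in> Obj D" "A \<in> Obj D"
    show "Gam C A \<in> iso (GObj Gx C A) (GObj G C A)" using Gam_hom[OF o] Gam_bij[OF o] by (simp add: iso_def)
  next
    fix c a E assume h: "c \<in> Arr D" "a \<in> Arr D" "E \<in> carrier (GObj Gx (Cod D c) (Dom D a))"
    have E: "E \<in> EC (Cod D c) (Dom D a)" using h(3) by simp
    have c: "c \<in> homs D (Dom D c) (Cod D c)" and a: "a \<in> homs D (Dom D a) (Cod D a)" using h by (simp_all add: in_homs)
    show "Gam (Dom D c) (Cod D a) (GMap Gx c a E) = GMap G c a (Gam (Cod D c) (Dom D a) E)"
      unfolding Gx_simps(4) Gam_pu[OF pl_in[OF E c] a] Gam_pl[OF E c] by (rule GMap_eq[OF Gam_in(1)[OF E] a c, symmetric])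
  next
    fix C A E assume "E \<in> carrier (GObj Gx C A)"
    then show "r C A (Gam C A E) = r_of C A E" using Gam_in(2)[of E C A] by (simp add: r_of_def)
  qed
  then show ?thesis using id_equivalent_iff[OF exangulated_structuresD(3)[OF Gx]] by blast
qed

end

theorem theorem4:
  fixes D :: "('o, 'm) precat" and n :: nat
  assumes "n \<ge> 1" and "additive_category D"
  shows
    "let \<E> = exact_structures TYPE('e) D n;
         \<S> = exangulated_structures D n :: (('o, 'm, 'e) bifun \<times> ('o, 'm, 'e) realisation) set;
         R = id_equivalence_rel D n;
         \<Phi> = exangulated_class_of D n;
         \<Psi> = conflations_of_class D n
     in (\<forall>\<X>\<in>\<E>. (G_of D n \<X>, r_of) \<in> exangulated_structures D n \<and>
                conflations D n (G_of D n \<X>) r_of = \<X>) \<and>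
        (\<forall>(G, r)\<in>\<S>. conflations D n G r \<in> \<E> \<and>
                id_equivalent D n (G_of D n (conflations D n G r), r_of) (G, r)) \<and>
        equiv \<S> R \<and>
        (\<lambda>(G, r). conflations D n G r) respects R \<and>
        bij_betw \<Phi> \<E> (\<S> // R) \<and>
        bij_betw \<Psi> (\<S> // R) \<E> \<and>
        (\<forall>\<X>\<in>\<E>. \<Psi> (\<Phi> \<X>) = \<X>) \<and>
        (\<forall>K\<in>\<S> // R. \<Phi> (\<Psi> K) = K)"
proof -
  interpret acat D using assms(2) by (simp add: acat_def)
  define Ex where "Ex = exact_structures TYPE('e) D n"
  define S :: "(('o, 'm, 'e) bifun \<times> ('o, 'm, 'e) realisation) set" where "S = exangulated_structures D n"
  define R :: "(('o, 'm, 'e) bifun \<times> ('o, 'm, 'e) realisation) rel" where "R = id_equivalence_rel D n"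
  define cf :: "('o, 'm, 'e) bifun \<times> ('o, 'm, 'e) realisation \<Rightarrow> ('o, 'm) cplx set" where "cf = (\<lambda>(G, r). conflations D n G r)"
  let ?\<Phi> = "exangulated_class_of D n :: _ \<Rightarrow> (('o, 'm, 'e) bifun \<times> ('o, 'm, 'e) realisation) set"
  let ?\<Psi> = "conflations_of_class D n :: (('o, 'm, 'e) bifun \<times> ('o, 'm, 'e) realisation) set \<Rightarrow> _"
  have R: "(s, t) \<in> R \<longleftrightarrow> s \<in> S \<and> t \<in> S \<and> id_equivalent D n s t" for s t
    by (simp add: R_def S_def id_equivalence_rel_def)
  have refl: "(s, s) \<in> R" if "s \<in> S" for s using that id_equivalent_refl R S_def by blast
  have sym: "(t, s) \<in> R" if "(s, t) \<in> R" for s t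
    using that unfolding R S_def by (cases s; cases t) (auto intro: id_equivalent_sym)
  have trans: "(s, u) \<in> R" if "(s, t) \<in> R" "(t, u) \<in> R" for s t u
    using that unfolding R S_def by (cases s; cases t; cases u) (auto intro: id_equivalent_trans)
  have equiv: "equiv S R"
  proof (rule equivI)
    show "R \<subseteq> S \<times> S" by (rule subrelI) (simp only: R SigmaI)
    show "refl_on S R" using refl by (rule refl_onI)
    show "sym R" using sym by (rule symI)
    show "trans R" using trans by (rule transI)
  qed
  have cf_R: "cf s = cf t" if "(s, t) \<in> R" for s t
    using that unfolding R S_def cf_def by (cases s; cases t) (auto dest: id_equivalent_conflations)
  have cf_in: "cf s \<in> Ex" if "s \<in> S" for s
    using that conflations_mem[OF assms(1)] unfolding S_def cf_def Ex_def by (cases s) auto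
  have cf_eq: "id_equivalent D n (G_of D n (cf s), r_of) s" if "s \<in> S" for s
    using that id_equivalent_of_conflations[OF assms(1)] unfolding S_def cf_def by (cases s) auto
  have Gx: "(G_of D n X, r_of) \<in> exangulated_structures D n" "conflations D n (G_of D n X) r_of = X" if "X \<in> Ex" for X
    using exact_structure_Gx[OF assms(1)] that unfolding Ex_def by blast+
  have mem: "t \<in> ?\<Phi> X \<longleftrightarrow> t \<in> S \<and> id_equivalent D n (G_of D n X, r_of) t" for X t
    by (simp add: exangulated_class_of_def S_def)
  \<comment> \<open>\<open>(G_of D n (cf s), r_of)\<close> has extensions of another type than the
    elements of \<open>S\<close>, so \<open>R\<close> does not relate it to them; symmetry and
    transitivity of \<open>id_equivalent\<close> across types do.\<close>
  have \<Phi>_cf: "?\<Phi> (cf s) = R `` {s}" if s: "s \<in> S" for s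
  proof -
    have "id_equivalent D n (G_of D n (cf s), r_of) t \<longleftrightarrow> id_equivalent D n s t" if t: "t \<in> S" for t
    proof -
      obtain G r where s': "s = (G, r)" by (cases s)
      obtain G' r' where t': "t = (G', r')" by (cases t)
      note g = Gx(1)[OF cf_in[OF s]]
      have sS: "(G, r) \<in> exangulated_structures D n" and e: "id_equivalent D n (G_of D n (cf s), r_of) (G, r)"
        using s cf_eq[OF s] unfolding s' S_def by simp_all
      show ?thesis unfolding t'
        using id_equivalent_trans[OF g sS e, of G' r'] id_equivalent_trans[OF sS g id_equivalent_sym[OF g sS e], of G' r'] s' by blast
    qed
    then have "t \<in> ?\<Phi> (cf s) \<longleftrightarrow> t \<in> R `` {s}" for t unfolding mem Image_singleton_iff R using s by blast
    then show ?thesis by blast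
  qed
  have \<Psi>_class: "?\<Psi> (R `` {s}) = cf s" if s: "s \<in> S" for s
  proof -
    have "cf ` (R `` {s}) = {cf s}" using cf_R refl[OF s] by blast
    then show ?thesis unfolding conflations_of_class_def cf_def by simp
  qed
  \<comment> \<open>Smallness enters here, through \<open>ex_id_equivalent\<close>; afterwards both
    maps are computed on classes of elements of \<open>S\<close>.\<close>
  have \<Phi>_obtain: "\<exists>s\<in>S. cf s = X" if X: "X \<in> Ex" for X
  proof -
    obtain G :: "('o, 'm, 'e) bifun" and r where s: "(G, r) \<in> S" "id_equivalent D n (G_of D n X, r_of) (G, r)"
      using ex_id_equivalent[OF assms(1), of X] X unfolding Ex_def S_def by blast
    have "cf (G, r) = X"
      using id_equivalent_conflations[OF Gx(1)[OF X] _ s(2)] s(1) Gx(2)[OF X] by (simp add: cf_def S_def)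
    then show ?thesis using s(1) by blast
  qed
  have \<Phi>: "?\<Phi> X \<in> S // R \<and> ?\<Psi> (?\<Phi> X) = X" if X: "X \<in> Ex" for X
  proof -
    obtain s where s: "s \<in> S" "X = cf s" using \<Phi>_obtain[OF X] by blast
    show ?thesis unfolding s(2) \<Phi>_cf[OF s(1)] \<Psi>_class[OF s(1)] using quotientI[OF s(1)] by blast
  qed
  have \<Psi>: "?\<Psi> K \<in> Ex \<and> ?\<Phi> (?\<Psi> K) = K" if K: "K \<in> S // R" for K
  proof -
    obtain s where s: "s \<in> S" "K = R `` {s}" using K by (rule quotientE)
    show ?thesis unfolding s(2) \<Psi>_class[OF s(1)] \<Phi>_cf[OF s(1)] using cf_in[OF s(1)] by blast
  qed
  have "bij_betw ?\<Phi> Ex (S // R)" by (rule bij_betw_byWitness[where f' = ?\<Psi>]) (use \<Phi> \<Psi> in blast)+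
  moreover have "bij_betw ?\<Psi> (S // R) Ex" by (rule bij_betw_byWitness[where f' = ?\<Phi>]) (use \<Phi> \<Psi> in blast)+
  moreover have "cf respects R" using cf_R by (auto simp: congruent_def)
  ultimately show ?thesis
    unfolding Let_def Ex_def[symmetric] S_def[symmetric] R_def[symmetric]
    using Gx cf_in cf_eq equiv \<Phi> \<Psi> by (auto simp: cf_def)
qed

end
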